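(* Let $g$ be an analytic function in $\mathbb{D}$, and for $1<p<\infty$ let $p'$ be defined by $\frac1p+\frac1{p'}=1$. Then: (1) If $1<p\le2$ and $0<s\le1$, then: (1a) $I_g$ maps $B^p$ into $Q_s$ if and only if $g\in H^\infty$. (1b) If $M_g$ maps $B^p$ into $Q_s$, then $g\in Q_{s,\log,1/p'}\cap H^\infty$. (1c) If $g\in Q_{s,\log,\alpha}\cap H^\infty$ for some $\alpha>1/2$, then $M_g$ maps $B^p$ into $Q_s$. (2) If $2<p<\infty$ and $1-\frac2p<s\le1$, then: (2a) $I_g$ maps $B^p$ into $Q_s$ if and only if $g\in H^\infty$. (2b) $M_g$ maps $B^p$ into $Q_s$ if and only if $g\in Q_{s,\log,1/p'}\cap H^\infty$. (3) If $2<p<\infty$ and $0<s\le1-\frac2p$, then: (3a) $I_g$ maps $B^p$ into $Q_s$ if and only if $g\equiv0$. (3b) $M_g$ maps $B^p$ into $Q_s$ if and only if $g\equiv0$.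
   Context: $\mathbb{D}$ is the open unit disc in $\mathbb{C}$ and $dA$ is the normalized Lebesgue area measure on $\mathbb{D}$. $H^\infty$ is the space of bounded analytic functions in $\mathbb{D}$. For $a\in\mathbb{D}$, $\varphi_a(z)=\frac{a-z}{1-\overline{a}z}$. For $1<p<\infty$, the Besov space $B^p$ is the space of all analytic $f$ in $\mathbb{D}$ with $\int_{\mathbb{D}}(1-|z|)^{p-2}|f'(z)|^p\,dA(z)<\infty$. For $0<s<\infty$, $Q_s$ is the space of all analytic $f$ in $\mathbb{D}$ with $\sup_{a\in\mathbb{D}}\int_{\mathbb{D}}|f'(z)|^2 g(z,a)^s\,dA(z)<\infty$, where $g(z,a)=\log\frac{|1-\overline{a}z|}{|a-z|}$ is the Green function; equivalently (a known fact), $\sup_{a\in\mathbb{D}}\int_{\mathbb{D}}|f'(z)|^2(1-|\varphi_a(z)|^2)^s\,dA(z)<\infty$. For $0<s<\infty$ and $\alpha>0$, $Q_{s,\log,\alpha}$ is the space of all analytic $f$ in $\mathbb{D}$ with $\sup_{a\in\mathbb{D}}\left(\log\frac{2}{1-|a|}\right)^{2\alpha}\int_{\mathbb{D}}|f'(z)|^2(1-|\varphi_a(z)|^2)^s\,dA(z)<\infty$. For $g$ and $f$ analytic in $\mathbb{D}$ and $z\in\mathbb{D}$: $I_g(f)(z)=\int_0^z g(\xi)f'(\xi)\,d\xi$, $M_g(f)(z)=g(z)f(z)$. An operator $T$ maps $X$ into $Y$ if $T(X)\subset Y$. *)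

theory Defs
  imports "HOL-Complex_Analysis.Complex_Analysis"
begin

text \<open>
  A function on the unit disc is represented by a total function on the complex numbers. All
  notions below depend only on its values in the disc: the disc is open, so \<^const>\<open>deriv\<close> at a
  point of the disc is determined by them, and all integrals are cut off to the disc.
\<close>

abbreviation unit_disc :: "complex set" ("\<D>")
  where "\<D> \<equiv> ball 0 1"

definition disc_area :: "complex measure"
  where "disc_area = uniform_measure lborel \<D>"

definition moebius_disc :: "complex \<Rightarrow> complex \<Rightarrow> complex"
  where "moebius_disc a z = (a - z) / (1 - cnj a * z)"

text \<open>
  At \<open>z = a\<close>, where the Green function is infinite, the value below is \<open>0\<close> by the conventions for
  division by zero and \<open>ln 0\<close>. This is a single point, hence irrelevant for the integrals.
\<close>

definition green_disc :: "complex \<Rightarrow> complex \<Rightarrow> real"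
  where "green_disc z a = ln (norm (1 - cnj a * z) / norm (a - z))"

text \<open>
  Integrals of nonnegative functions are taken in the extended nonnegative reals, so that
  finiteness of an integral, or of a supremum of integrals, is a genuine condition.
\<close>

definition Besov_space :: "real \<Rightarrow> (complex \<Rightarrow> complex) set"
  where "Besov_space p = {f. f holomorphic_on \<D> \<and>
    (\<integral>\<^sup>+z\<in>\<D>. ennreal ((1 - norm z) powr (p - 2) * norm (deriv f z) powr p) \<partial>disc_area) < \<infinity>}"

definition Q_space :: "real \<Rightarrow> (complex \<Rightarrow> complex) set"
  where "Q_space s = {f. f holomorphic_on \<D> \<and>
    (SUP a\<in>\<D>. \<integral>\<^sup>+z\<in>\<D>. ennreal ((norm (deriv f z))\<^sup>2 * green_disc z a powr s) \<partial>disc_area) < \<infinity>}"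

definition Q_log_space :: "real \<Rightarrow> real \<Rightarrow> (complex \<Rightarrow> complex) set"
  where "Q_log_space s \<alpha> = {f. f holomorphic_on \<D> \<and>
    (SUP a\<in>\<D>. ennreal (ln (2 / (1 - norm a)) powr (2 * \<alpha>)) *
      (\<integral>\<^sup>+z\<in>\<D>. ennreal ((norm (deriv f z))\<^sup>2 * (1 - (norm (moebius_disc a z))\<^sup>2) powr s)
        \<partial>disc_area)) < \<infinity>}"

definition H_infinity :: "(complex \<Rightarrow> complex) set"
  where "H_infinity = {f. f holomorphic_on \<D> \<and> bounded (f ` \<D>)}"

definition integral_op :: "(complex \<Rightarrow> complex) \<Rightarrow> (complex \<Rightarrow> complex) \<Rightarrow> complex \<Rightarrow> complex"
  where "integral_op g f z = contour_integral (linepath 0 z) (\<lambda>\<xi>. g \<xi> * deriv f \<xi>)"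

definition mult_op :: "(complex \<Rightarrow> complex) \<Rightarrow> (complex \<Rightarrow> complex) \<Rightarrow> complex \<Rightarrow> complex"
  where "mult_op g f z = g z * f z"

definition maps_into :: "('a \<Rightarrow> 'b) \<Rightarrow> 'a set \<Rightarrow> 'b set \<Rightarrow> bool"
  where "maps_into T X Y \<longleftrightarrow> T ` X \<subseteq> Y"

end

theory Submission
  imports Defs
begin

text \<open>
  The conformally invariant form of the \<open>Q\<^sub>s\<close> integral, with \<open>1 - |\<phi>\<^sub>a|\<^sup>2\<close> in place of the Green
  function, is available because functions with bounded invariant integral are Bloch functions.

  For sufficiency, Hoelder's inequality embeds \<open>B\<^sup>p\<close> in \<open>Q\<^sub>s\<close> when \<open>p \<le> 2\<close> or \<open>s > 1 - 2/p\<close>, and a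
  \<open>B\<^sup>p\<close> function grows at most like \<open>(log 2/(1 - |a|)) powr (1/p')\<close>. In \<open>(g f)' = g f' + g' f\<close> the
  first term is thus harmless, the part \<open>g' f(a)\<close> is absorbed by the logarithmic condition on \<open>g\<close>,
  and \<open>g' (f - f(a))\<close> is controlled by a Carleson embedding whose logarithmic gain of exponent
  \<open>2 \<alpha> > 1\<close> replaces a capacitary condition.

  For necessity, a gliding hump argument shows that an operator mapping \<open>B\<^sup>p\<close> into \<open>Q\<^sub>s\<close> is bounded.
  Testing it on the involutions \<open>\<phi>\<^sub>a\<close> gives \<open>g \<in> H\<^sup>\<infinity>\<close>; testing it on normalized logarithms
  concentrated at \<open>a\<close> gives the logarithmic condition. If \<open>s \<le> 1 - 2/p\<close> and \<open>g\<close> is not zero, the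
  lacunary polynomials \<open>n powr (-1/p) \<Sum>k<n. \<plusminus> 2 powr (-k/p) z\<^sup>2\<^sup>^\<^sup>k\<close> are bounded in \<open>B\<^sup>p\<close>, while for
  suitable signs their images have \<open>Q\<^sub>s\<close> integrals at least of the order \<open>n powr (1 - 2/p)\<close>.
\<close>

section \<open>Area integrals and mean values\<close>

text \<open>The threshold 1/2 for \<open>\<alpha>\<close> comes from the cones
  \<open>disc_cone z\<close>: an increment of a function is bounded by an integral of its derivative
  over a cone, and the hyperbolic area of a cone, of order \<open>disc_log z\<close>, becomes
  bounded once it is weighted by \<open>disc_log w powr (- \<beta>)\<close> with \<beta> > 1; this
  is used with \<beta> = 2 \<alpha>. For p > 2 the exponent 2 / p' that necessity delivers already
  exceeds 1, so the multiplier criterion is an equivalence; for p \<le> 2 it is at most 1, and the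
  two directions stay apart. The threshold 1 - 2 / p for s is where the exponent \<sigma> = s p / (p
  - 2) left over by Hoelder reaches 1: (1 - |\<phi>|^2)^\<sigma>, \<phi> a disc involution, is
  integrable for the hyperbolic area exactly when \<sigma> > 1. Below it, the obstruction is the gap
  between l^p, in which lacunary coefficients are measured by the Besov integral, and l^2, in which
  the Q integral measures them. Mapping into \<open>Q_space s\<close> is a statement about one
  function at a time, whereas all test functions move with \<open>a\<close> or \<open>n\<close>;
  hence nothing can be tested before a uniform bound is available.\<close>

lemma lborel_complex_pair:
  "distr (lborel \<Otimes>\<^sub>M lborel) borel (\<lambda>p::real \<times> real. Complex (fst p) (snd p)) = lborel"
proof -
  have [measurable]: "(\<lambda>p::real \<times> real. Complex (fst p) (snd p)) \<in> borel_measurable borel"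
    by (auto intro!: borel_measurable_continuous_onI continuous_intros simp: Complex_eq)
  have m: "(\<lambda>p::real \<times> real. Complex (fst p) (snd p)) \<in> borel_measurable (lborel \<Otimes>\<^sub>M lborel)"
    by (simp add: lborel_prod)
  show ?thesis
  proof (rule lborel_eqI[symmetric])
    fix l u :: complex
    assume "\<And>b. b \<in> Basis \<Longrightarrow> l \<bullet> b \<le> u \<bullet> b"
    from this[of 1] this[of \<i>] have lu: "Re l \<le> Re u" "Im l \<le> Im u"
      by (simp_all add: Basis_complex_def)
    have eq: "(\<lambda>p::real \<times> real. Complex (fst p) (snd p)) -` box l u = box (Re l) (Re u) \<times> box (Im l) (Im u)"
      by (auto simp: box_def Basis_complex_def inner_complex_def)
    have "emeasure (distr (lborel \<Otimes>\<^sub>M lborel) borel (\<lambda>p::real \<times> real. Complex (fst p) (snd p))) (box l u)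
       = emeasure (lborel \<Otimes>\<^sub>M lborel) (box (Re l) (Re u) \<times> box (Im l) (Im u))"
      using m by (subst emeasure_distr) (auto simp: eq space_pair_measure)
    also have "\<dots> = emeasure lborel (box (Re l) (Re u)) * emeasure lborel (box (Im l) (Im u))"
      by (subst lborel.emeasure_pair_measure_Times) auto
    also have "\<dots> = ennreal ((Re u - Re l) * (Im u - Im l))"
      using lu by (simp add: ennreal_mult box_real)
    also have "\<dots> = ennreal (\<Prod>b\<in>Basis. (u - l) \<bullet> b)"
      by (simp add: Basis_complex_def)
    finally show "emeasure (distr (lborel \<Otimes>\<^sub>M lborel) borel (\<lambda>p::real \<times> real. Complex (fst p) (snd p))) (box l u)
       = ennreal (\<Prod>b\<in>Basis. (u - l) \<bullet> b)" .
  qed simp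
qed

lemma nn_integral_complex_Fubini:
  assumes [measurable]: "F \<in> borel_measurable borel"
  shows "(\<integral>\<^sup>+z. F z \<partial>lborel) = (\<integral>\<^sup>+y. \<integral>\<^sup>+x. F (Complex x y) \<partial>lborel \<partial>lborel)"
proof -
  have [measurable]: "(\<lambda>p::real \<times> real. Complex (fst p) (snd p)) \<in> borel_measurable (lborel \<Otimes>\<^sub>M lborel)"
    unfolding lborel_prod
    by (auto intro!: borel_measurable_continuous_onI continuous_intros simp: Complex_eq)
  have "(\<integral>\<^sup>+z. F z \<partial>lborel) = (\<integral>\<^sup>+p. F (Complex (fst p) (snd p)) \<partial>(lborel \<Otimes>\<^sub>M lborel))"
    by (subst lborel_complex_pair[symmetric]) (subst nn_integral_distr, auto)
  also have "\<dots> = (\<integral>\<^sup>+y. \<integral>\<^sup>+x. F (Complex x y) \<partial>lborel \<partial>lborel)"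
    by (subst lborel_pair.nn_integral_snd[symmetric]) auto
  finally show ?thesis .
qed

lemma nn_integral_complex_Fubini':
  assumes [measurable]: "F \<in> borel_measurable borel"
  shows "(\<integral>\<^sup>+z. F z \<partial>lborel) = (\<integral>\<^sup>+x. \<integral>\<^sup>+y. F (Complex x y) \<partial>lborel \<partial>lborel)"
proof -
  have [measurable]: "(\<lambda>p::real \<times> real. Complex (fst p) (snd p)) \<in> borel_measurable (lborel \<Otimes>\<^sub>M lborel)"
    unfolding lborel_prod
    by (auto intro!: borel_measurable_continuous_onI continuous_intros simp: Complex_eq)
  have "(\<integral>\<^sup>+z. F z \<partial>lborel) = (\<integral>\<^sup>+p. F (Complex (fst p) (snd p)) \<partial>(lborel \<Otimes>\<^sub>M lborel))"
    by (subst lborel_complex_pair[symmetric]) (subst nn_integral_distr, auto)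
  also have "\<dots> = (\<integral>\<^sup>+x. \<integral>\<^sup>+y. F (Complex x y) \<partial>lborel \<partial>lborel)"
    by (subst lborel.nn_integral_fst[symmetric]) auto
  finally show ?thesis .
qed

section \<open>Rotation invariance of planar Lebesgue measure\<close>

lemma nn_integral_real_translate:
  assumes [measurable]: "F \<in> borel_measurable borel"
  shows "(\<integral>\<^sup>+x. F (x + t) \<partial>lborel) = (\<integral>\<^sup>+x. F (x::real) \<partial>lborel)"
  using nn_integral_real_affine[OF assms, of 1 t] by (simp add: add.commute)

text \<open>A rotation by an angle \<open>\<theta>\<close> with \<open>cos (\<theta>/2) \<noteq> 0\<close> is a product of three shears, each of
  which preserves the measure by Fubini's theorem.\<close>

lemma nn_integral_shear_Re:
  assumes [measurable]: "F \<in> borel_measurable borel"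
  shows "(\<integral>\<^sup>+z. F (Complex (Re z + t * Im z) (Im z)) \<partial>lborel) = (\<integral>\<^sup>+z. F z \<partial>lborel)"
proof -
  have [measurable]: "(\<lambda>z. Complex (Re z + t * Im z) (Im z)) \<in> borel_measurable borel"
    "\<And>y. (\<lambda>x. Complex x y) \<in> borel_measurable borel"
    by (auto intro!: borel_measurable_continuous_onI continuous_intros simp: Complex_eq)
  show ?thesis
    by (simp add: nn_integral_complex_Fubini nn_integral_real_translate[of "\<lambda>x. F (Complex x _)"])
qed

lemma nn_integral_shear_Im:
  assumes [measurable]: "F \<in> borel_measurable borel"
  shows "(\<integral>\<^sup>+z. F (Complex (Re z) (Im z + t * Re z)) \<partial>lborel) = (\<integral>\<^sup>+z. F z \<partial>lborel)"
proof -
  have [measurable]: "(\<lambda>z. Complex (Re z) (Im z + t * Re z)) \<in> borel_measurable borel"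
    "\<And>x. (\<lambda>y. Complex x y) \<in> borel_measurable borel"
    by (auto intro!: borel_measurable_continuous_onI continuous_intros simp: Complex_eq)
  show ?thesis
    by (simp add: nn_integral_complex_Fubini' nn_integral_real_translate[of "\<lambda>y. F (Complex _ y)"])
qed

lemma nn_integral_rotate:
  assumes [measurable]: "F \<in> borel_measurable borel" and \<theta>: "cos (\<theta> / 2) \<noteq> 0"
  shows "(\<integral>\<^sup>+z. F (cis \<theta> * z) \<partial>lborel) = (\<integral>\<^sup>+z. F z \<partial>lborel)"
proof -
  \<comment> \<open>The factorization is shear \<open>t\<close>, shear \<open>s\<close>, shear
    \<open>t\<close>. Its matrix entries reduce to the identities \<open>a\<close> and
    \<open>b\<close>; the assumption on \<theta> is what makes the tangent meaningful.\<close>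
  define t where "t = - tan (\<theta> / 2)"
  define s where "s = sin \<theta>"
  define S1 where "S1 z = Complex (Re z + t * Im z) (Im z)" for z
  define S2 where "S2 z = Complex (Re z) (Im z + s * Re z)" for z
  have [measurable]: "S1 \<in> borel_measurable borel" "S2 \<in> borel_measurable borel"
    unfolding S1_def S2_def
    by (auto intro!: borel_measurable_continuous_onI continuous_intros simp: Complex_eq)
  define x where "x = \<theta> / 2"
  have \<theta>x: "\<theta> = 2 * x" by (simp add: x_def)
  have cx: "cos x \<noteq> 0" using \<theta> by (simp add: x_def)
  have a: "t * s + 1 = cos \<theta>"
  proof -
    have "t * s = - (2 * sin x ^ 2)"
      using cx by (simp add: t_def s_def x_def[symmetric] \<theta>x tan_def sin_double power2_eq_square)
    then show ?thesis by (simp add: \<theta>x cos_double_sin)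
  qed
  have "sin x * (1 + cos \<theta>) = s * cos x"
    unfolding s_def \<theta>x by (simp add: sin_double cos_double_cos power2_eq_square)
  moreover have "t + (t * s + 1) * t = - (sin x * (1 + cos \<theta>) / cos x)"
    unfolding a by (simp add: t_def x_def[symmetric] tan_def ring_distribs add_divide_distrib mult.commute)
  ultimately have b: "t + (t * s + 1) * t = - s" using cx by simp
  have rot: "S1 (S2 (S1 z)) = cis \<theta> * z" for z
  proof (rule complex_eqI)
    have "Re (S1 (S2 (S1 z))) = (t * s + 1) * Re z + (t + (t * s + 1) * t) * Im z"
      by (simp add: S1_def S2_def algebra_simps)
    then show "Re (S1 (S2 (S1 z))) = Re (cis \<theta> * z)"
      unfolding b unfolding a by (simp add: s_def)
    have "Im (S1 (S2 (S1 z))) = (t * s + 1) * Im z + s * Re z"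
      by (simp add: S1_def S2_def algebra_simps)
    then show "Im (S1 (S2 (S1 z))) = Im (cis \<theta> * z)"
      unfolding a by (simp add: s_def)
  qed
  have "(\<integral>\<^sup>+z. F (cis \<theta> * z) \<partial>lborel) = (\<integral>\<^sup>+z. F (S1 (S2 (S1 z))) \<partial>lborel)"
    by (simp add: rot)
  also have "\<dots> = (\<integral>\<^sup>+z. F (S1 (S2 z)) \<partial>lborel)"
    using nn_integral_shear_Re[of "\<lambda>z. F (S1 (S2 z))" t, folded S1_def] by simp
  also have "\<dots> = (\<integral>\<^sup>+z. F (S1 z) \<partial>lborel)"
    using nn_integral_shear_Im[of "\<lambda>z. F (S1 z)" s, folded S2_def] by simp
  also have "\<dots> = (\<integral>\<^sup>+z. F z \<partial>lborel)"
    using nn_integral_shear_Re[of F t, folded S1_def] by simp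
  finally show ?thesis .
qed

lemma lborel_distr_rotate:
  assumes "cos (\<theta> / 2) \<noteq> 0"
  shows "distr lborel borel (\<lambda>z. cis \<theta> * z) = lborel"
proof (rule measure_eqI)
  fix A assume "A \<in> sets (distr lborel borel (\<lambda>z. cis \<theta> * z))"
  then have [measurable]: "A \<in> sets borel" by simp
  have "emeasure (distr lborel borel (\<lambda>z. cis \<theta> * z)) A = (\<integral>\<^sup>+z. indicator A (cis \<theta> * z) \<partial>lborel)"
    by (subst nn_integral_indicator[symmetric], simp, subst nn_integral_distr) auto
  also have "\<dots> = emeasure lborel A"
    by (subst nn_integral_rotate[OF _ assms]) auto
  finally show "emeasure (distr lborel borel (\<lambda>z. cis \<theta> * z)) A = emeasure lborel A" .
qed simp

text \<open>Rotation by pi / (2 n) preserves the disc and multiplies z ^ n by \<i>, so the integral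
  equals \<i> times itself. The angle pi / n would change the sign instead, but for n = 1 it is the
  half turn excluded in \<open>nn_integral_rotate\<close>.\<close>

lemma ball_integral_power_eq_0:
  assumes "n > 0" "r > 0"
  shows "(LINT z:ball 0 r|lborel. z ^ n) = (0::complex)"
proof -
  define \<theta> where "\<theta> = pi / real n / 2"
  have "0 < \<theta> / 2" "\<theta> / 2 < pi / 2"
    using assms by (auto simp: \<theta>_def divide_simps)
  then have c: "cos (\<theta> / 2) \<noteq> 0" using cos_gt_zero[of "\<theta>/2"] by simp
  have ci: "cis \<theta> ^ n = \<i>"
  proof -
    have "real n * \<theta> = pi / 2" using assms by (simp add: \<theta>_def)
    then show ?thesis using Complex.DeMoivre[of \<theta> n] by (simp only: cis_pi_half)
  qed
  let ?I = "(LINT z:ball 0 r|lborel. z ^ n) :: complex"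
  have "?I = (\<integral>z. indicator (ball 0 r) z *\<^sub>R z ^ n \<partial>(distr lborel borel (\<lambda>z. cis \<theta> * z)))"
    by (simp add: lborel_distr_rotate[OF c] set_lebesgue_integral_def)
  also have "\<dots> = (\<integral>z. indicator (ball 0 r) (cis \<theta> * z) *\<^sub>R (cis \<theta> * z) ^ n \<partial>lborel)"
  proof (rule integral_distr)
    show "(\<lambda>z. indicator (ball 0 r) z *\<^sub>R z ^ n :: complex) \<in> borel_measurable borel"
      by (rule borel_measurable_continuous_on_indicator) (simp_all add: continuous_on_power continuous_on_id)
  qed simp
  also have "\<dots> = (\<integral>z. \<i> * (indicator (ball 0 r) z *\<^sub>R z ^ n) \<partial>lborel)"
    by (intro Bochner_Integration.integral_cong refl)
       (auto simp: indicator_def norm_mult power_mult_distrib ci)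
  also have "\<dots> = \<i> * ?I"
    unfolding set_lebesgue_integral_def by (rule integral_mult_right_zero)
  finally have "(1 - \<i>) * ?I = 0"
    by (simp only: left_diff_distrib mult_1 right_minus_eq)
  moreover have "1 - \<i> \<noteq> 0" by (simp add: complex_eq_iff)
  ultimately show ?thesis by (simp only: mult_eq_0_iff simp_thms)
qed

section \<open>The mean value property over discs\<close>

lemma set_integrable_ball_continuous:
  fixes f :: "complex \<Rightarrow> complex"
  assumes "continuous_on (cball c r) f"
  shows "set_integrable lborel (ball c r) f"
proof -
  have "set_integrable lborel (cball c r) f"
    unfolding set_integrable_def using assms by (intro borel_integrable_compact) auto
  then show ?thesis
    by (rule set_integrable_subset) auto
qed

text \<open>When the power series is integrated termwise, \<open>ball_integral_power_eq_0\<close>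
  kills every term but the constant one.\<close>

lemma ball_mean_value_0:
  fixes f :: "complex \<Rightarrow> complex"
  assumes f: "f holomorphic_on ball 0 R" and r: "0 < r" "r < R"
  shows "(LINT z:ball 0 r|lborel. f z) = of_real (pi * r\<^sup>2) * f 0"
proof -
  define a where "a n = (deriv ^^ n) f 0 / fact n" for n
  have sums: "(\<lambda>n. a n * z ^ n) sums f z" if "z \<in> ball 0 R" for z
    using holomorphic_power_series[OF f that] by (simp add: a_def)
  have summ: "summable (\<lambda>n. norm (a n) * r ^ n)"
  proof -
    \<comment> \<open>Convergence at a radius strictly between \<open>r\<close> and \<open>R\<close>
      gives absolute convergence at \<open>r\<close>, which dominates all terms on the ball and
      justifies the interchange.\<close>
    define \<rho> where "\<rho> = (r + R) / 2"
    have \<rho>: "r < \<rho>" "\<rho> < R" using r by (auto simp: \<rho>_def)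
    have "summable (\<lambda>n. a n * of_real \<rho> ^ n)"
      using sums[of "of_real \<rho>"] \<rho> r by (auto intro: sums_summable)
    then have "summable (\<lambda>n. norm (a n * of_real r ^ n))"
      by (rule powser_insidea) (use \<rho> r in auto)
    then show ?thesis using r by (simp add: norm_mult norm_power)
  qed
  have int: "set_integrable lborel (ball 0 r) (\<lambda>z::complex. z ^ n)" for n
    by (intro set_integrable_ball_continuous continuous_intros)
  have "(\<integral>z. (\<Sum>n. a n * (indicator (ball 0 r) z *\<^sub>R z ^ n)) \<partial>lborel)
      = (\<Sum>n. \<integral>z. a n * (indicator (ball 0 r) z *\<^sub>R z ^ n) \<partial>lborel)"
  proof (rule integral_suminf)
    show "integrable lborel (\<lambda>z. a n * (indicator (ball 0 r) z *\<^sub>R z ^ n))" for n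
      using int[of n] by (intro integrable_mult_right) (auto simp: set_integrable_def)
    have le: "norm (a n * (indicator (ball 0 r) z *\<^sub>R z ^ n)) \<le> norm (a n) * r ^ n" for n z
      using r by (auto simp: indicator_def norm_mult norm_power intro!: mult_left_mono power_mono)
    show "AE z in lborel. summable (\<lambda>n. norm (a n * (indicator (ball 0 r) z *\<^sub>R z ^ n)))"
      by (intro AE_I2 summable_comparison_test'[OF summ]) (use le in auto)
    have "norm (\<integral>z. norm (a n * (indicator (ball 0 r) z *\<^sub>R z ^ n)) \<partial>lborel)
        \<le> norm (a n) * r ^ n * measure lborel (ball (0::complex) r)" for n
    proof -
      have "(\<integral>z. norm (a n * (indicator (ball 0 r) z *\<^sub>R z ^ n)) \<partial>lborel)
        \<le> (\<integral>z. norm (a n) * r ^ n * indicator (ball (0::complex) r) z \<partial>lborel)"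
      proof (rule integral_mono)
        show "integrable lborel (\<lambda>z. norm (a n * (indicator (ball 0 r) z *\<^sub>R z ^ n)))"
          using int[of n] by (intro integrable_norm integrable_mult_right) (auto simp: set_integrable_def)
        show "integrable lborel (\<lambda>z. norm (a n) * r ^ n * indicator (ball (0::complex) r) z)"
          using emeasure_lborel_ball_finite[of "0::complex" r]
          by (intro integrable_mult_right integrable_real_indicator) auto
        show "norm (a n * (indicator (ball 0 r) z *\<^sub>R z ^ n)) \<le> norm (a n) * r ^ n * indicator (ball 0 r) z" for z
          using le[of n z] by (auto simp: indicator_def)
      qed
      then show ?thesis by simp
    qed
    then show "summable (\<lambda>n. \<integral>z. norm (a n * (indicator (ball 0 r) z *\<^sub>R z ^ n)) \<partial>lborel)"
      by (intro summable_comparison_test'[OF summable_mult2[OF summ]]) auto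
  qed
  also have "(\<lambda>n. \<integral>z. a n * (indicator (ball 0 r) z *\<^sub>R z ^ n) \<partial>lborel) = (\<lambda>n. if n = 0 then a 0 * of_real (pi * r\<^sup>2) else 0)"
  proof
    fix n
    have "(\<integral>z. a n * (indicator (ball 0 r) z *\<^sub>R z ^ n) \<partial>lborel) = a n * (LINT z:ball 0 r|lborel. z ^ n)"
      unfolding set_lebesgue_integral_def by (rule integral_mult_right_zero)
    also have "\<dots> = (if n = 0 then a 0 * of_real (pi * r\<^sup>2) else 0)"
    proof (cases "n = 0")
      case True
      then show ?thesis using r
        by (simp add: set_lebesgue_integral_def content_ball unit_ball_vol_2 scaleR_conv_of_real)
    qed (use ball_integral_power_eq_0[of n r] r in auto)
    finally show "(\<integral>z. a n * (indicator (ball 0 r) z *\<^sub>R z ^ n) \<partial>lborel) = (if n = 0 then a 0 * of_real (pi * r\<^sup>2) else 0)" .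
  qed
  also have "(\<Sum>n. (if n = 0 then a 0 * of_real (pi * r\<^sup>2) else 0)) = a 0 * of_real (pi * r\<^sup>2)"
    by (subst suminf_finite[of "{0}"]) auto
  also have "(\<integral>z. (\<Sum>n. a n * (indicator (ball 0 r) z *\<^sub>R z ^ n)) \<partial>lborel) = (LINT z:ball 0 r|lborel. f z)"
    unfolding set_lebesgue_integral_def
  proof (intro Bochner_Integration.integral_cong refl)
    fix z
    show "(\<Sum>n. a n * (indicator (ball 0 r) z *\<^sub>R z ^ n)) = indicator (ball 0 r) z *\<^sub>R f z"
    proof (cases "z \<in> ball 0 r")
      case True
      then have "(\<Sum>n. a n * z ^ n) = f z" using sums[of z] r by (simp add: sums_unique[symmetric])
      then show ?thesis using True by simp
    qed simp
  qed
  finally show ?thesis by (simp add: a_def mult.commute)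
qed

lemma ball_mean_value:
  fixes f :: "complex \<Rightarrow> complex"
  assumes f: "f holomorphic_on ball c R" and r: "0 < r" "r < R"
  shows "(LINT z:ball c r|lborel. f z) = of_real (pi * r\<^sup>2) * f c"
proof -
  have h: "(\<lambda>z. f (c + z)) holomorphic_on ball 0 R"
    by (rule holomorphic_on_compose_gen[OF _ f, unfolded o_def]) (auto intro!: holomorphic_intros simp: dist_norm)
  have "(LINT z:ball c r|lborel. f z) = (\<integral>z. indicator (ball c r) z *\<^sub>R f z \<partial>(distr lborel borel ((+) c)))"
    by (simp add: lborel_distr_plus set_lebesgue_integral_def)
  also have "\<dots> = (\<integral>z. indicator (ball c r) (c + z) *\<^sub>R f (c + z) \<partial>lborel)"
  proof (rule integral_distr)
    have "continuous_on (ball c r) f"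
      using f holomorphic_on_imp_continuous_on r
      by (metis continuous_on_subset less_imp_le subset_ball)
    then show "(\<lambda>z. indicator (ball c r) z *\<^sub>R f z) \<in> borel_measurable borel"
      by (intro borel_measurable_continuous_on_indicator) auto
  qed simp
  also have "\<dots> = (LINT z:ball 0 r|lborel. f (c + z))"
    unfolding set_lebesgue_integral_def
    by (intro Bochner_Integration.integral_cong refl) (auto simp: indicator_def dist_norm)
  finally show ?thesis
    using ball_mean_value_0[OF h r] by simp
qed

section \<open>Integration over the disc\<close>

abbreviation disc_lborel :: "complex measure" ("\<lambda>\<D>")
  where "\<lambda>\<D> \<equiv> restrict_space lborel \<D>"

lemma nn_integral_disc_lborel:
  "(\<integral>\<^sup>+z. F z \<partial>\<lambda>\<D>) = (\<integral>\<^sup>+z. F z * indicator \<D> z \<partial>lborel)"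
  by (rule nn_integral_restrict_space) simp

lemma measurable_disc_lborel_id [measurable]: "(\<lambda>z. z) \<in> borel_measurable \<lambda>\<D>"
  by (intro measurable_restrict_space1) simp

lemma space_disc_lborel [simp]: "space \<lambda>\<D> = \<D>"
  by (simp add: space_restrict_space)

lemma sigma_finite_disc_lborel: "sigma_finite_measure \<lambda>\<D>"
  by (intro sigma_finite_measure_restrict_space sigma_finite_lborel) simp

interpretation disc: sigma_finite_measure "\<lambda>\<D>"
  by (rule sigma_finite_disc_lborel)

interpretation disc_pair: pair_sigma_finite "\<lambda>\<D>" "\<lambda>\<D>" ..

lemma measurable_disc_continuous:
  fixes f :: "complex \<Rightarrow> 'b::topological_space"
  assumes "continuous_on \<D> f" shows "f \<in> borel_measurable \<lambda>\<D>"
proof -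
  have "sets \<lambda>\<D> = sets (restrict_space borel \<D>)"
    by (intro sets_restrict_space_cong) simp
  then show ?thesis
    using borel_measurable_continuous_on_restrict[OF assms] by (simp cong: measurable_cong_sets)
qed

lemma measurable_disc_holomorphic:
  assumes "f holomorphic_on \<D>" shows "f \<in> borel_measurable \<lambda>\<D>"
  using assms by (intro measurable_disc_continuous holomorphic_on_imp_continuous_on)

lemma measurable_disc_deriv:
  assumes "f holomorphic_on \<D>" shows "deriv f \<in> borel_measurable \<lambda>\<D>"
  using assms by (intro measurable_disc_holomorphic holomorphic_deriv) auto

text \<open>The normalization of \<open>disc_area\<close> costs only the constant \<open>pi\<close>;
  once the spaces are reformulated, all estimates are made with
  \<open>\<lambda>\<D>\<close>.\<close>

lemma nn_integral_disc_area:
  assumes "F \<in> borel_measurable \<lambda>\<D>"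
  shows "(\<integral>\<^sup>+z\<in>\<D>. F z \<partial>disc_area) = (\<integral>\<^sup>+z. F z \<partial>\<lambda>\<D>) / ennreal pi"
proof -
  have "(\<lambda>z. F z * indicator \<D> z) \<in> borel_measurable lborel"
    using assms by (subst (asm) borel_measurable_restrict_space_iff_ennreal) auto
  moreover have "emeasure lborel \<D> = ennreal pi"
    by (simp add: emeasure_ball unit_ball_vol_2)
  ultimately show ?thesis
    unfolding disc_area_def
    by (subst nn_integral_uniform_measure)
       (auto simp: nn_integral_disc_lborel mult.assoc simp flip: indicator_inter_arith)
qed

lemma emeasure_disc_lborel_le:
  assumes "A \<in> sets borel" "A \<inter> \<D> \<subseteq> ball c r" "r \<ge> 0"
  shows "(\<integral>\<^sup>+z. indicator A z \<partial>\<lambda>\<D>) \<le> ennreal (pi * r\<^sup>2)"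
proof -
  have "(\<integral>\<^sup>+z. indicator A z \<partial>\<lambda>\<D>) \<le> (\<integral>\<^sup>+z. indicator (ball c r) z \<partial>lborel)"
    unfolding nn_integral_disc_lborel
    using assms by (intro nn_integral_mono) (auto simp: indicator_def)
  also have "\<dots> = ennreal (pi * r\<^sup>2)"
    using assms by (simp add: emeasure_ball unit_ball_vol_2)
  finally show ?thesis .
qed

text \<open>The mean value property combined with the triangle inequality for integrals. Every
  pointwise bound on a derivative obtained from an area integral goes through this
  inequality.\<close>

lemma norm_le_ball_average:
  assumes h: "h holomorphic_on \<D>" and r: "0 < r" "r < 1 - norm c"
  shows "ennreal (pi * r\<^sup>2 * norm (h c)) \<le> (\<integral>\<^sup>+z. ennreal (norm (h z)) * indicator (ball c r) z \<partial>\<lambda>\<D>)"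
proof -
  define R where "R = 1 - norm c"
  have sub: "ball c R \<subseteq> \<D>" and sub': "cball c r \<subseteq> \<D>"
  proof -
    have "norm z < 1" if "dist c z < R" for z
      using that norm_triangle_ineq2[of z c] by (auto simp: R_def dist_norm norm_minus_commute)
    then show "ball c R \<subseteq> \<D>" "cball c r \<subseteq> \<D>" using r by (auto simp: R_def)
  qed
  have hh: "h holomorphic_on ball c R" using h sub by (rule holomorphic_on_subset)
  have "continuous_on (cball c r) h"
    using h sub' holomorphic_on_imp_continuous_on holomorphic_on_subset by blast
  then have int: "set_integrable lborel (ball c r) h"
    by (rule set_integrable_ball_continuous)
  have "ennreal (pi * r\<^sup>2 * norm (h c)) = norm (LINT z:ball c r|lborel. h z)"
    using ball_mean_value[OF hh r(1)] r by (simp add: R_def norm_mult norm_power)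
  also have "\<dots> \<le> (\<integral>\<^sup>+z. norm (indicator (ball c r) z *\<^sub>R h z) \<partial>lborel)"
    using integral_norm_bound_ennreal[OF int[unfolded set_integrable_def]]
    by (simp add: set_lebesgue_integral_def)
  also have "\<dots> = (\<integral>\<^sup>+z. ennreal (norm (h z)) * indicator (ball c r) z \<partial>\<lambda>\<D>)"
    unfolding nn_integral_disc_lborel
    using subsetD[OF sub'] by (intro nn_integral_cong) (auto simp: indicator_def)
  finally show ?thesis .
qed

section \<open>Areas weighted by a power of the distance to the circle\<close>

lemma nn_integral_powr_interval_le:
  fixes t b r :: real
  assumes t: "-1 < t" "t \<le> 0" and r: "r > 0"
  shows "(\<integral>\<^sup>+u. ennreal (u powr t) * indicator {u. 0 < u \<and> \<bar>u - b\<bar> < r} u \<partial>lborel)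
    \<le> ennreal ((2 * r) powr (t + 1) / (t + 1))"
proof -
  \<comment> \<open>\<open>m\<close> is the left end of the interval after cutting at 0. Shifting
    the interval to start at 0 only increases the integrand, because
    \<open>t \<le> 0\<close>.\<close>
  define m where "m = max 0 (b - r)"
  have "(\<integral>\<^sup>+u. ennreal (u powr t) * indicator {u. 0 < u \<and> \<bar>u - b\<bar> < r} u \<partial>lborel)
    = (\<integral>\<^sup>+v. ennreal ((m + v) powr t) * indicator {u. 0 < u \<and> \<bar>u - b\<bar> < r} (m + v) \<partial>lborel)"
    by (subst nn_integral_real_affine[where c = 1 and t = m]) auto
  also have "\<dots> \<le> (\<integral>\<^sup>+v. ennreal (v powr t) * indicator {0..2 * r} v \<partial>lborel)"
  proof (rule nn_integral_mono_AE)
    show "AE v in lborel. ennreal ((m + v) powr t) * indicator {u. 0 < u \<and> \<bar>u - b\<bar> < r} (m + v)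
        \<le> ennreal (v powr t) * indicator {0..2 * r} v"
      using AE_lborel_singleton[of "m - b - r"] AE_lborel_singleton[of 0]
    proof eventually_elim
      case (elim v)
      show ?case
      proof (cases "0 < m + v \<and> \<bar>m + v - b\<bar> < r")
        case True
        then have "v > 0" "v \<le> 2 * r" using elim unfolding m_def by (auto simp: max_def split: if_splits)
        moreover have "(m + v) powr t \<le> v powr t"
          using \<open>v > 0\<close> t by (intro powr_mono2') (auto simp: m_def)
        ultimately show ?thesis by (auto simp: indicator_def intro: ennreal_leI)
      qed (auto simp: indicator_def)
    qed
  qed
  also have "\<dots> = ennreal ((2 * r) powr (t + 1) / (t + 1))"
    using has_integral_powr_from_0[of t "2 * r"] t r
    by (intro nn_integral_has_integral_lebesgue') auto
  finally show ?thesis .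
qed

text \<open>On each half line \<open>q - \<bar>x\<bar>\<close> is an affine variable of slope 1 or
  -1, which turns the integral into two interval integrals centred at \<open>q - b\<close> and
  \<open>q + b\<close>.\<close>

lemma nn_integral_boundary_strip_le:
  fixes t q b r :: real
  assumes t: "-1 < t" "t \<le> 0" and r: "r > 0"
  shows "(\<integral>\<^sup>+x. ennreal ((q - \<bar>x\<bar>) powr t) * indicator {x. \<bar>x\<bar> < q \<and> \<bar>x - b\<bar> < r} x \<partial>lborel)
    \<le> ennreal (2 * ((2 * r) powr (t + 1) / (t + 1)))"
proof -
  let ?c = "(2 * r) powr (t + 1) / (t + 1)"
  let ?G = "\<lambda>b u. ennreal (u powr t) * indicator {u. 0 < u \<and> \<bar>u - b\<bar> < r} (u::real)"
  have "(\<integral>\<^sup>+x. ennreal ((q - \<bar>x\<bar>) powr t) * indicator {x. \<bar>x\<bar> < q \<and> \<bar>x - b\<bar> < r} x \<partial>lborel)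
    \<le> (\<integral>\<^sup>+x. ?G (q - b) (q + (-1) * x) + ?G (q + b) (q + 1 * x) \<partial>lborel)"
  proof (rule nn_integral_mono)
    fix x
    show "ennreal ((q - \<bar>x\<bar>) powr t) * indicator {x. \<bar>x\<bar> < q \<and> \<bar>x - b\<bar> < r} x
       \<le> ?G (q - b) (q + (-1) * x) + ?G (q + b) (q + 1 * x)"
      by (cases "x \<ge> 0") (auto simp: indicator_def abs_if split: if_splits)
  qed
  also have "\<dots> = (\<integral>\<^sup>+x. ?G (q - b) (q + (-1) * x) \<partial>lborel) + (\<integral>\<^sup>+x. ?G (q + b) (q + 1 * x) \<partial>lborel)"
    by (rule nn_integral_add) auto
  also have "(\<integral>\<^sup>+x. ?G (q - b) (q + (-1) * x) \<partial>lborel) = (\<integral>\<^sup>+x. ?G (q - b) x \<partial>lborel)"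
    using nn_integral_real_affine[of "?G (q - b)" "-1" q] by simp
  also have "(\<integral>\<^sup>+x. ?G (q + b) (q + 1 * x) \<partial>lborel) = (\<integral>\<^sup>+x. ?G (q + b) x \<partial>lborel)"
    using nn_integral_real_affine[of "?G (q + b)" "1" q] by simp
  also have "(\<integral>\<^sup>+x. ?G (q - b) x \<partial>lborel) + (\<integral>\<^sup>+x. ?G (q + b) x \<partial>lborel) \<le> ennreal ?c + ennreal ?c"
    by (intro add_mono nn_integral_powr_interval_le assms)
  also have "\<dots> = ennreal (2 * ?c)"
    using t by (subst ennreal_plus[symmetric]) auto
  finally show ?thesis .
qed

text \<open>Near the circle the distance to it is comparable to the horizontal or to the vertical one.\<close>

lemma one_minus_norm_powr_le:
  assumes t: "-1 < t" "t \<le> 0" and z: "norm z < 1"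
  defines "S \<equiv> \<lambda>x y. if \<bar>x\<bar> < sqrt (1 - y\<^sup>2) then (sqrt (1 - y\<^sup>2) - \<bar>x\<bar>) powr t else 0"
  shows "(1 - norm z) powr t \<le> 4 * (1 + S (Re z) (Im z) + S (Im z) (Re z))"
proof -
  have S0: "S x y \<ge> 0" for x y by (simp add: S_def)
  have le4: "c powr t \<le> 4" if "1/4 \<le> c" for c :: real
  proof -
    have "c powr t \<le> (1/4) powr t" using that t by (intro powr_mono2') auto
    also have "\<dots> \<le> (1/4) powr (-1)" using t by (intro powr_mono') auto
    finally show ?thesis by (simp add: powr_minus_divide)
  qed
  \<comment> \<open>With \<open>q = sqrt (1 - y^2)\<close>, the product of
    \<open>q - \<bar>x\<bar>\<close> and \<open>q + \<bar>x\<bar>\<close> is 1 - |z|^2, and the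
    second factor is at least 1 because both of its summands are at least 1/2. So the horizontal
    distance is at most twice the radial one.\<close>
  have key: "(1 - norm z) powr t \<le> 4 * S x y" if "x\<^sup>2 + y\<^sup>2 = (norm z)\<^sup>2" "\<bar>x\<bar> \<ge> 1/2" for x y
  proof -
    have n2: "(norm z)\<^sup>2 < 1" using z by (simp add: abs_square_less_1)
    define q where "q = sqrt (1 - y\<^sup>2)"
    have q2: "q\<^sup>2 = 1 - y\<^sup>2" unfolding q_def using that n2
      by (intro real_sqrt_pow2) (smt (verit) zero_le_power2)
    have xq: "\<bar>x\<bar> < q" unfolding q_def using that n2 by (intro real_less_rsqrt) auto
    have "(q - \<bar>x\<bar>) * 1 \<le> (q - \<bar>x\<bar>) * (q + \<bar>x\<bar>)"
      using xq that by (intro mult_left_mono) auto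
    also have "\<dots> = 1 - (norm z)\<^sup>2" using q2 that by (simp add: power2_eq_square algebra_simps)
    also have "\<dots> = (1 - norm z) * (1 + norm z)" by (simp add: power2_eq_square algebra_simps)
    also have "\<dots> \<le> (1 - norm z) * 2" using z by (intro mult_left_mono) auto
    finally have "(q - \<bar>x\<bar>) * (1/2) \<le> 1 - norm z" by simp
    then have "(1 - norm z) powr t \<le> ((q - \<bar>x\<bar>) * (1/2)) powr t"
      using xq t by (intro powr_mono2') auto
    also have "\<dots> = (q - \<bar>x\<bar>) powr t * (1/2) powr t" by (simp only: powr_mult)
    also have "\<dots> \<le> (q - \<bar>x\<bar>) powr t * 4" by (intro mult_left_mono le4) auto
    finally show ?thesis using xq by (simp add: S_def q_def mult.commute)
  qed
  have n: "(Re z)\<^sup>2 + (Im z)\<^sup>2 = (norm z)\<^sup>2" by (simp add: cmod_power2)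
  consider "norm z \<le> 3/4" | "\<bar>Re z\<bar> \<ge> 1/2" | "\<bar>Im z\<bar> \<ge> 1/2"
  proof -
    have "norm z \<le> 3/4" if "\<bar>Re z\<bar> < 1/2" "\<bar>Im z\<bar> < 1/2"
    proof -
      have "(Re z)\<^sup>2 \<le> (1/2)\<^sup>2" "(Im z)\<^sup>2 \<le> (1/2)\<^sup>2"
        using that by (auto simp: abs_le_square_iff[symmetric])
      then have "(norm z)\<^sup>2 \<le> (3/4)\<^sup>2" using n by (simp add: power2_eq_square)
      then show ?thesis by (rule power2_le_imp_le) simp
    qed
    then show thesis using that by argo
  qed
  then show ?thesis
  proof cases
    case 1
    then show ?thesis using le4[of "1 - norm z"] S0[of "Re z" "Im z"] S0[of "Im z" "Re z"] by argo
  next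
    case 2
    then show ?thesis using key[of "Re z" "Im z"] n S0[of "Im z" "Re z"] by argo
  next
    case 3
    then show ?thesis using key[of "Im z" "Re z"] n S0[of "Re z" "Im z"] by argo
  qed
qed

text \<open>The ball lies in the square \<open>X\<close> times \<open>Y\<close>. After the weight is
  majorized by \<open>one_minus_norm_powr_le\<close>, Fubini leaves an inner integral of order r^(t
  + 1), uniformly in the position of the square, and an outer side of length 2 r.\<close>

lemma boundary_weight_ball:
  assumes t: "-1 < t" "t \<le> 0"
  obtains C where "C > 0"
    "\<And>c r. 0 < r \<Longrightarrow> r \<le> 8 \<Longrightarrow>
      (\<integral>\<^sup>+z. ennreal ((1 - norm z) powr t) * indicator (ball c r) z \<partial>\<lambda>\<D>) \<le> ennreal (C * r powr (t + 2))"
proof -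
  define S where "S x y = (if \<bar>x\<bar> < sqrt (1 - y\<^sup>2) then (sqrt (1 - y\<^sup>2) - \<bar>x\<bar>) powr t else 0)" for x y :: real
  define C where "C = 4 * (32 + 16 / (t + 1))"
  have Cpos: "C > 0" using t by (simp add: C_def add_pos_nonneg)
  show ?thesis
  proof (rule that[OF Cpos])
    fix c :: complex and r :: real
    assume r: "0 < r" "r \<le> 8"
    define X where "X = {x. \<bar>x - Re c\<bar> < r}"
    define Y where "Y = {y. \<bar>y - Im c\<bar> < r}"
    have [measurable]: "X \<in> sets borel" "Y \<in> sets borel" by (simp_all add: X_def Y_def)
    have [measurable]: "case_prod S \<in> borel_measurable (borel \<Otimes>\<^sub>M borel)"
      unfolding S_def by measurable
    have [measurable]: "Re \<in> borel_measurable borel" "Im \<in> borel_measurable borel"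
      by simp_all
    have S1: "(\<lambda>z. ennreal (S (Re z) (Im z))) \<in> borel_measurable borel"
      "(\<lambda>z. ennreal (S (Im z) (Re z))) \<in> borel_measurable borel" by measurable
    have XY: "emeasure lborel X \<le> ennreal (2 * r)" "emeasure lborel Y \<le> ennreal (2 * r)"
    proof -
      have "X = {Re c - r <..< Re c + r}" "Y = {Im c - r <..< Im c + r}"
        by (auto simp: X_def Y_def)
      then show "emeasure lborel X \<le> ennreal (2 * r)" "emeasure lborel Y \<le> ennreal (2 * r)"
        using r by simp_all
    qed
    define K where "K = 2 * ((2 * r) powr (t + 1) / (t + 1))"
    have K0: "K \<ge> 0" using t by (simp add: K_def)
    have I1: "(\<integral>\<^sup>+z. ennreal (S (Re z) (Im z)) * (indicator X (Re z) * indicator Y (Im z)) \<partial>lborel) \<le> ennreal (K * (2 * r))"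
    proof -
      have "(\<integral>\<^sup>+z. ennreal (S (Re z) (Im z)) * (indicator X (Re z) * indicator Y (Im z)) \<partial>lborel)
        = (\<integral>\<^sup>+y. (\<integral>\<^sup>+x. (ennreal (S x y) * indicator X x) * indicator Y y \<partial>lborel) \<partial>lborel)"
        using S1 by (subst nn_integral_complex_Fubini) (auto simp: mult.assoc)
      also have "\<dots> \<le> (\<integral>\<^sup>+y. ennreal K * indicator Y y \<partial>lborel)"
      proof (intro nn_integral_mono)
        fix y
        have "(\<integral>\<^sup>+x. (ennreal (S x y) * indicator X x) * indicator Y y \<partial>lborel)
          = (\<integral>\<^sup>+x. ennreal (S x y) * indicator X x \<partial>lborel) * indicator Y y"
          by (intro nn_integral_multc) measurable
        also have "(\<integral>\<^sup>+x. ennreal (S x y) * indicator X x \<partial>lborel) =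
           (\<integral>\<^sup>+x. ennreal ((sqrt (1 - y\<^sup>2) - \<bar>x\<bar>) powr t) * indicator {x. \<bar>x\<bar> < sqrt (1 - y\<^sup>2) \<and> \<bar>x - Re c\<bar> < r} x \<partial>lborel)"
          by (intro nn_integral_cong) (auto simp: S_def X_def indicator_def)
        also have "\<dots> \<le> ennreal K" unfolding K_def
          by (rule nn_integral_boundary_strip_le) (use t r in auto)
        finally show "(\<integral>\<^sup>+x. (ennreal (S x y) * indicator X x) * indicator Y y \<partial>lborel) \<le> ennreal K * indicator Y y"
          by (auto simp: mult_right_mono)
      qed
      also have "\<dots> = ennreal K * emeasure lborel Y" by (simp add: nn_integral_cmult)
      also have "\<dots> \<le> ennreal K * ennreal (2 * r)" by (intro mult_left_mono XY) auto
      finally show ?thesis using K0 r by (simp add: ennreal_mult)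
    qed
    have I2: "(\<integral>\<^sup>+z. ennreal (S (Im z) (Re z)) * (indicator X (Re z) * indicator Y (Im z)) \<partial>lborel) \<le> ennreal (K * (2 * r))"
    proof -
      have "(\<integral>\<^sup>+z. ennreal (S (Im z) (Re z)) * (indicator X (Re z) * indicator Y (Im z)) \<partial>lborel)
        = (\<integral>\<^sup>+x. (\<integral>\<^sup>+y. (ennreal (S y x) * indicator Y y) * indicator X x \<partial>lborel) \<partial>lborel)"
        using S1 by (subst nn_integral_complex_Fubini') (auto simp: mult_ac)
      also have "\<dots> \<le> (\<integral>\<^sup>+x. ennreal K * indicator X x \<partial>lborel)"
      proof (intro nn_integral_mono)
        fix x
        have "(\<integral>\<^sup>+y. (ennreal (S y x) * indicator Y y) * indicator X x \<partial>lborel)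
          = (\<integral>\<^sup>+y. ennreal (S y x) * indicator Y y \<partial>lborel) * indicator X x"
          by (intro nn_integral_multc) measurable
        also have "(\<integral>\<^sup>+y. ennreal (S y x) * indicator Y y \<partial>lborel) =
           (\<integral>\<^sup>+y. ennreal ((sqrt (1 - x\<^sup>2) - \<bar>y\<bar>) powr t) * indicator {y. \<bar>y\<bar> < sqrt (1 - x\<^sup>2) \<and> \<bar>y - Im c\<bar> < r} y \<partial>lborel)"
          by (intro nn_integral_cong) (auto simp: S_def Y_def indicator_def)
        also have "\<dots> \<le> ennreal K" unfolding K_def
          by (rule nn_integral_boundary_strip_le) (use t r in auto)
        finally show "(\<integral>\<^sup>+y. (ennreal (S y x) * indicator Y y) * indicator X x \<partial>lborel) \<le> ennreal K * indicator X x"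
          by (auto simp: mult_right_mono)
      qed
      also have "\<dots> = ennreal K * emeasure lborel X" by (simp add: nn_integral_cmult)
      also have "\<dots> \<le> ennreal K * ennreal (2 * r)" by (intro mult_left_mono XY) auto
      finally show ?thesis using K0 r by (simp add: ennreal_mult)
    qed
    have I3: "(\<integral>\<^sup>+z. indicator X (Re z) * indicator Y (Im z) \<partial>lborel) \<le> ennreal (2 * r * (2 * r))"
    proof -
      have "(\<integral>\<^sup>+z. indicator X (Re z) * indicator Y (Im z) \<partial>lborel) = (\<integral>\<^sup>+y. \<integral>\<^sup>+x. indicator X x * indicator Y y \<partial>lborel \<partial>lborel)"
        by (subst nn_integral_complex_Fubini) auto
      also have "\<dots> = emeasure lborel X * emeasure lborel Y"
        by (simp add: nn_integral_multc nn_integral_cmult)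
      also have "\<dots> \<le> ennreal (2 * r) * ennreal (2 * r)" by (intro mult_mono XY) auto
      finally show ?thesis using r by (subst ennreal_mult) auto
    qed
    have "(\<integral>\<^sup>+z. ennreal ((1 - norm z) powr t) * indicator (ball c r) z \<partial>\<lambda>\<D>)
      \<le> (\<integral>\<^sup>+z. ennreal 4 * (indicator X (Re z) * indicator Y (Im z)
            + ennreal (S (Re z) (Im z)) * (indicator X (Re z) * indicator Y (Im z))
            + ennreal (S (Im z) (Re z)) * (indicator X (Re z) * indicator Y (Im z))) \<partial>lborel)"
      unfolding nn_integral_disc_lborel
    proof (intro nn_integral_mono)
      fix z
      have S0: "S x y \<ge> 0" for x y by (simp add: S_def)
      show "ennreal ((1 - norm z) powr t) * indicator (ball c r) z * indicator \<D> z \<le>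
         ennreal 4 * (indicator X (Re z) * indicator Y (Im z)
            + ennreal (S (Re z) (Im z)) * (indicator X (Re z) * indicator Y (Im z))
            + ennreal (S (Im z) (Re z)) * (indicator X (Re z) * indicator Y (Im z)))"
      proof (cases "z \<in> ball c r \<inter> \<D>")
        case True
        then have "Re z \<in> X" "Im z \<in> Y"
          using abs_Re_le_cmod[of "z - c"] abs_Im_le_cmod[of "z - c"]
          by (auto simp: X_def Y_def dist_norm norm_minus_commute)
        moreover have "ennreal ((1 - norm z) powr t) \<le> ennreal (4 * (1 + S (Re z) (Im z) + S (Im z) (Re z)))"
          using True one_minus_norm_powr_le[OF t, of z] by (intro ennreal_leI) (simp add: S_def)
        ultimately show ?thesis using True S0 by (simp add: ennreal_mult ennreal_plus)
      qed auto
    qed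
    also have "\<dots> = ennreal 4 * ((\<integral>\<^sup>+z. indicator X (Re z) * indicator Y (Im z) \<partial>lborel)
            + (\<integral>\<^sup>+z. ennreal (S (Re z) (Im z)) * (indicator X (Re z) * indicator Y (Im z)) \<partial>lborel)
            + (\<integral>\<^sup>+z. ennreal (S (Im z) (Re z)) * (indicator X (Re z) * indicator Y (Im z)) \<partial>lborel))"
      using S1 by (simp add: nn_integral_cmult nn_integral_add)
    also have "\<dots> \<le> ennreal 4 * (ennreal (2 * r * (2 * r)) + ennreal (K * (2 * r)) + ennreal (K * (2 * r)))"
      by (intro mult_left_mono add_mono I1 I2 I3) auto
    also have "\<dots> = ennreal (4 * (2 * r * (2 * r) + K * (2 * r) + K * (2 * r)))"
    proof -
      have "ennreal 4 * (ennreal a + ennreal b + ennreal c) = ennreal (4 * (a + b + c))"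
        if "a \<ge> 0" "b \<ge> 0" "c \<ge> 0" for a b c
        using that by (simp only: ennreal_plus[symmetric] add_nonneg_nonneg ennreal_mult)
      from this[of "2 * r * (2 * r)" "K * (2 * r)" "K * (2 * r)"] show ?thesis using r K0 by auto
    qed
    also have "\<dots> \<le> ennreal (C * r powr (t + 2))"
    proof (rule ennreal_leI)
      \<comment> \<open>The constant summand of the majorant contributes plain area r^2. Since -1 <
        t \<le> 0, the bound \<open>r \<le> 8\<close> absorbs it into r^(t + 2).\<close>
      have 1: "r * r \<le> 8 * r powr (t + 2)"
      proof -
        have "r powr (- t) \<le> 8 powr (-t)" using r t by (intro powr_mono2) auto
        also have "\<dots> \<le> 8 powr 1" using t by (intro powr_mono) auto
        finally have "r powr (-t) * r powr (t + 2) \<le> 8 * r powr (t + 2)"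
          by (intro mult_right_mono) auto
        moreover have "r powr (-t) * r powr (t + 2) = r * r"
          using r by (simp add: powr_add[symmetric] power2_eq_square[symmetric])
        ultimately show ?thesis by simp
      qed
      have 2: "K * r \<le> 4 / (t + 1) * r powr (t + 2)"
      proof -
        have "K * r = 2 / (t + 1) * 2 powr (t + 1) * (r powr (t + 1) * r powr 1)"
          using r by (simp add: K_def powr_mult)
        also have "r powr (t + 1) * r powr 1 = r powr (t + 2)"
          using r by (subst powr_add[symmetric]) (simp add: add.commute)
        also have "2 / (t + 1) * 2 powr (t + 1) * r powr (t + 2) \<le> 2 / (t + 1) * 2 powr 1 * r powr (t + 2)"
          using t by (intro mult_right_mono mult_left_mono powr_mono) auto
        finally show ?thesis by simp
      qed
      have "4 * (2 * r * (2 * r) + K * (2 * r) + K * (2 * r)) = 4 * (4 * (r * r) + 4 * (K * r))" by simp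
      also have "\<dots> \<le> 4 * (4 * (8 * r powr (t + 2)) + 4 * (4 / (t + 1) * r powr (t + 2)))"
        using 1 2 by (intro mult_left_mono add_mono) auto
      also have "\<dots> = C * r powr (t + 2)" by (simp add: C_def algebra_simps)
      finally show "4 * (2 * r * (2 * r) + K * (2 * r) + K * (2 * r)) \<le> C * r powr (t + 2)" .
    qed
    finally show "(\<integral>\<^sup>+z. ennreal ((1 - norm z) powr t) * indicator (ball c r) z \<partial>\<lambda>\<D>) \<le> ennreal (C * r powr (t + 2))" .
  qed
qed

section \<open>Kernel estimates\<close>

lemma one_minus_norm_le: "1 - norm a \<le> norm (1 - cnj a * z)" if "norm z \<le> 1"
proof -
  have "norm (cnj a * z) \<le> norm a" using that by (simp add: norm_mult mult_left_le)
  moreover have "1 - norm (cnj a * z) \<le> norm (1 - cnj a * z)"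
    using norm_triangle_ineq2[of 1 "cnj a * z"] by simp
  ultimately show ?thesis by simp
qed

lemma norm_one_minus_cnj_mult_swap: "norm (1 - cnj a * z) = norm (1 - cnj z * a)"
proof -
  have "1 - cnj z * a = cnj (1 - cnj a * z)" by (simp add: mult.commute)
  then show ?thesis by (simp only: complex_mod_cnj)
qed

lemma one_minus_norm_le': "1 - norm z \<le> norm (1 - cnj a * z)" if "norm a \<le> 1"
  using one_minus_norm_le[OF that, of z] norm_one_minus_cnj_mult_swap by simp

lemma norm_one_minus_cnj_mult_less_2: "norm (1 - cnj a * z) < 2" if "norm a < 1" "norm z < 1"
proof -
  have "norm (1 - cnj a * z) \<le> 1 + norm a * norm z"
    using norm_triangle_ineq4[of 1 "cnj a * z"] by (simp add: norm_mult)
  also have "norm a * norm z < 1" using that by (smt (verit) mult_left_le norm_ge_zero)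
  finally show ?thesis by simp
qed

text \<open>For r < 1/2 the region meets the disc only if |a| > 1/2, and then it lies within
  distance 2 r of the reflected point \<open>1 / cnj a\<close>. For r \<ge> 1/2 the whole disc is
  taken, and the same factor 3 makes \<open>3 * r\<close> at least 1.\<close>

lemma boundary_weight_box:
  assumes t: "-1 < t" "t \<le> 0"
  obtains C where "C > 0"
    "\<And>a r. norm a < 1 \<Longrightarrow> 0 < r \<Longrightarrow>
      (\<integral>\<^sup>+z. ennreal ((1 - norm z) powr t) * indicator {z. norm (1 - cnj a * z) \<le> r} z \<partial>\<lambda>\<D>)
        \<le> ennreal (C * r powr (t + 2))"
proof -
  obtain C where C: "C > 0"
    "\<And>c r. 0 < r \<Longrightarrow> r \<le> 8 \<Longrightarrow>
      (\<integral>\<^sup>+z. ennreal ((1 - norm z) powr t) * indicator (ball c r) z \<partial>\<lambda>\<D>) \<le> ennreal (C * r powr (t + 2))"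
    using boundary_weight_ball[OF t] by blast
  define C' where "C' = C * 3 powr (t + 2)"
  have C': "C' > 0" using C by (simp add: C'_def)
  show ?thesis
  proof (rule that[OF C'])
    fix a :: complex and r :: real
    assume a: "norm a < 1" and r: "0 < r"
    let ?E = "{z. norm (1 - cnj a * z) \<le> r}"
    show "(\<integral>\<^sup>+z. ennreal ((1 - norm z) powr t) * indicator ?E z \<partial>\<lambda>\<D>) \<le> ennreal (C' * r powr (t + 2))"
    proof (cases "r \<ge> 1/2")
      case True
      have "(\<integral>\<^sup>+z. ennreal ((1 - norm z) powr t) * indicator ?E z \<partial>\<lambda>\<D>)
         \<le> (\<integral>\<^sup>+z. ennreal ((1 - norm z) powr t) * indicator \<D> z \<partial>\<lambda>\<D>)"
        by (intro nn_integral_mono) (auto simp: indicator_def)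
      also have "\<dots> \<le> ennreal (C * 1 powr (t + 2))" by (rule C) auto
      also have "\<dots> \<le> ennreal (C' * r powr (t + 2))"
      proof (rule ennreal_leI)
        have "1 \<le> (3 * r) powr (t + 2)" using True t by (intro ge_one_powr_ge_zero) auto
        also have "\<dots> = 3 powr (t + 2) * r powr (t + 2)" by (simp only: powr_mult)
        finally show "C * 1 powr (t + 2) \<le> C' * r powr (t + 2)"
          using C(1) unfolding C'_def by (simp add: mult.assoc)
      qed
      finally show ?thesis .
    next
      case False
      have sub: "z \<in> ball (1 / cnj a) (3 * r)" if z: "norm z < 1" "norm (1 - cnj a * z) \<le> r" for z
      proof -
        have "1 - norm a < 1/2" using one_minus_norm_le[of z a] z False by simp
        then have a2: "norm a > 1/2" by simp
        then have a0: "a \<noteq> 0" by auto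
        have "dist (1 / cnj a) z * norm a = norm ((1 / cnj a - z) * cnj a)"
          by (simp add: dist_norm norm_mult)
        also have "(1 / cnj a - z) * cnj a = 1 - cnj a * z" using a0 by (simp add: field_simps)
        finally have "dist (1 / cnj a) z * norm a \<le> r" using z by simp
        moreover have "dist (1 / cnj a) z * (1/2) \<le> dist (1 / cnj a) z * norm a"
          using a2 by (intro mult_left_mono) auto
        ultimately have "dist (1 / cnj a) z \<le> 2 * r" by simp
        then show ?thesis using r by simp
      qed
      have "(\<integral>\<^sup>+z. ennreal ((1 - norm z) powr t) * indicator ?E z \<partial>\<lambda>\<D>)
         \<le> (\<integral>\<^sup>+z. ennreal ((1 - norm z) powr t) * indicator (ball (1 / cnj a) (3 * r)) z \<partial>\<lambda>\<D>)"
        using sub by (intro nn_integral_mono mult_left_mono) (auto simp: indicator_def)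
      also have "\<dots> \<le> ennreal (C * (3 * r) powr (t + 2))" using False r by (intro C) auto
      finally show ?thesis by (simp only: C'_def powr_mult mult.assoc)
    qed
  qed
qed

section \<open>Forelli-Rudin integrals\<close>

lemma dyadic_index:
  fixes x \<delta> :: real
  assumes "\<delta> \<le> x" "x < 2 ^ N * \<delta>"
  shows "\<exists>k<N. 2 ^ k * \<delta> \<le> x \<and> x < 2 ^ (k + 1) * \<delta>"
  using assms
proof (induction N)
  case (Suc N)
  then show ?case by (cases "x < 2 ^ N * \<delta>") (auto simp: less_Suc_eq not_less)
qed auto

text \<open>The disc is cut into shells where |1 - cnj a z| is about 2^k (1 - |a|); by
  \<open>boundary_weight_box\<close> such a shell has weighted area about the power t + 2 of that
  size, which leaves the power -c. Keeping the sum finite, with \<open>N\<close> just large enough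
  to reach the diameter 2, treats c > 0 and c = 0 together.\<close>

lemma Forelli_Rudin_dyadic:
  assumes t: "-1 < t" "t \<le> 0" and c: "c \<ge> 0"
  obtains C where "C > 0"
    "\<And>a N. norm a < 1 \<Longrightarrow> 2 < 2 ^ N * (1 - norm a) \<Longrightarrow>
      (\<integral>\<^sup>+z. ennreal ((1 - norm z) powr t / norm (1 - cnj a * z) powr (t + 2 + c)) \<partial>\<lambda>\<D>)
        \<le> ennreal (C * (\<Sum>k<N. (2 ^ k * (1 - norm a)) powr (- c)))"
proof -
  obtain C where C: "C > 0"
    "\<And>a r. norm a < 1 \<Longrightarrow> 0 < r \<Longrightarrow>
      (\<integral>\<^sup>+z. ennreal ((1 - norm z) powr t) * indicator {z. norm (1 - cnj a * z) \<le> r} z \<partial>\<lambda>\<D>)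
        \<le> ennreal (C * r powr (t + 2))"
    using boundary_weight_box[OF t] by blast
  define C' where "C' = C * 2 powr (t + 2)"
  have C': "C' > 0" using C by (simp add: C'_def)
  show ?thesis
  proof (rule that[OF C'])
    fix a :: complex and N :: nat
    assume a: "norm a < 1" and N: "2 < 2 ^ N * (1 - norm a)"
    define \<delta> where "\<delta> = 1 - norm a"
    have \<delta>: "\<delta> > 0" using a by (simp add: \<delta>_def)
    define e where "e = t + 2 + c"
    let ?E = "\<lambda>k. {z. norm (1 - cnj a * z) \<le> 2 ^ (k + 1) * \<delta>}"
    have "(\<integral>\<^sup>+z. ennreal ((1 - norm z) powr t / norm (1 - cnj a * z) powr e) \<partial>\<lambda>\<D>)
      \<le> (\<integral>\<^sup>+z. (\<Sum>k<N. ennreal ((2 ^ k * \<delta>) powr (-e)) * (ennreal ((1 - norm z) powr t) * indicator (?E k) z)) \<partial>\<lambda>\<D>)"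
    proof (rule nn_integral_mono)
      fix z assume "z \<in> space \<lambda>\<D>"
      then have z: "norm z < 1" by simp
      define x where "x = norm (1 - cnj a * z)"
      have "\<delta> \<le> x" using one_minus_norm_le[of z a] z by (simp add: \<delta>_def x_def)
      moreover have "x < 2 ^ N * \<delta>" using norm_one_minus_cnj_mult_less_2[OF a z] N by (simp add: \<delta>_def x_def)
      ultimately obtain k where k: "k < N" "2 ^ k * \<delta> \<le> x" "x < 2 ^ (k + 1) * \<delta>"
        using dyadic_index by blast
      have "x powr (-e) \<le> (2 ^ k * \<delta>) powr (-e)"
        using k \<delta> t c by (intro powr_mono2') (auto simp: e_def)
      then have "x powr (-e) * (1 - norm z) powr t \<le> (2 ^ k * \<delta>) powr (-e) * (1 - norm z) powr t"
        by (rule mult_right_mono) simp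
      moreover have "(1 - norm z) powr t / x powr e = x powr (-e) * (1 - norm z) powr t"
        by (simp add: powr_minus divide_inverse mult.commute)
      ultimately have "(1 - norm z) powr t / x powr e \<le> (2 ^ k * \<delta>) powr (-e) * (1 - norm z) powr t"
        by simp
      then have "ennreal ((1 - norm z) powr t / x powr e) \<le> ennreal ((2 ^ k * \<delta>) powr (-e)) * (ennreal ((1 - norm z) powr t) * indicator (?E k) z)"
        using k by (simp add: x_def ennreal_mult[symmetric] ennreal_leI)
      also have "\<dots> \<le> (\<Sum>k<N. ennreal ((2 ^ k * \<delta>) powr (-e)) * (ennreal ((1 - norm z) powr t) * indicator (?E k) z))"
        using k by (intro member_le_sum) auto
      finally show "ennreal ((1 - norm z) powr t / norm (1 - cnj a * z) powr e) \<le> (\<Sum>k<N. ennreal ((2 ^ k * \<delta>) powr (-e)) * (ennreal ((1 - norm z) powr t) * indicator (?E k) z))"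
        by (simp add: x_def)
    qed
    also have "\<dots> = (\<Sum>k<N. ennreal ((2 ^ k * \<delta>) powr (-e)) * (\<integral>\<^sup>+z. ennreal ((1 - norm z) powr t) * indicator (?E k) z \<partial>\<lambda>\<D>))"
      by (simp add: nn_integral_sum nn_integral_cmult)
    also have "\<dots> \<le> (\<Sum>k<N. ennreal ((2 ^ k * \<delta>) powr (-e)) * ennreal (C * (2 ^ (k + 1) * \<delta>) powr (t + 2)))"
      using a \<delta> by (intro sum_mono mult_left_mono C) auto
    also have "\<dots> = (\<Sum>k<N. ennreal (C' * (2 ^ k * \<delta>) powr (- c)))"
    proof (intro sum.cong refl)
      fix k
      have "(2 ^ (k + 1) * \<delta>) powr (t + 2) = 2 powr (t + 2) * (2 ^ k * \<delta>) powr (t + 2)"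
        by (subst powr_mult[symmetric]) (simp add: mult.assoc)
      moreover have "(2 ^ k * \<delta>) powr (-e) * (2 ^ k * \<delta>) powr (t + 2) = (2 ^ k * \<delta>) powr (- c)"
        by (subst powr_add[symmetric]) (simp add: e_def)
      ultimately have "(2 ^ k * \<delta>) powr (-e) * (C * (2 ^ (k + 1) * \<delta>) powr (t + 2)) = C' * (2 ^ k * \<delta>) powr (- c)"
        by (simp add: C'_def algebra_simps)
      then show "ennreal ((2 ^ k * \<delta>) powr (-e)) * ennreal (C * (2 ^ (k + 1) * \<delta>) powr (t + 2)) = ennreal (C' * (2 ^ k * \<delta>) powr (- c))"
        using C(1) by (simp add: ennreal_mult[symmetric])
    qed
    also have "\<dots> = ennreal (C' * (\<Sum>k<N. (2 ^ k * \<delta>) powr (- c)))"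
      using C' by (subst sum_ennreal) (auto simp: sum_distrib_left)
    finally show "(\<integral>\<^sup>+z. ennreal ((1 - norm z) powr t / norm (1 - cnj a * z) powr (t + 2 + c)) \<partial>\<lambda>\<D>)
        \<le> ennreal (C' * (\<Sum>k<N. (2 ^ k * (1 - norm a)) powr (- c)))" by (simp add: \<delta>_def e_def)
  qed
qed

text \<open>A positive power of 1 - |z| cancels against the kernel because 1 - |z| \<le> |1 - cnj a
  z|. This removes the restriction \<open>t \<le> 0\<close> inherited from the weighted
  areas.\<close>

lemma Forelli_Rudin_reduce:
  assumes "0 \<le> t" "norm a < 1" "norm z < 1"
  shows "(1 - norm z) powr t / norm (1 - cnj a * z) powr (t + 2 + c)
    \<le> (1 - norm z) powr 0 / norm (1 - cnj a * z) powr (0 + 2 + c)"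
proof -
  define x where "x = norm (1 - cnj a * z)"
  have x: "1 - norm z \<le> x" using one_minus_norm_le'[of a z] assms by (simp add: x_def)
  then have x0: "x > 0" using assms by simp
  have "(1 - norm z) powr t \<le> x powr t" using x assms by (intro powr_mono2) auto
  then have "(1 - norm z) powr t / x powr (t + (2 + c)) \<le> x powr t / x powr (t + (2 + c))"
    by (intro divide_right_mono) auto
  also have "\<dots> = 1 / x powr (2 + c)" using x0 by (simp add: powr_add)
  finally show ?thesis using assms by (simp add: x_def add.assoc)
qed

text \<open>For c > 0 the shell contributions form a geometric series of ratio 2^(-c), so the
  innermost shell, of size 1 - |a|, decides.\<close>

lemma Forelli_Rudin:
  assumes t: "-1 < t" and c: "c > 0"
  obtains C where "C > 0"
    "\<And>a. norm a < 1 \<Longrightarrow>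
      (\<integral>\<^sup>+z. ennreal ((1 - norm z) powr t / norm (1 - cnj a * z) powr (t + 2 + c)) \<partial>\<lambda>\<D>)
        \<le> ennreal (C * (1 - norm a) powr (- c))"
proof -
  define t' where "t' = min t 0"
  have t': "-1 < t'" "t' \<le> 0" using t by (auto simp: t'_def)
  obtain C where C: "C > 0"
    "\<And>a N. norm a < 1 \<Longrightarrow> 2 < 2 ^ N * (1 - norm a) \<Longrightarrow>
      (\<integral>\<^sup>+z. ennreal ((1 - norm z) powr t' / norm (1 - cnj a * z) powr (t' + 2 + c)) \<partial>\<lambda>\<D>)
        \<le> ennreal (C * (\<Sum>k<N. (2 ^ k * (1 - norm a)) powr (- c)))"
    using Forelli_Rudin_dyadic[OF t', of c] c by auto
  define q where "q = (2::real) powr (- c)"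
  have q: "0 < q" "q < 1" using c by (auto simp: q_def powr_less_one)
  define C' where "C' = C / (1 - q)"
  have C': "C' > 0" using C q by (simp add: C'_def)
  show ?thesis
  proof (rule that[OF C'])
    fix a :: complex assume a: "norm a < 1"
    obtain N where "2 / (1 - norm a) < 2 ^ N" using real_arch_pow[of 2] by auto
    then have N: "2 < 2 ^ N * (1 - norm a)" using a by (simp add: field_simps)
    have "(\<integral>\<^sup>+z. ennreal ((1 - norm z) powr t / norm (1 - cnj a * z) powr (t + 2 + c)) \<partial>\<lambda>\<D>)
      \<le> (\<integral>\<^sup>+z. ennreal ((1 - norm z) powr t' / norm (1 - cnj a * z) powr (t' + 2 + c)) \<partial>\<lambda>\<D>)"
      using Forelli_Rudin_reduce[of t a _ c] a
      by (intro nn_integral_mono ennreal_leI) (auto simp: t'_def min_def)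
    also have "\<dots> \<le> ennreal (C * (\<Sum>k<N. (2 ^ k * (1 - norm a)) powr (- c)))" by (rule C(2)[OF a N])
    also have "\<dots> \<le> ennreal (C' * (1 - norm a) powr (- c))"
    proof (rule ennreal_leI)
      have "(\<Sum>k<N. (2 ^ k * (1 - norm a)) powr (- c)) = (\<Sum>k<N. q ^ k) * (1 - norm a) powr (- c)"
        by (simp add: powr_mult q_def powr_power powr_realpow[symmetric] powr_powr sum_distrib_left mult.commute)
      also have "\<dots> \<le> 1 / (1 - q) * (1 - norm a) powr (- c)"
        using q sum_le_suminf[of "\<lambda>k. q ^ k" "{..<N}"] by (intro mult_right_mono) (auto simp: suminf_geometric)
      finally have "C * (\<Sum>k<N. (2 ^ k * (1 - norm a)) powr (- c)) \<le> C * (1 / (1 - q) * (1 - norm a) powr (- c))"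
        using C(1) by (intro mult_left_mono) auto
      then show "C * (\<Sum>k<N. (2 ^ k * (1 - norm a)) powr (- c)) \<le> C' * (1 - norm a) powr (- c)"
        by (simp add: C'_def)
    qed
    finally show "(\<integral>\<^sup>+z. ennreal ((1 - norm z) powr t / norm (1 - cnj a * z) powr (t + 2 + c)) \<partial>\<lambda>\<D>)
        \<le> ennreal (C' * (1 - norm a) powr (- c))" .
  qed
qed

text \<open>The 2 keeps the value at least \<open>ln 2\<close> on the disc, so that powers of either
  sign stay under control near the centre.\<close>

definition disc_log :: "complex \<Rightarrow> real"
  where "disc_log a = ln (2 / (1 - norm a))"

lemma disc_log_ge: "ln 2 \<le> disc_log a" and disc_log_pos: "0 < disc_log a" if "norm a < 1"
proof -
  have "2 \<le> 2 / (1 - norm a)" using that by (simp add: field_simps)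
  then show "ln 2 \<le> disc_log a" unfolding disc_log_def using that by (subst ln_le_cancel_iff) auto
  moreover have "0 < ln (2::real)" by simp
  ultimately show "0 < disc_log a" by linarith
qed

text \<open>\<open>N\<close> counts the dyadic scales between 1 - |a| and 1, hence the logarithm.
  The 5 is the aperture of \<open>disc_cone\<close>, whose scales are counted with the same
  \<open>N\<close>.\<close>

lemma dyadic_count_le:
  assumes "norm a < 1"
  shows "\<exists>N. 5 < 2 ^ N * (1 - norm a) \<and> real N \<le> 4 / ln 2 * disc_log a"
proof -
  define l where "l = disc_log a / ln 2"
  have l: "l \<ge> 1" using disc_log_ge[OF assms] by (simp add: l_def)
  have 2: "2 powr l = 2 / (1 - norm a)"
    using assms by (simp add: l_def disc_log_def powr_def)
  define N where "N = nat \<lfloor>l + 2\<rfloor> + 1"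
  have N: "l + 2 < real N" "real N \<le> l + 3" using l by (auto simp: N_def) linarith+
  have "2 powr (l + 2) < 2 powr real N" using N by simp
  then have "8 / (1 - norm a) < 2 ^ N" by (simp add: powr_add 2 powr_realpow)
  then have "5 < 2 ^ N * (1 - norm a)" using assms by (simp add: field_simps)
  moreover have "real N \<le> 4 * l" using N l by simp
  ultimately show ?thesis by (auto simp: l_def)
qed

text \<open>For c = 0 all shells contribute equally, so the bound is their number.\<close>

lemma Forelli_Rudin_log:
  assumes t: "-1 < t"
  obtains C where "C > 0"
    "\<And>a. norm a < 1 \<Longrightarrow>
      (\<integral>\<^sup>+z. ennreal ((1 - norm z) powr t / norm (1 - cnj a * z) powr (t + 2)) \<partial>\<lambda>\<D>)
        \<le> ennreal (C * disc_log a)"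
proof -
  define t' where "t' = min t 0"
  have t': "-1 < t'" "t' \<le> 0" using t by (auto simp: t'_def)
  obtain C where C: "C > 0"
    "\<And>a N. norm a < 1 \<Longrightarrow> 2 < 2 ^ N * (1 - norm a) \<Longrightarrow>
      (\<integral>\<^sup>+z. ennreal ((1 - norm z) powr t' / norm (1 - cnj a * z) powr (t' + 2 + 0)) \<partial>\<lambda>\<D>)
        \<le> ennreal (C * (\<Sum>k<N. (2 ^ k * (1 - norm a)) powr (- 0)))"
    using Forelli_Rudin_dyadic[OF t', of 0] by auto
  define C' where "C' = C * (4 / ln 2)"
  have C': "C' > 0" using C by (simp add: C'_def)
  show ?thesis
  proof (rule that[OF C'])
    fix a :: complex assume a: "norm a < 1"
    obtain N where N: "5 < 2 ^ N * (1 - norm a)" "real N \<le> 4 / ln 2 * disc_log a"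
      using dyadic_count_le[OF a] by blast
    have "(\<integral>\<^sup>+z. ennreal ((1 - norm z) powr t / norm (1 - cnj a * z) powr (t + 2)) \<partial>\<lambda>\<D>)
      \<le> (\<integral>\<^sup>+z. ennreal ((1 - norm z) powr t' / norm (1 - cnj a * z) powr (t' + 2 + 0)) \<partial>\<lambda>\<D>)"
      using Forelli_Rudin_reduce[of t a _ 0] a
      by (intro nn_integral_mono ennreal_leI) (auto simp: t'_def min_def)
    also have "\<dots> \<le> ennreal (C * (\<Sum>k<N. (2 ^ k * (1 - norm a)) powr (- 0)))"
      using N by (intro C a) simp
    also have "(\<Sum>k<N. (2 ^ k * (1 - norm a)) powr (- 0)) = real N" using a by simp
    also have "ennreal (C * real N) \<le> ennreal (C' * disc_log a)"
      using mult_left_mono[OF N(2), of C] C(1) by (intro ennreal_leI) (simp add: C'_def)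
    finally show "(\<integral>\<^sup>+z. ennreal ((1 - norm z) powr t / norm (1 - cnj a * z) powr (t + 2)) \<partial>\<lambda>\<D>)
        \<le> ennreal (C' * disc_log a)" .
  qed
qed

text \<open>As a set of \<open>w\<close> this is a nontangential region around the radius ending at
  \<open>z\<close>, cut off near the height of \<open>z\<close> because 1 - |z| \<le> |1 - cnj w z|.
  Read for fixed \<open>w\<close> as a condition on \<open>z\<close> it describes a Carleson box of
  size 1 - |w|; both readings meet under Fubini. The 5 is what the discs in
  \<open>norm_diff_le_cone\<close> need.\<close>

definition disc_cone :: "complex \<Rightarrow> complex set"
  where "disc_cone z = {w. norm (1 - cnj w * z) \<le> 5 * (1 - norm w)}"

lemma disc_cone_measurable [measurable]: "disc_cone z \<in> sets borel"
proof -
  have [measurable]: "(cnj :: complex \<Rightarrow> complex) \<in> borel_measurable borel"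
    by (intro borel_measurable_continuous_onI continuous_intros)
  show ?thesis unfolding disc_cone_def by measurable
qed

lemma ennreal_le_suminf: "f k \<le> (\<Sum>k. f k)" for f :: "nat \<Rightarrow> ennreal"
  using sum_le_suminf[of f "{k}"] by simp

text \<open>At height about 2^(-k) the cone has area of order 4^(-k), which the hyperbolic density 1
  / (1 - |w|)^2 cancels. Each dyadic height therefore contributes only the bound \<open>m k\<close>
  of \<psi> there.\<close>

lemma disc_cone_dyadic:
  obtains C where "C > 0"
    "\<And>z \<psi> m. norm z < 1 \<Longrightarrow> (\<And>k. 0 \<le> m k) \<Longrightarrow>
      (\<And>w k. norm w < 1 \<Longrightarrow> w \<in> disc_cone z \<Longrightarrow> (1/2) ^ (k + 1) < 1 - norm w \<Longrightarrow> 1 - norm w \<le> (1/2) ^ k \<Longrightarrow> \<psi> w \<le> m k) \<Longrightarrow>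
      (\<integral>\<^sup>+w. ennreal (\<psi> w / (1 - norm w)\<^sup>2) * indicator (disc_cone z) w \<partial>\<lambda>\<D>)
        \<le> ennreal C * (\<Sum>k. ennreal (m k))"
proof -
  obtain C where C: "C > 0"
    "\<And>a r. norm a < 1 \<Longrightarrow> 0 < r \<Longrightarrow>
      (\<integral>\<^sup>+z. ennreal ((1 - norm z) powr 0) * indicator {z. norm (1 - cnj a * z) \<le> r} z \<partial>\<lambda>\<D>)
        \<le> ennreal (C * r powr (0 + 2))"
    using boundary_weight_box[of 0] by auto
  have half_sq: "((1/2 :: real) ^ k)\<^sup>2 = (1/4) ^ k" for k
  proof -
    have "((1/2 :: real) ^ k)\<^sup>2 = ((1/2)\<^sup>2) ^ k" by (simp only: power_mult[symmetric] mult.commute)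
    then show ?thesis by (simp add: power_divide)
  qed
  show ?thesis
  \<comment> \<open>100 = 4 * 25: the 4 comes from using the lower end 2^(-k-1) of the height in the
    density, the 25 from the squared aperture.\<close>
  proof (rule that[of "100 * C"])
    show "100 * C > 0" using C by simp
    fix z :: complex and \<psi> :: "complex \<Rightarrow> real" and m :: "nat \<Rightarrow> real"
    assume z: "norm z < 1" and m0: "\<And>k. 0 \<le> m k"
      and m: "\<And>w k. norm w < 1 \<Longrightarrow> w \<in> disc_cone z \<Longrightarrow> (1/2) ^ (k + 1) < 1 - norm w \<Longrightarrow> 1 - norm w \<le> (1/2) ^ k \<Longrightarrow> \<psi> w \<le> m k"
    let ?E = "\<lambda>k. {w. norm (1 - cnj z * w) \<le> 5 * (1/2) ^ k}"
    have "(\<integral>\<^sup>+w. ennreal (\<psi> w / (1 - norm w)\<^sup>2) * indicator (disc_cone z) w \<partial>\<lambda>\<D>)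
       \<le> (\<integral>\<^sup>+w. (\<Sum>k. ennreal (m k * 4 ^ (k + 1)) * indicator (?E k) w) \<partial>\<lambda>\<D>)"
    proof (rule nn_integral_mono)
      fix w assume "w \<in> space \<lambda>\<D>"
      then have w: "norm w < 1" by simp
      show "ennreal (\<psi> w / (1 - norm w)\<^sup>2) * indicator (disc_cone z) w \<le> (\<Sum>k. ennreal (m k * 4 ^ (k + 1)) * indicator (?E k) w)"
      proof (cases "w \<in> disc_cone z")
        case True
        obtain N where "(1/2) ^ N < 1 - norm w" using real_arch_pow_inv[of "1 - norm w" "1/2"] w by auto
        moreover have "(1/2 :: real) ^ (N + 1) \<le> (1/2) ^ N" by simp
        ultimately have ex: "\<exists>k. (1/2) ^ (k + 1) < 1 - norm w"
          by (meson le_less_trans)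
        define k where "k = (LEAST k. (1/2) ^ (k + 1) < 1 - norm w)"
        have k1: "(1/2) ^ (k + 1) < 1 - norm w" unfolding k_def using ex by (rule LeastI_ex)
        have k2: "1 - norm w \<le> (1/2) ^ k"
        proof (cases k)
          case (Suc j)
          then have "\<not> (1/2) ^ (j + 1) < 1 - norm w" unfolding k_def using not_less_Least[of j] by (metis lessI)
          then show ?thesis using Suc by simp
        qed simp
        have "norm (1 - cnj z * w) \<le> 5 * (1 - norm w)"
          using True norm_one_minus_cnj_mult_swap[of z w] by (simp add: disc_cone_def)
        also have "\<dots> \<le> 5 * (1/2) ^ k" using k2 by simp
        finally have E: "w \<in> ?E k" by simp
        have "\<psi> w / (1 - norm w)\<^sup>2 \<le> m k / (1 - norm w)\<^sup>2"
          using m[OF w True k1 k2] by (intro divide_right_mono) auto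
        also have "\<dots> \<le> m k / ((1/2) ^ (k + 1))\<^sup>2"
          using k1 m0[of k] w by (intro divide_left_mono power_mono mult_pos_pos zero_less_power) auto
        also have "\<dots> = m k * 4 ^ (k + 1)"
          unfolding half_sq by (simp add: power_one_over)
        finally have "ennreal (\<psi> w / (1 - norm w)\<^sup>2) \<le> ennreal (m k * 4 ^ (k + 1))"
          by (rule ennreal_leI)
        then have "ennreal (\<psi> w / (1 - norm w)\<^sup>2) \<le> ennreal (m k * 4 ^ (k + 1)) * indicator (?E k) w"
          using E by (simp only: indicator_simps mult_1_right)
        also have "\<dots> \<le> (\<Sum>k. ennreal (m k * 4 ^ (k + 1)) * indicator (?E k) w)"
          by (rule ennreal_le_suminf[of "\<lambda>k. ennreal (m k * 4 ^ (k + 1)) * indicator (?E k) w"])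
        finally show ?thesis using True by simp
      qed simp
    qed
    also have "\<dots> = (\<Sum>k. ennreal (m k * 4 ^ (k + 1)) * (\<integral>\<^sup>+w. indicator (?E k) w \<partial>\<lambda>\<D>))"
      by (simp add: nn_integral_suminf nn_integral_cmult)
    also have "\<dots> \<le> (\<Sum>k. ennreal (100 * C) * ennreal (m k))"
    proof (intro suminf_le)
      fix k
      have "(\<integral>\<^sup>+w. indicator (?E k) w \<partial>\<lambda>\<D>) \<le> (\<integral>\<^sup>+w. ennreal ((1 - norm w) powr 0) * indicator (?E k) w \<partial>\<lambda>\<D>)"
        by (intro nn_integral_mono) (auto simp: indicator_def)
      also have "\<dots> \<le> ennreal (C * (5 * (1/2) ^ k) powr (0 + 2))" by (rule C(2)[OF z]) simp
      also have "(5 * (1/2) ^ k) powr (0 + 2) = 25 * (1/4 :: real) ^ k"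
        using half_sq[of k] by (simp add: power_mult_distrib)
      finally have "ennreal (m k * 4 ^ (k + 1)) * (\<integral>\<^sup>+w. indicator (?E k) w \<partial>\<lambda>\<D>)
        \<le> ennreal (m k * 4 ^ (k + 1)) * ennreal (C * (25 * (1/4) ^ k))"
        by (intro mult_left_mono) auto
      also have "\<dots> = ennreal (m k * 4 ^ (k + 1) * (C * (25 * (1/4) ^ k)))"
        using C(1) m0[of k] by (subst ennreal_mult) auto
      also have "m k * 4 ^ (k + 1) * (C * (25 * (1/4) ^ k)) = 100 * C * m k"
        by (simp add: power_one_over field_simps)
      also have "ennreal (100 * C * m k) = ennreal (100 * C) * ennreal (m k)"
        using C(1) m0[of k] by (subst ennreal_mult) auto
      finally show "ennreal (m k * 4 ^ (k + 1)) * (\<integral>\<^sup>+w. indicator (?E k) w \<partial>\<lambda>\<D>) \<le> ennreal (100 * C) * ennreal (m k)" .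
    qed auto
    also have "\<dots> = ennreal (100 * C) * (\<Sum>k. ennreal (m k))" by simp
    finally show "(\<integral>\<^sup>+w. ennreal (\<psi> w / (1 - norm w)\<^sup>2) * indicator (disc_cone z) w \<partial>\<lambda>\<D>)
        \<le> ennreal (100 * C) * (\<Sum>k. ennreal (m k))" .
  qed
qed

text \<open>Inside the cone 1 - |z| \<le> 5 (1 - |w|), so only about \<open>disc_log z\<close>
  dyadic heights occur, each with bounded contribution.\<close>

lemma disc_cone_hyperbolic_area:
  obtains C where "C > 0"
    "\<And>z. norm z < 1 \<Longrightarrow>
      (\<integral>\<^sup>+w. ennreal (1 / (1 - norm w)\<^sup>2) * indicator (disc_cone z) w \<partial>\<lambda>\<D>) \<le> ennreal (C * disc_log z)"
proof -
  obtain C where C: "C > 0"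
    "\<And>z \<psi> m. norm z < 1 \<Longrightarrow> (\<And>k. 0 \<le> m k) \<Longrightarrow>
      (\<And>w k. norm w < 1 \<Longrightarrow> w \<in> disc_cone z \<Longrightarrow> (1/2) ^ (k + 1) < 1 - norm w \<Longrightarrow> 1 - norm w \<le> (1/2) ^ k \<Longrightarrow> \<psi> w \<le> m k) \<Longrightarrow>
      (\<integral>\<^sup>+w. ennreal (\<psi> w / (1 - norm w)\<^sup>2) * indicator (disc_cone z) w \<partial>\<lambda>\<D>)
        \<le> ennreal C * (\<Sum>k. ennreal (m k))"
    by (fact disc_cone_dyadic)
  define C' where "C' = C * (4 / ln 2)"
  have C': "C' > 0" using C by (simp add: C'_def)
  show ?thesis
  proof (rule that[OF C'])
    fix z :: complex assume z: "norm z < 1"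
    obtain N where N: "5 < 2 ^ N * (1 - norm z)" "real N \<le> 4 / ln 2 * disc_log z"
      using dyadic_count_le[OF z] by blast
    define m where "m k = (if k < N then 1 else 0 :: real)" for k
    have "(\<integral>\<^sup>+w. ennreal (1 / (1 - norm w)\<^sup>2) * indicator (disc_cone z) w \<partial>\<lambda>\<D>) \<le> ennreal C * (\<Sum>k. ennreal (m k))"
    proof (rule C(2)[OF z, where \<psi> = "\<lambda>_. 1"])
      fix w k assume w: "norm w < 1" "w \<in> disc_cone z" "(1/2) ^ (k + 1) < 1 - norm w" "1 - norm w \<le> (1/2) ^ k"
      have "1 - norm z \<le> norm (1 - cnj w * z)" using one_minus_norm_le'[of w z] w by simp
      also have "\<dots> \<le> 5 * (1 - norm w)" using w by (simp add: disc_cone_def)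
      also have "\<dots> \<le> 5 * (1/2) ^ k" using w by simp
      finally have "2 ^ k * (1 - norm z) \<le> 5" by (simp add: field_simps power_one_over)
      with N(1) have "2 ^ k * (1 - norm z) < 2 ^ N * (1 - norm z)" by simp
      then have "(2::real) ^ k < 2 ^ N" using z by simp
      then show "1 \<le> m k" by (simp add: m_def)
    qed (simp add: m_def)
    also have "(\<Sum>k. ennreal (m k)) = ennreal (real N)"
      by (subst suminf_finite[of "{..<N}"]) (auto simp: m_def ennreal_of_nat_eq_real_of_nat)
    also have "ennreal C * ennreal (real N) = ennreal (C * real N)" using C(1) by (simp add: ennreal_mult)
    also have "\<dots> \<le> ennreal (C' * disc_log z)"
      using mult_left_mono[OF N(2), of C] C(1) by (intro ennreal_leI) (simp add: C'_def)
    finally show "(\<integral>\<^sup>+w. ennreal (1 / (1 - norm w)\<^sup>2) * indicator (disc_cone z) w \<partial>\<lambda>\<D>) \<le> ennreal (C' * disc_log z)" .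
  qed
qed

text \<open>At the k-th dyadic height \<open>disc_log w\<close> is at least (k + 1) ln 2, so the
  contributions are dominated by the convergent series of (k + 1)^(-\<beta>).\<close>

lemma disc_cone_log_area:
  assumes \<beta>: "\<beta> > 1"
  obtains C where "C > 0"
    "\<And>z. norm z < 1 \<Longrightarrow>
      (\<integral>\<^sup>+w. ennreal (disc_log w powr (- \<beta>) / (1 - norm w)\<^sup>2) * indicator (disc_cone z) w \<partial>\<lambda>\<D>) \<le> ennreal C"
proof -
  obtain C where C: "C > 0"
    "\<And>z \<psi> m. norm z < 1 \<Longrightarrow> (\<And>k. 0 \<le> m k) \<Longrightarrow>
      (\<And>w k. norm w < 1 \<Longrightarrow> w \<in> disc_cone z \<Longrightarrow> (1/2) ^ (k + 1) < 1 - norm w \<Longrightarrow> 1 - norm w \<le> (1/2) ^ k \<Longrightarrow> \<psi> w \<le> m k) \<Longrightarrow>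
      (\<integral>\<^sup>+w. ennreal (\<psi> w / (1 - norm w)\<^sup>2) * indicator (disc_cone z) w \<partial>\<lambda>\<D>)
        \<le> ennreal C * (\<Sum>k. ennreal (m k))"
    by (fact disc_cone_dyadic)
  define m where "m k = ln 2 powr (- \<beta>) * real (Suc k) powr (- \<beta>)" for k
  have "summable (\<lambda>k. real (Suc k) powr (- \<beta>))"
    using \<beta> by (subst summable_Suc_iff) (simp add: summable_real_powr_iff)
  then have sm: "summable m" unfolding m_def by (rule summable_mult)
  have m0: "m k \<ge> 0" for k by (simp add: m_def)
  have "suminf m > 0" using sm by (intro suminf_pos) (auto simp: m_def)
  then have pos: "C * suminf m > 0" using C by simp
  show ?thesis
  proof (rule that[OF pos])
    fix z :: complex assume z: "norm z < 1"
    have "(\<integral>\<^sup>+w. ennreal (disc_log w powr (- \<beta>) / (1 - norm w)\<^sup>2) * indicator (disc_cone z) w \<partial>\<lambda>\<D>) \<le> ennreal C * (\<Sum>k. ennreal (m k))"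
    proof (rule C(2)[OF z m0])
      fix w :: complex and k assume w: "norm w < 1" "1 - norm w \<le> (1/2) ^ k"
      have "2 ^ (k + 1) \<le> 2 / (1 - norm w)" using w by (simp add: field_simps power_one_over)
      then have "ln (2 ^ (k + 1)) \<le> disc_log w" unfolding disc_log_def using w
        by (subst ln_le_cancel_iff) auto
      then have "ln 2 * real (Suc k) \<le> disc_log w" by (simp add: ln_realpow[of 2 "Suc k", simplified] mult.commute)
      then have "disc_log w powr (- \<beta>) \<le> (ln 2 * real (Suc k)) powr (- \<beta>)"
        using \<beta> by (intro powr_mono2') auto
      also have "\<dots> = m k" by (simp only: m_def powr_mult)
      finally show "disc_log w powr (- \<beta>) \<le> m k" .
    qed
    also have "(\<Sum>k. ennreal (m k)) = ennreal (suminf m)" using sm m0 by (intro suminf_ennreal2) auto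
    also have "ennreal C * \<dots> = ennreal (C * suminf m)" using C(1) sm m0 by (simp add: ennreal_mult suminf_nonneg)
    finally show "(\<integral>\<^sup>+w. ennreal (disc_log w powr (- \<beta>) / (1 - norm w)\<^sup>2) * indicator (disc_cone z) w \<partial>\<lambda>\<D>) \<le> ennreal (C * suminf m)" .
  qed
qed

text \<open>The value \<open>top\<close> at 0 makes the product bound in
  \<open>nn_integral_inverse_norm_ball_le\<close> true on the coordinate axes as well, while a
  single point costs nothing in the integral.\<close>

lemma nn_integral_abs_powr_half_le:
  assumes "R > 0"
  shows "(\<integral>\<^sup>+x. (if x = 0 then top else ennreal (\<bar>x\<bar> powr (-1/2))) * indicator {x. \<bar>x\<bar> < R} x \<partial>lborel)
    \<le> ennreal (4 * (2 * R) powr (1/2))"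
proof -
  let ?G = "\<lambda>u. ennreal (u powr (-1/2)) * indicator {u. 0 < u \<and> \<bar>u - 0\<bar> < R} u"
  have "(\<integral>\<^sup>+x. (if x = 0 then top else ennreal (\<bar>x\<bar> powr (-1/2))) * indicator {x. \<bar>x\<bar> < R} x \<partial>lborel)
    \<le> (\<integral>\<^sup>+x. ?G x + ?G (0 + (-1) * x) \<partial>lborel)"
  proof (rule nn_integral_mono_AE)
    show "AE x in lborel. (if x = 0 then top else ennreal (\<bar>x\<bar> powr (-1/2))) * indicator {x. \<bar>x\<bar> < R} x
        \<le> ?G x + ?G (0 + (-1) * x)"
      using AE_lborel_singleton[of 0]
    proof eventually_elim
      case (elim x)
      then show ?case by (cases "x > 0") (auto simp: indicator_def)
    qed
  qed
  also have "\<dots> = (\<integral>\<^sup>+x. ?G x \<partial>lborel) + (\<integral>\<^sup>+x. ?G (0 + (-1) * x) \<partial>lborel)"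
    by (rule nn_integral_add) auto
  also have "(\<integral>\<^sup>+x. ?G (0 + (-1) * x) \<partial>lborel) = (\<integral>\<^sup>+x. ?G x \<partial>lborel)"
    using nn_integral_real_affine[of ?G "-1" 0] by simp
  also have "(\<integral>\<^sup>+x. ?G x \<partial>lborel) + (\<integral>\<^sup>+x. ?G x \<partial>lborel)
    \<le> ennreal ((2 * R) powr (-1/2 + 1) / (-1/2 + 1)) + ennreal ((2 * R) powr (-1/2 + 1) / (-1/2 + 1))"
    by (intro add_mono nn_integral_powr_interval_le) (use assms in auto)
  also have "\<dots> = ennreal (4 * (2 * R) powr (1/2))"
    by (subst ennreal_plus[symmetric]) auto
  finally show ?thesis .
qed

text \<open>Since \<bar>x\<bar> \<bar>y\<bar> \<le> |z|^2, the integrand 1 / |z| is at most the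
  product of \<bar>x\<bar>^(-1/2) and \<bar>y\<bar>^(-1/2); this splits the integral into two
  one-dimensional ones of order R^(1/2).\<close>

lemma nn_integral_inverse_norm_ball_le:
  fixes a :: complex
  assumes R: "R > 0"
  shows "(\<integral>\<^sup>+z. ennreal (1 / norm (z - a)) * indicator (ball a R) z \<partial>lborel) \<le> ennreal (32 * R)"
proof -
  define F where "F z = ennreal (1 / norm z) * indicator (ball 0 R) z" for z :: complex
  have [measurable]: "ball (0::complex) R \<in> sets borel" "ball a R \<in> sets borel" by simp_all
  have [measurable]: "F \<in> borel_measurable borel" unfolding F_def by measurable
  define g where "g x = (if x = 0 then top else ennreal (\<bar>x\<bar> powr (-1/2))) * indicator {x. \<bar>x\<bar> < R} x" for x :: real
  have [measurable]: "g \<in> borel_measurable borel" unfolding g_def by measurable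
  have g: "(\<integral>\<^sup>+x. g x \<partial>lborel) \<le> ennreal (4 * (2 * R) powr (1/2))"
    unfolding g_def by (rule nn_integral_abs_powr_half_le[OF R])
  have "(\<integral>\<^sup>+z. ennreal (1 / norm (z - a)) * indicator (ball a R) z \<partial>lborel)
      = (\<integral>\<^sup>+z. ennreal (1 / norm (z - a)) * indicator (ball a R) z \<partial>(distr lborel borel ((+) a)))"
    by (simp only: lborel_distr_plus)
  also have "\<dots> = (\<integral>\<^sup>+z. F z \<partial>lborel)"
  proof (subst nn_integral_distr)
    show "(\<integral>\<^sup>+z. ennreal (1 / norm (a + z - a)) * indicator (ball a R) (a + z) \<partial>lborel) = (\<integral>\<^sup>+z. F z \<partial>lborel)"
      by (intro nn_integral_cong) (auto simp: F_def indicator_def dist_norm)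
    show "(\<lambda>z. ennreal (1 / norm (z - a)) * indicator (ball a R) z) \<in> borel_measurable (distr lborel borel ((+) a))"
      unfolding measurable_distr_eq1 by measurable
  qed simp
  also have "\<dots> = (\<integral>\<^sup>+y. \<integral>\<^sup>+x. F (Complex x y) \<partial>lborel \<partial>lborel)"
    by (rule nn_integral_complex_Fubini) simp
  also have "\<dots> \<le> (\<integral>\<^sup>+y. \<integral>\<^sup>+x. g x * g y \<partial>lborel \<partial>lborel)"
  proof (intro nn_integral_mono)
    fix x y :: real
    define z where "z = Complex x y"
    show "F (Complex x y) \<le> g x * g y"
    proof (cases "norm z < R")
      case True
      then have lt: "\<bar>x\<bar> < R" "\<bar>y\<bar> < R"
        using abs_Re_le_cmod[of z] abs_Im_le_cmod[of z] by (auto simp: z_def)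
      show ?thesis
      proof (cases "x = 0 \<or> y = 0")
        case True
        then show ?thesis using lt by (auto simp: g_def ennreal_top_mult ennreal_mult_top)
      next
        case False
        have "0 \<le> \<bar>x\<bar> * \<bar>y\<bar>" by simp
        moreover have "2 * (\<bar>x\<bar> * \<bar>y\<bar>) \<le> (norm z)\<^sup>2"
          using sum_squares_bound[of "\<bar>x\<bar>" "\<bar>y\<bar>"] by (simp add: z_def cmod_power2 mult.assoc)
        ultimately have le: "\<bar>x\<bar> * \<bar>y\<bar> \<le> (norm z)\<^sup>2" by linarith
        have "sqrt (\<bar>x\<bar> * \<bar>y\<bar>) \<le> norm z" by (rule real_le_lsqrt) (use le in auto)
        moreover have "sqrt (\<bar>x\<bar> * \<bar>y\<bar>) > 0" using False by simp
        ultimately have "1 / norm z \<le> 1 / sqrt (\<bar>x\<bar> * \<bar>y\<bar>)" by (intro frac_le) auto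
        also have "\<dots> = \<bar>x\<bar> powr (-1/2) * \<bar>y\<bar> powr (-1/2)"
        proof -
          have "u powr - (1/2) = 1 / sqrt u" if "u > 0" for u :: real
            using that powr_minus_divide[of u "1/2"] by (simp add: powr_half_sqrt)
          then show ?thesis using False by (simp add: real_sqrt_mult)
        qed
        finally have "ennreal (1 / norm z) \<le> ennreal (\<bar>x\<bar> powr (-1/2)) * ennreal (\<bar>y\<bar> powr (-1/2))"
          by (subst ennreal_mult[symmetric]) (auto intro: ennreal_leI)
        moreover have "F z = ennreal (1 / norm z)" using True by (simp add: F_def)
        moreover have "g x = ennreal (\<bar>x\<bar> powr (-1/2))" "g y = ennreal (\<bar>y\<bar> powr (-1/2))"
          using lt False by (simp_all add: g_def)
        ultimately show ?thesis by (simp only: z_def)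
      qed
    qed (simp add: F_def z_def)
  qed
  also have "\<dots> = (\<integral>\<^sup>+x. g x \<partial>lborel) * (\<integral>\<^sup>+x. g x \<partial>lborel)"
    by (simp add: nn_integral_multc nn_integral_cmult)
  also have "\<dots> \<le> ennreal (4 * (2 * R) powr (1/2)) * ennreal (4 * (2 * R) powr (1/2))"
    by (intro mult_mono g) auto
  also have "\<dots> = ennreal (4 * (2 * R) powr (1/2) * (4 * (2 * R) powr (1/2)))"
    by (rule ennreal_mult[symmetric]) auto
  also have "4 * (2 * R) powr (1/2) * (4 * (2 * R) powr (1/2)) = 32 * R"
    using R by (simp add: powr_half_sqrt)
  finally show ?thesis .
qed

section \<open>Increments along a radius and cone integrals\<close>

lemma nn_integral_radius_ge:
  assumes h: "h holomorphic_on \<D>" and z: "norm z < 1" "z \<noteq> 0"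
  defines "e \<equiv> z / of_real (norm z)"
  shows "ennreal (norm (h z - h 0))
    \<le> (\<integral>\<^sup>+t. ennreal (norm (deriv h (of_real t * e))) * indicator {0..norm z} t \<partial>lborel)"
proof -
  have ne: "norm e = 1" using z by (simp add: e_def norm_divide)
  have inD: "of_real t * e \<in> \<D>" if "t \<in> {0..norm z}" for t
    using that z ne by (simp add: norm_mult)
  define \<phi> where "\<phi> t = deriv h (of_real t * e) * e" for t :: real
  have FTC: "(\<phi> has_integral (h (of_real (norm z) * e) - h (of_real 0 * e))) {0..norm z}"
  proof (rule fundamental_theorem_of_calculus)
    fix t assume t: "t \<in> {0..norm z}"
    have "(h has_field_derivative deriv h (of_real t * e)) (at (of_real t * e))"
      using h inD[OF t] by (intro holomorphic_derivI[of _ \<D>]) auto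
    then have "((\<lambda>s. h (s * e)) has_field_derivative deriv h (of_real t * e) * e) (at (of_real t))"
      by (intro DERIV_chain2[where g = "\<lambda>s. s * e" and f = h]) (auto intro!: derivative_eq_intros)
    then have "((\<lambda>s. h (of_real s * e)) has_vector_derivative \<phi> t) (at t)"
      unfolding \<phi>_def by (rule has_vector_derivative_real_field)
    then show "((\<lambda>s. h (of_real s * e)) has_vector_derivative \<phi> t) (at t within {0..norm z})"
      by (rule has_vector_derivative_at_within)
  qed simp
  have "continuous_on \<D> (deriv h)"
    using h by (intro holomorphic_on_imp_continuous_on holomorphic_deriv) auto
  then have "continuous_on {0..norm z} (\<lambda>t. deriv h (of_real t * e))"
    by (rule continuous_on_compose2) (use inD in \<open>auto intro!: continuous_intros\<close>)
  then have cont\<phi>: "continuous_on {0..norm z} \<phi>"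
    unfolding \<phi>_def by (intro continuous_intros)
  then have cont: "continuous_on {0..norm z} (\<lambda>t. norm (\<phi> t))"
    by (intro continuous_intros)
  have "ennreal (norm (h z - h 0)) = ennreal (norm (integral {0..norm z} \<phi>))"
    using FTC z by (simp add: integral_unique e_def)
  also have "\<dots> \<le> ennreal (integral {0..norm z} (\<lambda>t. norm (\<phi> t)))"
    using FTC cont cont\<phi> by (intro ennreal_leI integral_norm_bound_integral integrable_continuous_real)
      (auto simp: has_integral_integrable)
  also have "\<dots> = (\<integral>\<^sup>+t. ennreal (norm (\<phi> t)) * indicator {0..norm z} t \<partial>lborel)"
    using integrable_integral[OF integrable_continuous_real[OF cont]]
    by (subst nn_integral_has_integral_lebesgue') auto
  finally show ?thesis by (simp add: \<phi>_def norm_mult ne)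
qed

text \<open>The increment of \<open>h\<close> along a radius is bounded by averages of the derivative over discs
  around the points of the radius; these discs all lie in the cone.\<close>

lemma norm_diff_le_cone:
  assumes h: "h holomorphic_on \<D>" and z: "norm z < 1"
  shows "ennreal (norm (h z - h 0))
    \<le> ennreal 4 * (\<integral>\<^sup>+w. ennreal (norm (deriv h w) / (1 - norm w)) * indicator (disc_cone z) w \<partial>\<lambda>\<D>)"
proof (cases "z = 0")
  case False
  define e where "e = z / of_real (norm z)"
  have ne: "norm e = 1" using False by (simp add: e_def norm_divide)
  have ze: "z = of_real (norm z) * e" using False by (simp add: e_def)
  have h': "deriv h holomorphic_on \<D>" using h by (intro holomorphic_deriv) auto
  note [measurable] = measurable_disc_deriv[OF h]
  \<comment> \<open>\<open>K t\<close> is the averaging kernel over the disc of radius (1 - t) / 2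
    about the point of the radius at distance \<open>t\<close> from 0; the constant is the
    reciprocal of its area.\<close>
  define K where "K t w = ennreal (4 / (pi * (1 - t)\<^sup>2)) * indicator {0..norm z} t
      * indicator {p. dist (of_real (fst p) * e) (snd p) < (1 - fst p) / 2} (t, w)" for t :: real and w :: complex
  have K: "(\<lambda>p. K (fst p) (snd p)) \<in> borel_measurable (lborel \<Otimes>\<^sub>M \<lambda>\<D>)"
  proof -
    have 1: "(\<lambda>p. (fst p, snd p)) \<in> lborel \<Otimes>\<^sub>M \<lambda>\<D> \<rightarrow>\<^sub>M borel \<Otimes>\<^sub>M (borel :: complex measure)"
      by measurable
    have "(\<lambda>p. K (fst p) (snd p)) \<in> borel_measurable (borel \<Otimes>\<^sub>M (borel :: complex measure))"
      unfolding K_def by measurable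
    from measurable_compose[OF 1 this] show ?thesis by simp
  qed
  have "ennreal (norm (h z - h 0))
    \<le> (\<integral>\<^sup>+t. ennreal (norm (deriv h (of_real t * e))) * indicator {0..norm z} t \<partial>lborel)"
    unfolding e_def by (rule nn_integral_radius_ge[OF h z False])
  also have "\<dots> \<le> (\<integral>\<^sup>+t. \<integral>\<^sup>+w. K t w * ennreal (norm (deriv h w)) \<partial>\<lambda>\<D> \<partial>lborel)"
  proof (rule nn_integral_mono)
    fix t :: real
    show "ennreal (norm (deriv h (of_real t * e))) * indicator {0..norm z} t
      \<le> (\<integral>\<^sup>+w. K t w * ennreal (norm (deriv h w)) \<partial>\<lambda>\<D>)"
    proof (cases "t \<in> {0..norm z}")
      case True
      then have t: "0 \<le> t" "t < 1" using z by auto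
      let ?c = "of_real t * e" let ?r = "(1 - t) / 2"
      let ?X = "\<integral>\<^sup>+w. ennreal (norm (deriv h w)) * indicator (ball ?c ?r) w \<partial>\<lambda>\<D>"
      have pos: "4 / (pi * (1 - t)\<^sup>2) > 0" using t by simp
      have "ennreal (pi * ?r\<^sup>2 * norm (deriv h ?c)) \<le> ?X"
        using t ne by (intro norm_le_ball_average h') (auto simp: norm_mult)
      then have "ennreal (4 / (pi * (1 - t)\<^sup>2)) * ennreal (pi * ?r\<^sup>2 * norm (deriv h ?c)) \<le> ennreal (4 / (pi * (1 - t)\<^sup>2)) * ?X"
        by (rule mult_left_mono) simp
      also have "ennreal (4 / (pi * (1 - t)\<^sup>2)) * ennreal (pi * ?r\<^sup>2 * norm (deriv h ?c)) = ennreal (norm (deriv h ?c))"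
        using t pos by (subst ennreal_mult[symmetric]) (auto simp: power_divide)
      also have "ennreal (4 / (pi * (1 - t)\<^sup>2)) * ?X = (\<integral>\<^sup>+w. K t w * ennreal (norm (deriv h w)) \<partial>\<lambda>\<D>)"
        using True
        by (subst nn_integral_cmult[symmetric]) (auto simp: K_def indicator_def intro!: nn_integral_cong)
      finally show ?thesis using True by simp
    qed simp
  qed
  also have "\<dots> = (\<integral>\<^sup>+w. \<integral>\<^sup>+t. K t w * ennreal (norm (deriv h w)) \<partial>lborel \<partial>\<lambda>\<D>)"
  proof -
    interpret P: pair_sigma_finite lborel "\<lambda>\<D>" ..
    show ?thesis using K by (intro P.Fubini'[symmetric]) (simp add: case_prod_beta')
  qed
  also have "\<dots> \<le> (\<integral>\<^sup>+w. ennreal 4 * (ennreal (norm (deriv h w) / (1 - norm w)) * indicator (disc_cone z) w) \<partial>\<lambda>\<D>)"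
  proof (rule nn_integral_mono)
    fix w assume "w \<in> space \<lambda>\<D>"
    then have w: "norm w < 1" by simp
    define d where "d = 1 - norm w"
    have d: "d > 0" using w by (simp add: d_def)
    \<comment> \<open>A disc that contains \<open>w\<close> has its centre at a \<open>t\<close>
      with 1 - t between 2/3 d and 2 d. These \<open>t\<close> fill an interval of length 4/3 d, so
      integrating the kernel, of size d^(-2), over \<open>t\<close> leaves d^(-1).\<close>
    have Kle: "K t w \<le> ennreal (9 / (pi * d\<^sup>2)) * indicator {1 - 2 * d .. 1 - 2/3 * d} t * indicator (disc_cone z) w" for t
    proof (cases "t \<in> {0..norm z} \<and> dist (of_real t * e) w < (1 - t) / 2")
      case True
      then have t: "0 \<le> t" "t \<le> norm z" "t < 1" and ds: "norm (of_real t * e - w) < (1 - t) / 2"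
        using z by (auto simp: dist_norm)
      have nt: "norm (of_real t * e) = t" using t ne by (simp add: norm_mult)
      have "\<bar>t - norm w\<bar> < (1 - t) / 2"
        using norm_triangle_ineq3[of "of_real t * e" w] ds nt by linarith
      then have *: "1 - 2 * d \<le> t" "t \<le> 1 - 2/3 * d"
        using t by (auto simp: d_def abs_if field_simps split: if_splits)
      have "d \<le> 3/2 * (1 - t)" using * by simp
      then have "d\<^sup>2 \<le> (3/2 * (1 - t))\<^sup>2" using d by (intro power_mono) auto
      also have "\<dots> = 9/4 * (1 - t)\<^sup>2" by (simp only: power_mult_distrib) (simp add: power_divide)
      finally have "d\<^sup>2 \<le> 9/4 * (1 - t)\<^sup>2" .
      then have "9 / (9/4 * (1 - t)\<^sup>2) \<le> 9 / d\<^sup>2"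
        using d t by (intro divide_left_mono) auto
      then have "4 / (1 - t)\<^sup>2 / pi \<le> 9 / d\<^sup>2 / pi"
        by (intro divide_right_mono) auto
      then have 4: "4 / (pi * (1 - t)\<^sup>2) \<le> 9 / (pi * d\<^sup>2)"
        by (simp add: mult.commute)
      \<comment> \<open>This is the origin of the aperture: the centre of the disc gives 2 (1 - t),
        since \<open>t \<le> norm z\<close>, the offset of \<open>w\<close> from it gives (1 - t) /
        2, and 5/2 (1 - t) \<le> 5 d.\<close>
      have "norm (1 - cnj w * z) \<le> norm (1 - of_real t * cnj e * z) + norm (cnj (of_real t * e - w) * z)"
        using norm_triangle_ineq[of "1 - of_real t * cnj e * z" "cnj (of_real t * e - w) * z"]
        by (simp add: algebra_simps)
      also have "norm (cnj (of_real t * e - w) * z) \<le> (1 - t) / 2 * 1"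
        unfolding norm_mult complex_mod_cnj using ds z t by (intro mult_mono) auto
      also have "cnj e * z = of_real (norm z)"
      proof -
        have "cnj e * e = 1" using complex_norm_square[of e] ne by (simp add: mult.commute)
        then have "cnj e * (of_real (norm z) * e) = of_real (norm z)" by (simp add: mult.left_commute)
        then show ?thesis by (simp only: ze[symmetric])
      qed
      then have "1 - of_real t * cnj e * z = of_real (1 - t * norm z)" by (simp add: mult.assoc)
      then have "norm (1 - of_real t * cnj e * z) = \<bar>1 - t * norm z\<bar>" by (simp only: norm_of_real)
      also have "\<bar>1 - t * norm z\<bar> \<le> 2 * (1 - t)"
      proof -
        have "t * t \<le> t * norm z" using t by (intro mult_left_mono) auto
        moreover have "t * norm z \<le> 1 * 1" using t z by (intro mult_mono) auto
        moreover have "0 \<le> (1 - t)\<^sup>2" by simp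
        ultimately show ?thesis by (simp add: power2_eq_square algebra_simps)
      qed
      finally have "norm (1 - cnj w * z) \<le> 2 * (1 - t) + (1 - t) / 2" by simp
      then have "norm (1 - cnj w * z) \<le> 5 * d" using * by (simp add: field_simps)
      then have "w \<in> disc_cone z" by (simp add: disc_cone_def d_def)
      then show ?thesis using * 4 True by (simp add: K_def ennreal_leI)
    qed (auto simp: K_def indicator_def)
    have "(\<integral>\<^sup>+t. K t w * ennreal (norm (deriv h w)) \<partial>lborel)
      \<le> (\<integral>\<^sup>+t. (ennreal (9 / (pi * d\<^sup>2)) * indicator (disc_cone z) w * ennreal (norm (deriv h w))) * indicator {1 - 2 * d .. 1 - 2/3 * d} t \<partial>lborel)"
    proof (rule nn_integral_mono)
      fix t
      show "K t w * ennreal (norm (deriv h w)) \<le> (ennreal (9 / (pi * d\<^sup>2)) * indicator (disc_cone z) w * ennreal (norm (deriv h w))) * indicator {1 - 2 * d .. 1 - 2/3 * d} t"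
        using mult_right_mono[OF Kle[of t], of "ennreal (norm (deriv h w))"] by (simp add: mult_ac)
    qed
    also have "\<dots> = (ennreal (9 / (pi * d\<^sup>2)) * indicator (disc_cone z) w * ennreal (norm (deriv h w))) * ennreal (4/3 * d)"
      using d by (subst nn_integral_cmult_indicator) auto
    also have "\<dots> = ennreal (9 / (pi * d\<^sup>2)) * ennreal (4/3 * d) * ennreal (norm (deriv h w)) * indicator (disc_cone z) w"
      by (simp add: mult_ac)
    also have "ennreal (9 / (pi * d\<^sup>2)) * ennreal (4/3 * d) * ennreal (norm (deriv h w)) = ennreal (12 / (pi * d) * norm (deriv h w))"
      using d by (simp add: ennreal_mult[symmetric] power2_eq_square)
    also have "\<dots> \<le> ennreal (4 * (norm (deriv h w) / d))"
    proof (rule ennreal_leI)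
      have "12 / (pi * d) \<le> 4 / d" using d pi_gt3 by (simp add: field_simps)
      then have "12 / (pi * d) * norm (deriv h w) \<le> 4 / d * norm (deriv h w)" by (rule mult_right_mono) simp
      then show "12 / (pi * d) * norm (deriv h w) \<le> 4 * (norm (deriv h w) / d)" by simp
    qed
    also have "\<dots> = ennreal 4 * ennreal (norm (deriv h w) / d)" using d by (subst ennreal_mult) auto
    finally show "(\<integral>\<^sup>+t. K t w * ennreal (norm (deriv h w)) \<partial>lborel)
      \<le> ennreal 4 * (ennreal (norm (deriv h w) / (1 - norm w)) * indicator (disc_cone z) w)"
      by (auto simp: d_def mult.assoc indicator_def)
  qed
  also have "\<dots> = ennreal 4 * (\<integral>\<^sup>+w. ennreal (norm (deriv h w) / (1 - norm w)) * indicator (disc_cone z) w \<partial>\<lambda>\<D>)"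
    by (rule nn_integral_cmult) (auto intro!: borel_measurable_times_ennreal borel_measurable_indicator measurable_restrict_space1)
  finally show ?thesis .
qed simp

section \<open>Besov and Q integrals\<close>

definition Besov_integral :: "real \<Rightarrow> (complex \<Rightarrow> complex) \<Rightarrow> ennreal"
  where "Besov_integral p f = (\<integral>\<^sup>+z. ennreal ((1 - norm z) powr (p - 2) * norm (deriv f z) powr p) \<partial>\<lambda>\<D>)"

definition moebius_weight :: "real \<Rightarrow> complex \<Rightarrow> complex \<Rightarrow> real"
  where "moebius_weight s a z = (1 - (norm (moebius_disc a z))\<^sup>2) powr s"

text \<open>An arbitrary \<open>u\<close> stands in place of the derivative, so that the summands of
  a product rule can be estimated separately.\<close>

definition Q_integral :: "real \<Rightarrow> (complex \<Rightarrow> complex) \<Rightarrow> complex \<Rightarrow> ennreal"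
  where "Q_integral s u a = (\<integral>\<^sup>+z. ennreal ((norm (u z))\<^sup>2 * moebius_weight s a z) \<partial>\<lambda>\<D>)"

section \<open>Disc involutions and the Moebius weight\<close>

lemma one_minus_cnj_mult_nz: "1 - cnj a * z \<noteq> 0" if "norm a < 1" "norm z < 1"
  using one_minus_norm_le[of z a] that by force

lemma one_minus_norm_moebius:
  assumes "norm a < 1" "norm z < 1"
  shows "1 - (norm (moebius_disc a z))\<^sup>2 = (1 - (norm a)\<^sup>2) * (1 - (norm z)\<^sup>2) / (norm (1 - cnj a * z))\<^sup>2"
proof -
  have nz: "norm (1 - cnj a * z) \<noteq> 0" using one_minus_cnj_mult_nz[OF assms] by simp
  have "(norm (1 - cnj a * z))\<^sup>2 - (norm (a - z))\<^sup>2 = (1 - (norm a)\<^sup>2) * (1 - (norm z)\<^sup>2)"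
    unfolding cmod_power2 by (simp add: power2_eq_square algebra_simps)
  moreover have "(norm (moebius_disc a z))\<^sup>2 = (norm (a - z))\<^sup>2 / (norm (1 - cnj a * z))\<^sup>2"
    by (simp only: moebius_disc_def norm_divide power_divide)
  then have "1 - (norm (moebius_disc a z))\<^sup>2 = ((norm (1 - cnj a * z))\<^sup>2 - (norm (a - z))\<^sup>2) / (norm (1 - cnj a * z))\<^sup>2"
    using nz by (simp only: diff_divide_distrib) simp
  ultimately show ?thesis by simp
qed

lemma norm_moebius_less_1:
  assumes "norm a < 1" "norm z < 1"
  shows "norm (moebius_disc a z) < 1"
proof -
  have "(norm a)\<^sup>2 < 1" "(norm z)\<^sup>2 < 1" using assms by (simp_all add: abs_square_less_1)
  then have "0 < 1 - (norm (moebius_disc a z))\<^sup>2"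
    unfolding one_minus_norm_moebius[OF assms] using one_minus_cnj_mult_nz[OF assms]
    by (intro divide_pos_pos mult_pos_pos) auto
  then show ?thesis by (simp add: abs_square_less_1)
qed

lemma moebius_involution:
  assumes "norm a < 1" "norm z < 1"
  shows "moebius_disc a (moebius_disc a z) = z"
proof -
  have nz: "1 - cnj a * z \<noteq> 0" using one_minus_cnj_mult_nz[OF assms] .
  have nz2: "1 - cnj a * a \<noteq> 0" using one_minus_cnj_mult_nz[OF assms(1) assms(1)] .
  have "a - moebius_disc a z = z * (1 - cnj a * a) / (1 - cnj a * z)"
    using nz by (simp add: moebius_disc_def field_simps)
  moreover have "1 - cnj a * moebius_disc a z = (1 - cnj a * a) / (1 - cnj a * z)"
    using nz by (simp add: moebius_disc_def field_simps)
  ultimately show ?thesis using nz nz2 by (simp add: moebius_disc_def[of a "moebius_disc a z"])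
qed

lemma moebius_0 [simp]: "moebius_disc a 0 = a"
  by (simp add: moebius_disc_def)

lemma moebius_has_derivative:
  assumes "norm a < 1" "norm z < 1"
  shows "(moebius_disc a has_field_derivative - (1 - cnj a * a) / (1 - cnj a * z)\<^sup>2) (at z)"
proof -
  have "((\<lambda>z. (a - z) / (1 - cnj a * z)) has_field_derivative - (1 - cnj a * a) / (1 - cnj a * z)\<^sup>2) (at z)"
    by (rule derivative_eq_intros refl one_minus_cnj_mult_nz assms)+
      (simp add: power2_eq_square algebra_simps)

  then show ?thesis by (simp add: moebius_disc_def[abs_def])
qed

lemma norm_moebius_deriv:
  assumes "norm a < 1"
  shows "norm (- (1 - cnj a * a) / (1 - cnj a * z)\<^sup>2) = (1 - (norm a)\<^sup>2) / (norm (1 - cnj a * z))\<^sup>2"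
proof -
  have "1 - cnj a * a = of_real (1 - (norm a)\<^sup>2)"
    using complex_norm_square[of a] by (simp add: mult.commute)
  moreover have "(norm a)\<^sup>2 < 1" using assms by (simp add: abs_square_less_1)
  ultimately show ?thesis by (simp only: norm_divide norm_minus_cancel norm_of_real norm_power)
qed

lemma moebius_holomorphic: "norm a < 1 \<Longrightarrow> moebius_disc a holomorphic_on \<D>"
  using moebius_has_derivative by (intro holomorphic_onI) (auto simp: field_differentiable_def intro: has_field_derivative_at_within)

lemma moebius_weight_bounds:
  assumes "norm a < 1" "norm z < 1" "s > 0"
  shows "0 \<le> moebius_weight s a z" "moebius_weight s a z \<le> 1"
proof -
  have "1 - (norm (moebius_disc a z))\<^sup>2 \<le> 1" "0 \<le> 1 - (norm (moebius_disc a z))\<^sup>2"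
    using norm_moebius_less_1[OF assms(1,2)] by (auto simp: abs_square_le_1)
  then show "0 \<le> moebius_weight s a z" "moebius_weight s a z \<le> 1"
    using assms(3) by (auto simp: moebius_weight_def powr_le1)
qed

lemma moebius_disc_measurable: "moebius_disc a \<in> borel_measurable \<lambda>\<D>" if "norm a < 1"
  by (intro measurable_disc_holomorphic moebius_holomorphic that)

lemma moebius_weight_measurable: "moebius_weight s a \<in> borel_measurable \<lambda>\<D>" if "norm a < 1"
  using moebius_disc_measurable[OF that, measurable] unfolding moebius_weight_def[abs_def] by measurable

section \<open>The function spaces in terms of unnormalized integrals\<close>

lemma ennreal_divide_pi_less_top: "x / ennreal pi < top \<longleftrightarrow> x < top"
  by (auto simp: divide_ennreal_def inverse_ennreal ennreal_mult_less_top)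

lemma SUP_divide_pi_finite_iff:
  fixes F :: "complex \<Rightarrow> ennreal"
  shows "(SUP a\<in>\<D>. F a / ennreal pi) < \<infinity> \<longleftrightarrow> (\<exists>C. \<forall>a\<in>\<D>. F a \<le> ennreal C)"
proof
  assume fin: "(SUP a\<in>\<D>. F a / ennreal pi) < \<infinity>"
  define S where "S = (SUP a\<in>\<D>. F a / ennreal pi)"
  have "F a \<le> ennreal (enn2real S * pi)" if "a \<in> \<D>" for a
  proof -
    have "F a / ennreal pi \<le> S" unfolding S_def using that by (rule SUP_upper)
    then have "F a / ennreal pi * ennreal pi \<le> S * ennreal pi" by (rule mult_right_mono) simp
    moreover have "F a / ennreal pi * ennreal pi = F a"
      by (simp add: ennreal_divide_times divide_mult_eq)
    ultimately show ?thesis using fin by (simp add: S_def ennreal_mult)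
  qed
  then show "\<exists>C. \<forall>a\<in>\<D>. F a \<le> ennreal C" by blast
next
  assume "\<exists>C. \<forall>a\<in>\<D>. F a \<le> ennreal C"
  then obtain C where C: "\<And>a. a \<in> \<D> \<Longrightarrow> F a \<le> ennreal C" by blast
  have "(SUP a\<in>\<D>. F a / ennreal pi) \<le> ennreal C / ennreal pi"
    using C by (intro SUP_least divide_right_mono_ennreal) auto
  also have "\<dots> < \<infinity>" using ennreal_divide_pi_less_top[of "ennreal C"] by simp
  finally show "(SUP a\<in>\<D>. F a / ennreal pi) < \<infinity>" .
qed

lemma Besov_space_iff:
  "f \<in> Besov_space p \<longleftrightarrow> f holomorphic_on \<D> \<and> Besov_integral p f < top"
proof (cases "f holomorphic_on \<D>")
  case True
  note [measurable] = measurable_disc_deriv[OF True]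
  show ?thesis using True
    by (simp add: Besov_space_def Besov_integral_def nn_integral_disc_area ennreal_divide_pi_less_top)
qed (simp add: Besov_space_def)

lemma Q_log_space_iff:
  "g \<in> Q_log_space s \<alpha> \<longleftrightarrow> g holomorphic_on \<D> \<and>
    (\<exists>C. \<forall>a\<in>\<D>. ennreal (disc_log a powr (2 * \<alpha>)) * Q_integral s (deriv g) a \<le> ennreal C)"
proof (cases "g holomorphic_on \<D>")
  case True
  note [measurable] = measurable_disc_deriv[OF True]
  have "(SUP a\<in>\<D>. ennreal (ln (2 / (1 - norm a)) powr (2 * \<alpha>)) *
      (\<integral>\<^sup>+z\<in>\<D>. ennreal ((norm (deriv g z))\<^sup>2 * (1 - (norm (moebius_disc a z))\<^sup>2) powr s) \<partial>disc_area))
    = (SUP a\<in>\<D>. (ennreal (disc_log a powr (2 * \<alpha>)) * Q_integral s (deriv g) a) / ennreal pi)"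
  proof (rule SUP_cong)
    fix a assume "a \<in> \<D>"
    then have [measurable]: "moebius_weight s a \<in> borel_measurable \<lambda>\<D>"
      by (intro moebius_weight_measurable) simp
    have "(\<lambda>z. ennreal ((norm (deriv g z))\<^sup>2 * moebius_weight s a z)) \<in> borel_measurable \<lambda>\<D>"
      by measurable
    from nn_integral_disc_area[OF this]
    show "ennreal (ln (2 / (1 - norm a)) powr (2 * \<alpha>)) *
      (\<integral>\<^sup>+z\<in>\<D>. ennreal ((norm (deriv g z))\<^sup>2 * (1 - (norm (moebius_disc a z))\<^sup>2) powr s) \<partial>disc_area)
      = (ennreal (disc_log a powr (2 * \<alpha>)) * Q_integral s (deriv g) a) / ennreal pi"
      by (simp add: moebius_weight_def Q_integral_def disc_log_def ennreal_times_divide)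
  qed simp
  then show ?thesis using True SUP_divide_pi_finite_iff[of "\<lambda>a. ennreal (disc_log a powr (2 * \<alpha>)) * Q_integral s (deriv g) a"]
    by (simp add: Q_log_space_def)
qed (simp add: Q_log_space_def)

text \<open>Common core of \<open>Besov_Bloch\<close> and \<open>Q_Bloch\<close>: |f'| is averaged
  over the disc of radius (1 - |z|) / 2, and \<open>F\<close> is the density of the integral that is
  known to be bounded. The term 1 / (1 - |z|) pays for the points where |f'| is small, so a density
  with a power larger than 1 of |f'| suffices for the rest.\<close>

lemma norm_deriv_le_of_majorant:
  assumes f: "f holomorphic_on \<D>" and z: "norm z < 1" and K: "0 \<le> K" "0 \<le> M"
    and F: "F \<in> borel_measurable \<lambda>\<D>" "(\<integral>\<^sup>+w. ennreal (F w) \<partial>\<lambda>\<D>) \<le> ennreal K" "\<And>w. norm w < 1 \<Longrightarrow> 0 \<le> F w"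
    and le: "\<And>w. norm w < 1 \<Longrightarrow> norm (w - z) < (1 - norm z) / 2 \<Longrightarrow>
       norm (deriv f w) \<le> 1 / (1 - norm z) + (1 - norm z) * M * F w"
  shows "norm (deriv f z) \<le> (1 + 2 * M * K) / (1 - norm z)"
proof -
  define d where "d = 1 - norm z"
  have d: "d > 0" using z by (simp add: d_def)
  note [measurable] = F(1)
  have f': "deriv f holomorphic_on \<D>" using f by (intro holomorphic_deriv) auto
  have "ennreal (pi * (d/2)\<^sup>2 * norm (deriv f z)) \<le> (\<integral>\<^sup>+w. ennreal (norm (deriv f w)) * indicator (ball z (d/2)) w \<partial>\<lambda>\<D>)"
    using d by (intro norm_le_ball_average f') (auto simp: d_def)
  also have "\<dots> \<le> (\<integral>\<^sup>+w. ennreal (1 / d) * indicator (ball z (d/2)) w + ennreal (d * M) * ennreal (F w) \<partial>\<lambda>\<D>)"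
  proof (rule nn_integral_mono)
    fix w assume "w \<in> space \<lambda>\<D>"
    then have w: "norm w < 1" by simp
    show "ennreal (norm (deriv f w)) * indicator (ball z (d/2)) w
      \<le> ennreal (1 / d) * indicator (ball z (d/2)) w + ennreal (d * M) * ennreal (F w)"
    proof (cases "w \<in> ball z (d/2)")
      case True
      then have "norm (deriv f w) \<le> 1 / d + d * M * F w"
        using le[OF w] by (simp add: d_def dist_norm norm_minus_commute)
      then have "ennreal (norm (deriv f w)) \<le> ennreal (1 / d + d * M * F w)" by (rule ennreal_leI)
      also have "\<dots> = ennreal (1 / d) + ennreal (d * M) * ennreal (F w)"
        using d K F(3)[OF w] by (simp add: ennreal_plus ennreal_mult)
      finally show ?thesis using True by simp
    qed simp
  qed
  also have "\<dots> = ennreal (1 / d) * (\<integral>\<^sup>+w. indicator (ball z (d/2)) w \<partial>\<lambda>\<D>) + ennreal (d * M) * (\<integral>\<^sup>+w. ennreal (F w) \<partial>\<lambda>\<D>)"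
  proof -
    have m: "(indicator (ball z (d/2)) :: complex \<Rightarrow> ennreal) \<in> borel_measurable \<lambda>\<D>"
      by (intro measurable_restrict_space1 borel_measurable_indicator) simp
    show ?thesis
      by (subst nn_integral_add) (use m in \<open>auto simp: nn_integral_cmult[OF m] nn_integral_cmult\<close>)
  qed
  also have "\<dots> \<le> ennreal (1 / d) * ennreal (pi * (d/2)\<^sup>2) + ennreal (d * M) * ennreal K"
    using d by (intro add_mono mult_left_mono emeasure_disc_lborel_le F(2)) auto
  also have "\<dots> = ennreal (1 / d * (pi * (d/2)\<^sup>2) + d * M * K)"
    using d K by (simp add: ennreal_plus[symmetric] ennreal_mult[symmetric] del: ennreal_plus)
  finally have "pi * (d/2)\<^sup>2 * norm (deriv f z) \<le> 1 / d * (pi * (d/2)\<^sup>2) + d * M * K"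
    using d K by (subst (asm) ennreal_le_iff) auto
  then have "d\<^sup>2 * (pi * norm (deriv f z)) \<le> d * (pi + 4 * M * K)"
    using d by (simp add: power2_eq_square field_simps)
  then have "d * (pi * norm (deriv f z)) \<le> pi + 4 * M * K" using d by (simp add: power2_eq_square)
  also have "\<dots> \<le> pi * (1 + 2 * M * K)"
  proof -
    have "4 * (M * K) \<le> (2 * pi) * (M * K)" using pi_gt3 K by (intro mult_right_mono) auto
    then show ?thesis by (simp add: algebra_simps)
  qed
  finally have "pi * (d * norm (deriv f z)) \<le> pi * (1 + 2 * M * K)" by (simp add: mult_ac)
  then have "d * norm (deriv f z) \<le> 1 + 2 * M * K" by simp
  then show ?thesis using d by (simp add: d_def field_simps)
qed

section \<open>Bloch bounds and logarithmic growth\<close>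

lemma powr_comparable:
  fixes x y q :: real
  assumes "0 < x" "x / 2 \<le> y" "y \<le> 3/2 * x"
  shows "x powr q \<le> 2 powr \<bar>q\<bar> * y powr q"
proof (cases "q \<ge> 0")
  case True
  have "x powr q \<le> (2 * y) powr q" using assms True by (intro powr_mono2) auto
  then show ?thesis using True by (simp add: powr_mult)
next
  case False
  have "(2 * x) powr q \<le> y powr q" using assms False by (intro powr_mono2') auto
  then have "2 powr (-q) * (2 powr q * x powr q) \<le> 2 powr (-q) * y powr q"
    by (intro mult_left_mono) (auto simp: powr_mult)
  then show ?thesis using False by (simp add: mult.assoc[symmetric] powr_add[symmetric])
qed

lemma one_minus_norm_near:
  assumes "norm (w - z) < (1 - norm z) / 2"
  shows "(1 - norm z) / 2 \<le> 1 - norm w" "1 - norm w \<le> 3/2 * (1 - norm z)"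
  using norm_triangle_ineq3[of w z] assms by (auto simp: abs_if split: if_splits)

lemma Besov_Bloch:
  assumes p: "1 < p" and K: "0 \<le> K"
  obtains B where "B > 0"
    "\<And>f z. f holomorphic_on \<D> \<Longrightarrow> Besov_integral p f \<le> ennreal K \<Longrightarrow> norm z < 1 \<Longrightarrow>
      norm (deriv f z) \<le> B / (1 - norm z)"
proof (rule that[of "1 + 2 * 2 powr \<bar>p - 2\<bar> * K"])
  show "1 + 2 * 2 powr \<bar>p - 2\<bar> * K > 0" using K by (simp add: add_pos_nonneg)
  fix f and z :: complex assume f: "f holomorphic_on \<D>" and fK: "Besov_integral p f \<le> ennreal K" and z: "norm z < 1"
  note [measurable] = measurable_disc_deriv[OF f]
  define d where "d = 1 - norm z"
  have d: "d > 0" using z by (simp add: d_def)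
  show "norm (deriv f z) \<le> (1 + 2 * 2 powr \<bar>p - 2\<bar> * K) / (1 - norm z)"
  proof (rule norm_deriv_le_of_majorant[OF f z K, where F = "\<lambda>w. (1 - norm w) powr (p - 2) * norm (deriv f w) powr p"])
    show "(\<lambda>w. (1 - norm w) powr (p - 2) * norm (deriv f w) powr p) \<in> borel_measurable \<lambda>\<D>" by measurable
    show "(\<integral>\<^sup>+w. ennreal ((1 - norm w) powr (p - 2) * norm (deriv f w) powr p) \<partial>\<lambda>\<D>) \<le> ennreal K"
      using fK by (simp add: Besov_integral_def)
    fix w assume w: "norm w < 1" "norm (w - z) < (1 - norm z) / 2"
    define x where "x = norm (deriv f w)"
    have x: "x \<ge> 0" by (simp add: x_def)
    \<comment> \<open>The p-th power dominates wherever \<open>d * x\<close> exceeds 1. After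
      division by \<open>d\<close>, the power d^2 is split off so that exactly the Besov weight d^(p
      - 2) remains.\<close>
    have "d * x \<le> 1 + (d * x) powr p"
    proof (cases "d * x \<le> 1")
      case False
      then have "(d * x) powr 1 \<le> (d * x) powr p" using p by (intro powr_mono) auto
      then show ?thesis using False by simp
    qed (smt (verit) powr_ge_zero)
    also have "(d * x) powr p = d\<^sup>2 * (d powr (p - 2) * x powr p)"
      using d x by (simp add: powr_mult powr_diff powr_numeral)
    also have "d powr (p - 2) \<le> 2 powr \<bar>p - 2\<bar> * (1 - norm w) powr (p - 2)"
      using one_minus_norm_near[OF w(2)] d by (intro powr_comparable) (auto simp: d_def)
    finally have "d * x \<le> 1 + d\<^sup>2 * (2 powr \<bar>p - 2\<bar> * (1 - norm w) powr (p - 2) * x powr p)"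
      by (simp add: mult_left_mono mult_right_mono)
    then have "d * x / d \<le> (1 + d\<^sup>2 * (2 powr \<bar>p - 2\<bar> * (1 - norm w) powr (p - 2) * x powr p)) / d"
      using d by (intro divide_right_mono) auto
    also have "\<dots> = 1 / d + d * 2 powr \<bar>p - 2\<bar> * ((1 - norm w) powr (p - 2) * x powr p)"
      using d by (simp add: add_divide_distrib power2_eq_square)
    finally show "norm (deriv f w) \<le> 1 / (1 - norm z) + (1 - norm z) * 2 powr \<bar>p - 2\<bar> * ((1 - norm w) powr (p - 2) * norm (deriv f w) powr p)"
      using d by (simp add: d_def x_def)
  qed auto
qed

text \<open>Only the integral at \<open>a = z\<close> enters: on the disc of radius (1 - |z|) / 2
  about \<open>z\<close> the weight \<open>moebius_weight s z\<close> is at least (2/25)^s. The 2/25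
  is (d * d/2) / (5/2 d)^2.\<close>

lemma Q_Bloch:
  assumes s: "0 < s" and K: "0 \<le> K"
  obtains B where "B > 0"
    "\<And>f z. f holomorphic_on \<D> \<Longrightarrow> norm z < 1 \<Longrightarrow> Q_integral s (deriv f) z \<le> ennreal K \<Longrightarrow>
      norm (deriv f z) \<le> B / (1 - norm z)"
proof (rule that[of "1 + 2 * (25/2) powr s * K"])
  show "1 + 2 * (25/2) powr s * K > 0" using K by (simp add: add_pos_nonneg)
  fix f z assume f: "f holomorphic_on \<D>" and z: "norm z < 1" and fK: "Q_integral s (deriv f) z \<le> ennreal K"
  note [measurable] = measurable_disc_deriv[OF f]
  define d where "d = 1 - norm z"
  have d: "d > 0" using z by (simp add: d_def)
  show "norm (deriv f z) \<le> (1 + 2 * (25/2) powr s * K) / (1 - norm z)"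
  proof (rule norm_deriv_le_of_majorant[OF f z K, where F = "\<lambda>w. (norm (deriv f w))\<^sup>2 * moebius_weight s z w"])
    show "(\<lambda>w. (norm (deriv f w))\<^sup>2 * moebius_weight s z w) \<in> borel_measurable \<lambda>\<D>"
      using moebius_weight_measurable[OF z, measurable] by measurable
    show "(\<integral>\<^sup>+w. ennreal ((norm (deriv f w))\<^sup>2 * moebius_weight s z w) \<partial>\<lambda>\<D>) \<le> ennreal K"
      using fK by (simp add: Q_integral_def)
    show "norm w < 1 \<Longrightarrow> 0 \<le> (norm (deriv f w))\<^sup>2 * moebius_weight s z w" for w
      using moebius_weight_bounds(1)[OF z _ s] by simp
    fix w assume w: "norm w < 1" "norm (w - z) < (1 - norm z) / 2"
    define x where "x = norm (deriv f w)"
    have x: "x \<ge> 0" by (simp add: x_def)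
    have "norm (1 - cnj z * w) \<le> norm (1 - cnj z * z) + norm (cnj z * (z - w))"
      using norm_triangle_ineq[of "1 - cnj z * z" "cnj z * (z - w)"] by (simp add: algebra_simps)
    also have "norm (1 - cnj z * z) = \<bar>1 - (norm z)\<^sup>2\<bar>"
      using complex_norm_square[of z] norm_of_real[of "1 - (norm z)\<^sup>2", where 'a = complex] by (simp add: mult.commute)
    also have "\<bar>1 - (norm z)\<^sup>2\<bar> = (1 + norm z) * d"
      using z by (simp add: d_def power2_eq_square algebra_simps abs_if mult_le_one) (smt (verit) mult_le_one norm_ge_zero)
    also have "(1 + norm z) * d \<le> 2 * d" using z d by (intro mult_right_mono) auto
    also have "norm (cnj z * (z - w)) \<le> 1 * (d / 2)"
      unfolding norm_mult using z w by (intro mult_mono) (auto simp: d_def norm_minus_commute)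
    finally have n: "norm (1 - cnj z * w) \<le> 5/2 * d" by simp
    have "norm (1 - cnj z * w) > 0" using one_minus_cnj_mult_nz[OF z w(1)] by simp
    then have "(1 - (norm z)\<^sup>2) * (1 - (norm w)\<^sup>2) / (norm (1 - cnj z * w))\<^sup>2 \<ge> (d * (d / 2)) / (5/2 * d)\<^sup>2"
    proof (intro frac_le mult_mono power_mono n)
      show "d \<le> 1 - (norm z)\<^sup>2" using z by (simp add: d_def power2_eq_square mult_left_le)
      have "1 - norm w \<le> 1 - (norm w)\<^sup>2" using w by (simp add: power2_eq_square mult_left_le)
      then show "d / 2 \<le> 1 - (norm w)\<^sup>2" using one_minus_norm_near(1)[OF w(2)] by (simp add: d_def)
      show "0 \<le> 1 - (norm z)\<^sup>2" using z by (simp add: abs_square_le_1)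
      show "0 \<le> (1 - (norm z)\<^sup>2) * (1 - (norm w)\<^sup>2)" using z w by (simp add: abs_square_le_1)
    qed (use d in auto)
    moreover have "(d * (d / 2)) / (5/2 * d)\<^sup>2 = 2/25" using d by (simp add: power2_eq_square)
    ultimately have "2/25 \<le> 1 - (norm (moebius_disc z w))\<^sup>2"
      by (simp only: one_minus_norm_moebius[OF z w(1)])
    then have "(2/25) powr s \<le> moebius_weight s z w"
      unfolding moebius_weight_def using s by (intro powr_mono2) auto
    then have "(25/2) powr s * (2/25) powr s \<le> (25/2) powr s * moebius_weight s z w"
      by (rule mult_left_mono) simp
    then have 1: "1 \<le> (25/2) powr s * moebius_weight s z w" by (simp add: powr_mult[symmetric])
    have "d * x \<le> 1 + (d * x)\<^sup>2"
      by (smt (verit) zero_le_power2 power2_eq_square mult_left_le mult_le_cancel_left2)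
    also have "(d * x)\<^sup>2 \<le> (d * x)\<^sup>2 * ((25/2) powr s * moebius_weight s z w)"
      using mult_left_mono[OF 1, of "(d * x)\<^sup>2"] by simp
    finally have "d * x / d \<le> (1 + d\<^sup>2 * ((25/2) powr s * moebius_weight s z w * x\<^sup>2)) / d"
      using d by (intro divide_right_mono) (auto simp: power_mult_distrib mult_ac)
    also have "\<dots> = 1 / d + d * (25/2) powr s * (x\<^sup>2 * moebius_weight s z w)"
      using d by (simp add: add_divide_distrib power2_eq_square)
    finally show "norm (deriv f w) \<le> 1 / (1 - norm z) + (1 - norm z) * (25/2) powr s * ((norm (deriv f w))\<^sup>2 * moebius_weight s z w)"
      using d by (simp add: d_def x_def)
  qed auto
qed

lemma disc_cone_indicator_measurable [measurable]:
  "(indicator (disc_cone z) :: complex \<Rightarrow> ennreal) \<in> borel_measurable \<lambda>\<D>"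
  by (intro measurable_restrict_space1 borel_measurable_indicator) simp

lemma divide_le_self: "y / c \<le> y" if "0 \<le> y" "1 \<le> c" for y c :: real
  using frac_le[of y y 1 c] that by simp

lemma ennreal_mult_add:
  "0 \<le> a \<Longrightarrow> 0 \<le> b \<Longrightarrow> 0 \<le> c \<Longrightarrow> 0 \<le> d \<Longrightarrow>
    ennreal (a * b + c * d) = ennreal a * ennreal b + ennreal c * ennreal d"
  by (simp add: ennreal_plus ennreal_mult)

text \<open>Hoelder's inequality over the cone, pairing the Besov density with the hyperbolic area
  of size \<open>disc_log z\<close>. It is carried out pointwise by Young's inequality with a
  balancing parameter \<kappa>, so that only sums of integrals occur.\<close>

lemma Besov_growth:
  assumes p: "1 < p" "1 / p + 1 / p' = 1" and K: "0 \<le> K"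
  obtains C where "C > 0"
    "\<And>f z. f holomorphic_on \<D> \<Longrightarrow> Besov_integral p f \<le> ennreal K \<Longrightarrow> norm z < 1 \<Longrightarrow>
      norm (f z - f 0) \<le> C * disc_log z powr (1 / p')"
proof -
  have p': "p' > 1"
  proof -
    have "1 / p' = 1 - 1 / p" using p by simp
    also have "0 < 1 - 1 / p" "1 - 1 / p < 1" using p by auto
    ultimately have "0 < 1 / p'" "1 / p' < 1" by auto
    then show ?thesis by (auto simp: divide_less_eq split: if_splits)
  qed
  obtain C where C: "C > 0"
    "\<And>z. norm z < 1 \<Longrightarrow>
      (\<integral>\<^sup>+w. ennreal (1 / (1 - norm w)\<^sup>2) * indicator (disc_cone z) w \<partial>\<lambda>\<D>) \<le> ennreal (C * disc_log z)"
    using disc_cone_hyperbolic_area by blast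
  have C4: "4 * (K + C) > 0" using C K by simp
  show ?thesis
  proof (rule that[OF C4])
    fix f and z :: complex assume f: "f holomorphic_on \<D>" and fK: "Besov_integral p f \<le> ennreal K" and z: "norm z < 1"
    note [measurable] = measurable_disc_deriv[OF f]
    define L where "L = disc_log z"
    have L: "L > 0" using disc_log_pos[OF z] by (simp add: L_def)
    \<comment> \<open>This value balances the two terms: \<kappa>^p and \<kappa>^(-p') L are both
      L^(1 / p').\<close>
    define \<kappa> where "\<kappa> = L powr (1 / (p * p'))"
    have \<kappa>: "\<kappa> > 0" using L by (simp add: \<kappa>_def)
    have \<kappa>p: "\<kappa> powr p = L powr (1 / p')" "\<kappa> powr (- p') = L powr (- (1 / p))"
      using p p' by (simp_all add: \<kappa>_def powr_powr)
    have "ennreal (norm (f z - f 0)) \<le> ennreal 4 * (\<integral>\<^sup>+w. ennreal (norm (deriv f w) / (1 - norm w)) * indicator (disc_cone z) w \<partial>\<lambda>\<D>)"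
      by (rule norm_diff_le_cone[OF f z])
    also have "(\<integral>\<^sup>+w. ennreal (norm (deriv f w) / (1 - norm w)) * indicator (disc_cone z) w \<partial>\<lambda>\<D>)
      \<le> (\<integral>\<^sup>+w. ennreal (L powr (1 / p')) * ennreal ((1 - norm w) powr (p - 2) * norm (deriv f w) powr p)
           + ennreal (L powr (- (1 / p))) * (ennreal (1 / (1 - norm w)\<^sup>2) * indicator (disc_cone z) w) \<partial>\<lambda>\<D>)"
    proof (rule nn_integral_mono)
      fix w assume "w \<in> space \<lambda>\<D>"
      then have w: "norm w < 1" by simp
      define d where "d = 1 - norm w"
      have d: "d > 0" using w by (simp add: d_def)
      define x where "x = norm (deriv f w)"
      have x: "x \<ge> 0" by (simp add: x_def)
      show "ennreal (norm (deriv f w) / (1 - norm w)) * indicator (disc_cone z) w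
        \<le> ennreal (L powr (1 / p')) * ennreal ((1 - norm w) powr (p - 2) * norm (deriv f w) powr p)
           + ennreal (L powr (- (1 / p))) * (ennreal (1 / (1 - norm w)\<^sup>2) * indicator (disc_cone z) w)"
      proof (cases "w \<in> disc_cone z")
        case True
        \<comment> \<open>The exponents 1 - 2 / p and - 2 / p' add up to -1. The p-th power of
          \<open>A\<close> is the Besov density, the p'-th power of \<open>B\<close> the hyperbolic
          one, up to powers of \<kappa>.\<close>
        define A where "A = \<kappa> * x * d powr (1 - 2 / p)"
        define B where "B = d powr (- 2 / p') / \<kappa>"
        have "x / d = A * B"
        proof -
          have "1 - 2 / p + (- 2 / p') = -1" using p(2) by (simp add: field_simps)
          then have "d powr (1 - 2 / p) * d powr (- 2 / p') = d powr (-1)" by (simp only: powr_add[symmetric])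
          also have "d powr (-1) = 1 / d" using d by (simp add: powr_minus_divide)
          finally have "x / d = x * (d powr (1 - 2 / p) * d powr (- 2 / p'))" by simp
          moreover have "\<kappa> * x * y * (y' / \<kappa>) = x * (y * y')" for y y' using \<kappa> by simp
          ultimately show ?thesis by (simp only: A_def B_def)
        qed
        also have "\<dots> \<le> A powr p / p + B powr p' / p'"
          using p p' \<kappa> x d by (intro Youngs_inequality) (auto simp: A_def B_def)
        also have "\<dots> \<le> A powr p + B powr p'"
          using p p' by (intro add_mono divide_le_self) auto
        also have "A powr p = L powr (1 / p') * (d powr (p - 2) * x powr p)"
          using p \<kappa> x by (simp add: A_def powr_mult powr_powr \<kappa>p left_diff_distrib)
        also have "B powr p' = L powr (- (1 / p)) * (1 / d\<^sup>2)"
        proof -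
          have "B powr p' = (d powr (- 2 / p')) powr p' / \<kappa> powr p'" by (simp only: B_def powr_divide)
          also have "(d powr (- 2 / p')) powr p' = d powr (- 2)" using p' by (simp add: powr_powr)
          also have "\<dots> = 1 / d\<^sup>2" using d by (simp add: powr_minus_divide powr_numeral)
          also have "1 / d\<^sup>2 / \<kappa> powr p' = \<kappa> powr (- p') * (1 / d\<^sup>2)" by (simp add: powr_minus_divide)
          finally show ?thesis by (simp only: \<kappa>p(2))
        qed
        finally have "ennreal (x / d) \<le> ennreal (L powr (1 / p') * (d powr (p - 2) * x powr p) + L powr (- (1 / p)) * (1 / d\<^sup>2))"
          by (rule ennreal_leI)
        also have "\<dots> = ennreal (L powr (1 / p')) * ennreal (d powr (p - 2) * x powr p) + ennreal (L powr (- (1 / p))) * ennreal (1 / d\<^sup>2)"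
          by (intro ennreal_mult_add) auto
        finally show ?thesis using True by (simp add: d_def x_def)
      qed simp
    qed
    also have "\<dots> = ennreal (L powr (1 / p')) * Besov_integral p f
           + ennreal (L powr (- (1 / p))) * (\<integral>\<^sup>+w. ennreal (1 / (1 - norm w)\<^sup>2) * indicator (disc_cone z) w \<partial>\<lambda>\<D>)"
      by (subst nn_integral_add) (auto simp: Besov_integral_def nn_integral_cmult)
    also have "\<dots> \<le> ennreal (L powr (1 / p')) * ennreal K + ennreal (L powr (- (1 / p))) * ennreal (C * L)"
      using C(2)[OF z] fK by (intro add_mono mult_left_mono) (auto simp: L_def)
    also have "\<dots> = ennreal (L powr (1 / p') * K + L powr (- (1 / p)) * (C * L))"
      using C(1) L K by (simp add: ennreal_plus[symmetric] ennreal_mult[symmetric] del: ennreal_plus)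
    also have "L powr (- (1 / p)) * (C * L) = C * L powr (1 / p')"
    proof -
      have "1 / p' = - (1 / p) + 1" using p by simp
      then have "L powr (1 / p') = L powr (- (1 / p)) * L" using L by (simp only: powr_add) simp
      then show ?thesis by simp
    qed
    also have "ennreal 4 * ennreal (L powr (1 / p') * K + C * L powr (1 / p')) = ennreal (4 * (K + C) * L powr (1 / p'))"
      using C(1) K by (subst ennreal_mult[symmetric]) (auto simp: algebra_simps)
    finally have "ennreal (norm (f z - f 0)) \<le> ennreal (4 * (K + C) * L powr (1 / p'))"
      by (simp add: mult_left_mono)
    then show "norm (f z - f 0) \<le> 4 * (K + C) * disc_log z powr (1 / p')"
      using C4 by (subst (asm) ennreal_le_iff) (auto simp: L_def)
  qed
qed

text \<open>Composition with \<open>moebius_disc a\<close> preserves the Bloch condition up to a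
  factor 2 and moves \<open>a\<close> to the origin, from where the cone estimate measures the
  increment.\<close>

lemma Bloch_increment:
  obtains C where "C > 0"
    "\<And>f B a z. f holomorphic_on \<D> \<Longrightarrow> 0 \<le> B \<Longrightarrow> (\<And>w. norm w < 1 \<Longrightarrow> norm (deriv f w) \<le> B / (1 - norm w)) \<Longrightarrow>
      norm a < 1 \<Longrightarrow> norm z < 1 \<Longrightarrow> norm (f z - f a) \<le> C * B * disc_log (moebius_disc a z)"
proof -
  obtain C where C: "C > 0"
    "\<And>z. norm z < 1 \<Longrightarrow>
      (\<integral>\<^sup>+w. ennreal (1 / (1 - norm w)\<^sup>2) * indicator (disc_cone z) w \<partial>\<lambda>\<D>) \<le> ennreal (C * disc_log z)"
    using disc_cone_hyperbolic_area by blast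
  have C8: "8 * C > 0" using C by simp
  show ?thesis
  proof (rule that[OF C8])
    fix f B and a z :: complex
    assume f: "f holomorphic_on \<D>" and B: "0 \<le> B" and fB: "\<And>w. norm w < 1 \<Longrightarrow> norm (deriv f w) \<le> B / (1 - norm w)"
      and a: "norm a < 1" and z: "norm z < 1"
    define \<phi> where "\<phi> = moebius_disc a"
    define F where "F w = f (\<phi> w)" for w
    have \<phi>1: "norm (\<phi> w) < 1" if "norm w < 1" for w using norm_moebius_less_1[OF a that] by (simp add: \<phi>_def)
    have F: "F holomorphic_on \<D>" unfolding F_def
      by (rule holomorphic_on_compose_gen[OF _ f, unfolded o_def])
        (use moebius_holomorphic[OF a] \<phi>1 in \<open>auto simp: \<phi>_def\<close>)
    have F': "norm (deriv F w) \<le> 2 * B / (1 - norm w)" if w: "norm w < 1" for w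
    proof -
      have "(f has_field_derivative deriv f (\<phi> w)) (at (\<phi> w))"
        using f \<phi>1[OF w] by (intro holomorphic_derivI[of _ \<D>]) auto
      from DERIV_chain2[OF this moebius_has_derivative[OF a w, folded \<phi>_def]]
      have "norm (deriv F w) = norm (deriv f (\<phi> w)) * ((1 - (norm a)\<^sup>2) / (norm (1 - cnj a * w))\<^sup>2)"
        by (simp only: F_def[abs_def] DERIV_imp_deriv norm_mult norm_moebius_deriv[OF a])
      also have "(1 - (norm a)\<^sup>2) / (norm (1 - cnj a * w))\<^sup>2 = (1 - (norm (\<phi> w))\<^sup>2) / (1 - (norm w)\<^sup>2)"
      proof -
        have "(norm w)\<^sup>2 < 1" using w by (simp add: abs_square_less_1)
        then have "1 - (norm w)\<^sup>2 \<noteq> 0" by simp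
        then show ?thesis by (simp add: \<phi>_def one_minus_norm_moebius[OF a w])
      qed
      also have "norm (deriv f (\<phi> w)) * \<dots> \<le> B / (1 - norm (\<phi> w)) * (2 * (1 - norm (\<phi> w)) / (1 - norm w))"
      proof (intro mult_mono fB \<phi>1 w frac_le)
        have "(1 - norm (\<phi> w)) * (1 + norm (\<phi> w)) \<le> (1 - norm (\<phi> w)) * 2"
          using \<phi>1[OF w] by (intro mult_left_mono) auto
        then show "1 - (norm (\<phi> w))\<^sup>2 \<le> 2 * (1 - norm (\<phi> w))" by (simp add: power2_eq_square algebra_simps)
        show "1 - norm w \<le> 1 - (norm w)\<^sup>2" using w by (simp add: power2_eq_square mult_left_le)
        show "0 \<le> (1 - (norm (\<phi> w))\<^sup>2) / (1 - (norm w)\<^sup>2)"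
          using \<phi>1[OF w] w by (intro divide_nonneg_nonneg) (auto simp: abs_square_le_1)
      qed (use w \<phi>1[OF w] B in auto)
      also have "\<dots> = 2 * B / (1 - norm w)"
      proof -
        have gen: "B / t * (2 * t / u) = 2 * B / u" if "t \<noteq> 0" for t u :: real using that by simp
        show ?thesis by (rule gen) (use \<phi>1[OF w] in simp)
      qed
      finally show ?thesis .
    qed
    define u where "u = \<phi> z"
    have u: "norm u < 1" using \<phi>1[OF z] by (simp add: u_def)
    have "ennreal (norm (F u - F 0)) \<le> ennreal 4 * (\<integral>\<^sup>+w. ennreal (norm (deriv F w) / (1 - norm w)) * indicator (disc_cone u) w \<partial>\<lambda>\<D>)"
      by (rule norm_diff_le_cone[OF F u])
    also have "(\<integral>\<^sup>+w. ennreal (norm (deriv F w) / (1 - norm w)) * indicator (disc_cone u) w \<partial>\<lambda>\<D>)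
      \<le> (\<integral>\<^sup>+w. ennreal (2 * B) * (ennreal (1 / (1 - norm w)\<^sup>2) * indicator (disc_cone u) w) \<partial>\<lambda>\<D>)"
    proof (rule nn_integral_mono)
      fix w assume "w \<in> space \<lambda>\<D>"
      then have w: "norm w < 1" by simp
      have "norm (deriv F w) / (1 - norm w) \<le> 2 * B / (1 - norm w) / (1 - norm w)"
        using F'[OF w] w by (intro divide_right_mono) auto
      also have "\<dots> = 2 * B * (1 / (1 - norm w)\<^sup>2)" by (simp add: power2_eq_square)
      finally have "ennreal (norm (deriv F w) / (1 - norm w)) \<le> ennreal (2 * B) * ennreal (1 / (1 - norm w)\<^sup>2)"
        using B by (subst ennreal_mult[symmetric]) (auto intro: ennreal_leI)
      from mult_right_mono[OF this, of "indicator (disc_cone u) w"]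
      show "ennreal (norm (deriv F w) / (1 - norm w)) * indicator (disc_cone u) w
        \<le> ennreal (2 * B) * (ennreal (1 / (1 - norm w)\<^sup>2) * indicator (disc_cone u) w)"
        by (simp add: mult.assoc)
    qed
    also have "\<dots> = ennreal (2 * B) * (\<integral>\<^sup>+w. ennreal (1 / (1 - norm w)\<^sup>2) * indicator (disc_cone u) w \<partial>\<lambda>\<D>)"
      by (rule nn_integral_cmult) measurable
    also have "\<dots> \<le> ennreal (2 * B) * ennreal (C * disc_log u)"
      by (intro mult_left_mono C u) auto
    also have "ennreal 4 * (ennreal (2 * B) * ennreal (C * disc_log u)) = ennreal (8 * C * B * disc_log u)"
    proof -
      have "0 \<le> C * disc_log u" using C(1) disc_log_pos[OF u] by simp
      then have "ennreal 4 * (ennreal (2 * B) * ennreal (C * disc_log u)) = ennreal (4 * (2 * B * (C * disc_log u)))"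
        using B by (simp only: ennreal_mult[symmetric] mult_nonneg_nonneg zero_le_numeral)
      then show ?thesis by (simp add: mult_ac)
    qed
    finally have "ennreal (norm (F u - F 0)) \<le> ennreal (8 * C * B * disc_log u)"
      by (simp add: mult_left_mono)
    then have "norm (F u - F 0) \<le> 8 * C * B * disc_log u"
      using C(1) B disc_log_pos[OF u] by (subst (asm) ennreal_le_iff) auto
    then show "norm (f z - f a) \<le> 8 * C * B * disc_log (moebius_disc a z)"
      using moebius_involution[OF a z] by (simp add: F_def u_def \<phi>_def)
  qed
qed

section \<open>Embedding of the Besov space\<close>

lemma one_minus_norm_square_le: "(1 - (norm a)\<^sup>2) \<le> 2 * (1 - norm a)" if "norm a < 1"
proof -
  have "(1 - norm a) * (1 + norm a) \<le> (1 - norm a) * 2" using that by (intro mult_left_mono) auto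
  then show ?thesis by (simp add: power2_eq_square algebra_simps)
qed

lemma moebius_weight_le:
  assumes a: "norm a < 1" and z: "norm z < 1" and s: "0 < s"
  shows "moebius_weight s a z \<le> 4 powr s * ((1 - norm a) powr s * (1 - norm z) powr s / norm (1 - cnj a * z) powr (2 * s))"
proof -
  have pos: "norm (1 - cnj a * z) > 0" using one_minus_cnj_mult_nz[OF a z] by simp
  have "(1 - (norm a)\<^sup>2) * (1 - (norm z)\<^sup>2) \<le> (2 * (1 - norm a)) * (2 * (1 - norm z))"
    using a z by (intro mult_mono one_minus_norm_square_le) (auto simp: abs_square_le_1)
  also have "\<dots> = 4 * ((1 - norm a) * (1 - norm z))" by (simp add: algebra_simps)
  finally have "1 - (norm (moebius_disc a z))\<^sup>2 \<le> 4 * ((1 - norm a) * (1 - norm z)) / (norm (1 - cnj a * z))\<^sup>2"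
    unfolding one_minus_norm_moebius[OF a z] by (intro divide_right_mono) auto
  then have "moebius_weight s a z \<le> (4 * ((1 - norm a) * (1 - norm z)) / (norm (1 - cnj a * z))\<^sup>2) powr s"
    unfolding moebius_weight_def using norm_moebius_less_1[OF a z] s
    by (intro powr_mono2) (auto simp: abs_square_le_1)
  also have "\<dots> = 4 powr s * ((1 - norm a) powr s * (1 - norm z) powr s / norm (1 - cnj a * z) powr (2 * s))"
  proof -
    have "((norm (1 - cnj a * z))\<^sup>2) powr s = norm (1 - cnj a * z) powr (2 * s)"
      using pos by (simp add: powr_powr powr_numeral[symmetric] del: powr_numeral)
    then show ?thesis by (simp add: powr_divide powr_mult)
  qed
  finally show ?thesis .
qed

text \<open>Hyperbolic area is invariant under disc involutions, so independence of \<open>a\<close>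
  is to be expected. It is read off from \<open>Forelli_Rudin\<close> with exponents \<sigma> - 2
  and \<sigma>: the resulting (1 - |a|)^(-\<sigma>) cancels the factor in the weight, and \<sigma> >
  1 is integrability at the circle.\<close>

lemma hyperbolic_moebius_weight:
  assumes \<sigma>: "1 < \<sigma>"
  obtains C where "C > 0"
    "\<And>a. norm a < 1 \<Longrightarrow> (\<integral>\<^sup>+z. ennreal (moebius_weight \<sigma> a z / (1 - norm z)\<^sup>2) \<partial>\<lambda>\<D>) \<le> ennreal C"
proof -
  obtain C where C: "C > 0"
    "\<And>a. norm a < 1 \<Longrightarrow>
      (\<integral>\<^sup>+z. ennreal ((1 - norm z) powr (\<sigma> - 2) / norm (1 - cnj a * z) powr (\<sigma> - 2 + 2 + \<sigma>)) \<partial>\<lambda>\<D>)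
        \<le> ennreal (C * (1 - norm a) powr (- \<sigma>))"
    using Forelli_Rudin[of "\<sigma> - 2" \<sigma>] \<sigma> by auto
  have C4: "4 powr \<sigma> * C > 0" using C by simp
  show ?thesis
  proof (rule that[OF C4])
    fix a :: complex assume a: "norm a < 1"
    let ?I = "\<lambda>z. (1 - norm z) powr (\<sigma> - 2) / norm (1 - cnj a * z) powr (\<sigma> - 2 + 2 + \<sigma>)"
    have "(\<integral>\<^sup>+z. ennreal (moebius_weight \<sigma> a z / (1 - norm z)\<^sup>2) \<partial>\<lambda>\<D>)
      \<le> (\<integral>\<^sup>+z. ennreal (4 powr \<sigma> * (1 - norm a) powr \<sigma>) * ennreal (?I z) \<partial>\<lambda>\<D>)"
    proof (rule nn_integral_mono)
      fix z assume "z \<in> space \<lambda>\<D>"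
      then have z: "norm z < 1" by simp
      have "moebius_weight \<sigma> a z / (1 - norm z)\<^sup>2
        \<le> 4 powr \<sigma> * ((1 - norm a) powr \<sigma> * (1 - norm z) powr \<sigma> / norm (1 - cnj a * z) powr (2 * \<sigma>)) / (1 - norm z)\<^sup>2"
        using \<sigma> by (intro divide_right_mono moebius_weight_le a z) auto
      also have "\<dots> = 4 powr \<sigma> * (1 - norm a) powr \<sigma> * ?I z"
        using z by (simp add: powr_diff powr_numeral mult_ac)
      finally show "ennreal (moebius_weight \<sigma> a z / (1 - norm z)\<^sup>2) \<le> ennreal (4 powr \<sigma> * (1 - norm a) powr \<sigma>) * ennreal (?I z)"
        by (subst ennreal_mult[symmetric]) (auto intro: ennreal_leI)
    qed
    also have "\<dots> = ennreal (4 powr \<sigma> * (1 - norm a) powr \<sigma>) * (\<integral>\<^sup>+z. ennreal (?I z) \<partial>\<lambda>\<D>)"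
    proof (rule nn_integral_cmult)
      have [measurable]: "(\<lambda>z. 1 - cnj a * z) \<in> borel_measurable \<lambda>\<D>" by measurable
      show "(\<lambda>z. ennreal (?I z)) \<in> borel_measurable \<lambda>\<D>" by measurable
    qed
    also have "\<dots> \<le> ennreal (4 powr \<sigma> * (1 - norm a) powr \<sigma>) * ennreal (C * (1 - norm a) powr (- \<sigma>))"
      by (intro mult_left_mono C a) auto
    also have "\<dots> = ennreal (4 powr \<sigma> * C)"
      using a C(1) by (simp add: ennreal_mult[symmetric] powr_minus_divide)
    finally show "(\<integral>\<^sup>+z. ennreal (moebius_weight \<sigma> a z / (1 - norm z)\<^sup>2) \<partial>\<lambda>\<D>) \<le> ennreal (4 powr \<sigma> * C)" .
  qed
qed

text \<open>For p \<le> 2 the Bloch bound exchanges |f'|^(2 - p) for a multiple of (1 - |z|)^(p -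
  2), and the weight is simply bounded by 1. For p > 2 Young's inequality with exponents p / 2 and p
  / (p - 2) separates the Besov density from a power of the weight.\<close>

lemma Besov_Q_embedding:
  assumes p: "1 < p" and s: "0 < s" "2 < p \<Longrightarrow> 1 - 2 / p < s" and K: "0 \<le> K"
  obtains C where "C > 0"
    "\<And>f a. f holomorphic_on \<D> \<Longrightarrow> Besov_integral p f \<le> ennreal K \<Longrightarrow> norm a < 1 \<Longrightarrow>
      Q_integral s (deriv f) a \<le> ennreal C"
proof (cases "p \<le> 2")
  case True
  obtain B where B: "B > 0"
    "\<And>f z. f holomorphic_on \<D> \<Longrightarrow> Besov_integral p f \<le> ennreal K \<Longrightarrow> norm z < 1 \<Longrightarrow>
      norm (deriv f z) \<le> B / (1 - norm z)"
    using Besov_Bloch[OF p K] by blast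
  have pos: "B powr (2 - p) * K + 1 > 0" using K by (simp add: add_nonneg_pos)
  show ?thesis
  proof (rule that[OF pos])
    fix f and a :: complex assume f: "f holomorphic_on \<D>" and fK: "Besov_integral p f \<le> ennreal K" and a: "norm a < 1"
    note [measurable] = measurable_disc_deriv[OF f]
    have "Q_integral s (deriv f) a \<le> (\<integral>\<^sup>+z. ennreal (B powr (2 - p)) * ennreal ((1 - norm z) powr (p - 2) * norm (deriv f z) powr p) \<partial>\<lambda>\<D>)"
      unfolding Q_integral_def
    proof (rule nn_integral_mono)
      fix z assume "z \<in> space \<lambda>\<D>"
      then have z: "norm z < 1" by simp
      define x where "x = norm (deriv f z)"
      have xB: "x \<le> B / (1 - norm z)" using B(2)[OF f fK z] by (simp add: x_def)
      have "x\<^sup>2 * moebius_weight s a z \<le> x\<^sup>2"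
        using moebius_weight_bounds[OF a z s(1)] by (simp add: mult_left_le)
      also have "\<dots> \<le> B powr (2 - p) * ((1 - norm z) powr (p - 2) * x powr p)"
      proof (cases "x = 0")
        case False
        then have x: "x > 0" by (simp add: x_def)
        have "x\<^sup>2 = x powr (2 - p) * x powr p" using x by (simp add: powr_add[symmetric] powr_numeral)
        also have "\<dots> \<le> (B / (1 - norm z)) powr (2 - p) * x powr p"
          using x xB True by (intro mult_right_mono powr_mono2) auto
        also have "(B / (1 - norm z)) powr (2 - p) = B powr (2 - p) * (1 - norm z) powr (p - 2)"
          using B(1) z powr_minus_divide[of "1 - norm z" "2 - p"] by (simp add: powr_divide)
        finally show ?thesis by simp
      qed simp
      finally show "ennreal ((norm (deriv f z))\<^sup>2 * moebius_weight s a z) \<le> ennreal (B powr (2 - p)) * ennreal ((1 - norm z) powr (p - 2) * norm (deriv f z) powr p)"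
        by (subst ennreal_mult[symmetric]) (auto intro: ennreal_leI simp: x_def)
    qed
    also have "\<dots> = ennreal (B powr (2 - p)) * Besov_integral p f"
      unfolding Besov_integral_def by (rule nn_integral_cmult) measurable
    also have "\<dots> \<le> ennreal (B powr (2 - p)) * ennreal K" by (intro mult_left_mono fK) auto
    also have "\<dots> \<le> ennreal (B powr (2 - p) * K + 1)"
      using K by (subst ennreal_mult[symmetric]) (auto intro: ennreal_leI)
    finally show "Q_integral s (deriv f) a \<le> ennreal (B powr (2 - p) * K + 1)" .
  qed
next
  case False
  then have p2: "p > 2" by simp
  \<comment> \<open>p / (p - 2) is conjugate to p / 2, and \<sigma> > 1 is the condition s > 1 - 2 /
    p.\<close>
  define \<sigma> where "\<sigma> = s * (p / (p - 2))"
  have \<sigma>: "\<sigma> > 1" using s(2)[OF p2] p2 by (simp add: \<sigma>_def field_simps)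
  obtain C where C: "C > 0"
    "\<And>a. norm a < 1 \<Longrightarrow> (\<integral>\<^sup>+z. ennreal (moebius_weight \<sigma> a z / (1 - norm z)\<^sup>2) \<partial>\<lambda>\<D>) \<le> ennreal C"
    using hyperbolic_moebius_weight[OF \<sigma>] by blast
  have pos: "K + C > 0" using K C by simp
  show ?thesis
  proof (rule that[OF pos])
    fix f and a :: complex assume f: "f holomorphic_on \<D>" and fK: "Besov_integral p f \<le> ennreal K" and a: "norm a < 1"
    note [measurable] = measurable_disc_deriv[OF f] moebius_weight_measurable[OF a]
    have "Q_integral s (deriv f) a \<le> (\<integral>\<^sup>+z. ennreal ((1 - norm z) powr (p - 2) * norm (deriv f z) powr p) + ennreal (moebius_weight \<sigma> a z / (1 - norm z)\<^sup>2) \<partial>\<lambda>\<D>)"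
      unfolding Q_integral_def
    proof (rule nn_integral_mono)
      fix z assume "z \<in> space \<lambda>\<D>"
      then have z: "norm z < 1" by simp
      define d where "d = 1 - norm z"
      have d: "d > 0" using z by (simp add: d_def)
      define x where "x = norm (deriv f z)"
      have x: "x \<ge> 0" by (simp add: x_def)
      define m where "m = 1 - (norm (moebius_disc a z))\<^sup>2"
      define q where "q = p / (p - 2)"
      have q: "q > 1" using p2 by (simp add: q_def)
      \<comment> \<open>The exponent 2 - 4 / p makes the (p / 2)-th power of \<open>A\<close> the
        Besov density; its negative in \<open>B\<close>, raised to the power \<open>q\<close>, is
        then the hyperbolic density.\<close>
      define A where "A = x\<^sup>2 * d powr (2 - 4 / p)"
      define B where "B = d powr (- (2 - 4 / p)) * m powr s"
      have e: "(2 - 4 / p) * q = 2" "(2 - 4 / p) * (p / 2) = p - 2" using p2 by (simp_all add: q_def field_simps)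
      have "d powr (2 - 4 / p) * d powr (- (2 - 4 / p)) = 1"
        using d by (simp only: powr_add[symmetric]) simp
      then have "x\<^sup>2 * m powr s = x\<^sup>2 * (d powr (2 - 4 / p) * d powr (- (2 - 4 / p))) * m powr s" by simp
      also have "\<dots> = A * B" by (simp only: A_def B_def mult_ac)
      finally have "x\<^sup>2 * m powr s = A * B" .
      also have "A * B \<le> A powr (p / 2) / (p / 2) + B powr q / q"
        using p2 q d x by (intro Youngs_inequality) (auto simp: A_def B_def q_def field_simps)
      also have "\<dots> \<le> A powr (p / 2) + B powr q"
        using p2 q by (intro add_mono divide_le_self) auto
      also have "A powr (p / 2) = d powr (p - 2) * x powr p"
      proof (cases "x = 0")
        case False
        then have "(x\<^sup>2) powr (p / 2) = x powr p" using x by (simp add: powr_powr powr_numeral[symmetric] del: powr_numeral)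
        then show ?thesis by (simp only: A_def powr_mult powr_powr e(2)) (simp only: mult.commute)
      qed (use p2 in \<open>simp add: A_def\<close>)
      also have "B powr q = moebius_weight \<sigma> a z / d\<^sup>2"
      proof -
        have "- (2 - 4 / p) * q = - 2" using e(1) by (simp only: mult_minus_left)
        then have "B powr q = d powr (- 2) * m powr \<sigma>"
          by (simp only: B_def powr_mult powr_powr \<sigma>_def q_def[symmetric])
        also have "d powr (- 2) = 1 / d\<^sup>2" using d by (simp add: powr_minus_divide powr_numeral)
        finally show ?thesis by (simp add: moebius_weight_def m_def)
      qed
      finally have "ennreal (x\<^sup>2 * m powr s) \<le> ennreal (d powr (p - 2) * x powr p + moebius_weight \<sigma> a z / d\<^sup>2)"
        by (rule ennreal_leI)
      also have "\<dots> = ennreal (d powr (p - 2) * x powr p) + ennreal (moebius_weight \<sigma> a z / d\<^sup>2)"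
        by (rule ennreal_plus) (auto simp: moebius_weight_def)
      finally show "ennreal ((norm (deriv f z))\<^sup>2 * moebius_weight s a z) \<le> ennreal ((1 - norm z) powr (p - 2) * norm (deriv f z) powr p) + ennreal (moebius_weight \<sigma> a z / (1 - norm z)\<^sup>2)"
        by (simp add: x_def d_def m_def moebius_weight_def)
    qed
    also have "\<dots> = Besov_integral p f + (\<integral>\<^sup>+z. ennreal (moebius_weight \<sigma> a z / (1 - norm z)\<^sup>2) \<partial>\<lambda>\<D>)"
      unfolding Besov_integral_def by (rule nn_integral_add) measurable
    also have "\<dots> \<le> ennreal K + ennreal C" by (intro add_mono fK C a)
    also have "\<dots> = ennreal (K + C)" using K C(1) by simp
    finally show "Q_integral s (deriv f) a \<le> ennreal (K + C)" .
  qed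
qed

section \<open>The Green function against the Moebius weight\<close>

lemma norm_one_minus_le_of_moebius:
  assumes a: "norm a < 1" and z: "norm z < 1" and x: "norm (moebius_disc a z) < 1/2"
  shows "norm (a - z) < norm (1 - cnj a * z) / 2"
    "norm (1 - cnj a * z) \<le> 4 * (1 - norm a)" "norm (1 - cnj a * z) \<le> 4 * (1 - norm z)"
proof -
  have pos: "norm (1 - cnj a * z) > 0" using one_minus_cnj_mult_nz[OF a z] by simp
  show 1: "norm (a - z) < norm (1 - cnj a * z) / 2"
    using x pos by (simp add: moebius_disc_def norm_divide field_simps)
  \<comment> \<open>The pair is left general because it is used for \<open>a\<close>,
    \<open>z\<close> and with the roles exchanged.\<close>
  have key: "norm (1 - cnj b * c) \<le> 4 * (1 - norm b)"
    if b: "norm b < 1" and d: "norm (b - c) \<le> norm (1 - cnj b * c) / 2" for b c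
  proof -
    have "norm (1 - cnj b * c) \<le> norm (1 - cnj b * b) + norm (cnj b * (b - c))"
      using norm_triangle_ineq[of "1 - cnj b * b" "cnj b * (b - c)"] by (simp add: algebra_simps)
    also have "1 - cnj b * b = of_real (1 - (norm b)\<^sup>2)"
      using complex_norm_square[of b] by (simp add: mult.commute)
    also have "norm (of_real (1 - (norm b)\<^sup>2) :: complex) = 1 - (norm b)\<^sup>2"
      using b unfolding norm_of_real by (simp add: abs_square_le_1)
    also have "1 - (norm b)\<^sup>2 \<le> 2 * (1 - norm b)" by (rule one_minus_norm_square_le[OF b])
    also have "norm (cnj b * (b - c)) \<le> 1 * norm (b - c)"
      unfolding norm_mult using b by (intro mult_right_mono) auto
    finally have "norm (1 - cnj b * c) \<le> 2 * (1 - norm b) + norm (b - c)" by simp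
    then show ?thesis using d by simp
  qed
  show "norm (1 - cnj a * z) \<le> 4 * (1 - norm a)" using key[OF a] 1 by simp
  have "norm (1 - cnj z * a) \<le> 4 * (1 - norm z)"
    using 1 by (intro key z) (simp add: norm_minus_commute norm_one_minus_cnj_mult_swap[of z a])
  then show "norm (1 - cnj a * z) \<le> 4 * (1 - norm z)"
    by (simp add: norm_one_minus_cnj_mult_swap[of a z])
qed

lemma green_disc_eq: "green_disc z a = ln (1 / norm (moebius_disc a z))"
  by (simp add: green_disc_def moebius_disc_def norm_divide)

text \<open>From ln (x^2) \<le> x^2 - 1. The point \<open>z = a\<close> must stay out: there
  \<open>green_disc\<close> is 0 by convention, while the weight is 1.\<close>

lemma moebius_weight_le_green:
  assumes a: "norm a < 1" and z: "norm z < 1" "z \<noteq> a" and s: "0 < s"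
  shows "moebius_weight s a z \<le> 2 powr s * green_disc z a powr s"
proof -
  define x where "x = norm (moebius_disc a z)"
  have x: "0 < x" "x < 1"
    using norm_moebius_less_1[OF a z(1)] z one_minus_cnj_mult_nz[OF a z(1)]
    by (auto simp: x_def moebius_disc_def)
  have "ln (x\<^sup>2) \<le> x\<^sup>2 - 1" using x by (intro ln_le_minus_one) auto
  then have "1 - x\<^sup>2 \<le> 2 * ln (1 / x)" using x by (simp add: ln_realpow ln_div)
  then have "(1 - x\<^sup>2) powr s \<le> (2 * ln (1 / x)) powr s"
    using x s by (intro powr_mono2) (auto simp: abs_square_le_1)
  then show ?thesis by (simp add: moebius_weight_def green_disc_eq x_def powr_mult)
qed

text \<open>Away from \<open>a\<close> the Green function is comparable to \<open>1 - |\<phi>\<^sub>a|\<^sup>2\<close>; near \<open>a\<close> its singularity is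
  integrable and \<open>f'\<close> is controlled by the Bloch bound.\<close>

lemma green_integrand_le:
  assumes a: "norm a < 1" and z: "norm z < 1" and s: "0 < s" "s \<le> 1"
    and B: "0 \<le> B" "y \<le> B / (1 - norm z)" "0 \<le> y"
  shows "y\<^sup>2 * green_disc z a powr s
    \<le> 2 powr s * (y\<^sup>2 * moebius_weight s a z)
      + 16 * B\<^sup>2 / (1 - norm a) * (1 / norm (z - a) * indicator (ball a (4 * (1 - norm a))) z)"
proof -
  define x where "x = norm (moebius_disc a z)"
  define N where "N = norm (1 - cnj a * z)"
  have N: "N > 0" using one_minus_cnj_mult_nz[OF a z] by (simp add: N_def)
  have R0: "0 \<le> 16 * B\<^sup>2 / (1 - norm a) * (1 / norm (z - a) * indicator (ball a (4 * (1 - norm a))) z)"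
    using a by (intro mult_nonneg_nonneg divide_nonneg_nonneg) auto
  have L0: "0 \<le> 2 powr s * (y\<^sup>2 * moebius_weight s a z)"
    using moebius_weight_bounds[OF a z s(1)] by simp
  consider "z = a" | "z \<noteq> a" "x \<ge> 1/2" | "z \<noteq> a" "x < 1/2" by linarith
  then show ?thesis
  proof cases
    case 1
    then have "green_disc z a powr s = 0" using s by (simp add: green_disc_def)
    then show ?thesis using R0 L0 by simp
  next
    case 2
    have x1: "x < 1" using norm_moebius_less_1[OF a z] by (simp add: x_def)
    have "ln (1 / x) \<le> 1 / x - 1" using 2 by (intro ln_le_minus_one) auto
    also have "\<dots> = (1 - x) / x" using 2 by (simp add: field_simps)
    also have "\<dots> \<le> (1 - x) / (1/2)" using 2 x1 by (intro divide_left_mono) auto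
    also have "\<dots> \<le> 2 * (1 - x\<^sup>2)" using 2 x1 by (simp add: power2_eq_square mult_left_le)
    finally have "ln (1 / x) powr s \<le> (2 * (1 - x\<^sup>2)) powr s"
      using s 2 x1 by (intro powr_mono2) auto
    then have "green_disc z a powr s \<le> 2 powr s * moebius_weight s a z"
      by (simp only: green_disc_eq moebius_weight_def x_def powr_mult)
    then have "y\<^sup>2 * green_disc z a powr s \<le> y\<^sup>2 * (2 powr s * moebius_weight s a z)"
      by (rule mult_left_mono) simp
    then show ?thesis using R0 by (simp add: mult_ac)
  next
    case 3
    note near = norm_one_minus_le_of_moebius[OF a z 3(2)[unfolded x_def], folded N_def]
    have x0: "x > 0" using 3 one_minus_cnj_mult_nz[OF a z] by (auto simp: x_def moebius_disc_def)
    have x2: "1 / x \<ge> 1" using x0 3 by (simp add: field_simps)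
    have lnx: "0 \<le> ln (1 / x)" using x2 by simp
    \<comment> \<open>Here \<open>s \<le> 1\<close> enters: the singularity is reduced to the
      integrable 1 / |z - a|.\<close>
    have "ln (1 / x) powr s \<le> 1 / x"
    proof (cases "ln (1 / x) \<le> 1")
      case True
      then have "ln (1 / x) powr s \<le> 1" using lnx s by (intro powr_le1) auto
      then show ?thesis using x2 by simp
    next
      case False
      then have "ln (1 / x) powr s \<le> ln (1 / x) powr 1" using s by (intro powr_mono) auto
      also have "\<dots> \<le> 1 / x" using lnx x0 ln_le_minus_one[of "1 / x"] by simp
      finally show ?thesis .
    qed
    also have "1 / x = N / norm (z - a)"
      by (simp add: x_def N_def moebius_disc_def norm_divide norm_minus_commute)
    finally have g: "green_disc z a powr s \<le> N / norm (z - a)" by (simp add: green_disc_eq x_def)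
    have "y \<le> 4 * B / N"
    proof -
      have "B / (1 - norm z) \<le> B / (N / 4)" using near(3) N B z by (intro divide_left_mono) auto
      then show ?thesis using B by (simp add: mult.commute)
    qed
    then have "y\<^sup>2 \<le> (4 * B / N)\<^sup>2" using B by (intro power_mono) auto
    then have "y\<^sup>2 * green_disc z a powr s \<le> (4 * B / N)\<^sup>2 * (N / norm (z - a))"
      using g by (intro mult_mono) auto
    also have "\<dots> = 16 * B\<^sup>2 / N * (1 / norm (z - a))"
      using N by (simp add: power2_eq_square field_simps)
    also have "\<dots> \<le> 16 * B\<^sup>2 / (1 - norm a) * (1 / norm (z - a))"
      using N a one_minus_norm_le[of z a] z by (intro mult_right_mono divide_left_mono) (auto simp: N_def)
    also have "1 / norm (z - a) = 1 / norm (z - a) * indicator (ball a (4 * (1 - norm a))) z"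
      using near(1,2) a by (simp add: indicator_def dist_norm)
    finally show ?thesis using L0 by simp
  qed
qed

lemma inverse_norm_ball_measurable:
  "(\<lambda>z. ennreal (1 / norm (z - a)) * indicator (ball a R) z) \<in> borel_measurable lborel" for a :: complex
proof -
  have [measurable]: "ball a R \<in> sets borel" by simp
  have "(\<lambda>z. ennreal (1 / norm (z - a)) * indicator (ball a R) z) \<in> borel_measurable borel" by measurable
  then show ?thesis using measurable_cong_sets[OF sets_lborel refl] by blast
qed

text \<open>From the Moebius weight to the Green function, the additional term is 16 B^2 / (1 - |a|)
  times the integral of 1 / |z - a| over a ball of radius 4 (1 - |a|). That integral is of order 1 -
  |a|, so the scales cancel and the bound is uniform in \<open>a\<close>.\<close>

lemma Q_space_iff:
  assumes s: "0 < s" "s \<le> 1"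
  shows "f \<in> Q_space s \<longleftrightarrow> f holomorphic_on \<D> \<and> (\<exists>C. \<forall>a\<in>\<D>. Q_integral s (deriv f) a \<le> ennreal C)"
proof (cases "f holomorphic_on \<D>")
  case True
  note f = True
  note [measurable] = measurable_disc_deriv[OF f]
  define G where "G a = (\<integral>\<^sup>+z. ennreal ((norm (deriv f z))\<^sup>2 * green_disc z a powr s) \<partial>\<lambda>\<D>)" for a
  have green_meas [measurable]: "(\<lambda>z. green_disc z a) \<in> borel_measurable \<lambda>\<D>" for a
    unfolding green_disc_def by measurable
  have "(SUP a\<in>\<D>. \<integral>\<^sup>+z\<in>\<D>. ennreal ((norm (deriv f z))\<^sup>2 * green_disc z a powr s) \<partial>disc_area) = (SUP a\<in>\<D>. G a / ennreal pi)"
    unfolding G_def by (intro SUP_cong refl nn_integral_disc_area) measurable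
  then have "f \<in> Q_space s \<longleftrightarrow> (\<exists>C. \<forall>a\<in>\<D>. G a \<le> ennreal C)"
    using f SUP_divide_pi_finite_iff[of G] by (simp add: Q_space_def)
  also have "\<dots> \<longleftrightarrow> (\<exists>C. \<forall>a\<in>\<D>. Q_integral s (deriv f) a \<le> ennreal C)"
  proof
    assume "\<exists>C. \<forall>a\<in>\<D>. G a \<le> ennreal C"
    then obtain C where C: "\<And>a. a \<in> \<D> \<Longrightarrow> G a \<le> ennreal C" by blast
    have "Q_integral s (deriv f) a \<le> ennreal (2 powr s * C)" if a: "a \<in> \<D>" for a
    proof -
      have "Q_integral s (deriv f) a \<le> (\<integral>\<^sup>+z. ennreal (2 powr s) * ennreal ((norm (deriv f z))\<^sup>2 * green_disc z a powr s) \<partial>\<lambda>\<D>)"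
        unfolding Q_integral_def nn_integral_disc_lborel
      proof (rule nn_integral_mono_AE)
        show "AE z in lborel. ennreal ((norm (deriv f z))\<^sup>2 * moebius_weight s a z) * indicator \<D> z
          \<le> ennreal (2 powr s) * ennreal ((norm (deriv f z))\<^sup>2 * green_disc z a powr s) * indicator \<D> z"
          using AE_lborel_singleton[of a]
        proof eventually_elim
          case (elim z)
          show ?case
          proof (cases "z \<in> \<D>")
            case True
            have "moebius_weight s a z \<le> 2 powr s * green_disc z a powr s"
              using a True elim s by (intro moebius_weight_le_green) auto
            then have "(norm (deriv f z))\<^sup>2 * moebius_weight s a z \<le> (norm (deriv f z))\<^sup>2 * (2 powr s * green_disc z a powr s)"
              by (rule mult_left_mono) simp
            then show ?thesis using True
              by (simp add: ennreal_mult'[symmetric] ennreal_leI mult_ac)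
          qed simp
        qed
      qed
      also have "\<dots> = ennreal (2 powr s) * G a" unfolding G_def by (rule nn_integral_cmult) measurable
      also have "\<dots> \<le> ennreal (2 powr s) * ennreal C" by (intro mult_left_mono C a) auto
      finally show ?thesis by (simp add: ennreal_mult')
    qed
    then show "\<exists>C. \<forall>a\<in>\<D>. Q_integral s (deriv f) a \<le> ennreal C" by blast
  next
    assume "\<exists>C. \<forall>a\<in>\<D>. Q_integral s (deriv f) a \<le> ennreal C"
    then obtain C' where C': "\<And>a. a \<in> \<D> \<Longrightarrow> Q_integral s (deriv f) a \<le> ennreal C'" by blast
    define C where "C = max C' 0"
    have C: "C \<ge> 0" "\<And>a. norm a < 1 \<Longrightarrow> Q_integral s (deriv f) a \<le> ennreal C"
      using order_trans[OF C' ennreal_leI[of C' "max C' 0"]] by (auto simp: C_def)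
    obtain B where B: "B > 0" "\<And>f z. f holomorphic_on \<D> \<Longrightarrow> norm z < 1 \<Longrightarrow> Q_integral s (deriv f) z \<le> ennreal C \<Longrightarrow>
      norm (deriv f z) \<le> B / (1 - norm z)"
      using Q_Bloch[OF s(1) C(1)] by blast
    have fB: "norm (deriv f z) \<le> B / (1 - norm z)" if "norm z < 1" for z
      using B(2)[OF f that] C(2) that by simp
    have "G a \<le> ennreal (2 powr s * C + 2048 * B\<^sup>2)" if "a \<in> \<D>" for a
    proof -
      have a: "norm a < 1" using that by simp
      note [measurable] = moebius_weight_measurable[OF a]
      define k where "k z = ennreal (1 / norm (z - a)) * indicator (ball a (4 * (1 - norm a))) z" for z
      have [measurable]: "k \<in> borel_measurable \<lambda>\<D>"
        unfolding k_def by (intro measurable_restrict_space1) (rule inverse_norm_ball_measurable)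
      have "G a \<le> (\<integral>\<^sup>+z. ennreal (2 powr s) * ennreal ((norm (deriv f z))\<^sup>2 * moebius_weight s a z)
         + ennreal (16 * B\<^sup>2 / (1 - norm a)) * k z \<partial>\<lambda>\<D>)"
        unfolding G_def
      proof (rule nn_integral_mono)
        fix z assume "z \<in> space \<lambda>\<D>"
        then have z: "norm z < 1" by simp
        define y where "y = norm (deriv f z)"
        have "ennreal (y\<^sup>2 * green_disc z a powr s)
           \<le> ennreal (2 powr s * (y\<^sup>2 * moebius_weight s a z)
             + 16 * B\<^sup>2 / (1 - norm a) * (1 / norm (z - a) * indicator (ball a (4 * (1 - norm a))) z))"
          using fB[OF z] B(1) by (intro ennreal_leI green_integrand_le a z s) (auto simp: y_def)
        also have "\<dots> = ennreal (2 powr s) * ennreal (y\<^sup>2 * moebius_weight s a z)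
            + ennreal (16 * B\<^sup>2 / (1 - norm a)) * ennreal (1 / norm (z - a) * indicator (ball a (4 * (1 - norm a))) z)"
          using a moebius_weight_bounds[OF a z s(1)] by (intro ennreal_mult_add) auto
        also have "ennreal (1 / norm (z - a) * indicator (ball a (4 * (1 - norm a))) z) = k z"
          by (simp add: k_def indicator_def)
        finally show "ennreal ((norm (deriv f z))\<^sup>2 * green_disc z a powr s)
          \<le> ennreal (2 powr s) * ennreal ((norm (deriv f z))\<^sup>2 * moebius_weight s a z)
            + ennreal (16 * B\<^sup>2 / (1 - norm a)) * k z" by (simp only: y_def)
      qed
      also have "\<dots> = ennreal (2 powr s) * Q_integral s (deriv f) a + ennreal (16 * B\<^sup>2 / (1 - norm a)) * (\<integral>\<^sup>+z. k z \<partial>\<lambda>\<D>)"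
        unfolding Q_integral_def by (subst nn_integral_add) (auto simp: nn_integral_cmult)
      also have "\<dots> \<le> ennreal (2 powr s) * ennreal C + ennreal (16 * B\<^sup>2 / (1 - norm a)) * ennreal (32 * (4 * (1 - norm a)))"
      proof (intro add_mono mult_left_mono C(2) a)
        have "(\<integral>\<^sup>+z. k z \<partial>\<lambda>\<D>) \<le> (\<integral>\<^sup>+z. k z \<partial>lborel)"
          unfolding nn_integral_disc_lborel by (intro nn_integral_mono) (auto simp: indicator_def)
        also have "\<dots> \<le> ennreal (32 * (4 * (1 - norm a)))"
          unfolding k_def using a by (intro nn_integral_inverse_norm_ball_le) auto
        finally show "(\<integral>\<^sup>+z. k z \<partial>\<lambda>\<D>) \<le> ennreal (32 * (4 * (1 - norm a)))" .
      qed auto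
      also have "\<dots> = ennreal (2 powr s * C + 16 * B\<^sup>2 / (1 - norm a) * (32 * (4 * (1 - norm a))))"
        using a C(1) by (intro ennreal_mult_add[symmetric]) auto
      also have "16 * B\<^sup>2 / (1 - norm a) * (32 * (4 * (1 - norm a))) = 2048 * B\<^sup>2"
      proof -
        have gen: "16 * B\<^sup>2 / d * (32 * (4 * d)) = 2048 * B\<^sup>2" if "d \<noteq> 0" for d :: real using that by simp
        show ?thesis by (rule gen) (use a in simp)
      qed
      finally show ?thesis .
    qed
    then show "\<exists>C. \<forall>a\<in>\<D>. G a \<le> ennreal C" by blast
  qed
  finally show ?thesis using f by simp
qed (simp add: Q_space_def)

section \<open>A Carleson embedding\<close>

text \<open>Monotone convergence. Truncation to a smaller disc makes holomorphic functions bounded,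
  which gives finiteness in the Carleson embedding and control of the tail in the gliding
  hump.\<close>

lemma nn_integral_disc_exhaust:
  assumes [measurable]: "F \<in> borel_measurable \<lambda>\<D>"
    and le: "\<And>r. 0 < r \<Longrightarrow> r < 1 \<Longrightarrow> (\<integral>\<^sup>+z. F z * indicator (ball 0 r) z \<partial>\<lambda>\<D>) \<le> K"
  shows "(\<integral>\<^sup>+z. F z \<partial>\<lambda>\<D>) \<le> K"
proof -
  define r where "r n = 1 - 1 / (real n + 2)" for n :: nat
  have r: "0 < r n" "r n < 1" for n by (auto simp: r_def field_simps)
  have rmono: "r m \<le> r n" if "m \<le> n" for m n using that by (auto simp: r_def field_simps)
  have [measurable]: "(indicator (ball 0 t) :: complex \<Rightarrow> ennreal) \<in> borel_measurable \<lambda>\<D>" for t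
    by (intro measurable_restrict_space1 borel_measurable_indicator) simp
  have "(\<integral>\<^sup>+z. F z \<partial>\<lambda>\<D>) = (\<integral>\<^sup>+z. (SUP n. F z * indicator (ball 0 (r n)) z) \<partial>\<lambda>\<D>)"
  proof (rule nn_integral_cong)
    fix z assume "z \<in> space \<lambda>\<D>"
    then have z: "norm z < 1" by simp
    obtain n where "inverse (real (Suc n)) < 1 - norm z" using reals_Archimedean[of "1 - norm z"] z by auto
    moreover have "1 / (real n + 2) \<le> inverse (real (Suc n))" by (simp add: field_simps)
    ultimately have "norm z < r n" by (simp add: r_def)
    then have "F z * indicator (ball 0 (r n)) z = F z" by simp
    then have "F z \<le> (SUP n. F z * indicator (ball 0 (r n)) z)" by (metis SUP_upper UNIV_I)
    moreover have "(SUP n. F z * indicator (ball 0 (r n)) z) \<le> F z"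
      by (intro SUP_least) (simp add: indicator_def)
    ultimately show "F z = (SUP n. F z * indicator (ball 0 (r n)) z)" by (rule antisym)
  qed
  also have "\<dots> = (SUP n. \<integral>\<^sup>+z. F z * indicator (ball 0 (r n)) z \<partial>\<lambda>\<D>)"
  proof (rule nn_integral_monotone_convergence_SUP)
    show "incseq (\<lambda>n z. F z * indicator (ball 0 (r n)) z)"
    proof (rule incseq_SucI, rule le_funI)
      fix n z
      have "ball (0::complex) (r n) \<subseteq> ball 0 (r (Suc n))" by (intro subset_ball rmono) simp
      then show "F z * indicator (ball 0 (r n)) z \<le> F z * indicator (ball 0 (r (Suc n))) z"
        by (intro mult_left_mono) (auto simp: indicator_def)
    qed
  qed measurable
  also have "\<dots> \<le> K" using le r by (intro SUP_least) auto
  finally show ?thesis .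
qed

text \<open>Finiteness of \<open>A\<close> cannot be dropped: at \<open>top\<close> the inequality
  to be solved is satisfied trivially. This is why the Carleson embedding is proved on smaller
  discs.\<close>

lemma ennreal_absorb:
  assumes "A \<le> ennreal X + ennreal (1/2) * A" "A < top" "X \<ge> 0"
  shows "A \<le> ennreal (2 * X)"
proof -
  obtain a where a: "a \<ge> 0" "A = ennreal a" using assms(2) by (cases A) auto
  have "ennreal (X + 1/2 * a) = ennreal X + ennreal (1/2 * a)"
    using a assms(3) by (intro ennreal_plus) auto
  also have "ennreal (1/2 * a) = ennreal (1/2) * ennreal a" using a by (intro ennreal_mult) auto
  finally have "ennreal a \<le> ennreal (X + 1/2 * a)" using assms(1) unfolding a(2) by (simp only:)
  then have "a \<le> X + 1/2 * a" using a assms(3) by (subst (asm) ennreal_le_iff) auto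
  then show ?thesis using a by (auto intro: ennreal_leI)
qed

text \<open>Density of the measure which is an s-Carleson measure exactly when \<open>g\<close>
  belongs to the space Q of index \<open>s\<close>.\<close>

definition Carleson_density :: "real \<Rightarrow> (complex \<Rightarrow> complex) \<Rightarrow> complex \<Rightarrow> real"
  where "Carleson_density s g z = (norm (deriv g z))\<^sup>2 * (1 - (norm z)\<^sup>2) powr s"

lemma Carleson_density_nonneg: "0 \<le> Carleson_density s g z"
  by (simp add: Carleson_density_def)

lemma Carleson_density_measurable:
  "g holomorphic_on \<D> \<Longrightarrow> Carleson_density s g \<in> borel_measurable \<lambda>\<D>"
  using measurable_disc_deriv[of g, measurable] unfolding Carleson_density_def[abs_def] by measurable

text \<open>For fixed \<open>w\<close> the points \<open>z\<close> with
  \<open>w \<in> disc_cone z\<close> satisfy |1 - cnj w z| \<le> 5 (1 - |w|). By the identity for 1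
  - |\<phi>|^2, \<phi> the involution of \<open>w\<close>, the quantity 1 - |z|^2 is then at most 25
  (1 - |w|) times it.\<close>

lemma Carleson_density_le:
  assumes w: "norm w < 1" and z: "norm z < 1" "w \<in> disc_cone z" and s: "0 < s"
  shows "Carleson_density s g z
    \<le> (25 * (1 - norm w)) powr s * ((norm (deriv g z))\<^sup>2 * moebius_weight s w z)"
proof -
  define d where "d = 1 - norm w"
  have d: "d > 0" using w by (simp add: d_def)
  define N where "N = norm (1 - cnj w * z)"
  have N: "0 < N" "N \<le> 5 * d" using one_minus_cnj_mult_nz[OF w z(1)] z(2) by (auto simp: N_def d_def disc_cone_def)
  define b where "b = 1 - (norm z)\<^sup>2"
  have b: "b \<ge> 0" using z by (simp add: b_def abs_square_le_1)
  have "d \<le> 1 - (norm w)\<^sup>2" using w by (simp add: d_def power2_eq_square mult_left_le)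
  moreover have "N\<^sup>2 \<le> (5 * d)\<^sup>2" using N by (intro power_mono) auto
  ultimately have "d * b / (5 * d)\<^sup>2 \<le> (1 - (norm w)\<^sup>2) * b / N\<^sup>2"
    using b N d by (intro frac_le mult_right_mono) auto
  also have "\<dots> = 1 - (norm (moebius_disc w z))\<^sup>2" by (simp add: one_minus_norm_moebius[OF w z(1)] b_def N_def)
  finally have "25 * d * (d * b / (5 * d)\<^sup>2) \<le> 25 * d * (1 - (norm (moebius_disc w z))\<^sup>2)"
    using d by (intro mult_left_mono) auto
  moreover have "25 * d * (d * b / (5 * d)\<^sup>2) = b" using d by (simp add: power2_eq_square)
  ultimately have "b powr s \<le> (25 * d * (1 - (norm (moebius_disc w z))\<^sup>2)) powr s"
    using b s by (intro powr_mono2) auto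
  then have "b powr s \<le> (25 * d) powr s * moebius_weight s w z"
    by (simp only: powr_mult moebius_weight_def)
  then have "(norm (deriv g z))\<^sup>2 * b powr s \<le> (norm (deriv g z))\<^sup>2 * ((25 * d) powr s * moebius_weight s w z)"
    by (rule mult_left_mono) simp
  then show ?thesis by (simp only: Carleson_density_def b_def d_def mult_ac)
qed

text \<open>The Carleson box condition with logarithmic gain: on the box belonging to
  \<open>w\<close> the density is compared with the integrand of the Q integral at that same
  \<open>w\<close>, where the hypothesis supplies
  \<open>disc_log w powr (- \<beta>)\<close>.\<close>

lemma Carleson_box:
  assumes g: "g holomorphic_on \<D>" and s: "0 < s" and Cg: "0 \<le> Cg"
    and gQ: "\<And>a. norm a < 1 \<Longrightarrow> ennreal (disc_log a powr \<beta>) * Q_integral s (deriv g) a \<le> ennreal Cg"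
    and w: "norm w < 1"
  shows "(\<integral>\<^sup>+z. ennreal (Carleson_density s g z) * indicator {z. w \<in> disc_cone z} z \<partial>\<lambda>\<D>)
    \<le> ennreal (25 powr s * Cg * ((1 - norm w) powr s * disc_log w powr (- \<beta>)))"
proof -
  note [measurable] = measurable_disc_deriv[OF g] moebius_weight_measurable[OF w]
  have L: "disc_log w > 0" by (rule disc_log_pos[OF w])
  have "(\<integral>\<^sup>+z. ennreal (Carleson_density s g z) * indicator {z. w \<in> disc_cone z} z \<partial>\<lambda>\<D>)
    \<le> (\<integral>\<^sup>+z. ennreal ((25 * (1 - norm w)) powr s) * ennreal ((norm (deriv g z))\<^sup>2 * moebius_weight s w z) \<partial>\<lambda>\<D>)"
  proof (rule nn_integral_mono)
    fix z assume "z \<in> space \<lambda>\<D>"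
    then have z: "norm z < 1" by simp
    show "ennreal (Carleson_density s g z) * indicator {z. w \<in> disc_cone z} z
      \<le> ennreal ((25 * (1 - norm w)) powr s) * ennreal ((norm (deriv g z))\<^sup>2 * moebius_weight s w z)"
    proof (cases "w \<in> disc_cone z")
      case True
      then show ?thesis using Carleson_density_le[OF w z True s, of g]
        by (simp add: ennreal_mult'[symmetric] ennreal_leI)
    qed simp
  qed
  also have "\<dots> = ennreal ((25 * (1 - norm w)) powr s) * Q_integral s (deriv g) w"
    unfolding Q_integral_def by (rule nn_integral_cmult) measurable
  also have "Q_integral s (deriv g) w \<le> ennreal (disc_log w powr (- \<beta>)) * ennreal Cg"
  proof -
    have "ennreal (disc_log w powr (- \<beta>)) * (ennreal (disc_log w powr \<beta>) * Q_integral s (deriv g) w)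
      \<le> ennreal (disc_log w powr (- \<beta>)) * ennreal Cg" by (intro mult_left_mono gQ w) simp
    moreover have "ennreal (disc_log w powr (- \<beta>)) * ennreal (disc_log w powr \<beta>) = 1"
      using L by (simp add: ennreal_mult[symmetric] powr_minus_divide)
    ultimately show ?thesis by (simp only: mult.assoc[symmetric] mult_1)
  qed
  also have "ennreal ((25 * (1 - norm w)) powr s) * (ennreal (disc_log w powr (- \<beta>)) * ennreal Cg)
      = ennreal (25 powr s * Cg * ((1 - norm w) powr s * disc_log w powr (- \<beta>)))"
  proof -
    have pm: "(25 * (1 - norm w)) powr s = 25 powr s * (1 - norm w) powr s" by (rule powr_mult)
    show ?thesis using Cg
      by (simp only: pm ennreal_mult[symmetric] mult_nonneg_nonneg powr_ge_zero) (simp only: mult_ac)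
  qed
  finally show ?thesis by (simp add: mult_left_mono)
qed

lemma disc_cone_pred_measurable [measurable]:
  "Measurable.pred (\<lambda>\<D> \<Otimes>\<^sub>M \<lambda>\<D>) (\<lambda>p. snd p \<in> disc_cone (fst p))"
proof -
  have [measurable]: "(cnj :: complex \<Rightarrow> complex) \<in> borel_measurable borel"
    by (intro borel_measurable_continuous_onI continuous_intros)
  show ?thesis unfolding disc_cone_def by measurable
qed

text \<open>Weighting the pointwise arithmetic-geometric mean inequality by \<open>disc_log w powr \<beta>\<close> makes both
  resulting double integrals finite: the first by the box condition, the second because \<open>\<beta> > 1\<close>.\<close>

lemma Carleson_embedding:
  assumes g: "g holomorphic_on \<D>" and s: "0 < s" and \<beta>: "1 < \<beta>" and Cg: "0 \<le> Cg"
    and gQ: "\<And>a. norm a < 1 \<Longrightarrow> ennreal (disc_log a powr \<beta>) * Q_integral s (deriv g) a \<le> ennreal Cg"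
  obtains C where "C > 0"
    "\<And>h N. h holomorphic_on \<D> \<Longrightarrow> 0 \<le> N \<Longrightarrow>
      (\<integral>\<^sup>+w. ennreal ((norm (deriv h w))\<^sup>2 * (1 - norm w) powr s) \<partial>\<lambda>\<D>) \<le> ennreal N \<Longrightarrow>
      (\<integral>\<^sup>+z. ennreal ((norm (h z - h 0))\<^sup>2 * Carleson_density s g z) \<partial>\<lambda>\<D>) \<le> ennreal (C * N)"
proof -
  obtain C2 where C2: "C2 > 0"
    "\<And>z. norm z < 1 \<Longrightarrow>
      (\<integral>\<^sup>+w. ennreal (disc_log w powr (- \<beta>) / (1 - norm w)\<^sup>2) * indicator (disc_cone z) w \<partial>\<lambda>\<D>) \<le> ennreal C2"
    using disc_cone_log_area[OF \<beta>] by blast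
  define C1 where "C1 = 25 powr s * Cg"
  have C1: "C1 \<ge> 0" using Cg by (simp add: C1_def)
  \<comment> \<open>Chosen so that the second double integral comes out as 2 / \<kappa> * C2 = 1/2
    times the quantity to be estimated, ready for absorption.\<close>
  define \<kappa> where "\<kappa> = 4 * C2"
  have \<kappa>: "\<kappa> > 0" using C2 by (simp add: \<kappa>_def)
  define m where "m = Carleson_density s g"
  have m0: "m z \<ge> 0" for z by (simp add: m_def Carleson_density_nonneg)
  have m_meas [measurable]: "m \<in> borel_measurable \<lambda>\<D>" unfolding m_def by (rule Carleson_density_measurable[OF g])
  have box: "(\<integral>\<^sup>+z. ennreal (m z) * indicator {z. w \<in> disc_cone z} z \<partial>\<lambda>\<D>)
    \<le> ennreal (C1 * ((1 - norm w) powr s * disc_log w powr (- \<beta>)))" if "norm w < 1" for w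
    unfolding m_def C1_def by (rule Carleson_box[OF g s Cg gQ that])
  \<comment> \<open>The hypothesis at \<open>a = 0\<close>, where \<open>disc_log\<close> is
    positive, bounds the total mass; this makes the truncated integral \<open>A\<close>
    finite.\<close>
  have m_fin: "(\<integral>\<^sup>+z. ennreal (m z) \<partial>\<lambda>\<D>) < top"
  proof -
    have "(\<integral>\<^sup>+z. ennreal (m z) \<partial>\<lambda>\<D>) = Q_integral s (deriv g) 0"
      unfolding Q_integral_def m_def
      by (intro nn_integral_cong) (simp add: Carleson_density_def moebius_weight_def moebius_disc_def)
    moreover have "Q_integral s (deriv g) 0 < top"
    proof (rule ccontr)
      assume "\<not> Q_integral s (deriv g) 0 < top"
      then have "Q_integral s (deriv g) 0 = top" unfolding less_top[symmetric] by simp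
      moreover have "disc_log 0 powr \<beta> > 0" by (simp add: disc_log_def)
      ultimately have "ennreal (disc_log 0 powr \<beta>) * Q_integral s (deriv g) 0 = top"
        by (simp add: ennreal_mult_top)
      then show False using gQ[of 0] by (simp add: top_unique)
    qed
    ultimately show ?thesis by simp
  qed
  \<comment> \<open>The added 1 keeps the constant positive also when \<open>Cg\<close> is
    0.\<close>
  have pos: "16 * C2 * C1 + 1 > 0" using C1 C2 by (intro add_nonneg_pos) auto
  show ?thesis
  proof (rule that[OF pos])
    fix h N assume h: "h holomorphic_on \<D>" and N: "0 \<le> N"
      and hN: "(\<integral>\<^sup>+w. ennreal ((norm (deriv h w))\<^sup>2 * (1 - norm w) powr s) \<partial>\<lambda>\<D>) \<le> ennreal N"
    note [measurable] = measurable_disc_deriv[OF h] measurable_disc_holomorphic[OF h]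
    define H where "H z = norm (h z - h 0)" for z
    have [measurable]: "H \<in> borel_measurable \<lambda>\<D>" unfolding H_def by measurable
    have [measurable]: "disc_log \<in> borel_measurable \<lambda>\<D>" unfolding disc_log_def[abs_def] by measurable
    have "(\<integral>\<^sup>+z. ennreal ((H z)\<^sup>2 * m z) \<partial>\<lambda>\<D>) \<le> ennreal (16 * C2 * C1 * N)"
    proof (rule nn_integral_disc_exhaust)
      show "(\<lambda>z. ennreal ((H z)\<^sup>2 * m z)) \<in> borel_measurable \<lambda>\<D>" by measurable
      fix r :: real assume r: "0 < r" "r < 1"
      have [measurable]: "(indicator (ball 0 r) :: complex \<Rightarrow> ennreal) \<in> borel_measurable \<lambda>\<D>"
        by (intro measurable_restrict_space1 borel_measurable_indicator) simp
      have [measurable]: "(\<lambda>p. indicator (disc_cone (fst p)) (snd p) :: ennreal) \<in> borel_measurable (\<lambda>\<D> \<Otimes>\<^sub>M \<lambda>\<D>)"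
      proof -
        have "(\<lambda>p. indicator {p. snd p \<in> disc_cone (fst p)} p :: ennreal) \<in> borel_measurable (\<lambda>\<D> \<Otimes>\<^sub>M \<lambda>\<D>)"
          by measurable
        then show ?thesis by (simp add: indicator_def)
      qed
      define A where "A = (\<integral>\<^sup>+z. ennreal ((H z)\<^sup>2 * m z) * indicator (ball 0 r) z \<partial>\<lambda>\<D>)"
      have A_fin: "A < top"
      proof -
        have "compact (H ` cball 0 r)"
        proof (intro compact_continuous_image)
          have "continuous_on (cball 0 r) h"
            using h r by (intro holomorphic_on_imp_continuous_on holomorphic_on_subset[OF h]) auto
          then show "continuous_on (cball 0 r) H" unfolding H_def by (intro continuous_intros)
        qed simp
        then have "bounded (H ` cball 0 r)" by (rule compact_imp_bounded)
        then obtain b where "\<forall>y\<in>H ` cball 0 r. norm y \<le> b" unfolding bounded_iff by blast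
        then have b: "\<bar>H z\<bar> \<le> b" if "norm z \<le> r" for z using that by auto
        have "A \<le> (\<integral>\<^sup>+z. ennreal (b\<^sup>2) * ennreal (m z) \<partial>\<lambda>\<D>)"
          unfolding A_def
        proof (rule nn_integral_mono)
          fix z
          show "ennreal ((H z)\<^sup>2 * m z) * indicator (ball 0 r) z \<le> ennreal (b\<^sup>2) * ennreal (m z)"
          proof (cases "norm z < r")
            case True
            then have "(H z)\<^sup>2 \<le> b\<^sup>2" using b[of z] by (intro power2_le_iff_abs_le[THEN iffD2]) auto
            then have "(H z)\<^sup>2 * m z \<le> b\<^sup>2 * m z" using m0 by (rule mult_right_mono)
            then show ?thesis using True m0[of z] by (simp add: ennreal_mult'[symmetric] ennreal_leI)
          qed simp
        qed
        also have "\<dots> = ennreal (b\<^sup>2) * (\<integral>\<^sup>+z. ennreal (m z) \<partial>\<lambda>\<D>)" by (rule nn_integral_cmult) measurable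
        also have "\<dots> < top" using m_fin by (simp add: ennreal_mult_less_top)
        finally show ?thesis .
      qed
      \<comment> \<open>\<open>U\<close> contains only h' and is integrated over \<open>z\<close>
        before \<open>w\<close>, where \<open>Carleson_box\<close> applies; \<open>V\<close>
        contains only H^2 and is integrated over \<open>w\<close> before \<open>z\<close>, where
        \<open>disc_cone_log_area\<close> applies.\<close>
      define U where "U z w = ennreal (2 * \<kappa>) * (ennreal ((norm (deriv h w))\<^sup>2 * disc_log w powr \<beta>) * (ennreal (m z) * indicator (disc_cone z) w))" for z w
      define V where "V z w = ennreal (2 / \<kappa>) * (ennreal ((H z)\<^sup>2 * m z) * indicator (ball 0 r) z * (ennreal (disc_log w powr (- \<beta>) / (1 - norm w)\<^sup>2) * indicator (disc_cone z) w))" for z w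
      have U [measurable]: "(\<lambda>p. U (fst p) (snd p)) \<in> borel_measurable (\<lambda>\<D> \<Otimes>\<^sub>M \<lambda>\<D>)" unfolding U_def by measurable
      have V [measurable]: "(\<lambda>p. V (fst p) (snd p)) \<in> borel_measurable (\<lambda>\<D> \<Otimes>\<^sub>M \<lambda>\<D>)" unfolding V_def by measurable
      have U1: "U z \<in> borel_measurable \<lambda>\<D>" and V1: "V z \<in> borel_measurable \<lambda>\<D>" if "norm z < 1" for z
        using measurable_compose[OF measurable_Pair1'[of z "\<lambda>\<D>" "\<lambda>\<D>"] U] measurable_compose[OF measurable_Pair1'[of z "\<lambda>\<D>" "\<lambda>\<D>"] V] that
        by auto
      have "A \<le> (\<integral>\<^sup>+z. (\<integral>\<^sup>+w. U z w + V z w \<partial>\<lambda>\<D>) \<partial>\<lambda>\<D>)"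
        unfolding A_def
      proof (rule nn_integral_mono)
        fix z assume "z \<in> space \<lambda>\<D>"
        then have z: "norm z < 1" by simp
        show "ennreal ((H z)\<^sup>2 * m z) * indicator (ball 0 r) z \<le> (\<integral>\<^sup>+w. U z w + V z w \<partial>\<lambda>\<D>)"
        proof (cases "norm z < r")
          case True
          have H0: "H z \<ge> 0" by (simp add: H_def)
          have "ennreal ((H z)\<^sup>2 * m z) = ennreal (H z * m z) * ennreal (H z)"
            using H0 m0[of z] by (subst ennreal_mult[symmetric]) (auto simp: power2_eq_square mult_ac)
          also have "\<dots> \<le> ennreal (H z * m z) * (ennreal 4 * (\<integral>\<^sup>+w. ennreal (norm (deriv h w) / (1 - norm w)) * indicator (disc_cone z) w \<partial>\<lambda>\<D>))"
            unfolding H_def by (intro mult_left_mono norm_diff_le_cone h z) simp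
          also have "\<dots> = (\<integral>\<^sup>+w. ennreal (H z * m z) * (ennreal 4 * (ennreal (norm (deriv h w) / (1 - norm w)) * indicator (disc_cone z) w)) \<partial>\<lambda>\<D>)"
            by (simp add: nn_integral_cmult)
          also have "\<dots> \<le> (\<integral>\<^sup>+w. U z w + V z w \<partial>\<lambda>\<D>)"
          proof (rule nn_integral_mono)
            fix w assume "w \<in> space \<lambda>\<D>"
            then have w: "norm w < 1" by simp
            show "ennreal (H z * m z) * (ennreal 4 * (ennreal (norm (deriv h w) / (1 - norm w)) * indicator (disc_cone z) w)) \<le> U z w + V z w"
            proof (cases "w \<in> disc_cone z")
              case cone: True
              define x where "x = norm (deriv h w)"
              define d where "d = 1 - norm w"
              have d: "d > 0" using w by (simp add: d_def)
              \<comment> \<open>Half of the logarithmic weight: in the mean inequality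
                \<open>l\<close> cancels on the product side, while its square goes to h' and its
                inverse square to \<open>H\<close>.\<close>
              define l where "l = disc_log w powr (\<beta> / 2)"
              have l: "l > 0" using disc_log_pos[OF w] by (simp add: l_def)
              have l2: "disc_log w powr \<beta> = l\<^sup>2" "disc_log w powr (- \<beta>) = 1 / l\<^sup>2"
                using disc_log_pos[OF w] by (simp_all add: l_def powr_minus_divide powr_add[symmetric] power2_eq_square)
              have "2 * (x * l) * (H z / (\<kappa> * d * l)) \<le> (x * l)\<^sup>2 + (H z / (\<kappa> * d * l))\<^sup>2"
                by (rule sum_squares_bound)
              then have "2 * \<kappa> * (2 * (x * l) * (H z / (\<kappa> * d * l))) \<le> 2 * \<kappa> * ((x * l)\<^sup>2 + (H z / (\<kappa> * d * l))\<^sup>2)"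
                using \<kappa> by (intro mult_left_mono) auto
              also have "2 * \<kappa> * (2 * (x * l) * (H z / (\<kappa> * d * l))) = 4 * (x / d) * H z"
                using \<kappa> l by simp
              also have "2 * \<kappa> * ((x * l)\<^sup>2 + (H z / (\<kappa> * d * l))\<^sup>2)
                = 2 * \<kappa> * (x\<^sup>2 * l\<^sup>2) + 2 / \<kappa> * ((H z)\<^sup>2 * (1 / l\<^sup>2 / d\<^sup>2))"
                using \<kappa> by (simp add: power_mult_distrib power_divide distrib_left power2_eq_square)
              finally have "m z * (4 * (x / d) * H z) \<le> m z * (2 * \<kappa> * (x\<^sup>2 * l\<^sup>2) + 2 / \<kappa> * ((H z)\<^sup>2 * (1 / l\<^sup>2 / d\<^sup>2)))"
                using m0[of z] by (rule mult_left_mono)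
              then have "ennreal (m z * (4 * (x / d) * H z)) \<le> ennreal (2 * \<kappa> * (x\<^sup>2 * l\<^sup>2 * m z) + 2 / \<kappa> * ((H z)\<^sup>2 * m z * (1 / l\<^sup>2 / d\<^sup>2)))"
                by (intro ennreal_leI) (simp add: distrib_left mult_ac)
              also have "\<dots> = ennreal (2 * \<kappa>) * ennreal (x\<^sup>2 * l\<^sup>2 * m z) + ennreal (2 / \<kappa>) * ennreal ((H z)\<^sup>2 * m z * (1 / l\<^sup>2 / d\<^sup>2))"
                using \<kappa> m0[of z] by (intro ennreal_mult_add) auto
              also have "ennreal (x\<^sup>2 * l\<^sup>2 * m z) = ennreal (x\<^sup>2 * l\<^sup>2) * ennreal (m z)"
                using m0[of z] by (intro ennreal_mult) auto
              also have "ennreal ((H z)\<^sup>2 * m z * (1 / l\<^sup>2 / d\<^sup>2)) = ennreal ((H z)\<^sup>2 * m z) * ennreal (1 / l\<^sup>2 / d\<^sup>2)"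
                using m0[of z] by (intro ennreal_mult) auto
              also have "ennreal (2 * \<kappa>) * (ennreal (x\<^sup>2 * l\<^sup>2) * ennreal (m z)) + ennreal (2 / \<kappa>) * (ennreal ((H z)\<^sup>2 * m z) * ennreal (1 / l\<^sup>2 / d\<^sup>2)) = U z w + V z w"
                using cone True by (simp add: U_def V_def x_def d_def l2)
              also have "ennreal (m z * (4 * (x / d) * H z)) = ennreal (H z * m z) * (ennreal 4 * (ennreal (norm (deriv h w) / (1 - norm w)) * indicator (disc_cone z) w))"
              proof -
                have "m z * (4 * (x / d) * H z) = H z * m z * (4 * (x / d))" by simp
                moreover have "0 \<le> H z * m z" "0 \<le> x / d" using H0 m0[of z] d by (auto simp: x_def)
                ultimately show ?thesis using cone by (simp only: x_def[symmetric] d_def[symmetric] ennreal_mult mult_nonneg_nonneg zero_le_numeral indicator_simps mult_1_right)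
              qed
              finally show ?thesis .
            qed simp
          qed
          finally show ?thesis using True by simp
        qed simp
      qed
      also have "\<dots> = (\<integral>\<^sup>+z. (\<integral>\<^sup>+w. U z w \<partial>\<lambda>\<D>) \<partial>\<lambda>\<D>) + (\<integral>\<^sup>+z. (\<integral>\<^sup>+w. V z w \<partial>\<lambda>\<D>) \<partial>\<lambda>\<D>)"
      proof -
        have "(\<integral>\<^sup>+z. (\<integral>\<^sup>+w. U z w + V z w \<partial>\<lambda>\<D>) \<partial>\<lambda>\<D>) = (\<integral>\<^sup>+z. (\<integral>\<^sup>+w. U z w \<partial>\<lambda>\<D>) + (\<integral>\<^sup>+w. V z w \<partial>\<lambda>\<D>) \<partial>\<lambda>\<D>)"
          using U1 V1 by (intro nn_integral_cong nn_integral_add) auto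
        also have "\<dots> = (\<integral>\<^sup>+z. (\<integral>\<^sup>+w. U z w \<partial>\<lambda>\<D>) \<partial>\<lambda>\<D>) + (\<integral>\<^sup>+z. (\<integral>\<^sup>+w. V z w \<partial>\<lambda>\<D>) \<partial>\<lambda>\<D>)"
          using U V by (intro nn_integral_add disc.borel_measurable_nn_integral) (auto simp: case_prod_beta')
        finally show ?thesis .
      qed
      also have "(\<integral>\<^sup>+z. (\<integral>\<^sup>+w. U z w \<partial>\<lambda>\<D>) \<partial>\<lambda>\<D>) \<le> ennreal (2 * \<kappa> * C1 * N)"
      proof -
        have "(\<integral>\<^sup>+z. (\<integral>\<^sup>+w. U z w \<partial>\<lambda>\<D>) \<partial>\<lambda>\<D>) = (\<integral>\<^sup>+w. (\<integral>\<^sup>+z. U z w \<partial>\<lambda>\<D>) \<partial>\<lambda>\<D>)"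
          using U by (intro disc_pair.Fubini'[symmetric]) (simp add: case_prod_beta')
        also have "\<dots> \<le> (\<integral>\<^sup>+w. ennreal (2 * \<kappa> * C1) * ennreal ((norm (deriv h w))\<^sup>2 * (1 - norm w) powr s) \<partial>\<lambda>\<D>)"
        proof (rule nn_integral_mono)
          fix w assume "w \<in> space \<lambda>\<D>"
          then have w: "norm w < 1" by simp
          let ?c = "ennreal ((norm (deriv h w))\<^sup>2 * disc_log w powr \<beta>)"
          have mw: "(\<lambda>z. ennreal (m z) * indicator {z. w \<in> disc_cone z} z) \<in> borel_measurable \<lambda>\<D>"
          proof -
            have "(indicator {z. w \<in> disc_cone z} :: complex \<Rightarrow> ennreal) \<in> borel_measurable \<lambda>\<D>"
              by (intro measurable_restrict_space1 borel_measurable_indicator) (simp add: disc_cone_def)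
            then show ?thesis by measurable
          qed
          have "(\<integral>\<^sup>+z. U z w \<partial>\<lambda>\<D>) = (\<integral>\<^sup>+z. (ennreal (2 * \<kappa>) * ?c) * (ennreal (m z) * indicator {z. w \<in> disc_cone z} z) \<partial>\<lambda>\<D>)"
            by (intro nn_integral_cong) (simp add: U_def indicator_def mult.assoc)
          also have "\<dots> = (ennreal (2 * \<kappa>) * ?c) * (\<integral>\<^sup>+z. ennreal (m z) * indicator {z. w \<in> disc_cone z} z \<partial>\<lambda>\<D>)"
            by (rule nn_integral_cmult[OF mw])
          also have "\<dots> \<le> (ennreal (2 * \<kappa>) * ?c) * ennreal (C1 * ((1 - norm w) powr s * disc_log w powr (- \<beta>)))"
            by (intro mult_left_mono box w) simp
          also have "\<dots> = ennreal (2 * \<kappa> * C1) * ennreal ((norm (deriv h w))\<^sup>2 * (1 - norm w) powr s)"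
          proof -
            have "2 * \<kappa> * ((norm (deriv h w))\<^sup>2 * disc_log w powr \<beta>) * (C1 * ((1 - norm w) powr s * disc_log w powr (- \<beta>)))
              = 2 * \<kappa> * C1 * ((norm (deriv h w))\<^sup>2 * (1 - norm w) powr s)"
              using disc_log_pos[OF w] by (simp add: powr_minus_divide)
            then show ?thesis using \<kappa> C1 by (simp only: ennreal_mult[symmetric] mult_nonneg_nonneg powr_ge_zero zero_le_power2 zero_le_numeral less_imp_le)
          qed
          finally show "(\<integral>\<^sup>+z. U z w \<partial>\<lambda>\<D>) \<le> ennreal (2 * \<kappa> * C1) * ennreal ((norm (deriv h w))\<^sup>2 * (1 - norm w) powr s)" .
        qed
        also have "\<dots> = ennreal (2 * \<kappa> * C1) * (\<integral>\<^sup>+w. ennreal ((norm (deriv h w))\<^sup>2 * (1 - norm w) powr s) \<partial>\<lambda>\<D>)"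
          by (rule nn_integral_cmult) measurable
        also have "\<dots> \<le> ennreal (2 * \<kappa> * C1) * ennreal N" by (intro mult_left_mono hN) simp
        also have "\<dots> = ennreal (2 * \<kappa> * C1 * N)" using \<kappa> C1 N by (intro ennreal_mult[symmetric]) auto
        finally show ?thesis .
      qed
      also have "(\<integral>\<^sup>+z. (\<integral>\<^sup>+w. V z w \<partial>\<lambda>\<D>) \<partial>\<lambda>\<D>) \<le> ennreal (1/2) * A"
      proof -
        have "(\<integral>\<^sup>+z. (\<integral>\<^sup>+w. V z w \<partial>\<lambda>\<D>) \<partial>\<lambda>\<D>) \<le> (\<integral>\<^sup>+z. ennreal (1/2) * (ennreal ((H z)\<^sup>2 * m z) * indicator (ball 0 r) z) \<partial>\<lambda>\<D>)"
        proof (rule nn_integral_mono)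
          fix z assume "z \<in> space \<lambda>\<D>"
          then have z: "norm z < 1" by simp
          let ?c = "ennreal ((H z)\<^sup>2 * m z) * indicator (ball 0 r) z"
          have "(\<integral>\<^sup>+w. V z w \<partial>\<lambda>\<D>) = ennreal (2 / \<kappa>) * (?c * (\<integral>\<^sup>+w. ennreal (disc_log w powr (- \<beta>) / (1 - norm w)\<^sup>2) * indicator (disc_cone z) w \<partial>\<lambda>\<D>))"
            by (simp add: V_def nn_integral_cmult)
          also have "\<dots> \<le> ennreal (2 / \<kappa>) * (?c * ennreal C2)"
            by (intro mult_left_mono C2(2) z) simp_all
          also have "\<dots> = (ennreal (2 / \<kappa>) * ennreal C2) * ?c" by (simp only: mult_ac)
          also have "ennreal (2 / \<kappa>) * ennreal C2 = ennreal (2 / \<kappa> * C2)" using \<kappa> C2(1) by (intro ennreal_mult[symmetric]) auto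
          also have "2 / \<kappa> * C2 = 1/2" using C2(1) by (simp add: \<kappa>_def)
          finally show "(\<integral>\<^sup>+w. V z w \<partial>\<lambda>\<D>) \<le> ennreal (1/2) * ?c" .
        qed
        also have "\<dots> = ennreal (1/2) * A" unfolding A_def by (rule nn_integral_cmult) measurable
        finally show ?thesis .
      qed
      finally have "A \<le> ennreal (2 * \<kappa> * C1 * N) + ennreal (1/2) * A" by (simp add: add_mono)
      then have "A \<le> ennreal (2 * (2 * \<kappa> * C1 * N))" using \<kappa> C1 N A_fin by (intro ennreal_absorb) auto
      then show "(\<integral>\<^sup>+z. ennreal ((H z)\<^sup>2 * m z) * indicator (ball 0 r) z \<partial>\<lambda>\<D>) \<le> ennreal (16 * C2 * C1 * N)"
        by (simp add: A_def \<kappa>_def mult_ac)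
    qed
    also have "\<dots> \<le> ennreal ((16 * C2 * C1 + 1) * N)"
      using N by (intro ennreal_leI mult_right_mono) auto
    finally show "(\<integral>\<^sup>+z. ennreal ((norm (h z - h 0))\<^sup>2 * Carleson_density s g z) \<partial>\<lambda>\<D>) \<le> ennreal ((16 * C2 * C1 + 1) * N)"
      by (simp add: H_def m_def)
  qed
qed

lemma disc_log_le_powr:
  assumes u: "norm u < 1" and \<epsilon>: "0 < \<epsilon>"
  shows "disc_log u \<le> 4 powr \<epsilon> / \<epsilon> * (1 - (norm u)\<^sup>2) powr (- \<epsilon>)"
proof -
  have "(norm u)\<^sup>2 < 1" using u by (simp add: abs_square_less_1)
  then have t: "1 - (norm u)\<^sup>2 > 0" by simp
  have "disc_log u \<le> (2 / (1 - norm u)) powr \<epsilon> / \<epsilon>"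
    unfolding disc_log_def using u \<epsilon> by (intro ln_powr_bound) (auto simp: field_simps)
  also have "2 / (1 - norm u) \<le> 4 / (1 - (norm u)\<^sup>2)"
    using one_minus_norm_square_le[OF u] u t by (simp add: field_simps)
  then have "(2 / (1 - norm u)) powr \<epsilon> \<le> (4 / (1 - (norm u)\<^sup>2)) powr \<epsilon>"
    using u \<epsilon> by (intro powr_mono2) auto
  also have "\<dots> = 4 powr \<epsilon> * (1 - (norm u)\<^sup>2) powr (- \<epsilon>)"
    by (simp add: powr_divide powr_minus_divide)
  finally show ?thesis using \<epsilon> by (simp add: divide_right_mono)
qed

lemma norm_add_square_le: "(norm (x + y))\<^sup>2 \<le> 2 * (norm x)\<^sup>2 + 2 * (norm y)\<^sup>2" for x y :: "'a::real_normed_vector"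
proof -
  have "(norm (x + y))\<^sup>2 \<le> (norm x + norm y)\<^sup>2" by (intro power_mono norm_triangle_ineq) simp
  also have "\<dots> \<le> 2 * (norm x)\<^sup>2 + 2 * (norm y)\<^sup>2"
    using sum_squares_bound[of "norm x" "norm y"] by (simp add: power2_sum)
  finally show ?thesis .
qed

text \<open>The logarithm in \<open>Bloch_increment\<close> is traded for a small negative power.
  Half of the exponent \<open>s\<close> of the weight pays for it, and the other half stays
  available for integration.\<close>

lemma Bloch_increment_square:
  assumes f: "f holomorphic_on \<D>" and B: "0 \<le> B" "\<And>w. norm w < 1 \<Longrightarrow> norm (deriv f w) \<le> B / (1 - norm w)"
    and s: "0 < s"
  obtains D where "D > 0"
    "\<And>a z. norm a < 1 \<Longrightarrow> norm z < 1 \<Longrightarrow> (norm (f z - f a))\<^sup>2 \<le> D * (1 - (norm (moebius_disc a z))\<^sup>2) powr (- s / 2)"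
proof -
  obtain C where C: "C > 0"
    "\<And>f B a z. f holomorphic_on \<D> \<Longrightarrow> 0 \<le> B \<Longrightarrow> (\<And>w. norm w < 1 \<Longrightarrow> norm (deriv f w) \<le> B / (1 - norm w)) \<Longrightarrow>
      norm a < 1 \<Longrightarrow> norm z < 1 \<Longrightarrow> norm (f z - f a) \<le> C * B * disc_log (moebius_disc a z)"
    by (fact Bloch_increment)
  \<comment> \<open>Squaring doubles the exponent to s / 2.\<close>
  define \<epsilon> where "\<epsilon> = s / 4"
  have \<epsilon>: "\<epsilon> > 0" using s by (simp add: \<epsilon>_def)
  define E where "E = C * B * (4 powr \<epsilon> / \<epsilon>)"
  have E: "E \<ge> 0" using C B \<epsilon> by (simp add: E_def)
  have pos: "E\<^sup>2 + 1 > 0" by (simp add: add_nonneg_pos)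
  show ?thesis
  proof (rule that[OF pos])
    fix a z :: complex assume a: "norm a < 1" and z: "norm z < 1"
    define t where "t = 1 - (norm (moebius_disc a z))\<^sup>2"
    have u: "norm (moebius_disc a z) < 1" by (rule norm_moebius_less_1[OF a z])
    have "norm (f z - f a) \<le> C * B * disc_log (moebius_disc a z)" by (rule C(2)[OF f B a z])
    also have "\<dots> \<le> C * B * (4 powr \<epsilon> / \<epsilon> * t powr (- \<epsilon>))"
      unfolding t_def using C(1) B(1) by (intro mult_left_mono disc_log_le_powr u \<epsilon>) auto
    also have "\<dots> = E * t powr (- \<epsilon>)" by (simp only: E_def mult.assoc)
    finally have "(norm (f z - f a))\<^sup>2 \<le> (E * t powr (- \<epsilon>))\<^sup>2" by (intro power_mono) auto
    also have "\<dots> = E\<^sup>2 * t powr (- s / 2)"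
      by (simp add: power_mult_distrib power2_eq_square powr_add[symmetric] \<epsilon>_def)
    also have "\<dots> \<le> (E\<^sup>2 + 1) * t powr (- s / 2)" by (intro mult_right_mono) auto
    finally show "(norm (f z - f a))\<^sup>2 \<le> (E\<^sup>2 + 1) * (1 - (norm (moebius_disc a z))\<^sup>2) powr (- s / 2)"
      by (simp only: t_def)
  qed
qed

lemma moebius_kernel_area:
  assumes s: "0 < s"
  obtains C where "C > 0"
    "\<And>a. norm a < 1 \<Longrightarrow> (\<integral>\<^sup>+z. ennreal (moebius_weight s a z / (norm (1 - cnj a * z))\<^sup>2) \<partial>\<lambda>\<D>) \<le> ennreal C"
proof -
  obtain C where C: "C > 0"
    "\<And>a. norm a < 1 \<Longrightarrow>
      (\<integral>\<^sup>+z. ennreal ((1 - norm z) powr s / norm (1 - cnj a * z) powr (s + 2 + s)) \<partial>\<lambda>\<D>)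
        \<le> ennreal (C * (1 - norm a) powr (- s))"
    using Forelli_Rudin[of s s] s by auto
  have C4: "4 powr s * C > 0" using C by simp
  show ?thesis
  proof (rule that[OF C4])
    fix a :: complex assume a: "norm a < 1"
    let ?I = "\<lambda>z. (1 - norm z) powr s / norm (1 - cnj a * z) powr (s + 2 + s)"
    have "(\<integral>\<^sup>+z. ennreal (moebius_weight s a z / (norm (1 - cnj a * z))\<^sup>2) \<partial>\<lambda>\<D>)
      \<le> (\<integral>\<^sup>+z. ennreal (4 powr s * (1 - norm a) powr s) * ennreal (?I z) \<partial>\<lambda>\<D>)"
    proof (rule nn_integral_mono)
      fix z assume "z \<in> space \<lambda>\<D>"
      then have z: "norm z < 1" by simp
      define n where "n = norm (1 - cnj a * z)"
      have n: "n > 0" using one_minus_cnj_mult_nz[OF a z] by (simp add: n_def)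
      have "moebius_weight s a z / n\<^sup>2 \<le> 4 powr s * ((1 - norm a) powr s * (1 - norm z) powr s / n powr (2 * s)) / n\<^sup>2"
        unfolding n_def using s by (intro divide_right_mono moebius_weight_le a z) auto
      also have "n powr (2 * s) * n\<^sup>2 = n powr (s + 2 + s)"
        using n by (simp add: powr_add powr_numeral mult_2 mult_ac)
      then have "4 powr s * ((1 - norm a) powr s * (1 - norm z) powr s / n powr (2 * s)) / n\<^sup>2 = 4 powr s * (1 - norm a) powr s * ((1 - norm z) powr s / n powr (s + 2 + s))"
        by (simp add: mult_ac flip: \<open>n powr (2 * s) * n\<^sup>2 = n powr (s + 2 + s)\<close>)
      finally show "ennreal (moebius_weight s a z / (norm (1 - cnj a * z))\<^sup>2) \<le> ennreal (4 powr s * (1 - norm a) powr s) * ennreal (?I z)"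
        by (subst ennreal_mult[symmetric]) (auto intro: ennreal_leI simp: n_def)
    qed
    also have "\<dots> = ennreal (4 powr s * (1 - norm a) powr s) * (\<integral>\<^sup>+z. ennreal (?I z) \<partial>\<lambda>\<D>)"
    proof (rule nn_integral_cmult)
      have [measurable]: "(\<lambda>z. 1 - cnj a * z) \<in> borel_measurable \<lambda>\<D>" by measurable
      show "(\<lambda>z. ennreal (?I z)) \<in> borel_measurable \<lambda>\<D>" by measurable
    qed
    also have "\<dots> \<le> ennreal (4 powr s * (1 - norm a) powr s) * ennreal (C * (1 - norm a) powr (- s))"
      by (intro mult_left_mono C a) auto
    also have "\<dots> = ennreal (4 powr s * C)"
      using a C(1) by (simp add: ennreal_mult[symmetric] powr_minus_divide)
    finally show "(\<integral>\<^sup>+z. ennreal (moebius_weight s a z / (norm (1 - cnj a * z))\<^sup>2) \<partial>\<lambda>\<D>) \<le> ennreal (4 powr s * C)" .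
  qed
qed

text \<open>The Carleson embedding is applied to
  \<open>h(z) = (f(z) - f(a)) (1 - |a|\<^sup>2)\<^sup>s\<^sup>/\<^sup>2 (1 - \<^bold>a z)\<^sup>-\<^sup>s\<close> with \<open>\<^bold>a\<close> the conjugate of \<open>a\<close>; then
  \<open>|h(z)|\<^sup>2 (1 - |z|\<^sup>2)\<^sup>s = |f(z) - f(a)|\<^sup>2 (1 - |\<phi>\<^sub>a(z)|\<^sup>2)\<^sup>s\<close>.\<close>

lemma multiplier_oscillation_bound:
  assumes g: "g holomorphic_on \<D>" and s: "0 < s" and \<beta>: "1 < \<beta>" and Cg: "0 \<le> Cg"
    and gQ: "\<And>a. norm a < 1 \<Longrightarrow> ennreal (disc_log a powr \<beta>) * Q_integral s (deriv g) a \<le> ennreal Cg"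
    and f: "f holomorphic_on \<D>" and Cf: "0 \<le> Cf" "\<And>a. norm a < 1 \<Longrightarrow> Q_integral s (deriv f) a \<le> ennreal Cf"
  obtains C where "C \<ge> 0"
    "\<And>a. norm a < 1 \<Longrightarrow>
      (\<integral>\<^sup>+z. ennreal ((norm (deriv g z))\<^sup>2 * (norm (f z - f a))\<^sup>2 * moebius_weight s a z) \<partial>\<lambda>\<D>) \<le> ennreal C"
proof -
  note [measurable] = measurable_disc_deriv[OF g] measurable_disc_deriv[OF f] measurable_disc_holomorphic[OF f]
  obtain B where B: "B > 0" "\<And>f z. f holomorphic_on \<D> \<Longrightarrow> norm z < 1 \<Longrightarrow> Q_integral s (deriv f) z \<le> ennreal Cf \<Longrightarrow>
      norm (deriv f z) \<le> B / (1 - norm z)"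
    using Q_Bloch[OF s Cf(1)] by blast
  have fB: "norm (deriv f z) \<le> B / (1 - norm z)" if "norm z < 1" for z
    using B(2)[OF f that Cf(2)[OF that]] .
  obtain D where D: "D > 0"
    "\<And>a z. norm a < 1 \<Longrightarrow> norm z < 1 \<Longrightarrow> (norm (f z - f a))\<^sup>2 \<le> D * (1 - (norm (moebius_disc a z))\<^sup>2) powr (- s / 2)"
    using Bloch_increment_square[OF f _ fB s] B(1) by auto
  obtain CC where CC: "CC > 0"
    "\<And>h N. h holomorphic_on \<D> \<Longrightarrow> 0 \<le> N \<Longrightarrow>
      (\<integral>\<^sup>+w. ennreal ((norm (deriv h w))\<^sup>2 * (1 - norm w) powr s) \<partial>\<lambda>\<D>) \<le> ennreal N \<Longrightarrow>
      (\<integral>\<^sup>+z. ennreal ((norm (h z - h 0))\<^sup>2 * Carleson_density s g z) \<partial>\<lambda>\<D>) \<le> ennreal (CC * N)"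
    by (rule Carleson_embedding[OF g s \<beta> Cg gQ]) blast+
  obtain CK where CK: "CK > 0"
    "\<And>a. norm a < 1 \<Longrightarrow> (\<integral>\<^sup>+z. ennreal (moebius_weight (s/2) a z / (norm (1 - cnj a * z))\<^sup>2) \<partial>\<lambda>\<D>) \<le> ennreal CK"
    using moebius_kernel_area[of "s/2"] s by auto
  define m where "m = Carleson_density s g"
  have m0: "m z \<ge> 0" for z by (simp add: m_def Carleson_density_nonneg)
  have m_meas [measurable]: "m \<in> borel_measurable \<lambda>\<D>" unfolding m_def by (rule Carleson_density_measurable[OF g])
  define Cm where "Cm = ln 2 powr (- \<beta>) * Cg"
  have Cm: "Cm \<ge> 0" using Cg by (simp add: Cm_def)
  have m_int: "(\<integral>\<^sup>+z. ennreal (m z) \<partial>\<lambda>\<D>) \<le> ennreal Cm"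
  proof -
    have "(\<integral>\<^sup>+z. ennreal (m z) \<partial>\<lambda>\<D>) = Q_integral s (deriv g) 0"
      unfolding Q_integral_def m_def
      by (intro nn_integral_cong) (simp add: Carleson_density_def moebius_weight_def moebius_disc_def)
    also have "\<dots> = ennreal (ln 2 powr (- \<beta>)) * (ennreal (disc_log 0 powr \<beta>) * Q_integral s (deriv g) 0)"
      by (simp add: disc_log_def mult.assoc[symmetric] ennreal_mult[symmetric] powr_minus_divide)
    also have "\<dots> \<le> ennreal (ln 2 powr (- \<beta>)) * ennreal Cg" by (intro mult_left_mono gQ) auto
    finally show ?thesis using Cg by (simp add: Cm_def ennreal_mult)
  qed
  \<comment> \<open>\<open>2 * Cf\<close> bounds the part of h' that contains f'; the other summand
    bounds the part where the kernel power is differentiated, which leaves f - f(a).\<close>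
  define N where "N = 2 * Cf + 2 * s\<^sup>2 * D * CK"
  have N: "N \<ge> 0" using Cf D CK by (simp add: N_def)
  have pos: "2 * (CC * N) + 2 * D * Cm \<ge> 0" using CC N D Cm by simp
  show ?thesis
  proof (rule that[OF pos])
    fix a :: complex assume a: "norm a < 1"
    note [measurable] = moebius_weight_measurable[OF a]
    define A where "A = 1 - (norm a)\<^sup>2"
    have A: "0 < A" "A \<le> 1" using a by (auto simp: A_def abs_square_less_1)
    define c where "c = A powr (s/2)"
    have c2: "c\<^sup>2 = A powr s" by (simp add: c_def power2_eq_square powr_add[symmetric])
    define E where "E z = (1 - cnj a * z) powr (of_real (- s))" for z
    define E' where "E' z = of_real s * cnj a * (1 - cnj a * z) powr (of_real (- s - 1))" for z
    define h where "h z = of_real c * ((f z - f a) * E z)" for z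
    have nE: "norm (E z) = norm (1 - cnj a * z) powr (- s)" for z
      unfolding E_def by (subst norm_powr_real_powr') auto
    have nE': "norm (E' z) \<le> s * norm (1 - cnj a * z) powr (- s - 1)" for z
    proof -
      have "norm (E' z) = s * norm a * norm (1 - cnj a * z) powr (- s - 1)"
        unfolding E'_def norm_mult using s by (subst norm_powr_real_powr') auto
      also have "\<dots> \<le> s * 1 * norm (1 - cnj a * z) powr (- s - 1)"
        using a s by (intro mult_right_mono mult_left_mono) auto
      finally show ?thesis by simp
    qed
    \<comment> \<open>|cnj a z| < 1 keeps the base in the right half plane, where the principal
      power is holomorphic.\<close>
    have dE: "(E has_field_derivative E' z) (at z)" if z: "norm z < 1" for z
    proof -
      have "norm (cnj a * z) < 1" using a z by (simp add: norm_mult) (smt (verit) mult_less_cancel_right1 norm_ge_zero mult_left_le)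
      then have "Re (cnj a * z) < 1" using complex_Re_le_cmod[of "cnj a * z"] by linarith
      then have "1 - cnj a * z \<notin> \<real>\<^sub>\<le>\<^sub>0" by (auto simp: complex_nonpos_Reals_iff)
      from has_field_derivative_powr[OF this, of "of_real (- s)"]
      have "((\<lambda>z. z powr of_real (- s)) has_field_derivative (of_real (- s) * (1 - cnj a * z) powr (of_real (- s) - 1))) (at (1 - cnj a * z))" .
      moreover have "((\<lambda>z. 1 - cnj a * z) has_field_derivative - cnj a) (at z)"
        by (auto intro!: derivative_eq_intros)
      ultimately have "((\<lambda>z. (1 - cnj a * z) powr of_real (- s)) has_field_derivative (of_real (- s) * (1 - cnj a * z) powr (of_real (- s) - 1)) * (- cnj a)) (at z)"
        by (rule DERIV_chain2)
      then show ?thesis by (simp add: E_def[abs_def] E'_def mult_ac)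
    qed
    have dh: "(h has_field_derivative of_real c * (deriv f z * E z + (f z - f a) * E' z)) (at z)" if z: "norm z < 1" for z
    proof -
      have "(f has_field_derivative deriv f z) (at z)"
        using f z by (intro holomorphic_derivI[of _ \<D>]) auto
      with dE[OF z] show ?thesis
        unfolding h_def by (auto intro!: derivative_eq_intros simp: algebra_simps)
    qed
    have h: "h holomorphic_on \<D>"
      using dh by (intro holomorphic_onI) (auto simp: field_differentiable_def intro: has_field_derivative_at_within)
    have key: "(norm (h z))\<^sup>2 * m z = (norm (deriv g z))\<^sup>2 * (norm (f z - f a))\<^sup>2 * moebius_weight s a z"
      if z: "norm z < 1" for z
    proof -
      define n where "n = norm (1 - cnj a * z)"
      have n: "n > 0" using one_minus_cnj_mult_nz[OF a z] by (simp add: n_def)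
      have "moebius_weight s a z = A powr s * (1 - (norm z)\<^sup>2) powr s / (n\<^sup>2) powr s"
        unfolding moebius_weight_def one_minus_norm_moebius[OF a z] by (simp only: A_def n_def powr_divide powr_mult)
      moreover have "(n powr (- s))\<^sup>2 = 1 / (n\<^sup>2) powr s"
        using n by (simp add: powr_minus_divide power_divide power2_eq_square powr_mult)
      moreover have "(norm (h z))\<^sup>2 = c\<^sup>2 * ((norm (f z - f a))\<^sup>2 * (n powr (- s))\<^sup>2)"
        by (simp add: h_def norm_mult nE n_def power_mult_distrib c_def)
      ultimately show ?thesis by (simp add: m_def Carleson_density_def c2)
    qed
    have h'_le: "(norm (deriv h z))\<^sup>2 * (1 - norm z) powr s
       \<le> 2 * ((norm (deriv f z))\<^sup>2 * moebius_weight s a z)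
         + 2 * s\<^sup>2 * D * (moebius_weight (s/2) a z / (norm (1 - cnj a * z))\<^sup>2)" if z: "norm z < 1" for z
    proof -
      define n where "n = norm (1 - cnj a * z)"
      have n: "n > 0" using one_minus_cnj_mult_nz[OF a z] by (simp add: n_def)
      define t where "t = 1 - (norm (moebius_disc a z))\<^sup>2"
      have t: "t > 0" using norm_moebius_less_1[OF a z] by (simp add: t_def abs_square_less_1)
      define W where "W = A powr s * (1 - norm z) powr s * (n powr (- s))\<^sup>2"
      have W0: "W \<ge> 0" by (simp add: W_def)
      have W: "W \<le> t powr s"
      proof -
        have "t powr s = A powr s * (1 - (norm z)\<^sup>2) powr s / (n\<^sup>2) powr s"
          unfolding t_def one_minus_norm_moebius[OF a z] by (simp only: A_def n_def powr_divide powr_mult)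
        moreover have "(n powr (- s))\<^sup>2 = 1 / (n\<^sup>2) powr s"
          using n by (simp add: powr_minus_divide power_divide power2_eq_square powr_mult)
        moreover have "(1 - norm z) powr s \<le> (1 - (norm z)\<^sup>2) powr s"
          using z s by (intro powr_mono2) (auto simp: power2_eq_square mult_left_le)
        ultimately show ?thesis unfolding W_def by (simp add: divide_right_mono mult_left_mono)
      qed
      have "(norm (deriv h z))\<^sup>2 = c\<^sup>2 * (norm (deriv f z * E z + (f z - f a) * E' z))\<^sup>2"
        by (simp add: DERIV_imp_deriv[OF dh[OF z]] norm_mult power_mult_distrib)
      also have "\<dots> \<le> c\<^sup>2 * (2 * (norm (deriv f z * E z))\<^sup>2 + 2 * (norm ((f z - f a) * E' z))\<^sup>2)"
        by (intro mult_left_mono norm_add_square_le) simp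
      also have "(norm (deriv f z * E z))\<^sup>2 = (norm (deriv f z))\<^sup>2 * (n powr (- s))\<^sup>2"
        by (simp add: norm_mult nE n_def power_mult_distrib)
      also have "(norm ((f z - f a) * E' z))\<^sup>2 \<le> (norm (f z - f a))\<^sup>2 * (s\<^sup>2 * ((n powr (- s))\<^sup>2 / n\<^sup>2))"
      proof -
        have "norm (E' z) \<le> s * (n powr (- s) / n)" using nE'[of z] n by (simp add: n_def powr_diff)
        then have "(norm (E' z))\<^sup>2 \<le> (s * (n powr (- s) / n))\<^sup>2" by (intro power_mono) auto
        then have "(norm (f z - f a))\<^sup>2 * (norm (E' z))\<^sup>2 \<le> (norm (f z - f a))\<^sup>2 * (s * (n powr (- s) / n))\<^sup>2"
          by (intro mult_left_mono) auto
        then show ?thesis by (simp add: norm_mult power_mult_distrib power_divide)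
      qed
      finally have "(norm (deriv h z))\<^sup>2 \<le> c\<^sup>2 * (2 * ((norm (deriv f z))\<^sup>2 * (n powr (- s))\<^sup>2) + 2 * ((norm (f z - f a))\<^sup>2 * (s\<^sup>2 * ((n powr (- s))\<^sup>2 / n\<^sup>2))))"
        by (simp add: mult_left_mono)
      then have "(norm (deriv h z))\<^sup>2 * (1 - norm z) powr s \<le> c\<^sup>2 * (2 * ((norm (deriv f z))\<^sup>2 * (n powr (- s))\<^sup>2) + 2 * ((norm (f z - f a))\<^sup>2 * (s\<^sup>2 * ((n powr (- s))\<^sup>2 / n\<^sup>2)))) * (1 - norm z) powr s"
        by (rule mult_right_mono) simp
      also have "\<dots> = 2 * ((norm (deriv f z))\<^sup>2 * W) + 2 * s\<^sup>2 * ((norm (f z - f a))\<^sup>2 * W / n\<^sup>2)"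
        by (simp add: c2 W_def algebra_simps)
      \<comment> \<open>The increment bound costs t^(-s/2) of the available t^s. The remaining
        t^(s/2) / n^2 is what \<open>moebius_kernel_area\<close> integrates with s / 2 in place of
        s.\<close>
      also have "\<dots> \<le> 2 * ((norm (deriv f z))\<^sup>2 * t powr s) + 2 * s\<^sup>2 * (D * t powr (- s / 2) * t powr s / n\<^sup>2)"
        using W W0 D(1) D(2)[OF a z]
        by (intro add_mono mult_left_mono divide_right_mono mult_mono) (auto simp: t_def)
      also have "D * t powr (- s / 2) * t powr s = D * t powr (s / 2)"
        by (simp add: mult.assoc powr_add[symmetric])
      finally show ?thesis by (simp add: moebius_weight_def t_def n_def mult_ac)
    qed
    have "(\<integral>\<^sup>+w. ennreal ((norm (deriv h w))\<^sup>2 * (1 - norm w) powr s) \<partial>\<lambda>\<D>)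
      \<le> (\<integral>\<^sup>+z. ennreal 2 * ennreal ((norm (deriv f z))\<^sup>2 * moebius_weight s a z)
          + ennreal (2 * s\<^sup>2 * D) * ennreal (moebius_weight (s/2) a z / (norm (1 - cnj a * z))\<^sup>2) \<partial>\<lambda>\<D>)"
    proof (rule nn_integral_mono)
      fix z assume "z \<in> space \<lambda>\<D>"
      then have z: "norm z < 1" by simp
      have "ennreal ((norm (deriv h z))\<^sup>2 * (1 - norm z) powr s) \<le> ennreal (2 * ((norm (deriv f z))\<^sup>2 * moebius_weight s a z)
         + 2 * s\<^sup>2 * D * (moebius_weight (s/2) a z / (norm (1 - cnj a * z))\<^sup>2))"
        by (rule ennreal_leI[OF h'_le[OF z]])
      also have "\<dots> = ennreal 2 * ennreal ((norm (deriv f z))\<^sup>2 * moebius_weight s a z)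
          + ennreal (2 * s\<^sup>2 * D) * ennreal (moebius_weight (s/2) a z / (norm (1 - cnj a * z))\<^sup>2)"
        using D(1) by (intro ennreal_mult_add) (auto simp: moebius_weight_def)
      finally show "ennreal ((norm (deriv h z))\<^sup>2 * (1 - norm z) powr s) \<le> \<dots>" .
    qed
    also have "\<dots> = ennreal 2 * Q_integral s (deriv f) a
      + ennreal (2 * s\<^sup>2 * D) * (\<integral>\<^sup>+z. ennreal (moebius_weight (s/2) a z / (norm (1 - cnj a * z))\<^sup>2) \<partial>\<lambda>\<D>)"
    proof -
      have [measurable]: "(\<lambda>z. 1 - cnj a * z) \<in> borel_measurable \<lambda>\<D>" by measurable
      have "(\<lambda>z. ennreal (moebius_weight (s/2) a z / (norm (1 - cnj a * z))\<^sup>2)) \<in> borel_measurable \<lambda>\<D>"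
        "(\<lambda>z. ennreal ((norm (deriv f z))\<^sup>2 * moebius_weight s a z)) \<in> borel_measurable \<lambda>\<D>" by measurable
      then show ?thesis unfolding Q_integral_def by (simp only: nn_integral_add nn_integral_cmult borel_measurable_times_ennreal borel_measurable_const)
    qed
    also have "\<dots> \<le> ennreal 2 * ennreal Cf + ennreal (2 * s\<^sup>2 * D) * ennreal CK"
      by (intro add_mono mult_left_mono Cf a CK) auto
    also have "\<dots> = ennreal N" unfolding N_def using Cf D(1) CK(1) by (intro ennreal_mult_add[symmetric]) auto
    finally have 1: "(\<integral>\<^sup>+z. ennreal ((norm (h z - h 0))\<^sup>2 * m z) \<partial>\<lambda>\<D>) \<le> ennreal (CC * N)"
      unfolding m_def by (rule CC(2)[OF h N])
    \<comment> \<open>\<open>Carleson_embedding\<close> controls only h - h(0). The value at 0 is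
      bounded separately and paired with the finite total mass of \<open>m\<close>.\<close>
    have h0: "(norm (h 0))\<^sup>2 \<le> D"
    proof -
      have "(norm (h 0))\<^sup>2 = A powr s * (norm (f 0 - f a))\<^sup>2"
        by (simp add: h_def norm_mult E_def power_mult_distrib c2)
      also have "\<dots> \<le> A powr s * (D * A powr (- s / 2))"
        using D(2)[OF a, of 0] by (intro mult_left_mono) (auto simp: A_def)
      also have "\<dots> = D * A powr (s / 2)" by (simp add: powr_add[symmetric])
      also have "\<dots> \<le> D * 1" using A s D(1) by (intro mult_left_mono powr_le1) auto
      finally show ?thesis by simp
    qed
    have "(\<integral>\<^sup>+z. ennreal ((norm (deriv g z))\<^sup>2 * (norm (f z - f a))\<^sup>2 * moebius_weight s a z) \<partial>\<lambda>\<D>)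
      \<le> (\<integral>\<^sup>+z. ennreal 2 * ennreal ((norm (h z - h 0))\<^sup>2 * m z) + ennreal (2 * D) * ennreal (m z) \<partial>\<lambda>\<D>)"
    proof (rule nn_integral_mono)
      fix z assume "z \<in> space \<lambda>\<D>"
      then have z: "norm z < 1" by simp
      have "(norm (h z))\<^sup>2 \<le> 2 * (norm (h z - h 0))\<^sup>2 + 2 * (norm (h 0))\<^sup>2"
        using norm_add_square_le[of "h z - h 0" "h 0"] by simp
      then have "(norm (h z))\<^sup>2 \<le> 2 * (norm (h z - h 0))\<^sup>2 + 2 * D" using h0 by linarith
      then have "(norm (h z))\<^sup>2 * m z \<le> (2 * (norm (h z - h 0))\<^sup>2 + 2 * D) * m z" using m0 by (rule mult_right_mono)
      then have "ennreal ((norm (h z))\<^sup>2 * m z) \<le> ennreal (2 * ((norm (h z - h 0))\<^sup>2 * m z) + 2 * D * m z)"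
        by (intro ennreal_leI) (simp add: algebra_simps)
      also have "\<dots> = ennreal 2 * ennreal ((norm (h z - h 0))\<^sup>2 * m z) + ennreal (2 * D) * ennreal (m z)"
        using D(1) m0 by (intro ennreal_mult_add) auto
      finally show "ennreal ((norm (deriv g z))\<^sup>2 * (norm (f z - f a))\<^sup>2 * moebius_weight s a z) \<le> \<dots>"
        by (simp only: key[OF z])
    qed
    also have "\<dots> = ennreal 2 * (\<integral>\<^sup>+z. ennreal ((norm (h z - h 0))\<^sup>2 * m z) \<partial>\<lambda>\<D>) + ennreal (2 * D) * (\<integral>\<^sup>+z. ennreal (m z) \<partial>\<lambda>\<D>)"
    proof -
      have [measurable]: "h \<in> borel_measurable \<lambda>\<D>" by (rule measurable_disc_holomorphic[OF h])
      show ?thesis by (simp add: nn_integral_add nn_integral_cmult)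
    qed
    also have "\<dots> \<le> ennreal 2 * ennreal (CC * N) + ennreal (2 * D) * ennreal Cm"
      by (intro add_mono mult_left_mono 1 m_int) auto
    also have "\<dots> = ennreal (2 * (CC * N) + 2 * D * Cm)"
      using CC(1) N D(1) Cm by (intro ennreal_mult_add[symmetric]) auto
    finally show "(\<integral>\<^sup>+z. ennreal ((norm (deriv g z))\<^sup>2 * (norm (f z - f a))\<^sup>2 * moebius_weight s a z) \<partial>\<lambda>\<D>)
       \<le> ennreal (2 * (CC * N) + 2 * D * Cm)" .
  qed
qed

section \<open>Sufficient conditions\<close>

lemma H_infinityD:
  assumes "g \<in> H_infinity"
  obtains M where "M > 0" "\<And>z. norm z < 1 \<Longrightarrow> norm (g z) \<le> M"
proof -
  obtain b where "\<forall>x\<in>g ` \<D>. norm x \<le> b" using assms by (auto simp: H_infinity_def bounded_iff)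
  then show ?thesis by (intro that[of "max b 1"]) (auto simp: le_max_iff_disj)
qed

lemma Besov_integral_finiteD:
  assumes "f \<in> Besov_space p"
  obtains K where "0 \<le> K" "f holomorphic_on \<D>" "Besov_integral p f \<le> ennreal K"
proof -
  have "Besov_integral p f < top" "f holomorphic_on \<D>" using assms by (auto simp: Besov_space_iff)
  then show ?thesis by (intro that[of "enn2real (Besov_integral p f)"]) auto
qed

lemma ennreal_nonneg_bound:
  assumes "\<exists>C. \<forall>a\<in>\<D>. F a \<le> ennreal C"
  obtains C where "C \<ge> 0" "\<And>a. norm a < 1 \<Longrightarrow> F a \<le> ennreal C"
proof -
  obtain C where C: "\<And>a. a \<in> \<D> \<Longrightarrow> F a \<le> ennreal C" using assms by blast
  show ?thesis
    using order_trans[OF C ennreal_leI[of C "max C 0"]] by (intro that[of "max C 0"]) auto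
qed

lemma deriv_mult_op:
  assumes "g holomorphic_on \<D>" "f holomorphic_on \<D>" "norm z < 1"
  shows "deriv (mult_op g f) z = deriv g z * f z + g z * deriv f z"
proof -
  have "(g has_field_derivative deriv g z) (at z)" "(f has_field_derivative deriv f z) (at z)"
    using assms by (auto intro!: holomorphic_derivI[of _ \<D>])
  from DERIV_imp_deriv[OF DERIV_mult[OF this]] show ?thesis
    by (simp add: mult_op_def[abs_def] mult_ac)
qed

lemma mult_op_holomorphic: "g holomorphic_on \<D> \<Longrightarrow> f holomorphic_on \<D> \<Longrightarrow> mult_op g f holomorphic_on \<D>"
  unfolding mult_op_def[abs_def] by (intro holomorphic_intros)

text \<open>The disc is convex, so the integrand has a primitive \<open>F\<close>; the segment
  integral that defines \<open>integral_op\<close> equals \<open>F z - F 0\<close>.\<close>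

lemma integral_op_deriv:
  assumes g: "g holomorphic_on \<D>" and f: "f holomorphic_on \<D>"
  shows "integral_op g f holomorphic_on \<D>" "norm z < 1 \<Longrightarrow> deriv (integral_op g f) z = g z * deriv f z"
proof -
  have "(\<lambda>z. g z * deriv f z) holomorphic_on \<D>"
    using f by (intro holomorphic_intros g holomorphic_deriv) auto
  then obtain F where F: "\<And>z. z \<in> \<D> \<Longrightarrow> (F has_field_derivative g z * deriv f z) (at z within \<D>)"
    using holomorphic_convex_primitive'[of \<D> "\<lambda>z. g z * deriv f z"] by auto
  have eq: "integral_op g f z = F z - F 0" if z: "z \<in> \<D>" for z
  proof -
    have "closed_segment 0 z \<subseteq> \<D>" using z by (intro closed_segment_subset) auto
    then have "((\<lambda>z. g z * deriv f z) has_contour_integral (F (pathfinish (linepath 0 z)) - F (pathstart (linepath 0 z)))) (linepath 0 z)"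
      by (intro contour_integral_primitive[OF F]) auto
    then show ?thesis by (simp add: integral_op_def contour_integral_unique)
  qed
  have d: "(integral_op g f has_field_derivative g z * deriv f z) (at z)" if z: "z \<in> \<D>" for z
  proof -
    have "(F has_field_derivative g z * deriv f z) (at z)" using F[OF z] z by (simp add: at_within_open[of z \<D>])
    then have "((\<lambda>z. F z - F 0) has_field_derivative g z * deriv f z) (at z)"
      by (auto intro!: derivative_eq_intros)
    then show ?thesis
      by (rule has_field_derivative_transform_within_open[of _ _ _ \<D>]) (use z eq in auto)
  qed
  then show "integral_op g f holomorphic_on \<D>"
    by (intro holomorphic_onI) (auto simp: field_differentiable_def intro: has_field_derivative_at_within)
  show "norm z < 1 \<Longrightarrow> deriv (integral_op g f) z = g z * deriv f z"
    using DERIV_imp_deriv[OF d] by simp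
qed

lemma Q_integral_cong:
  "(\<And>z. norm z < 1 \<Longrightarrow> u z = v z) \<Longrightarrow> Q_integral s u a = Q_integral s v a"
  unfolding Q_integral_def by (intro nn_integral_cong) auto

lemma Q_integral_bounded_mult:
  assumes v: "v \<in> borel_measurable \<lambda>\<D>" and M: "0 \<le> M" "\<And>z. norm z < 1 \<Longrightarrow> norm (u z) \<le> M"
    and a: "norm a < 1" and s: "0 < s"
  shows "Q_integral s (\<lambda>z. u z * v z) a \<le> ennreal (M\<^sup>2) * Q_integral s v a"
proof -
  note [measurable] = v moebius_weight_measurable[OF a]
  have "Q_integral s (\<lambda>z. u z * v z) a \<le> (\<integral>\<^sup>+z. ennreal (M\<^sup>2) * ennreal ((norm (v z))\<^sup>2 * moebius_weight s a z) \<partial>\<lambda>\<D>)"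
    unfolding Q_integral_def
  proof (rule nn_integral_mono)
    fix z assume "z \<in> space \<lambda>\<D>"
    then have z: "norm z < 1" by simp
    have "(norm (u z))\<^sup>2 \<le> M\<^sup>2" using M z by (intro power_mono) auto
    then have "(norm (u z))\<^sup>2 * ((norm (v z))\<^sup>2 * moebius_weight s a z) \<le> M\<^sup>2 * ((norm (v z))\<^sup>2 * moebius_weight s a z)"
      using moebius_weight_bounds[OF a z s] by (intro mult_right_mono) auto
    then show "ennreal ((norm (u z * v z))\<^sup>2 * moebius_weight s a z) \<le> ennreal (M\<^sup>2) * ennreal ((norm (v z))\<^sup>2 * moebius_weight s a z)"
      by (subst ennreal_mult'[symmetric]) (auto intro!: ennreal_leI simp: norm_mult power_mult_distrib mult_ac)
  qed
  also have "\<dots> = ennreal (M\<^sup>2) * Q_integral s v a"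
    unfolding Q_integral_def by (rule nn_integral_cmult) measurable
  finally show ?thesis .
qed

lemma Q_integral_add_le:
  assumes u: "u \<in> borel_measurable \<lambda>\<D>" and v: "v \<in> borel_measurable \<lambda>\<D>" and a: "norm a < 1" and s: "0 < s"
  shows "Q_integral s (\<lambda>z. u z + v z) a \<le> ennreal 2 * Q_integral s u a + ennreal 2 * Q_integral s v a"
proof -
  note [measurable] = u v moebius_weight_measurable[OF a]
  have "Q_integral s (\<lambda>z. u z + v z) a \<le> (\<integral>\<^sup>+z. ennreal 2 * ennreal ((norm (u z))\<^sup>2 * moebius_weight s a z)
     + ennreal 2 * ennreal ((norm (v z))\<^sup>2 * moebius_weight s a z) \<partial>\<lambda>\<D>)"
    unfolding Q_integral_def
  proof (rule nn_integral_mono)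
    fix z assume "z \<in> space \<lambda>\<D>"
    then have w: "0 \<le> moebius_weight s a z" using moebius_weight_bounds[OF a _ s] by simp
    have "(norm (u z + v z))\<^sup>2 * moebius_weight s a z \<le> (2 * (norm (u z))\<^sup>2 + 2 * (norm (v z))\<^sup>2) * moebius_weight s a z"
      using w by (intro mult_right_mono norm_add_square_le)
    then have "ennreal ((norm (u z + v z))\<^sup>2 * moebius_weight s a z)
      \<le> ennreal (2 * ((norm (u z))\<^sup>2 * moebius_weight s a z) + 2 * ((norm (v z))\<^sup>2 * moebius_weight s a z))"
      by (intro ennreal_leI) (simp add: algebra_simps)
    also have "\<dots> = ennreal 2 * ennreal ((norm (u z))\<^sup>2 * moebius_weight s a z) + ennreal 2 * ennreal ((norm (v z))\<^sup>2 * moebius_weight s a z)"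
      using w by (intro ennreal_mult_add) auto
    finally show "ennreal ((norm (u z + v z))\<^sup>2 * moebius_weight s a z) \<le> \<dots>" .
  qed
  also have "\<dots> = ennreal 2 * Q_integral s u a + ennreal 2 * Q_integral s v a"
    unfolding Q_integral_def by (simp add: nn_integral_add nn_integral_cmult)
  finally show ?thesis .
qed

lemma integral_op_sufficient:
  assumes p: "1 < p" and s: "0 < s" "s \<le> 1" "2 < p \<Longrightarrow> 1 - 2 / p < s" and g: "g \<in> H_infinity"
  shows "maps_into (integral_op g) (Besov_space p) (Q_space s)"
  unfolding maps_into_def
proof (rule image_subsetI)
  fix f assume "f \<in> Besov_space p"
  then obtain K where K: "0 \<le> K" and f: "f holomorphic_on \<D>" and fK: "Besov_integral p f \<le> ennreal K"
    by (rule Besov_integral_finiteD)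
  have gh: "g holomorphic_on \<D>" using g by (simp add: H_infinity_def)
  obtain M where M: "M > 0" "\<And>z. norm z < 1 \<Longrightarrow> norm (g z) \<le> M" using H_infinityD[OF g] by blast
  obtain C where C: "C > 0" "\<And>f a. f holomorphic_on \<D> \<Longrightarrow> Besov_integral p f \<le> ennreal K \<Longrightarrow> norm a < 1 \<Longrightarrow>
      Q_integral s (deriv f) a \<le> ennreal C"
    using Besov_Q_embedding[OF p s(1,3) K] by blast
  have "Q_integral s (deriv (integral_op g f)) a \<le> ennreal (M\<^sup>2 * C)" if "a \<in> \<D>" for a
  proof -
    have a: "norm a < 1" using that by simp
    have "Q_integral s (deriv (integral_op g f)) a = Q_integral s (\<lambda>z. g z * deriv f z) a"
      by (intro Q_integral_cong integral_op_deriv gh f)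
    also have "\<dots> \<le> ennreal (M\<^sup>2) * Q_integral s (deriv f) a"
      using M by (intro Q_integral_bounded_mult measurable_disc_deriv f a s) auto
    also have "\<dots> \<le> ennreal (M\<^sup>2) * ennreal C" by (intro mult_left_mono C f fK a) simp
    finally show ?thesis using C(1) by (simp add: ennreal_mult)
  qed
  then show "integral_op g f \<in> Q_space s"
    unfolding Q_space_iff[OF s(1,2)] using integral_op_deriv(1)[OF gh f] by blast
qed

text \<open>The two lower bounds on \<alpha> have separate purposes: 1/2 < \<alpha> makes the
  exponent 2 \<alpha> of the Carleson embedding exceed 1, and 1 / p' \<le> \<alpha> lets
  \<open>disc_log a powr \<alpha>\<close> dominate the growth of \<open>f\<close>.\<close>

lemma mult_op_sufficient:
  assumes p: "1 < p" "1 / p + 1 / p' = 1" and s: "0 < s" "s \<le> 1" "2 < p \<Longrightarrow> 1 - 2 / p < s"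
    and \<alpha>: "1/2 < \<alpha>" "1 / p' \<le> \<alpha>" and g: "g \<in> Q_log_space s \<alpha>" "g \<in> H_infinity"
  shows "maps_into (mult_op g) (Besov_space p) (Q_space s)"
  unfolding maps_into_def
proof (rule image_subsetI)
  fix f assume "f \<in> Besov_space p"
  then obtain K where K: "0 \<le> K" and f: "f holomorphic_on \<D>" and fK: "Besov_integral p f \<le> ennreal K"
    by (rule Besov_integral_finiteD)
  have gh: "g holomorphic_on \<D>" using g by (simp add: H_infinity_def)
  note [measurable] = measurable_disc_deriv[OF gh] measurable_disc_deriv[OF f] measurable_disc_holomorphic[OF f] measurable_disc_holomorphic[OF gh]
  obtain M where M: "M > 0" "\<And>z. norm z < 1 \<Longrightarrow> norm (g z) \<le> M" using H_infinityD[OF g(2)] by blast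
  obtain Cf where Cf: "Cf > 0" "\<And>f a. f holomorphic_on \<D> \<Longrightarrow> Besov_integral p f \<le> ennreal K \<Longrightarrow> norm a < 1 \<Longrightarrow>
      Q_integral s (deriv f) a \<le> ennreal Cf"
    using Besov_Q_embedding[OF p(1) s(1,3) K] by blast
  obtain Cg where Cg: "Cg \<ge> 0" "\<And>a. norm a < 1 \<Longrightarrow> ennreal (disc_log a powr (2 * \<alpha>)) * Q_integral s (deriv g) a \<le> ennreal Cg"
  proof (rule ennreal_nonneg_bound)
    show "\<exists>C. \<forall>a\<in>\<D>. ennreal (disc_log a powr (2 * \<alpha>)) * Q_integral s (deriv g) a \<le> ennreal C"
      using g(1) by (simp add: Q_log_space_iff)
  qed blast
  obtain C0 where C0: "C0 > 0" "\<And>f z. f holomorphic_on \<D> \<Longrightarrow> Besov_integral p f \<le> ennreal K \<Longrightarrow> norm z < 1 \<Longrightarrow>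
      norm (f z - f 0) \<le> C0 * disc_log z powr (1 / p')"
    using Besov_growth[OF p K] by blast
  have \<alpha>2: "1 < 2 * \<alpha>" using \<alpha> by simp
  obtain CO where CO: "CO \<ge> 0" "\<And>a. norm a < 1 \<Longrightarrow>
      (\<integral>\<^sup>+z. ennreal ((norm (deriv g z))\<^sup>2 * (norm (f z - f a))\<^sup>2 * moebius_weight s a z) \<partial>\<lambda>\<D>) \<le> ennreal CO"
    using multiplier_oscillation_bound[OF gh s(1) \<alpha>2 Cg f less_imp_le[OF Cf(1)] Cf(2)[OF f fK]] by blast
  \<comment> \<open>Both the constant f(0) and the power 1 / p' of \<open>disc_log a\<close> are
    raised to the power \<alpha>; because \<open>disc_log\<close> is at least \<open>ln 2\<close>,
    this costs only powers of \<open>ln 2\<close>.\<close>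
  define G where "G = norm (f 0) * ln 2 powr (- \<alpha>) + C0 * ln 2 powr (1 / p' - \<alpha>)"
  have G: "norm (f a) \<le> G * disc_log a powr \<alpha>" if a: "norm a < 1" for a
  proof -
    have L: "ln 2 \<le> disc_log a" "0 < disc_log a" using disc_log_ge[OF a] disc_log_pos[OF a] by auto
    have "disc_log a powr (1 / p' - \<alpha>) \<le> ln 2 powr (1 / p' - \<alpha>)" using L \<alpha> by (intro powr_mono2') auto
    then have "disc_log a powr (1 / p' - \<alpha>) * disc_log a powr \<alpha> \<le> ln 2 powr (1 / p' - \<alpha>) * disc_log a powr \<alpha>"
      by (rule mult_right_mono) simp
    then have 1: "disc_log a powr (1 / p') \<le> ln 2 powr (1 / p' - \<alpha>) * disc_log a powr \<alpha>"
      by (simp add: powr_add[symmetric])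
    have "disc_log a powr (- \<alpha>) \<le> ln 2 powr (- \<alpha>)" using L \<alpha> by (intro powr_mono2') auto
    then have "disc_log a powr (- \<alpha>) * disc_log a powr \<alpha> \<le> ln 2 powr (- \<alpha>) * disc_log a powr \<alpha>"
      by (rule mult_right_mono) simp
    then have 2: "1 \<le> ln 2 powr (- \<alpha>) * disc_log a powr \<alpha>" using L by (simp add: powr_add[symmetric])
    have "norm (f a) \<le> norm (f 0) * 1 + norm (f a - f 0)"
      using norm_triangle_ineq[of "f 0" "f a - f 0"] by simp
    also have "\<dots> \<le> norm (f 0) * (ln 2 powr (- \<alpha>) * disc_log a powr \<alpha>) + C0 * (ln 2 powr (1 / p' - \<alpha>) * disc_log a powr \<alpha>)"
      using 2 order_trans[OF C0(2)[OF f fK a] mult_left_mono[OF 1]] C0(1) by (intro add_mono mult_left_mono) auto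
    also have "\<dots> = G * disc_log a powr \<alpha>" by (simp add: G_def algebra_simps)
    finally show ?thesis .
  qed
  have "Q_integral s (deriv (mult_op g f)) a \<le> ennreal (2 * (2 * CO + 2 * G\<^sup>2 * Cg) + 2 * (M\<^sup>2 * Cf))" if "a \<in> \<D>" for a
  proof -
    have a: "norm a < 1" using that by simp
    note [measurable] = moebius_weight_measurable[OF a]
    have 1: "Q_integral s (\<lambda>z. deriv g z * f z) a \<le> ennreal (2 * CO + 2 * G\<^sup>2 * Cg)"
    proof -
      have "Q_integral s (\<lambda>z. deriv g z * f z) a
        \<le> (\<integral>\<^sup>+z. ennreal 2 * ennreal ((norm (deriv g z))\<^sup>2 * (norm (f z - f a))\<^sup>2 * moebius_weight s a z)
          + ennreal (2 * G\<^sup>2) * (ennreal (disc_log a powr (2 * \<alpha>)) * ennreal ((norm (deriv g z))\<^sup>2 * moebius_weight s a z)) \<partial>\<lambda>\<D>)"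
        unfolding Q_integral_def
      proof (rule nn_integral_mono)
        fix z assume "z \<in> space \<lambda>\<D>"
        then have w: "0 \<le> moebius_weight s a z" using moebius_weight_bounds[OF a _ s(1)] by simp
        have "(norm (f a))\<^sup>2 \<le> (G * disc_log a powr \<alpha>)\<^sup>2" using G[OF a] by (intro power_mono) auto
        also have "\<dots> = G\<^sup>2 * disc_log a powr (2 * \<alpha>)"
          by (simp add: power_mult_distrib power2_eq_square powr_add[symmetric])
        finally have "(norm (f z))\<^sup>2 \<le> 2 * (norm (f z - f a))\<^sup>2 + 2 * (G\<^sup>2 * disc_log a powr (2 * \<alpha>))"
          using norm_add_square_le[of "f z - f a" "f a"] by simp
        then have "(norm (f z))\<^sup>2 * ((norm (deriv g z))\<^sup>2 * moebius_weight s a z)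
          \<le> (2 * (norm (f z - f a))\<^sup>2 + 2 * (G\<^sup>2 * disc_log a powr (2 * \<alpha>))) * ((norm (deriv g z))\<^sup>2 * moebius_weight s a z)"
          using w by (intro mult_right_mono) auto
        then have "ennreal ((norm (deriv g z * f z))\<^sup>2 * moebius_weight s a z)
          \<le> ennreal (2 * ((norm (deriv g z))\<^sup>2 * (norm (f z - f a))\<^sup>2 * moebius_weight s a z)
            + 2 * G\<^sup>2 * (disc_log a powr (2 * \<alpha>) * ((norm (deriv g z))\<^sup>2 * moebius_weight s a z)))"
          by (intro ennreal_leI) (simp add: norm_mult power_mult_distrib algebra_simps)
        also have "\<dots> = ennreal 2 * ennreal ((norm (deriv g z))\<^sup>2 * (norm (f z - f a))\<^sup>2 * moebius_weight s a z)
          + ennreal (2 * G\<^sup>2) * ennreal (disc_log a powr (2 * \<alpha>) * ((norm (deriv g z))\<^sup>2 * moebius_weight s a z))"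
          using w by (intro ennreal_mult_add) auto
        also have "ennreal (disc_log a powr (2 * \<alpha>) * ((norm (deriv g z))\<^sup>2 * moebius_weight s a z))
          = ennreal (disc_log a powr (2 * \<alpha>)) * ennreal ((norm (deriv g z))\<^sup>2 * moebius_weight s a z)"
          using w by (intro ennreal_mult) auto
        finally show "ennreal ((norm (deriv g z * f z))\<^sup>2 * moebius_weight s a z)
          \<le> ennreal 2 * ennreal ((norm (deriv g z))\<^sup>2 * (norm (f z - f a))\<^sup>2 * moebius_weight s a z)
            + ennreal (2 * G\<^sup>2) * (ennreal (disc_log a powr (2 * \<alpha>)) * ennreal ((norm (deriv g z))\<^sup>2 * moebius_weight s a z))" .
      qed
      also have "\<dots> = ennreal 2 * (\<integral>\<^sup>+z. ennreal ((norm (deriv g z))\<^sup>2 * (norm (f z - f a))\<^sup>2 * moebius_weight s a z) \<partial>\<lambda>\<D>)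
        + ennreal (2 * G\<^sup>2) * (ennreal (disc_log a powr (2 * \<alpha>)) * Q_integral s (deriv g) a)"
        unfolding Q_integral_def by (simp add: nn_integral_add nn_integral_cmult)
      also have "\<dots> \<le> ennreal 2 * ennreal CO + ennreal (2 * G\<^sup>2) * ennreal Cg"
        by (intro add_mono mult_left_mono CO Cg a) auto
      also have "\<dots> = ennreal (2 * CO + 2 * G\<^sup>2 * Cg)" using CO(1) Cg(1) by (intro ennreal_mult_add[symmetric]) auto
      finally show ?thesis .
    qed
    have 2: "Q_integral s (\<lambda>z. g z * deriv f z) a \<le> ennreal (M\<^sup>2 * Cf)"
    proof -
      have "Q_integral s (\<lambda>z. g z * deriv f z) a \<le> ennreal (M\<^sup>2) * Q_integral s (deriv f) a"
        using M by (intro Q_integral_bounded_mult measurable_disc_deriv f a s) auto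
      also have "\<dots> \<le> ennreal (M\<^sup>2) * ennreal Cf" by (intro mult_left_mono Cf f fK a) simp
      finally show ?thesis using Cf(1) by (simp add: ennreal_mult)
    qed
    have "Q_integral s (deriv (mult_op g f)) a = Q_integral s (\<lambda>z. deriv g z * f z + g z * deriv f z) a"
      by (intro Q_integral_cong deriv_mult_op gh f)
    also have "\<dots> \<le> ennreal 2 * Q_integral s (\<lambda>z. deriv g z * f z) a + ennreal 2 * Q_integral s (\<lambda>z. g z * deriv f z) a"
      by (intro Q_integral_add_le a s) measurable
    also have "\<dots> \<le> ennreal 2 * ennreal (2 * CO + 2 * G\<^sup>2 * Cg) + ennreal 2 * ennreal (M\<^sup>2 * Cf)"
      by (intro add_mono mult_left_mono 1 2) auto
    also have "\<dots> = ennreal (2 * (2 * CO + 2 * G\<^sup>2 * Cg) + 2 * (M\<^sup>2 * Cf))"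
      using CO(1) Cg(1) Cf(1) by (intro ennreal_mult_add[symmetric]) auto
    finally show ?thesis .
  qed
  then show "mult_op g f \<in> Q_space s"
    unfolding Q_space_iff[OF s(1,2)] using mult_op_holomorphic[OF gh f] by blast
qed

section \<open>Uniform boundedness\<close>

lemma powr_add_le:
  fixes x y p :: real
  assumes "0 \<le> x" "0 \<le> y" "0 \<le> p"
  shows "(x + y) powr p \<le> 2 powr p * (x powr p + y powr p)"
proof -
  have "(x + y) powr p \<le> (2 * max x y) powr p" using assms by (intro powr_mono2) auto
  also have "\<dots> = 2 powr p * max x y powr p" by (rule powr_mult)
  also have "max x y powr p \<le> x powr p + y powr p" by (auto simp: max_def)
  finally show ?thesis by (simp add: mult_left_mono)
qed

text \<open>Young's inequality in tangent form: the power function lies above its tangent line at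
  \<open>X\<close>.\<close>

lemma powr_tangent_le:
  fixes x X p :: real
  assumes p: "1 < p" and "0 \<le> x" "0 \<le> X"
  shows "p * X powr (p - 1) * x \<le> x powr p + (p - 1) * X powr p"
proof -
  define q where "q = p / (p - 1)"
  have q: "q > 1" "1 / p + 1 / q = 1" "(p - 1) * q = p" using p by (auto simp: q_def field_simps)
  have "x * X powr (p - 1) \<le> x powr p / p + (X powr (p - 1)) powr q / q"
    using p q assms by (intro Youngs_inequality) auto
  also have "(X powr (p - 1)) powr q = X powr p" by (simp add: powr_powr q)
  finally have "p * (x * X powr (p - 1)) \<le> p * (x powr p / p + X powr p / q)"
    using p by (intro mult_left_mono) auto
  also have "\<dots> = x powr p + (p - 1) * X powr p" using p by (simp add: q_def distrib_left)
  finally show ?thesis by (simp add: mult_ac)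
qed

text \<open>Jensen's inequality by summing the tangent inequalities at the mean \<open>X\<close>.
  Total weight at most 1 is enough because the leftover term (p - 1) X^p is nonnegative; this suits
  partial sums of a convex series.\<close>

lemma sum_powr_le:
  fixes c x :: "'a \<Rightarrow> real" and p :: real
  assumes p: "1 < p" and c: "\<And>k. k \<in> S \<Longrightarrow> 0 \<le> c k" "sum c S \<le> 1" and x: "\<And>k. k \<in> S \<Longrightarrow> 0 \<le> x k"
  shows "(\<Sum>k\<in>S. c k * x k) powr p \<le> (\<Sum>k\<in>S. c k * x k powr p)"
proof -
  define X where "X = (\<Sum>k\<in>S. c k * x k)"
  have X: "X \<ge> 0" unfolding X_def using c x by (intro sum_nonneg) auto
  have "p * X powr (p - 1) * X = (\<Sum>k\<in>S. c k * (p * X powr (p - 1) * x k))"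
    by (subst (2) X_def) (simp add: sum_distrib_left mult_ac)
  also have "\<dots> \<le> (\<Sum>k\<in>S. c k * (x k powr p + (p - 1) * X powr p))"
    using c x X by (intro sum_mono mult_left_mono powr_tangent_le p) auto
  also have "\<dots> = (\<Sum>k\<in>S. c k * x k powr p) + (p - 1) * X powr p * sum c S"
    by (simp add: distrib_left sum.distrib sum_distrib_left sum_distrib_right mult_ac)
  also have "(p - 1) * X powr p * sum c S \<le> (p - 1) * X powr p * 1"
    using p c by (intro mult_left_mono) auto
  also have "p * X powr (p - 1) * X = p * X powr p"
    using X by (cases "X = 0") (simp_all add: powr_diff)
  finally show ?thesis by (simp add: X_def algebra_simps)
qed

lemma Besov_space_add_scaled:
  assumes p: "1 < p" and P: "P \<in> Besov_space p" and f: "f \<in> Besov_space p"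
  shows "(\<lambda>z. P z + of_real c * f z) \<in> Besov_space p"
proof -
  have Ph: "P holomorphic_on \<D>" "Besov_integral p P < top" and fh: "f holomorphic_on \<D>" "Besov_integral p f < top"
    using P f by (auto simp: Besov_space_iff)
  note [measurable] = measurable_disc_deriv[OF Ph(1)] measurable_disc_deriv[OF fh(1)]
  have h: "(\<lambda>z. P z + of_real c * f z) holomorphic_on \<D>" using Ph fh by (intro holomorphic_intros)
  have d: "deriv (\<lambda>z. P z + of_real c * f z) z = deriv P z + of_real c * deriv f z" if "norm z < 1" for z
  proof -
    have "(P has_field_derivative deriv P z) (at z)" "(f has_field_derivative deriv f z) (at z)"
      using that Ph fh by (auto intro!: holomorphic_derivI[of _ \<D>])
    then show ?thesis by (intro DERIV_imp_deriv) (auto intro!: derivative_eq_intros)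
  qed
  have "Besov_integral p (\<lambda>z. P z + of_real c * f z)
    \<le> (\<integral>\<^sup>+z. ennreal (2 powr p) * ennreal ((1 - norm z) powr (p - 2) * norm (deriv P z) powr p)
      + ennreal (2 powr p * \<bar>c\<bar> powr p) * ennreal ((1 - norm z) powr (p - 2) * norm (deriv f z) powr p) \<partial>\<lambda>\<D>)"
    unfolding Besov_integral_def
  proof (rule nn_integral_mono)
    fix z assume "z \<in> space \<lambda>\<D>"
    then have z: "norm z < 1" by simp
    have "norm (deriv P z + of_real c * deriv f z) \<le> norm (deriv P z) + \<bar>c\<bar> * norm (deriv f z)"
      using norm_triangle_ineq[of "deriv P z" "of_real c * deriv f z"] by (simp add: norm_mult)
    then have "norm (deriv P z + of_real c * deriv f z) powr p \<le> (norm (deriv P z) + \<bar>c\<bar> * norm (deriv f z)) powr p"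
      using p by (intro powr_mono2) auto
    also have "\<dots> \<le> 2 powr p * (norm (deriv P z) powr p + (\<bar>c\<bar> * norm (deriv f z)) powr p)"
      using p by (intro powr_add_le) auto
    also have "(\<bar>c\<bar> * norm (deriv f z)) powr p = \<bar>c\<bar> powr p * norm (deriv f z) powr p" by (rule powr_mult)
    finally have "(1 - norm z) powr (p - 2) * norm (deriv P z + of_real c * deriv f z) powr p
      \<le> (1 - norm z) powr (p - 2) * (2 powr p * (norm (deriv P z) powr p + \<bar>c\<bar> powr p * norm (deriv f z) powr p))"
      by (intro mult_left_mono) auto
    then have "ennreal ((1 - norm z) powr (p - 2) * norm (deriv P z + of_real c * deriv f z) powr p)
      \<le> ennreal (2 powr p * ((1 - norm z) powr (p - 2) * norm (deriv P z) powr p)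
        + 2 powr p * \<bar>c\<bar> powr p * ((1 - norm z) powr (p - 2) * norm (deriv f z) powr p))"
      by (intro ennreal_leI) (simp add: algebra_simps)
    also have "\<dots> = ennreal (2 powr p) * ennreal ((1 - norm z) powr (p - 2) * norm (deriv P z) powr p)
      + ennreal (2 powr p * \<bar>c\<bar> powr p) * ennreal ((1 - norm z) powr (p - 2) * norm (deriv f z) powr p)"
      by (intro ennreal_mult_add) auto
    finally show "ennreal ((1 - norm z) powr (p - 2) * norm (deriv (\<lambda>z. P z + of_real c * f z) z) powr p) \<le> \<dots>"
      by (simp only: d[OF z])
  qed
  also have "\<dots> = ennreal (2 powr p) * Besov_integral p P + ennreal (2 powr p * \<bar>c\<bar> powr p) * Besov_integral p f"
    unfolding Besov_integral_def by (simp add: nn_integral_add nn_integral_cmult)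
  also have "\<dots> < top" using Ph fh by (simp add: ennreal_mult_less_top)
  finally show ?thesis using h by (simp add: Besov_space_iff)
qed

text \<open>The integral does not see constants; the condition at 0 is what makes these functions
  locally bounded. With the bound 1 no p-th root has to be taken.\<close>

definition Besov_ball :: "real \<Rightarrow> (complex \<Rightarrow> complex) set"
  where "Besov_ball p = {f. f holomorphic_on \<D> \<and> Besov_integral p f \<le> 1 \<and> norm (f 0) \<le> 1}"

lemma Besov_ball_locally_bounded:
  assumes p: "1 < p" and r: "0 < r" "r < 1"
  obtains K where "K > 0"
    "\<And>f z. f \<in> Besov_ball p \<Longrightarrow> norm z \<le> r \<Longrightarrow> norm (f z) \<le> K \<and> norm (deriv f z) \<le> K"
proof -
  obtain B where B: "B > 0" "\<And>f z. f holomorphic_on \<D> \<Longrightarrow> Besov_integral p f \<le> ennreal 1 \<Longrightarrow> norm z < 1 \<Longrightarrow>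
      norm (deriv f z) \<le> B / (1 - norm z)"
    using Besov_Bloch[OF p, of 1] by auto
  define M where "M = B / (1 - r)"
  have M: "M > 0" using B r by (simp add: M_def)
  show ?thesis
  proof (rule that[of "1 + M"])
    show "1 + M > 0" using M by simp
    fix f and z :: complex assume f: "f \<in> Besov_ball p" and z: "norm z \<le> r"
    have fh: "f holomorphic_on \<D>" and f1: "Besov_integral p f \<le> ennreal 1" and f0: "norm (f 0) \<le> 1"
      using f by (auto simp: Besov_ball_def)
    have d: "norm (deriv f w) \<le> M" if "norm w \<le> r" for w
    proof -
      have "norm (deriv f w) \<le> B / (1 - norm w)" using that r by (intro B fh f1) auto
      also have "\<dots> \<le> M" unfolding M_def using that r B(1) by (intro divide_left_mono) auto
      finally show ?thesis .
    qed
    have "norm (f z - f 0) \<le> M * norm (z - 0)"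
    proof (rule field_differentiable_bound[of "cball 0 r" f "deriv f"])
      fix w :: complex assume "w \<in> cball 0 r"
      then have w: "norm w \<le> r" by simp
      then have "(f has_field_derivative deriv f w) (at w)"
        using r by (intro holomorphic_derivI[OF fh]) auto
      then show "(f has_field_derivative deriv f w) (at w within cball 0 r)"
        by (rule has_field_derivative_at_within)
      show "norm (deriv f w) \<le> M" by (rule d[OF w])
    qed (use z r in auto)
    also have "\<dots> \<le> M * 1" using M z r by (intro mult_left_mono) auto
    finally have "norm (f z) \<le> 1 + M" using f0 norm_triangle_ineq[of "f 0" "f z - f 0"] by simp
    then show "norm (f z) \<le> 1 + M \<and> norm (deriv f z) \<le> 1 + M" using d[OF z] by simp
  qed
qed

text \<open>The completeness that the gliding hump needs: the Weierstrass test gives locally uniform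
  convergence and with it convergence of the derivatives, \<open>sum_powr_le\<close> bounds the
  partial sums, and Fatou's lemma passes to the limit.\<close>

lemma Besov_ball_series:
  assumes p: "1 < p" and f: "\<And>k. f k \<in> Besov_ball p" and c: "\<And>k. 0 \<le> c k" "summable c" "suminf c \<le> 1"
  defines "P \<equiv> \<lambda>n z. \<Sum>k<n. of_real (c k) * f k z"
  obtains F where "F \<in> Besov_ball p"
    "\<And>z. norm z < 1 \<Longrightarrow> (\<lambda>n. P n z) \<longlonglongrightarrow> F z"
    "\<And>z. norm z < 1 \<Longrightarrow> (\<lambda>n. deriv (P n) z) \<longlonglongrightarrow> deriv F z"
proof -
  define F where "F z = (\<Sum>k. of_real (c k) * f k z)" for z
  have fh: "f k holomorphic_on \<D>" for k using f[of k] by (simp add: Besov_ball_def)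
  have Ph: "P n holomorphic_on \<D>" for n unfolding P_def using fh by (intro holomorphic_intros)
  have sumc: "sum c S \<le> 1" if "finite S" for S
    using sum_le_suminf[OF c(2) that] c by auto
  have ul: "uniform_limit (ball 0 r) P F sequentially" if r: "0 < r" "r < 1" for r
  proof -
    obtain K where K: "K > 0"
      "\<And>f z. f \<in> Besov_ball p \<Longrightarrow> norm z \<le> r \<Longrightarrow> norm (f z) \<le> K \<and> norm (deriv f z) \<le> K"
      using Besov_ball_locally_bounded[OF p r] by blast
    show ?thesis unfolding P_def F_def
    proof (rule Weierstrass_m_test)
      show "summable (\<lambda>k. c k * K)" using c(2) by (rule summable_mult2)
      fix k and z :: complex assume "z \<in> ball 0 r"
      then show "norm (of_real (c k) * f k z) \<le> c k * K"
        using K(2)[OF f, of z k] c(1)[of k] by (auto simp: norm_mult intro: mult_left_mono)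
    qed
  qed
  have Fh: "F holomorphic_on \<D>"
  proof (rule holomorphic_uniform_sequence[where f = P])
    show "open \<D>" by simp
    show "P n holomorphic_on \<D>" for n by (rule Ph)
    fix x :: complex assume "x \<in> \<D>"
    then have x: "norm x < 1" by simp
    \<comment> \<open>A third of the distance leaves room twice: \<open>cball x d\<close> stays
      inside \<open>ball 0 (1 - d)\<close>, a smaller concentric disc on which convergence is
      uniform.\<close>
    define d where "d = (1 - norm x) / 3"
    have d: "d > 0" using x by (simp add: d_def)
    have d1: "0 < 1 - d" unfolding d_def using norm_ge_zero[of x] by (simp add: field_simps) (smt (verit) norm_ge_zero)
    have sub: "cball x d \<subseteq> ball 0 (1 - d)"
    proof
      fix y assume "y \<in> cball x d"
      then have "norm y \<le> norm x + d" using norm_triangle_ineq[of x "y - x"] by (simp add: dist_norm norm_minus_commute)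
      then show "y \<in> ball 0 (1 - d)" using d x by (simp add: d_def field_simps)
    qed
    moreover have "ball 0 (1 - d) \<subseteq> \<D>" using d by (intro subset_ball) auto
    moreover have "uniform_limit (cball x d) P F sequentially"
      using d d1 by (intro uniform_limit_on_subset[OF ul sub]) simp_all
    ultimately show "\<exists>d. 0 < d \<and> cball x d \<subseteq> \<D> \<and> uniform_limit (cball x d) P F sequentially"
      using d by blast
  qed
  have lim: "(\<lambda>n. P n z) \<longlonglongrightarrow> F z" and dlim: "(\<lambda>n. deriv (P n) z) \<longlonglongrightarrow> deriv F z" if z: "norm z < 1" for z
  proof -
    define r where "r = (1 + norm z) / 2"
    have r: "0 < r" "r < 1" "norm z < r" using z by (auto simp: r_def add_pos_nonneg)
    show "(\<lambda>n. P n z) \<longlonglongrightarrow> F z" using tendsto_uniform_limitI[OF ul[OF r(1,2)]] r by simp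
    show "(\<lambda>n. deriv (P n) z) \<longlonglongrightarrow> deriv F z"
    proof (rule deriv_complex_uniform_limit[OF ul[OF r(1,2)]])
      show "\<forall>\<^sub>F n in sequentially. P n holomorphic_on ball 0 r"
        using r by (intro always_eventually allI holomorphic_on_subset[OF Ph] subset_ball) auto
    qed (use r in auto)
  qed
  have dP: "deriv (P n) z = (\<Sum>k<n. of_real (c k) * deriv (f k) z)" if z: "norm z < 1" for n z
  proof -
    have "(f k has_field_derivative deriv (f k) z) (at z)" for k
      using fh z by (intro holomorphic_derivI[of _ \<D>]) auto
    then show ?thesis unfolding P_def
      by (intro DERIV_imp_deriv) (auto intro!: derivative_eq_intros simp: mult.commute)
  qed
  note [measurable] = measurable_disc_deriv[OF fh] measurable_disc_deriv[OF Ph] measurable_disc_deriv[OF Fh]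
  let ?I = "\<lambda>u z. ennreal ((1 - norm z) powr (p - 2) * norm (deriv u z) powr p)"
  have BP: "Besov_integral p (P n) \<le> 1" for n
  proof -
    have "Besov_integral p (P n) \<le> (\<integral>\<^sup>+z. (\<Sum>k<n. ennreal (c k) * ?I (f k) z) \<partial>\<lambda>\<D>)"
      unfolding Besov_integral_def
    proof (rule nn_integral_mono)
      fix z assume "z \<in> space \<lambda>\<D>"
      then have z: "norm z < 1" by simp
      have "norm (deriv (P n) z) \<le> (\<Sum>k<n. c k * norm (deriv (f k) z))"
        unfolding dP[OF z] using c(1) by (intro sum_norm_le) (simp add: norm_mult)
      then have "norm (deriv (P n) z) powr p \<le> (\<Sum>k<n. c k * norm (deriv (f k) z)) powr p"
        using p by (intro powr_mono2) auto
      also have "\<dots> \<le> (\<Sum>k<n. c k * norm (deriv (f k) z) powr p)"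
        using c(1) sumc by (intro sum_powr_le p) auto
      finally have "(1 - norm z) powr (p - 2) * norm (deriv (P n) z) powr p
        \<le> (1 - norm z) powr (p - 2) * (\<Sum>k<n. c k * norm (deriv (f k) z) powr p)"
        by (intro mult_left_mono) auto
      also have "\<dots> = (\<Sum>k<n. c k * ((1 - norm z) powr (p - 2) * norm (deriv (f k) z) powr p))"
        by (simp add: sum_distrib_left mult_ac)
      finally have "?I (P n) z \<le> ennreal (\<Sum>k<n. c k * ((1 - norm z) powr (p - 2) * norm (deriv (f k) z) powr p))"
        by (rule ennreal_leI)
      also have "\<dots> = (\<Sum>k<n. ennreal (c k) * ?I (f k) z)"
        using c(1) by (subst sum_ennreal[symmetric]) (auto simp: ennreal_mult)
      finally show "?I (P n) z \<le> (\<Sum>k<n. ennreal (c k) * ?I (f k) z)" .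
    qed
    also have "\<dots> = (\<Sum>k<n. ennreal (c k) * Besov_integral p (f k))"
      unfolding Besov_integral_def by (simp add: nn_integral_sum nn_integral_cmult)
    also have "\<dots> \<le> (\<Sum>k<n. ennreal (c k) * 1)"
      using f by (intro sum_mono mult_left_mono) (auto simp: Besov_ball_def)
    also have "\<dots> = ennreal (\<Sum>k<n. c k)" using c(1) by (simp add: sum_ennreal)
    also have "\<dots> \<le> 1" using sumc[of "{..<n}"] by simp
    finally show ?thesis .
  qed
  have "Besov_integral p F = (\<integral>\<^sup>+z. liminf (\<lambda>n. ?I (P n) z) \<partial>\<lambda>\<D>)"
    unfolding Besov_integral_def
  proof (rule nn_integral_cong)
    fix z assume "z \<in> space \<lambda>\<D>"
    then have "(\<lambda>n. deriv (P n) z) \<longlonglongrightarrow> deriv F z" using dlim by simp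
    then have "(\<lambda>n. norm (deriv (P n) z) powr p) \<longlonglongrightarrow> norm (deriv F z) powr p"
      using p by (intro tendsto_powr2 tendsto_norm tendsto_const) auto
    then have "(\<lambda>n. ?I (P n) z) \<longlonglongrightarrow> ?I F z"
      by (intro tendsto_ennrealI tendsto_mult tendsto_const)
    then show "?I F z = liminf (\<lambda>n. ?I (P n) z)"
      using lim_imp_Liminf[OF trivial_limit_sequentially] by metis
  qed
  also have "\<dots> \<le> liminf (\<lambda>n. \<integral>\<^sup>+z. ?I (P n) z \<partial>\<lambda>\<D>)" by (rule nn_integral_liminf) measurable
  also have "\<dots> \<le> liminf (\<lambda>n. 1)"
    using BP by (intro Liminf_mono always_eventually) (simp add: Besov_integral_def)
  finally have BF: "Besov_integral p F \<le> 1" by (simp add: Liminf_const)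
  have "norm (F 0) \<le> 1"
  proof (rule tendsto_upperbound[OF tendsto_norm[OF lim]])
    have "norm (P n 0) \<le> 1" for n
    proof -
      have "norm (P n 0) \<le> (\<Sum>k<n. c k * 1)" unfolding P_def
        using f c(1) by (intro sum_norm_le) (auto simp: norm_mult Besov_ball_def mult_left_le)
      then show ?thesis using sumc[of "{..<n}"] by simp
    qed
    then show "\<forall>\<^sub>F n in sequentially. norm (P n 0) \<le> 1" by simp
  qed auto
  then have "F \<in> Besov_ball p" using Fh BF by (simp add: Besov_ball_def)
  from that[OF this lim dlim] show ?thesis .
qed

lemma Besov_ball_subset: "f \<in> Besov_ball p \<Longrightarrow> f \<in> Besov_space p"
  by (auto simp: Besov_ball_def Besov_space_iff intro: le_less_trans)

lemma sum_geometric_tail_le: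
  fixes c :: "nat \<Rightarrow> real"
  assumes c: "\<And>k. 0 \<le> c k" "\<And>k. c (Suc k) \<le> c k / 2" and "m \<le> N"
  shows "(\<Sum>k\<in>{m..<N}. c k) \<le> 2 * c m - 2 * c N"
  using \<open>m \<le> N\<close>
proof (induction N rule: dec_induct)
  case (step N)
  then show ?case using c(2)[of N] by simp
qed simp

text \<open>A gliding hump: the uniform boundedness principle for the operators
  \<open>f \<mapsto> u f + v f'\<close>, with the supremum over \<open>a\<close> and over truncations to smaller discs as the
  family of seminorms.\<close>

lemma Besov_uniform_bound:
  fixes u v :: "complex \<Rightarrow> complex"
  assumes p: "1 < p" and s: "0 < s" and u: "u holomorphic_on \<D>" and v: "v holomorphic_on \<D>"
    and H: "\<And>f. f \<in> Besov_space p \<Longrightarrow> \<exists>C. \<forall>a\<in>\<D>. Q_integral s (\<lambda>z. u z * f z + v z * deriv f z) a \<le> ennreal C"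
  obtains C where "C \<ge> 0"
    "\<And>f a. f \<in> Besov_ball p \<Longrightarrow> norm a < 1 \<Longrightarrow> Q_integral s (\<lambda>z. u z * f z + v z * deriv f z) a \<le> ennreal C"
proof (rule ccontr)
  assume contra: "\<not> thesis"
  note witness = that
  define E where "E f z = u z * f z + v z * deriv f z" for f z
  have E_meas: "E f \<in> borel_measurable \<lambda>\<D>" if "f holomorphic_on \<D>" for f
    using measurable_disc_holomorphic[OF u, measurable] measurable_disc_holomorphic[OF v, measurable]
      measurable_disc_holomorphic[OF that, measurable] measurable_disc_deriv[OF that, measurable]
    unfolding E_def[abs_def] by measurable
  define X where "X f a r = (\<integral>\<^sup>+z. ennreal ((norm (E f z))\<^sup>2 * moebius_weight s a z) * indicator (ball 0 r) z \<partial>\<lambda>\<D>)" for f a r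
  have big: "\<exists>f a r. f \<in> Besov_ball p \<and> norm a < 1 \<and> 0 < r \<and> r < 1 \<and> ennreal C < X f a r" if "C \<ge> 0" for C
  proof (rule ccontr)
    assume neg: "\<nexists>f a r. f \<in> Besov_ball p \<and> norm a < 1 \<and> 0 < r \<and> r < 1 \<and> ennreal C < X f a r"
    have "Q_integral s (\<lambda>z. u z * f z + v z * deriv f z) a \<le> ennreal C" if f: "f \<in> Besov_ball p" and a: "norm a < 1" for f a
    proof -
      have fh: "f holomorphic_on \<D>" using f by (simp add: Besov_ball_def)
      note [measurable] = E_meas[OF fh] moebius_weight_measurable[OF a]
      have "(\<integral>\<^sup>+z. ennreal ((norm (E f z))\<^sup>2 * moebius_weight s a z) \<partial>\<lambda>\<D>) \<le> ennreal C"
      proof (rule nn_integral_disc_exhaust)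
        show "(\<lambda>z. ennreal ((norm (E f z))\<^sup>2 * moebius_weight s a z)) \<in> borel_measurable \<lambda>\<D>" by measurable
        show "(\<integral>\<^sup>+z. ennreal ((norm (E f z))\<^sup>2 * moebius_weight s a z) * indicator (ball 0 r) z \<partial>\<lambda>\<D>) \<le> ennreal C"
          if "0 < r" "r < 1" for r
          using neg f a that unfolding X_def by (meson not_less)
      qed
      then show ?thesis by (simp add: Q_integral_def E_def)
    qed
    with contra witness[OF that] show False by blast
  qed
  have "\<exists>K>0. \<forall>f\<in>Besov_ball p. \<forall>z. norm z \<le> r \<longrightarrow> norm (E f z) \<le> K" if r: "0 < r" "r < 1" for r
  proof -
    obtain K where K: "K > 0"
      "\<And>f z. f \<in> Besov_ball p \<Longrightarrow> norm z \<le> r \<Longrightarrow> norm (f z) \<le> K \<and> norm (deriv f z) \<le> K"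
      using Besov_ball_locally_bounded[OF p r] by blast
    have bd: "\<exists>b>0. \<forall>z. norm z \<le> r \<longrightarrow> norm (w z) \<le> b" if w: "w holomorphic_on \<D>" for w
    proof -
      have "continuous_on (cball 0 r) w"
        using r by (intro holomorphic_on_imp_continuous_on holomorphic_on_subset[OF w]) auto
      then have "bounded (w ` cball 0 r)" by (intro compact_imp_bounded compact_continuous_image) auto
      then obtain b where "b > 0" "\<forall>y\<in>w ` cball 0 r. norm y \<le> b" unfolding bounded_pos by blast
      then show ?thesis by (intro exI[of _ b]) auto
    qed
    obtain b1 b2 where b: "b1 > 0" "\<And>z. norm z \<le> r \<Longrightarrow> norm (u z) \<le> b1" "b2 > 0" "\<And>z. norm z \<le> r \<Longrightarrow> norm (v z) \<le> b2"
      using bd[OF u] bd[OF v] by blast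
    have "norm (E f z) \<le> b1 * K + b2 * K" if f: "f \<in> Besov_ball p" and z: "norm z \<le> r" for f z
    proof -
      have "norm (E f z) \<le> norm (u z) * norm (f z) + norm (v z) * norm (deriv f z)"
        unfolding E_def by (metis norm_mult norm_triangle_ineq)
      also have "\<dots> \<le> b1 * K + b2 * K"
        using K(2)[OF f z] b z by (intro add_mono mult_mono) (auto simp: less_imp_le)
      finally show ?thesis .
    qed
    moreover have "b1 * K + b2 * K > 0" using b K by (intro add_pos_pos mult_pos_pos) auto
    ultimately show ?thesis by blast
  qed
  then obtain \<kappa> where \<kappa>: "\<And>r. 0 < r \<Longrightarrow> r < 1 \<Longrightarrow> \<kappa> r > 0"
    "\<And>r f z. 0 < r \<Longrightarrow> r < 1 \<Longrightarrow> f \<in> Besov_ball p \<Longrightarrow> norm z \<le> r \<Longrightarrow> norm (E f z) \<le> \<kappa> r"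
    by metis
  have "\<exists>C\<ge>0. \<forall>a. norm a < 1 \<longrightarrow> Q_integral s (E P) a \<le> ennreal C" if PB: "P \<in> Besov_space p" for P
  proof -
    obtain C where "C \<ge> 0" "\<And>a. norm a < 1 \<Longrightarrow> Q_integral s (E P) a \<le> ennreal C"
      using ennreal_nonneg_bound[OF H[OF PB]] unfolding E_def[abs_def] by blast
    then show ?thesis by blast
  qed
  then obtain Bd where Bd: "\<And>P. P \<in> Besov_space p \<Longrightarrow> Bd P \<ge> 0"
    "\<And>P a. P \<in> Besov_space p \<Longrightarrow> norm a < 1 \<Longrightarrow> Q_integral s (E P) a \<le> ennreal (Bd P)"
    by metis
  \<comment> \<open>A state holds the partial sum \<open>P\<close>, the next coefficient
    \<open>c\<close>, the hump \<open>f\<close> and the place \<open>a\<close>, \<open>r\<close>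
    where it is large. The threshold is fitted to the final estimate, in which c^2 times
    \<open>X f a r\<close> is at most 2 \<open>Bd F\<close> + 4 \<open>Bd P\<close> + 4 pi for the
    limit \<open>F\<close>: the n outgrows the unknown \<open>Bd F\<close>, and 16 exceeds 4
    pi.\<close>
  define Inv where "Inv n = (\<lambda>(P, c, f, a, r). P \<in> Besov_space p \<and> (n = 0 \<longrightarrow> P = (\<lambda>_. 0)) \<and> 0 < c \<and> c \<le> (1/2) ^ Suc n \<and>
     f \<in> Besov_ball p \<and> norm a < 1 \<and> 0 < r \<and> r < 1 \<and> ennreal ((2 * real n + 4 * Bd P + 16) / c\<^sup>2) < X f a r)"
    for n :: nat
  \<comment> \<open>The next coefficient is small relative to the bound \<open>\<kappa> r\<close> of
    all humps on the current disc, and at most half of the current one. Hence all later humps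
    together change the operator value on that disc by at most 1.\<close>
  define step where "step = (\<lambda>(P, c, f, a :: complex, r) (P', c', f' :: complex \<Rightarrow> complex, a' :: complex, r' :: real).
     P' = (\<lambda>z :: complex. P z + complex_of_real c * f z) \<and> c' = c * min (1/2) (1 / (1 + \<kappa> r)))"
  have ex: "\<exists>x. Inv n (P, c, x)" if "P \<in> Besov_space p" "n = 0 \<longrightarrow> P = (\<lambda>_. 0)" "0 < c" "c \<le> (1/2) ^ Suc n" for n P c
  proof -
    have "(2 * real n + 4 * Bd P + 16) / c\<^sup>2 \<ge> 0" using Bd(1)[OF that(1)] by simp
    from big[OF this] that show ?thesis unfolding Inv_def by auto
  qed
  have zero: "(\<lambda>_. 0) \<in> Besov_space p" using p by (simp add: Besov_space_iff Besov_integral_def)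
  have "\<exists>st. \<forall>n. Inv n (st n) \<and> step (st n) (st (Suc n))"
  proof (rule dependent_nat_choice)
    have "\<exists>y. Inv 0 (\<lambda>_. 0, 1/2, y)" by (rule ex) (use zero in simp_all)
    then show "\<exists>x. Inv 0 x" by blast
    fix x n assume x: "Inv n x"
    obtain P c f a r where xx: "x = (P, c, f, a, r)" by (cases x)
    have I: "P \<in> Besov_space p" "0 < c" "c \<le> (1/2) ^ Suc n" "f \<in> Besov_ball p" "0 < r" "r < 1"
      using x by (auto simp: Inv_def xx)
    define c' where "c' = c * min (1/2) (1 / (1 + \<kappa> r))"
    have c': "0 < c'" using I \<kappa>(1)[of r] by (simp add: c'_def)
    have "c' \<le> c * (1/2)" unfolding c'_def using I by (intro mult_left_mono) auto
    then have c'2: "c' \<le> (1/2) ^ Suc (Suc n)" using I by simp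
    have P': "(\<lambda>z. P z + complex_of_real c * f z) \<in> Besov_space p"
      by (intro Besov_space_add_scaled p I Besov_ball_subset)
    obtain y where "Inv (Suc n) (\<lambda>z. P z + complex_of_real c * f z, c', y)" using ex[OF P' _ c' c'2] by blast
    moreover have "step x (\<lambda>z. P z + complex_of_real c * f z, c', y)"
      unfolding xx step_def c'_def by (cases y) simp
    ultimately show "\<exists>y. Inv (Suc n) y \<and> step x y" by blast
  qed
  then obtain st where st: "\<And>n. Inv n (st n)" "\<And>n. step (st n) (st (Suc n))" by blast
  define P where "P n = fst (st n)" for n
  define c where "c n = fst (snd (st n))" for n
  define f where "f n = fst (snd (snd (st n)))" for n
  define a where "a n = fst (snd (snd (snd (st n))))" for n
  define r where "r n = snd (snd (snd (snd (st n))))" for n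
  have stn: "st n = (P n, c n, f n, a n, r n)" for n by (simp add: P_def c_def f_def a_def r_def)
  have I: "P n \<in> Besov_space p" "0 < c n" "c n \<le> (1/2) ^ Suc n" "f n \<in> Besov_ball p" "norm (a n) < 1" "0 < r n" "r n < 1"
    "ennreal ((2 * real n + 4 * Bd (P n) + 16) / (c n)\<^sup>2) < X (f n) (a n) (r n)" for n
    using st(1)[of n] by (auto simp: Inv_def stn)
  have P0: "P 0 = (\<lambda>_. 0)" using st(1)[of 0] by (simp add: Inv_def stn)
  have S: "P (Suc n) = (\<lambda>z. P n z + complex_of_real (c n) * f n z)" "c (Suc n) = c n * min (1/2) (1 / (1 + \<kappa> (r n)))" for n
    using st(2)[of n] by (simp_all add: step_def stn)
  have Psum: "P n = (\<lambda>z. \<Sum>k<n. complex_of_real (c k) * f k z)" for n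
    by (induction n) (simp_all add: P0 S)
  have c2: "c (Suc n) \<le> c n / 2" for n
    unfolding S using I(2)[of n] mult_left_mono[of "min (1/2) (1 / (1 + \<kappa> (r n)))" "1/2" "c n"] by simp
  have geo: "(\<lambda>n. (1/2) ^ Suc n) sums (1::real)" by (rule power_half_series)
  have csum: "summable c"
    using I(2,3) by (intro summable_comparison_test'[OF sums_summable[OF geo]]) (simp add: less_imp_le)
  have c1: "suminf c \<le> 1"
    using suminf_le[OF I(3) csum sums_summable[OF geo]] sums_unique[OF geo] by simp
  obtain F where F: "F \<in> Besov_ball p"
    "\<And>z. norm z < 1 \<Longrightarrow> (\<lambda>n. P n z) \<longlonglongrightarrow> F z"
    "\<And>z. norm z < 1 \<Longrightarrow> (\<lambda>n. deriv (P n) z) \<longlonglongrightarrow> deriv F z"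
  proof (rule Besov_ball_series[OF p I(4) less_imp_le[OF I(2)] csum c1])
    fix F assume "F \<in> Besov_ball p"
      "\<And>z. norm z < 1 \<Longrightarrow> (\<lambda>n. \<Sum>k<n. complex_of_real (c k) * f k z) \<longlonglongrightarrow> F z"
      "\<And>z. norm z < 1 \<Longrightarrow> (\<lambda>n. deriv (\<lambda>z. \<Sum>k<n. complex_of_real (c k) * f k z) z) \<longlonglongrightarrow> deriv F z"
    then show thesis by (intro that[of F]) (simp_all add: Psum)
  qed
  have fh: "f k holomorphic_on \<D>" for k using I(4)[of k] by (simp add: Besov_ball_def)
  have EP: "E (P n) z = (\<Sum>k<n. complex_of_real (c k) * E (f k) z)" if z: "norm z < 1" for n z
  proof -
    have "(f k has_field_derivative deriv (f k) z) (at z)" for k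
      using fh z by (intro holomorphic_derivI[of _ \<D>]) auto
    then have "deriv (P n) z = (\<Sum>k<n. of_real (c k) * deriv (f k) z)"
      unfolding Psum by (intro DERIV_imp_deriv) (auto intro!: derivative_eq_intros simp: mult.commute)
    then show ?thesis by (simp add: E_def Psum sum_distrib_left sum.distrib algebra_simps)
  qed
  have Elim: "(\<lambda>n. E (P n) z) \<longlonglongrightarrow> E F z" if z: "norm z < 1" for z
    unfolding E_def by (intro tendsto_intros F z)
  \<comment> \<open>The coefficients after \<open>n\<close> sum to at most 2
    \<open>c (Suc n)\<close>, and \<open>c (Suc n)\<close> was chosen to be at most 1/2 divided by 1
    + \<kappa> (r n).\<close>
  have tail: "norm (E F z - E (P (Suc n)) z) \<le> 1" if z: "norm z \<le> r n" for n z
  proof (rule tendsto_upperbound)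
    have z1: "norm z < 1" using z I(7)[of n] by simp
    show "(\<lambda>N. norm (E (P N) z - E (P (Suc n)) z)) \<longlonglongrightarrow> norm (E F z - E (P (Suc n)) z)"
      by (intro tendsto_intros Elim z1)
    have "norm (E (P N) z - E (P (Suc n)) z) \<le> 1" if N: "N \<ge> Suc n" for N
    proof -
      have set_eq: "{..<N} = {..<Suc n} \<union> {Suc n..<N}" using N by auto
      have "(\<Sum>k<N. h k) = (\<Sum>k<Suc n. h k) + (\<Sum>k\<in>{Suc n..<N}. h k)" for h :: "nat \<Rightarrow> complex"
        unfolding set_eq by (rule sum.union_disjoint) auto
      then have "E (P N) z - E (P (Suc n)) z = (\<Sum>k\<in>{Suc n..<N}. complex_of_real (c k) * E (f k) z)"
        unfolding EP[OF z1] by (simp del: sum.lessThan_Suc)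
      also have "norm \<dots> \<le> (\<Sum>k\<in>{Suc n..<N}. c k * \<kappa> (r n))"
      proof (rule sum_norm_le)
        fix k
        show "norm (complex_of_real (c k) * E (f k) z) \<le> c k * \<kappa> (r n)"
          using I(2)[of k] \<kappa>(2)[OF I(6,7,4) z] by (simp add: norm_mult)
      qed
      also have "\<dots> = (\<Sum>k\<in>{Suc n..<N}. c k) * \<kappa> (r n)" by (simp add: sum_distrib_right)
      also have "\<dots> \<le> (2 * c (Suc n)) * \<kappa> (r n)"
        using sum_geometric_tail_le[of c "Suc n" N] less_imp_le[OF I(2)] c2 N \<kappa>(1)[OF I(6,7), of n]
        by (intro mult_right_mono) (auto intro: order_trans)
      also have "\<dots> \<le> (2 * (1/2 * (1 / (1 + \<kappa> (r n))))) * \<kappa> (r n)"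
      proof -
        have "c n \<le> 1/2"
        proof -
          have "c n \<le> (1/2) ^ Suc n" by (rule I)
          also have "\<dots> \<le> (1/2) ^ Suc 0" by (intro power_decreasing) auto
          finally show ?thesis by simp
        qed
        then have "c (Suc n) \<le> 1/2 * (1 / (1 + \<kappa> (r n)))"
          unfolding S using I(2)[of n] \<kappa>(1)[OF I(6,7), of n] by (intro mult_mono) auto
        then show ?thesis using \<kappa>(1)[OF I(6,7), of n] by (intro mult_right_mono mult_left_mono) auto
      qed
      also have "\<dots> \<le> 1" using \<kappa>(1)[OF I(6,7), of n] by (simp add: field_simps)
      finally show ?thesis .
    qed
    then show "\<forall>\<^sub>F N in sequentially. norm (E (P N) z - E (P (Suc n)) z) \<le> 1"
      by (auto simp: eventually_sequentially)
  qed simp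
  have FB: "F \<in> Besov_space p" by (rule Besov_ball_subset[OF F(1)])
  have Fh: "F holomorphic_on \<D>" using FB by (simp add: Besov_space_iff)
  have Ph: "P n holomorphic_on \<D>" for n using I(1)[of n] by (simp add: Besov_space_iff)
  \<comment> \<open>The stage is picked only now, after the limit \<open>F\<close> and its finite
    bound are known; the hump at stage n was built to exceed any bound below n.\<close>
  obtain n where n: "Bd F < real n" using reals_Archimedean2 by blast
  note a = I(5)[of n]
  note [measurable] = E_meas[OF Fh] E_meas[OF Ph] E_meas[OF fh] moebius_weight_measurable[OF a]
  have [measurable]: "(indicator (ball 0 t) :: complex \<Rightarrow> ennreal) \<in> borel_measurable \<lambda>\<D>" for t
    by (intro measurable_restrict_space1 borel_measurable_indicator) simp
  have cn: "c n > 0" by (rule I)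
  have "ennreal ((c n)\<^sup>2) * X (f n) (a n) (r n)
    = (\<integral>\<^sup>+z. ennreal ((c n)\<^sup>2) * (ennreal ((norm (E (f n) z))\<^sup>2 * moebius_weight s (a n) z) * indicator (ball 0 (r n)) z) \<partial>\<lambda>\<D>)"
    unfolding X_def by (rule nn_integral_cmult[symmetric]) measurable
  also have "\<dots> \<le> (\<integral>\<^sup>+z. (ennreal 2 * ennreal ((norm (E F z))\<^sup>2 * moebius_weight s (a n) z)
     + ennreal 4 * ennreal ((norm (E (P n) z))\<^sup>2 * moebius_weight s (a n) z)) + ennreal 4 * indicator \<D> z \<partial>\<lambda>\<D>)"
  proof (rule nn_integral_mono)
    fix z assume "z \<in> space \<lambda>\<D>"
    then have z: "norm z < 1" by simp
    define w where "w = moebius_weight s (a n) z"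
    have w: "0 \<le> w" "w \<le> 1" using moebius_weight_bounds[OF a z s] by (simp_all add: w_def)
    show "ennreal ((c n)\<^sup>2) * (ennreal ((norm (E (f n) z))\<^sup>2 * moebius_weight s (a n) z) * indicator (ball 0 (r n)) z)
      \<le> (ennreal 2 * ennreal ((norm (E F z))\<^sup>2 * moebius_weight s (a n) z)
         + ennreal 4 * ennreal ((norm (E (P n) z))\<^sup>2 * moebius_weight s (a n) z)) + ennreal 4 * indicator \<D> z"
    proof (cases "norm z < r n")
      case True
      \<comment> \<open>The n-th hump is what is left of \<open>F\<close> when the earlier partial
        sum and the tail \<open>T\<close> are removed; both of these are under control.\<close>
      define T where "T = E (P (Suc n)) z - E F z"
      have T: "norm T \<le> 1" using tail[of z n] True by (simp add: T_def norm_minus_commute)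
      have "complex_of_real (c n) * E (f n) z = E F z + (- E (P n) z + T)"
        by (simp add: T_def EP[OF z])
      then have "(c n)\<^sup>2 * (norm (E (f n) z))\<^sup>2 = (norm (E F z + (- E (P n) z + T)))\<^sup>2"
        by (metis norm_mult norm_of_real power2_abs power_mult_distrib)
      also have "\<dots> \<le> 2 * (norm (E F z))\<^sup>2 + 2 * (norm (- E (P n) z + T))\<^sup>2" by (rule norm_add_square_le)
      also have "(norm (- E (P n) z + T))\<^sup>2 \<le> 2 * (norm (E (P n) z))\<^sup>2 + 2 * (norm T)\<^sup>2"
        using norm_add_square_le[of "- E (P n) z" T] by simp
      also have "(norm T)\<^sup>2 \<le> 1" using T by (simp add: abs_square_le_1)
      finally have "(c n)\<^sup>2 * (norm (E (f n) z))\<^sup>2 \<le> 2 * (norm (E F z))\<^sup>2 + 4 * (norm (E (P n) z))\<^sup>2 + 4" by simp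
      then have "(c n)\<^sup>2 * (norm (E (f n) z))\<^sup>2 * w \<le> (2 * (norm (E F z))\<^sup>2 + 4 * (norm (E (P n) z))\<^sup>2 + 4) * w"
        using w by (intro mult_right_mono) auto
      also have "\<dots> = 2 * ((norm (E F z))\<^sup>2 * w) + 4 * ((norm (E (P n) z))\<^sup>2 * w) + 4 * w" by (simp add: algebra_simps)
      also have "\<dots> \<le> 2 * ((norm (E F z))\<^sup>2 * w) + 4 * ((norm (E (P n) z))\<^sup>2 * w) + 4" using w by simp
      finally have "ennreal ((c n)\<^sup>2 * (norm (E (f n) z))\<^sup>2 * w) \<le> ennreal (2 * ((norm (E F z))\<^sup>2 * w) + 4 * ((norm (E (P n) z))\<^sup>2 * w) + 4)"
        by (rule ennreal_leI)
      also have "\<dots> = ennreal (2 * ((norm (E F z))\<^sup>2 * w) + 4 * ((norm (E (P n) z))\<^sup>2 * w)) + ennreal 4"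
        using w by (intro ennreal_plus) auto
      also have "ennreal (2 * ((norm (E F z))\<^sup>2 * w) + 4 * ((norm (E (P n) z))\<^sup>2 * w))
        = ennreal 2 * ennreal ((norm (E F z))\<^sup>2 * w) + ennreal 4 * ennreal ((norm (E (P n) z))\<^sup>2 * w)"
        using w by (intro ennreal_mult_add) auto
      also have "ennreal ((c n)\<^sup>2 * (norm (E (f n) z))\<^sup>2 * w) = ennreal ((c n)\<^sup>2) * ennreal ((norm (E (f n) z))\<^sup>2 * w)"
        using w by (simp add: ennreal_mult[symmetric] mult.assoc)
      finally show ?thesis using True z by (simp add: w_def)
    qed simp
  qed
  also have "\<dots> = ennreal 2 * Q_integral s (E F) (a n) + ennreal 4 * Q_integral s (E (P n)) (a n) + ennreal 4 * (\<integral>\<^sup>+z. indicator \<D> z \<partial>\<lambda>\<D>)"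
    unfolding Q_integral_def by (simp add: nn_integral_add nn_integral_cmult)
  also have "\<dots> \<le> ennreal 2 * ennreal (Bd F) + ennreal 4 * ennreal (Bd (P n)) + ennreal 4 * ennreal (pi * 1\<^sup>2)"
    by (intro add_mono mult_left_mono Bd FB I emeasure_disc_lborel_le) auto
  also have "\<dots> = ennreal (2 * Bd F + 4 * Bd (P n)) + ennreal (4 * pi)"
    using Bd(1)[OF FB] Bd(1)[OF I(1), of n] by (subst ennreal_mult_add) (auto simp: ennreal_mult')
  also have "\<dots> = ennreal (2 * Bd F + 4 * Bd (P n) + 4 * pi)"
    using Bd(1)[OF FB] Bd(1)[OF I(1), of n] by (intro ennreal_plus[symmetric]) auto
  also have "\<dots> \<le> ennreal (2 * real n + 4 * Bd (P n) + 16)"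
    using n pi_less_4 by (intro ennreal_leI) simp
  also have "\<dots> = ennreal ((c n)\<^sup>2) * ennreal ((2 * real n + 4 * Bd (P n) + 16) / (c n)\<^sup>2)"
    using cn Bd(1)[OF I(1), of n] by (subst ennreal_mult[symmetric]) auto
  also have "\<dots> < ennreal ((c n)\<^sup>2) * X (f n) (a n) (r n)"
    using I(8)[of n] cn by (intro ennreal_mult_strict_left_mono) auto
  finally show False by simp
qed

section \<open>Uniform bounds on balls of any size, and boundedness of the symbol\<close>

lemma deriv_scale: "norm z < 1 \<Longrightarrow> f holomorphic_on \<D> \<Longrightarrow> deriv (\<lambda>z. c * f z) z = c * deriv f z"
  by (intro DERIV_imp_deriv) (auto intro!: derivative_eq_intros holomorphic_derivI[of f \<D>])

text \<open>Division by \<open>K\<close> multiplies the integral by K^(-p), and K^(-p) K \<le> 1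
  because K \<ge> 1 and p > 1; the same factor serves the value at 0.\<close>

lemma Besov_ball_scale:
  assumes f: "f holomorphic_on \<D>" and K: "1 \<le> K" and fK: "Besov_integral p f \<le> ennreal K" "norm (f 0) \<le> K" and p: "1 < p"
  shows "(\<lambda>z. of_real (1 / K) * f z) \<in> Besov_ball p"
proof -
  note [measurable] = measurable_disc_deriv[OF f]
  have "Besov_integral p (\<lambda>z. of_real (1 / K) * f z)
     = (\<integral>\<^sup>+z. ennreal ((1 / K) powr p) * ennreal ((1 - norm z) powr (p - 2) * norm (deriv f z) powr p) \<partial>\<lambda>\<D>)"
    unfolding Besov_integral_def
  proof (rule nn_integral_cong)
    fix z assume "z \<in> space \<lambda>\<D>"
    then have z: "norm z < 1" by simp
    have "norm (deriv (\<lambda>z. of_real (1 / K) * f z) z) powr p = (1 / K) powr p * norm (deriv f z) powr p"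
      unfolding deriv_scale[OF z f] norm_mult using K by (simp only: powr_mult norm_of_real) simp
    then show "ennreal ((1 - norm z) powr (p - 2) * norm (deriv (\<lambda>z. of_real (1 / K) * f z) z) powr p)
      = ennreal ((1 / K) powr p) * ennreal ((1 - norm z) powr (p - 2) * norm (deriv f z) powr p)"
      by (simp only: ennreal_mult[symmetric] powr_ge_zero mult_nonneg_nonneg mult.left_commute)
  qed
  also have "\<dots> = ennreal ((1 / K) powr p) * Besov_integral p f"
    unfolding Besov_integral_def by (rule nn_integral_cmult) measurable
  also have "\<dots> \<le> ennreal ((1 / K) powr p) * ennreal K" by (intro mult_left_mono fK) simp
  also have "\<dots> \<le> ennreal ((1 / K) powr 1) * ennreal K"
    using K p by (intro mult_right_mono ennreal_leI powr_mono') auto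
  also have "\<dots> = 1" using K by (simp add: ennreal_mult[symmetric])
  finally have "Besov_integral p (\<lambda>z. of_real (1 / K) * f z) \<le> 1" .
  moreover have "norm (of_real (1 / K) * f 0) \<le> 1" using K fK(2) by (simp add: norm_mult norm_divide field_simps)
  moreover have "(\<lambda>z. of_real (1 / K) * f z) holomorphic_on \<D>" by (intro holomorphic_intros f)
  ultimately show ?thesis by (simp add: Besov_ball_def)
qed

lemma Besov_uniform_bound':
  fixes u v :: "complex \<Rightarrow> complex"
  assumes p: "1 < p" and s: "0 < s" and u: "u holomorphic_on \<D>" and v: "v holomorphic_on \<D>"
    and H: "\<And>f. f \<in> Besov_space p \<Longrightarrow> \<exists>C. \<forall>a\<in>\<D>. Q_integral s (\<lambda>z. u z * f z + v z * deriv f z) a \<le> ennreal C"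
  obtains C where "C \<ge> 0"
    "\<And>f a. f holomorphic_on \<D> \<Longrightarrow> Besov_integral p f \<le> ennreal K \<Longrightarrow> norm (f 0) \<le> K \<Longrightarrow> norm a < 1 \<Longrightarrow>
      Q_integral s (\<lambda>z. u z * f z + v z * deriv f z) a \<le> ennreal C"
proof -
  obtain C where C: "C \<ge> 0"
    "\<And>f a. f \<in> Besov_ball p \<Longrightarrow> norm a < 1 \<Longrightarrow> Q_integral s (\<lambda>z. u z * f z + v z * deriv f z) a \<le> ennreal C"
    using Besov_uniform_bound[OF p s u v H] by blast
  define M where "M = max K 1"
  have M: "1 \<le> M" "K \<le> M" by (auto simp: M_def)
  show ?thesis
  proof (rule that[of "M\<^sup>2 * C"])
    show "M\<^sup>2 * C \<ge> 0" using C by simp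
    fix f a assume f: "f holomorphic_on \<D>" and fK: "Besov_integral p f \<le> ennreal K" "norm (f 0) \<le> K" and a: "norm (a::complex) < 1"
    define h where "h z = of_real (1 / M) * f z" for z
    have hB: "h \<in> Besov_ball p" unfolding h_def
      using fK M by (intro Besov_ball_scale f M p) (auto intro: order_trans ennreal_leI)
    have h: "h holomorphic_on \<D>" using hB by (simp add: Besov_ball_def)
    have "Q_integral s (\<lambda>z. u z * f z + v z * deriv f z) a = Q_integral s (\<lambda>z. of_real M * (u z * h z + v z * deriv h z)) a"
    proof (rule Q_integral_cong)
      fix z :: complex assume z: "norm z < 1"
      have M0: "complex_of_real M \<noteq> 0" using M by simp
      have "deriv h z = of_real (1 / M) * deriv f z" unfolding h_def by (rule deriv_scale[OF z f])
      then show "u z * f z + v z * deriv f z = of_real M * (u z * h z + v z * deriv h z)"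
        using M0 by (simp add: h_def distrib_left)
    qed
    also have "\<dots> \<le> ennreal (M\<^sup>2) * Q_integral s (\<lambda>z. u z * h z + v z * deriv h z) a"
    proof (rule Q_integral_bounded_mult)
      note [measurable] = measurable_disc_deriv[OF h] measurable_disc_holomorphic[OF h] measurable_disc_holomorphic[OF u] measurable_disc_holomorphic[OF v]
      show "(\<lambda>z. u z * h z + v z * deriv h z) \<in> borel_measurable \<lambda>\<D>" by measurable
    qed (use M a s in auto)
    also have "\<dots> \<le> ennreal (M\<^sup>2) * ennreal C" by (intro mult_left_mono C hB a) simp
    finally show "Q_integral s (\<lambda>z. u z * f z + v z * deriv f z) a \<le> ennreal (M\<^sup>2 * C)"
      using C(1) by (simp add: ennreal_mult)
  qed
qed

text \<open>The derivative of the involution is of size (1 - |a|) / |1 - cnj a z|^2, so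
  \<open>Forelli_Rudin\<close> with exponents p - 2 and p yields (1 - |a|)^(-p), which cancels
  exactly.\<close>

lemma Besov_integral_moebius:
  assumes p: "1 < p"
  obtains C where "C > 0" "\<And>a. norm a < 1 \<Longrightarrow> Besov_integral p (moebius_disc a) \<le> ennreal C"
proof -
  obtain C where C: "C > 0"
    "\<And>a. norm a < 1 \<Longrightarrow>
      (\<integral>\<^sup>+z. ennreal ((1 - norm z) powr (p - 2) / norm (1 - cnj a * z) powr (p - 2 + 2 + p)) \<partial>\<lambda>\<D>)
        \<le> ennreal (C * (1 - norm a) powr (- p))"
    using Forelli_Rudin[of "p - 2" p] p by auto
  have C2: "2 powr p * C > 0" using C by simp
  show ?thesis
  proof (rule that[OF C2])
    fix a :: complex assume a: "norm a < 1"
    let ?I = "\<lambda>z. (1 - norm z) powr (p - 2) / norm (1 - cnj a * z) powr (p - 2 + 2 + p)"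
    have "Besov_integral p (moebius_disc a) \<le> (\<integral>\<^sup>+z. ennreal (2 powr p * (1 - norm a) powr p) * ennreal (?I z) \<partial>\<lambda>\<D>)"
      unfolding Besov_integral_def
    proof (rule nn_integral_mono)
      fix z assume "z \<in> space \<lambda>\<D>"
      then have z: "norm z < 1" by simp
      define n where "n = norm (1 - cnj a * z)"
      have n: "n > 0" using one_minus_cnj_mult_nz[OF a z] by (simp add: n_def)
      have "norm (deriv (moebius_disc a) z) = (1 - (norm a)\<^sup>2) / n\<^sup>2"
        using DERIV_imp_deriv[OF moebius_has_derivative[OF a z]] norm_moebius_deriv[OF a, of z] by (simp only: n_def)
      also have "\<dots> \<le> 2 * (1 - norm a) / n\<^sup>2" by (intro divide_right_mono one_minus_norm_square_le a) simp
      finally have "norm (deriv (moebius_disc a) z) powr p \<le> (2 * (1 - norm a) / n\<^sup>2) powr p"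
        using p by (intro powr_mono2) auto
      also have "\<dots> = 2 powr p * (1 - norm a) powr p / n powr (p - 2 + 2 + p)"
      proof -
        have "(n\<^sup>2) powr p = n powr (2 * p)"
          using n by (simp add: powr_powr powr_numeral[symmetric] del: powr_numeral)
        moreover have "p - 2 + 2 + p = 2 * p" by simp
        ultimately show ?thesis by (simp only: powr_divide powr_mult)
      qed
      finally have "(1 - norm z) powr (p - 2) * norm (deriv (moebius_disc a) z) powr p
        \<le> (1 - norm z) powr (p - 2) * (2 powr p * (1 - norm a) powr p / n powr (p - 2 + 2 + p))"
        by (rule mult_left_mono) simp
      also have "\<dots> = 2 powr p * (1 - norm a) powr p * ?I z" by (simp add: n_def)
      finally show "ennreal ((1 - norm z) powr (p - 2) * norm (deriv (moebius_disc a) z) powr p)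
        \<le> ennreal (2 powr p * (1 - norm a) powr p) * ennreal (?I z)"
        by (subst ennreal_mult[symmetric]) (auto intro: ennreal_leI)
    qed
    also have "\<dots> = ennreal (2 powr p * (1 - norm a) powr p) * (\<integral>\<^sup>+z. ennreal (?I z) \<partial>\<lambda>\<D>)"
    proof (rule nn_integral_cmult)
      have [measurable]: "(\<lambda>z. 1 - cnj a * z) \<in> borel_measurable \<lambda>\<D>" by measurable
      show "(\<lambda>z. ennreal (?I z)) \<in> borel_measurable \<lambda>\<D>" by measurable
    qed
    also have "\<dots> \<le> ennreal (2 powr p * (1 - norm a) powr p) * ennreal (C * (1 - norm a) powr (- p))"
      by (intro mult_left_mono C a) auto
    also have "\<dots> = ennreal (2 powr p * C)"
      using a C(1) by (simp add: ennreal_mult[symmetric] powr_minus_divide)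
    finally show "Besov_integral p (moebius_disc a) \<le> ennreal (2 powr p * C)" .
  qed
qed

lemma moebius_self [simp]: "moebius_disc a a = 0"
  by (simp add: moebius_disc_def)

text \<open>Testing on \<open>\<phi>\<^sub>a\<close>, which vanishes at \<open>a\<close>, so that only the term with \<open>g\<close> survives there.\<close>

lemma bounded_of_operator:
  assumes p: "1 < p" and s: "0 < s" "s \<le> 1" and g: "g holomorphic_on \<D>" and u: "u holomorphic_on \<D>"
    and T: "\<And>f. f holomorphic_on \<D> \<Longrightarrow> T f holomorphic_on \<D>"
      "\<And>f z. f holomorphic_on \<D> \<Longrightarrow> norm z < 1 \<Longrightarrow> deriv (T f) z = u z * f z + g z * deriv f z"
    and maps: "maps_into T (Besov_space p) (Q_space s)"
  shows "g \<in> H_infinity"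
    "\<exists>C\<ge>0. \<forall>f a. f holomorphic_on \<D> \<longrightarrow> Besov_integral p f \<le> ennreal K \<longrightarrow> norm (f 0) \<le> K \<longrightarrow> norm a < 1 \<longrightarrow>
      Q_integral s (\<lambda>z. u z * f z + g z * deriv f z) a \<le> ennreal C"
proof -
  have H: "\<exists>C. \<forall>a\<in>\<D>. Q_integral s (\<lambda>z. u z * f z + g z * deriv f z) a \<le> ennreal C" if f: "f \<in> Besov_space p" for f
  proof -
    have fh: "f holomorphic_on \<D>" using f by (simp add: Besov_space_iff)
    have "T f \<in> Q_space s" using maps f by (auto simp: maps_into_def)
    then obtain C where "\<And>a. a \<in> \<D> \<Longrightarrow> Q_integral s (deriv (T f)) a \<le> ennreal C"
      unfolding Q_space_iff[OF s] by blast
    moreover have "Q_integral s (deriv (T f)) a = Q_integral s (\<lambda>z. u z * f z + g z * deriv f z) a" for a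
      by (rule Q_integral_cong) (rule T(2)[OF fh])
    ultimately show ?thesis by (intro exI[of _ C] ballI) simp
  qed
  have uniform: "\<exists>C\<ge>0. \<forall>f a. f holomorphic_on \<D> \<longrightarrow> Besov_integral p f \<le> ennreal K \<longrightarrow> norm (f 0) \<le> K \<longrightarrow> norm a < 1 \<longrightarrow>
      Q_integral s (\<lambda>z. u z * f z + g z * deriv f z) a \<le> ennreal C" for K
  proof (rule Besov_uniform_bound'[OF p s(1) u g H, of K])
    fix C assume C: "0 \<le> C" "\<And>f a. f holomorphic_on \<D> \<Longrightarrow> Besov_integral p f \<le> ennreal K \<Longrightarrow> norm (f 0) \<le> K \<Longrightarrow> norm a < 1 \<Longrightarrow>
      Q_integral s (\<lambda>z. u z * f z + g z * deriv f z) a \<le> ennreal C"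
    show ?thesis by (intro exI[of _ C] conjI allI impI C)
  qed
  show "\<exists>C\<ge>0. \<forall>f a. f holomorphic_on \<D> \<longrightarrow> Besov_integral p f \<le> ennreal K \<longrightarrow> norm (f 0) \<le> K \<longrightarrow> norm a < 1 \<longrightarrow>
      Q_integral s (\<lambda>z. u z * f z + g z * deriv f z) a \<le> ennreal C"
    by (rule uniform)
  obtain K0 where K0: "K0 > 0" "\<And>a. norm a < 1 \<Longrightarrow> Besov_integral p (moebius_disc a) \<le> ennreal K0"
    using Besov_integral_moebius[OF p] by blast
  define K where "K = max K0 1"
  have K: "Besov_integral p (moebius_disc a) \<le> ennreal K" "norm (moebius_disc a 0) \<le> K" if "norm a < 1" for a
    using K0(2)[OF that] that by (auto simp: K_def intro: order_trans ennreal_leI)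
  obtain C where C: "C \<ge> 0"
    "\<And>f a. f holomorphic_on \<D> \<Longrightarrow> Besov_integral p f \<le> ennreal K \<Longrightarrow> norm (f 0) \<le> K \<Longrightarrow> norm a < 1 \<Longrightarrow>
      Q_integral s (\<lambda>z. u z * f z + g z * deriv f z) a \<le> ennreal C"
    using uniform[of K] by blast
  obtain B where B: "B > 0" "\<And>f z. f holomorphic_on \<D> \<Longrightarrow> norm z < 1 \<Longrightarrow> Q_integral s (deriv f) z \<le> ennreal C \<Longrightarrow>
      norm (deriv f z) \<le> B / (1 - norm z)"
    using Q_Bloch[OF s(1) C(1)] by blast
  \<comment> \<open>At \<open>a\<close> the derivative of the image is g(a) times a number of
    modulus 1 / (1 - |a|^2). The Bloch bound has the same blow-up, so the quotient bounds g(a); the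
    2 is from 1 - |a|^2 \<le> 2 (1 - |a|).\<close>
  have "norm (g a) \<le> 2 * B" if a: "norm a < 1" for a
  proof -
    note m = moebius_holomorphic[OF a]
    have "Q_integral s (deriv (T (moebius_disc a))) a = Q_integral s (\<lambda>z. u z * moebius_disc a z + g z * deriv (moebius_disc a) z) a"
      by (rule Q_integral_cong) (rule T(2)[OF m])
    also have "\<dots> \<le> ennreal C" by (rule C(2)[OF m K(1)[OF a] K(2)[OF a] a])
    finally have "norm (deriv (T (moebius_disc a)) a) \<le> B / (1 - norm a)" by (rule B(2)[OF T(1)[OF m] a])
    moreover have "norm (deriv (T (moebius_disc a)) a) = norm (g a) * (1 / (1 - (norm a)\<^sup>2))"
    proof -
      have sq: "(norm a)\<^sup>2 < 1" using a by (simp add: abs_square_less_1)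
      have "1 - cnj a * a = of_real (1 - (norm a)\<^sup>2)"
        using complex_norm_square[of a] by (simp add: mult.commute)
      then have "norm (1 - cnj a * a) = 1 - (norm a)\<^sup>2" using sq by (simp only: norm_of_real)
      then have "norm (deriv (moebius_disc a) a) = 1 / (1 - (norm a)\<^sup>2)"
        unfolding DERIV_imp_deriv[OF moebius_has_derivative[OF a a]] norm_moebius_deriv[OF a]
        using sq by (simp add: power2_eq_square[of "1 - _"])
      then show ?thesis unfolding T(2)[OF m a] by (simp add: norm_mult)
    qed
    ultimately have "norm (g a) * (1 / (1 - (norm a)\<^sup>2)) \<le> B / (1 - norm a)" by simp
    then have "norm (g a) * (1 / (1 - (norm a)\<^sup>2)) * (1 - (norm a)\<^sup>2) \<le> B / (1 - norm a) * (2 * (1 - norm a))"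
      using a B(1) one_minus_norm_square_le[OF a] by (intro mult_mono) (auto simp: abs_square_le_1)
    moreover have "norm (g a) * (1 / d) * d = norm (g a)" if "d \<noteq> 0" for d using that by simp
    moreover have "1 - (norm a)\<^sup>2 \<noteq> 0" using a abs_square_less_1[of "norm a"] by simp
    moreover have "B / d * (2 * d) = 2 * B" if "d \<noteq> 0" for d using that by simp
    moreover have "1 - norm a \<noteq> 0" using a by simp
    ultimately show ?thesis by metis
  qed
  then have "bounded (g ` \<D>)" unfolding bounded_iff by (intro exI[of _ "2 * B"]) auto
  then show "g \<in> H_infinity" using g by (simp add: H_infinity_def)
qed

section \<open>Logarithmic test functions\<close>

text \<open>The constant \<open>ln (2 * \<kappa>)\<close> lifts the real part of the logarithm to at
  least \<open>disc_log a\<close> on the whole region |1 - cnj a z| \<le> \<kappa> (1 - |a|). The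
  prefactor normalizes the Besov integral, which without it is of order
  \<open>disc_log a\<close>.\<close>

definition log_test :: "real \<Rightarrow> real \<Rightarrow> complex \<Rightarrow> complex \<Rightarrow> complex"
  where "log_test p \<kappa> a z = of_real (disc_log a powr (- (1 / p))) * (of_real (ln (2 * \<kappa>)) - Ln (1 - cnj a * z))"

lemma one_minus_cnj_mult_Re_pos: "0 < Re (1 - cnj a * z)" if "norm a < 1" "norm z < 1"
proof -
  have "norm (cnj a * z) \<le> norm a * 1" unfolding norm_mult using that by (intro mult_mono) auto
  then show ?thesis using complex_Re_le_cmod[of "cnj a * z"] that by simp
qed

lemma log_test_has_derivative:
  assumes "norm a < 1" "norm z < 1"
  shows "(log_test p \<kappa> a has_field_derivative of_real (disc_log a powr (- (1 / p))) * (cnj a / (1 - cnj a * z))) (at z)"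
proof -
  have "1 - cnj a * z \<notin> \<real>\<^sub>\<le>\<^sub>0"
    using one_minus_cnj_mult_Re_pos[OF assms] by (auto simp: complex_nonpos_Reals_iff)
  then show ?thesis
    unfolding log_test_def[abs_def] by (auto intro!: derivative_eq_intros simp: field_simps)
qed

lemma log_test_holomorphic:
  assumes a: "norm a < 1"
  shows "log_test p \<kappa> a holomorphic_on \<D>"
proof (rule holomorphic_onI)
  fix z :: complex assume "z \<in> \<D>"
  then have "norm z < 1" by simp
  from has_field_derivative_at_within[OF log_test_has_derivative[OF a this]]
  show "log_test p \<kappa> a field_differentiable at z within \<D>" unfolding field_differentiable_def by blast
qed

text \<open>The derivative is at most the prefactor over |1 - cnj a z|. This is the critical case
  \<open>Forelli_Rudin_log\<close>, and the p-th power of the prefactor is exactly 1 /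
  \<open>disc_log a\<close>.\<close>

lemma Besov_integral_log_test:
  assumes p: "1 < p"
  obtains C where "C > 0" "\<And>a \<kappa>. norm a < 1 \<Longrightarrow> Besov_integral p (log_test p \<kappa> a) \<le> ennreal C"
proof -
  obtain C where C: "C > 0"
    "\<And>a. norm a < 1 \<Longrightarrow>
      (\<integral>\<^sup>+z. ennreal ((1 - norm z) powr (p - 2) / norm (1 - cnj a * z) powr (p - 2 + 2)) \<partial>\<lambda>\<D>)
        \<le> ennreal (C * disc_log a)"
    using Forelli_Rudin_log[of "p - 2"] p by auto
  show ?thesis
  proof (rule that[OF C(1)])
    fix a :: complex and \<kappa> assume a: "norm a < 1"
    have L: "disc_log a > 0" by (rule disc_log_pos[OF a])
    let ?I = "\<lambda>z. (1 - norm z) powr (p - 2) / norm (1 - cnj a * z) powr (p - 2 + 2)"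
    have "Besov_integral p (log_test p \<kappa> a) \<le> (\<integral>\<^sup>+z. ennreal (1 / disc_log a) * ennreal (?I z) \<partial>\<lambda>\<D>)"
      unfolding Besov_integral_def
    proof (rule nn_integral_mono)
      fix z assume "z \<in> space \<lambda>\<D>"
      then have z: "norm z < 1" by simp
      define n where "n = norm (1 - cnj a * z)"
      have n: "n > 0" using one_minus_cnj_mult_nz[OF a z] by (simp add: n_def)
      have "norm (deriv (log_test p \<kappa> a) z) = disc_log a powr (- (1 / p)) * (norm a / n)"
        unfolding DERIV_imp_deriv[OF log_test_has_derivative[OF a z]] by (simp add: norm_mult norm_divide n_def)
      also have "\<dots> \<le> disc_log a powr (- (1 / p)) * (1 / n)"
        using a n by (intro mult_left_mono divide_right_mono) auto
      finally have "norm (deriv (log_test p \<kappa> a) z) powr p \<le> (disc_log a powr (- (1 / p)) * (1 / n)) powr p"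
        using p by (intro powr_mono2) auto
      also have "\<dots> = (disc_log a powr (- (1 / p))) powr p * (1 / n powr p)"
        by (simp only: powr_mult powr_divide powr_one_eq_one)
      also have "(disc_log a powr (- (1 / p))) powr p = 1 / disc_log a"
      proof -
        have "- (1 / p) * p = - 1" using p by simp
        then have "(disc_log a powr (- (1 / p))) powr p = disc_log a powr (- 1)" by (simp only: powr_powr)
        also have "\<dots> = 1 / disc_log a" using L by (simp add: powr_minus_divide)
        finally show ?thesis .
      qed
      finally have "(1 - norm z) powr (p - 2) * norm (deriv (log_test p \<kappa> a) z) powr p
        \<le> (1 - norm z) powr (p - 2) * (1 / disc_log a * (1 / n powr p))"
        by (rule mult_left_mono) simp
      also have "\<dots> = 1 / disc_log a * ?I z" by (simp add: n_def)
      finally show "ennreal ((1 - norm z) powr (p - 2) * norm (deriv (log_test p \<kappa> a) z) powr p)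
        \<le> ennreal (1 / disc_log a) * ennreal (?I z)"
        using L by (subst ennreal_mult[symmetric]) (auto intro: ennreal_leI)
    qed
    also have "\<dots> = ennreal (1 / disc_log a) * (\<integral>\<^sup>+z. ennreal (?I z) \<partial>\<lambda>\<D>)"
    proof (rule nn_integral_cmult)
      have [measurable]: "(\<lambda>z. 1 - cnj a * z) \<in> borel_measurable \<lambda>\<D>" by measurable
      show "(\<lambda>z. ennreal (?I z)) \<in> borel_measurable \<lambda>\<D>" by measurable
    qed
    also have "\<dots> \<le> ennreal (1 / disc_log a) * ennreal (C * disc_log a)"
      by (intro mult_left_mono C a) auto
    also have "\<dots> = ennreal C" using L C(1) by (subst ennreal_mult[symmetric]) auto
    finally show "Besov_integral p (log_test p \<kappa> a) \<le> ennreal C" .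
  qed
qed

text \<open>Only the real part is used: ln (2 \<kappa>) - ln |1 - cnj a z| is at least ln (2 / (1 -
  |a|)) in this region.\<close>

lemma norm_log_test_ge:
  assumes a: "norm a < 1" and z: "norm z < 1" "norm (1 - cnj a * z) \<le> \<kappa> * (1 - norm a)" and \<kappa>: "1 \<le> \<kappa>" and p: "1 < p"
  shows "disc_log a powr (1 - 1 / p) \<le> norm (log_test p \<kappa> a z)"
proof -
  define n where "n = norm (1 - cnj a * z)"
  have nz: "1 - cnj a * z \<noteq> 0" by (rule one_minus_cnj_mult_nz[OF a z(1)])
  then have n: "n > 0" by (simp add: n_def)
  have L: "disc_log a > 0" by (rule disc_log_pos[OF a])
  have "2 / (1 - norm a) \<le> 2 * \<kappa> / n" using z(2) n a by (simp add: n_def field_simps)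
  then have "disc_log a \<le> ln (2 * \<kappa> / n)" unfolding disc_log_def using n \<kappa> a by (subst ln_le_cancel_iff) auto
  also have "\<dots> = ln (2 * \<kappa>) - ln n" using n \<kappa> by (simp add: ln_div)
  also have "\<dots> = Re (of_real (ln (2 * \<kappa>)) - Ln (1 - cnj a * z))" using nz by (simp add: n_def)
  also have "\<dots> \<le> norm (of_real (ln (2 * \<kappa>)) - Ln (1 - cnj a * z))" by (rule complex_Re_le_cmod)
  finally have "disc_log a powr (- (1 / p)) * disc_log a \<le> norm (log_test p \<kappa> a z)"
    by (simp add: log_test_def norm_mult mult_left_mono)
  moreover have "disc_log a powr (1 - 1 / p) = disc_log a powr (- (1 / p)) * disc_log a"
    using L powr_add[of "disc_log a" "- (1 / p)" 1] by simp
  ultimately show ?thesis by simp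
qed

lemma norm_log_test_0:
  assumes a: "norm a < 1" and \<kappa>: "1 \<le> \<kappa>" and p: "1 < p"
  shows "norm (log_test p \<kappa> a 0) \<le> ln 2 powr (- (1 / p)) * ln (2 * \<kappa>)"
proof -
  have "norm (log_test p \<kappa> a 0) = disc_log a powr (- (1 / p)) * ln (2 * \<kappa>)"
    using \<kappa> by (simp add: log_test_def norm_mult)
  also have "\<dots> \<le> ln 2 powr (- (1 / p)) * ln (2 * \<kappa>)"
    using disc_log_ge[OF a] p \<kappa> by (intro mult_right_mono powr_mono2') auto
  finally show ?thesis .
qed

text \<open>Moving to \<open>a'\<close> enlarges the numerator 1 - |a|^2 by about the factor
  \<kappa>, while in the far region the kernel grows at most by the factor 2. Of the 8, a 4 is this
  factor squared and a 2 comes from 1 - |a|^2 \<le> 2 (1 - |a|).\<close>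

lemma moebius_weight_far:
  assumes a: "norm a < 1" and a': "norm a' < 1" "1 - norm a' = \<kappa> * (1 - norm a)" "norm (a - a') \<le> \<kappa> * (1 - norm a)"
    and z: "norm z < 1" "\<kappa> * (1 - norm a) < norm (1 - cnj a * z)" and \<kappa>: "1 \<le> \<kappa>" and s: "0 < s"
  shows "moebius_weight s a z \<le> (8 / \<kappa>) powr s * moebius_weight s a' z"
proof -
  define \<delta> where "\<delta> = 1 - norm a"
  have \<delta>: "\<delta> > 0" using a by (simp add: \<delta>_def)
  define n where "n = norm (1 - cnj a * z)"
  define n' where "n' = norm (1 - cnj a' * z)"
  have n: "n > 0" "n' > 0" using one_minus_cnj_mult_nz[OF a z(1)] one_minus_cnj_mult_nz[OF a'(1) z(1)] by (auto simp: n_def n'_def)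
  define b where "b = 1 - (norm z)\<^sup>2"
  have b: "b \<ge> 0" using z by (simp add: b_def abs_square_le_1)
  have "n' \<le> n + norm (cnj (a - a') * z)"
    using norm_triangle_ineq[of "1 - cnj a * z" "cnj (a - a') * z"] by (simp add: n_def n'_def algebra_simps)
  also have "norm (cnj (a - a') * z) \<le> \<kappa> * \<delta> * 1"
    unfolding norm_mult complex_mod_cnj using a' z by (intro mult_mono) (auto simp: \<delta>_def)
  finally have n2: "n' \<le> 2 * n" using z(2) by (simp add: n_def \<delta>_def)
  then have n2': "n'\<^sup>2 \<le> 4 * n\<^sup>2" using n power_mono[of n' "2 * n" 2] by (simp add: power_mult_distrib)
  have A: "1 - (norm a)\<^sup>2 \<le> 2 * \<delta>" unfolding \<delta>_def by (rule one_minus_norm_square_le[OF a])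
  have A': "\<kappa> * \<delta> \<le> 1 - (norm a')\<^sup>2"
    using a'(1,2) by (simp add: \<delta>_def[symmetric] power2_eq_square) (smt (verit) mult_left_le norm_ge_zero)
  have "(1 - (norm a)\<^sup>2) * b / n\<^sup>2 \<le> 8 / \<kappa> * ((1 - (norm a')\<^sup>2) * b / n'\<^sup>2)"
  proof -
    have "(1 - (norm a)\<^sup>2) * b / n\<^sup>2 \<le> (2 * \<delta>) * b / n\<^sup>2" using A b by (intro divide_right_mono mult_right_mono) auto
    also have "\<dots> \<le> (2 * \<delta>) * b / (n'\<^sup>2 / 4)" using n2' n b \<delta> by (intro divide_left_mono) auto
    also have "\<dots> = 8 / \<kappa> * ((\<kappa> * \<delta>) * b / n'\<^sup>2)" using \<kappa> by simp
    also have "\<dots> \<le> 8 / \<kappa> * ((1 - (norm a')\<^sup>2) * b / n'\<^sup>2)"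
      using A' b \<kappa> by (intro mult_left_mono divide_right_mono mult_right_mono) auto
    finally show ?thesis .
  qed
  then have "1 - (norm (moebius_disc a z))\<^sup>2 \<le> 8 / \<kappa> * (1 - (norm (moebius_disc a' z))\<^sup>2)"
    unfolding one_minus_norm_moebius[OF a z(1)] one_minus_norm_moebius[OF a'(1) z(1)] by (simp only: b_def n_def n'_def)
  then have "moebius_weight s a z \<le> (8 / \<kappa> * (1 - (norm (moebius_disc a' z))\<^sup>2)) powr s"
    unfolding moebius_weight_def using norm_moebius_less_1[OF a z(1)] s by (intro powr_mono2) (auto simp: abs_square_le_1)
  then show ?thesis by (simp only: powr_mult moebius_weight_def)
qed

text \<open>Far from \<open>a\<close> the weight at \<open>a\<close> is dominated, with a small factor, by the weight at a point
  \<open>a'\<close> that is \<open>\<kappa>\<close> times farther from the circle; iterating this reaches a compact set.\<close>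

lemma log_weight_of_near:
  assumes g: "g holomorphic_on \<D>" and s: "0 < s" and q: "0 < q"
    and C0: "0 \<le> C0" "\<And>a. norm a < 1 \<Longrightarrow> Q_integral s (deriv g) a \<le> ennreal C0"
    and near: "\<And>\<kappa>. 1 \<le> \<kappa> \<Longrightarrow> \<exists>C\<ge>0. \<forall>a. norm a < 1 \<longrightarrow> ennreal (disc_log a powr q) *
      (\<integral>\<^sup>+z. ennreal ((norm (deriv g z))\<^sup>2 * moebius_weight s a z) * indicator {z. norm (1 - cnj a * z) \<le> \<kappa> * (1 - norm a)} z \<partial>\<lambda>\<D>) \<le> ennreal C"
  shows "\<exists>C. \<forall>a\<in>\<D>. ennreal (disc_log a powr q) * Q_integral s (deriv g) a \<le> ennreal C"
proof -
  note [measurable] = measurable_disc_deriv[OF g]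
  \<comment> \<open>Makes (8 / \<kappa>)^s equal to 1 / (2 * 2^q): the factor gained by moving
    outward from the circle beats the loss 2^q in the logarithmic weight and still leaves
    1/2.\<close>
  define \<kappa> where "\<kappa> = 8 * (2 * 2 powr q) powr (1 / s)"
  have base: "1 \<le> (2 * 2 powr q) powr (1 / s)"
    using s q ge_one_powr_ge_zero[of 2 q] by (intro ge_one_powr_ge_zero) auto
  then have \<kappa>: "8 \<le> \<kappa>" by (simp add: \<kappa>_def)
  have \<kappa>s: "(8 / \<kappa>) powr s = 1 / (2 * 2 powr q)"
    using s base by (simp add: \<kappa>_def powr_divide powr_powr)
  obtain C2 where C2: "C2 \<ge> 0" "\<And>a. norm a < 1 \<Longrightarrow> ennreal (disc_log a powr q) *
      (\<integral>\<^sup>+z. ennreal ((norm (deriv g z))\<^sup>2 * moebius_weight s a z) * indicator {z. norm (1 - cnj a * z) \<le> \<kappa> * (1 - norm a)} z \<partial>\<lambda>\<D>) \<le> ennreal C2"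
    using near[of \<kappa>] \<kappa> by auto
  define C1 where "C1 = ln (\<kappa>\<^sup>2) powr q * C0"
  have C1: "C1 \<ge> 0" using C0 by (simp add: C1_def)
  define Y where "Y a = ennreal (disc_log a powr q) * Q_integral s (deriv g) a" for a
  \<comment> \<open>Base of the iteration: away from the circle the logarithm is bounded, so the
    unweighted bound \<open>C0\<close> suffices.\<close>
  have large: "Y a \<le> ennreal (2 * (C1 + C2))" if a: "norm a < 1" and \<delta>: "2 / \<kappa>\<^sup>2 < 1 - norm a" for a
  proof -
    have "2 / (1 - norm a) \<le> \<kappa>\<^sup>2" using \<delta> a \<kappa> by (simp add: field_simps)
    then have "disc_log a \<le> ln (\<kappa>\<^sup>2)" unfolding disc_log_def using a \<kappa> by (subst ln_le_cancel_iff) auto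
    then have "disc_log a powr q \<le> ln (\<kappa>\<^sup>2) powr q" using disc_log_pos[OF a] q by (intro powr_mono2) auto
    then have "Y a \<le> ennreal (ln (\<kappa>\<^sup>2) powr q) * ennreal C0"
      unfolding Y_def using C0(2)[OF a] by (intro mult_mono ennreal_leI) auto
    also have "\<dots> = ennreal C1" using C0 by (simp add: C1_def ennreal_mult)
    also have "\<dots> \<le> ennreal (2 * (C1 + C2))" using C1 C2 by (intro ennreal_leI) simp
    finally show ?thesis .
  qed
  \<comment> \<open>Induction on the number of steps, each multiplying the distance to the circle by
    \<kappa>, that lead from \<open>a\<close> into the region covered by
    \<open>large\<close>.\<close>
  have "Y a \<le> ennreal (2 * (C1 + C2))" if "norm a < 1" "2 / \<kappa>\<^sup>2 < \<kappa> ^ n * (1 - norm a)" for n a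
    using that
  proof (induction n arbitrary: a)
    case 0
    then show ?case by (intro large) auto
  next
    case (Suc n)
    note a = Suc.prems(1)
    define \<delta> where "\<delta> = 1 - norm a"
    have \<delta>: "\<delta> > 0" using a by (simp add: \<delta>_def)
    show ?case
    proof (cases "2 / \<kappa>\<^sup>2 < \<delta>")
      case True
      then show ?thesis using a by (intro large) (auto simp: \<delta>_def)
    next
      case False
      then have small: "\<delta> \<le> 2 / \<kappa>\<^sup>2" by simp
      then have "\<kappa> * \<delta> \<le> \<kappa> * (2 / \<kappa>\<^sup>2)" using \<kappa> by (intro mult_left_mono) auto
      also have "\<dots> = 2 / \<kappa>" using \<kappa> by (simp add: power2_eq_square)
      also have "\<dots> \<le> 1/4" using \<kappa> by (simp add: field_simps)
      finally have \<kappa>\<delta>: "\<kappa> * \<delta> \<le> 1/4" .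
      have "8 * \<delta> \<le> \<kappa> * \<delta>" using \<kappa> \<delta> by (intro mult_right_mono) auto
      then have a0: "norm a > 0" "a \<noteq> 0" using \<kappa>\<delta> by (auto simp: \<delta>_def)
      \<comment> \<open>The point on the same ray whose distance to the circle is \<kappa> times
        that of \<open>a\<close>; the smallness of \<kappa> \<delta> keeps it inside the
        disc.\<close>
      define a' where "a' = of_real ((1 - \<kappa> * \<delta>) / norm a) * a"
      have na': "norm a' = 1 - \<kappa> * \<delta>"
      proof -
        have "norm a' = \<bar>(1 - \<kappa> * \<delta>) / norm a\<bar> * norm a" by (simp only: a'_def norm_mult norm_of_real)
        also have "\<bar>(1 - \<kappa> * \<delta>) / norm a\<bar> = (1 - \<kappa> * \<delta>) / norm a" using a0 \<kappa>\<delta> by (intro abs_of_nonneg) auto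
        finally show ?thesis using a0 by simp
      qed
      have a': "norm a' < 1" using na' \<kappa> \<delta> by simp
      have "a - a' = of_real ((norm a - (1 - \<kappa> * \<delta>)) / norm a) * a"
        using a0 by (simp add: a'_def field_simps)
      then have "norm (a - a') = \<bar>(norm a - (1 - \<kappa> * \<delta>)) / norm a\<bar> * norm a"
        by (simp only: norm_mult norm_of_real)
      then have "norm (a - a') = \<bar>norm a - (1 - \<kappa> * \<delta>)\<bar>"
        using a0 by (simp add: abs_divide)
      also have "\<dots> \<le> \<kappa> * \<delta>" using \<delta> \<kappa> mult_right_mono[of 8 \<kappa> \<delta>] by (simp add: \<delta>_def abs_if)
      finally have aa': "norm (a - a') \<le> \<kappa> * (1 - norm a)" by (simp add: \<delta>_def)
      note [measurable] = moebius_weight_measurable[OF a] moebius_weight_measurable[OF a']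
      let ?N = "{z. norm (1 - cnj a * z) \<le> \<kappa> * (1 - norm a)}"
      have [measurable]: "(indicator ?N :: complex \<Rightarrow> ennreal) \<in> borel_measurable \<lambda>\<D>"
        by (intro measurable_restrict_space1 borel_measurable_indicator) simp
      have "Q_integral s (deriv g) a \<le> (\<integral>\<^sup>+z. ennreal ((norm (deriv g z))\<^sup>2 * moebius_weight s a z) * indicator ?N z
         + ennreal ((8 / \<kappa>) powr s) * ennreal ((norm (deriv g z))\<^sup>2 * moebius_weight s a' z) \<partial>\<lambda>\<D>)"
        unfolding Q_integral_def
      proof (rule nn_integral_mono)
        fix z assume "z \<in> space \<lambda>\<D>"
        then have z: "norm z < 1" by simp
        show "ennreal ((norm (deriv g z))\<^sup>2 * moebius_weight s a z) \<le> ennreal ((norm (deriv g z))\<^sup>2 * moebius_weight s a z) * indicator ?N z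
         + ennreal ((8 / \<kappa>) powr s) * ennreal ((norm (deriv g z))\<^sup>2 * moebius_weight s a' z)"
        proof (cases "z \<in> ?N")
          case False
          then have far: "\<kappa> * (1 - norm a) < norm (1 - cnj a * z)" by simp
          have eq: "1 - norm a' = \<kappa> * (1 - norm a)" using na' by (simp add: \<delta>_def)
          have "moebius_weight s a z \<le> (8 / \<kappa>) powr s * moebius_weight s a' z"
            using \<kappa> by (intro moebius_weight_far[OF a a' eq aa' z far _ s]) simp
          then have "(norm (deriv g z))\<^sup>2 * moebius_weight s a z \<le> (norm (deriv g z))\<^sup>2 * ((8 / \<kappa>) powr s * moebius_weight s a' z)"
            by (rule mult_left_mono) simp
          then have "ennreal ((norm (deriv g z))\<^sup>2 * moebius_weight s a z) \<le> ennreal ((8 / \<kappa>) powr s) * ennreal ((norm (deriv g z))\<^sup>2 * moebius_weight s a' z)"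
            by (subst ennreal_mult'[symmetric]) (auto intro!: ennreal_leI simp: mult_ac)
          then show ?thesis using False by simp
        qed simp
      qed
      also have "\<dots> = (\<integral>\<^sup>+z. ennreal ((norm (deriv g z))\<^sup>2 * moebius_weight s a z) * indicator ?N z \<partial>\<lambda>\<D>)
         + ennreal ((8 / \<kappa>) powr s) * Q_integral s (deriv g) a'"
        unfolding Q_integral_def by (subst nn_integral_add) (measurable, simp add: nn_integral_cmult)
      finally have "Y a \<le> ennreal (disc_log a powr q) * ((\<integral>\<^sup>+z. ennreal ((norm (deriv g z))\<^sup>2 * moebius_weight s a z) * indicator ?N z \<partial>\<lambda>\<D>)
         + ennreal ((8 / \<kappa>) powr s) * Q_integral s (deriv g) a')"
        unfolding Y_def by (intro mult_left_mono) auto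
      also have "\<dots> = ennreal (disc_log a powr q) * (\<integral>\<^sup>+z. ennreal ((norm (deriv g z))\<^sup>2 * moebius_weight s a z) * indicator ?N z \<partial>\<lambda>\<D>)
         + ennreal (disc_log a powr q * (8 / \<kappa>) powr s) * Q_integral s (deriv g) a'"
        by (simp add: distrib_left ennreal_mult mult.assoc)
      also have "\<dots> \<le> ennreal C2 + ennreal (1/2 * disc_log a' powr q) * Q_integral s (deriv g) a'"
      proof (intro add_mono C2(2) a mult_right_mono ennreal_leI)
        \<comment> \<open>For \<delta> \<le> 2 / \<kappa>^2 the number 2 / \<delta> is at most the
          square of 2 / (\<kappa> \<delta>), so one step at most halves the logarithm.\<close>
        have "disc_log a \<le> 2 * disc_log a'"
        proof -
          have "\<kappa> * \<delta> > 0" using \<kappa> \<delta> by simp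
          have "2 / \<delta> \<le> (2 / (\<kappa> * \<delta>))\<^sup>2"
            using small \<kappa> \<delta> by (simp add: power2_eq_square field_simps)
          then have "ln (2 / \<delta>) \<le> ln ((2 / (\<kappa> * \<delta>))\<^sup>2)"
            using \<kappa> \<delta> by (subst ln_le_cancel_iff) auto
          also have "\<dots> = 2 * ln (2 / (\<kappa> * \<delta>))" using \<open>\<kappa> * \<delta> > 0\<close> by (subst ln_realpow) auto
          finally show ?thesis using na' by (simp add: disc_log_def \<delta>_def)
        qed
        then have "disc_log a powr q \<le> (2 * disc_log a') powr q"
          using disc_log_pos[OF a] q by (intro powr_mono2) auto
        also have "\<dots> = 2 powr q * disc_log a' powr q" by (rule powr_mult)
        finally have "disc_log a powr q * (8 / \<kappa>) powr s \<le> 2 powr q * disc_log a' powr q * (8 / \<kappa>) powr s"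
          by (rule mult_right_mono) simp
        then show "disc_log a powr q * (8 / \<kappa>) powr s \<le> 1/2 * disc_log a' powr q" by (simp add: \<kappa>s)
      qed auto
      also have "ennreal (1/2 * disc_log a' powr q) * Q_integral s (deriv g) a' = ennreal (1/2) * Y a'"
        unfolding Y_def by (subst ennreal_mult) (simp, simp, simp only: mult.assoc)
      also have "Y a' \<le> ennreal (2 * (C1 + C2))"
      proof (rule Suc.IH[OF a'])
        have "1 - norm a' = \<kappa> * (1 - norm a)" using na' by (simp add: \<delta>_def)
        then have "\<kappa> ^ n * (1 - norm a') = \<kappa> ^ Suc n * (1 - norm a)" by (simp only: power_Suc mult_ac)
        then show "2 / \<kappa>\<^sup>2 < \<kappa> ^ n * (1 - norm a')" using Suc.prems(2) by (simp only:)
      qed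
      \<comment> \<open>The bound reproduces itself: C2 plus half of 2 (C1 + C2) is C1 + 2
        C2.\<close>
      also have "ennreal C2 + ennreal (1/2) * ennreal (2 * (C1 + C2)) = ennreal (C2 + 1/2 * (2 * (C1 + C2)))"
        using C1 C2(1) by (simp only: ennreal_mult[symmetric] ennreal_plus[symmetric] add_nonneg_nonneg mult_nonneg_nonneg zero_le_numeral zero_le_divide_1_iff)
      also have "\<dots> \<le> ennreal (2 * (C1 + C2))" using C1 C2(1) by (intro ennreal_leI) simp
      finally show ?thesis by (simp add: add_left_mono mult_left_mono)
    qed
  qed
  moreover have "\<exists>n. 2 / \<kappa>\<^sup>2 < \<kappa> ^ n * (1 - norm a)" if "norm a < 1" for a :: complex
  proof -
    have d: "0 < 1 - norm a" using that by simp
    obtain n where "2 / \<kappa>\<^sup>2 / (1 - norm a) < \<kappa> ^ n" using real_arch_pow[of \<kappa>] \<kappa> by force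
    then show ?thesis using iffD1[OF pos_divide_less_eq[OF d]] by blast
  qed
  ultimately have "Y a \<le> ennreal (2 * (C1 + C2))" if "norm a < 1" for a using that by blast
  then have "\<forall>a\<in>\<D>. Y a \<le> ennreal (2 * (C1 + C2))" unfolding Ball_def mem_ball_0 by blast
  then show ?thesis unfolding Y_def by blast
qed

text \<open>For a logarithmic test function F, g' F is (g F)' minus g F'. The former is bounded by
  the operator bound, the latter because \<open>g\<close> is bounded and the Besov space embeds.
  Since |F| is known to be large only near \<open>a\<close>, this yields the condition on the near
  region, and \<open>log_weight_of_near\<close> extends it to the disc.\<close>

lemma mult_op_necessary_log:
  assumes p: "1 < p" "1 / p + 1 / p' = 1" and s: "0 < s" "s \<le> 1" "2 < p \<Longrightarrow> 1 - 2 / p < s" and g: "g holomorphic_on \<D>"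
    and maps: "maps_into (mult_op g) (Besov_space p) (Q_space s)"
  shows "g \<in> Q_log_space s (1 / p')"
proof -
  have g': "deriv g holomorphic_on \<D>" using g by (intro holomorphic_deriv) auto
  note op = bounded_of_operator[OF p(1) s(1,2) g g' mult_op_holomorphic[OF g] deriv_mult_op[OF g] maps]
  obtain M where M: "M > 0" "\<And>z. norm z < 1 \<Longrightarrow> norm (g z) \<le> M" using H_infinityD[OF op(1)] by blast
  \<comment> \<open>Testing on the constant 1 bounds the Q integrals of g' itself: the a priori
    bound with which \<open>log_weight_of_near\<close> starts.\<close>
  have gi: "\<exists>C\<ge>0. \<forall>a. norm a < 1 \<longrightarrow> Q_integral s (deriv g) a \<le> ennreal C"
  proof -
    obtain C where C: "C \<ge> 0" "\<And>f a. f holomorphic_on \<D> \<Longrightarrow> Besov_integral p f \<le> ennreal 1 \<Longrightarrow> norm (f 0) \<le> 1 \<Longrightarrow> norm a < 1 \<Longrightarrow>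
      Q_integral s (\<lambda>z. deriv g z * f z + g z * deriv f z) a \<le> ennreal C"
      using op(2)[of 1] by blast
    have "Q_integral s (deriv g) a \<le> ennreal C" if "norm a < 1" for a
      using C(2)[of "\<lambda>_. 1" a] that p(1) by (simp add: Besov_integral_def)
    then show ?thesis using C(1) by blast
  qed
  have pp: "1 - 1 / p = 1 / p'" using p by simp
  have p': "1 / p' > 0" using p by (simp add: pp[symmetric])
  obtain CB where CB: "CB > 0" "\<And>a \<kappa>. norm a < 1 \<Longrightarrow> Besov_integral p (log_test p \<kappa> a) \<le> ennreal CB"
    using Besov_integral_log_test[OF p(1)] by blast
  obtain CQ where CQ: "CQ > 0" "\<And>f a. f holomorphic_on \<D> \<Longrightarrow> Besov_integral p f \<le> ennreal CB \<Longrightarrow> norm a < 1 \<Longrightarrow>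
      Q_integral s (deriv f) a \<le> ennreal CQ"
    using Besov_Q_embedding[OF p(1) s(1,3) less_imp_le[OF CB(1)]] by blast
  have near: "\<exists>C\<ge>0. \<forall>a. norm a < 1 \<longrightarrow> ennreal (disc_log a powr (2 * (1 / p'))) *
      (\<integral>\<^sup>+z. ennreal ((norm (deriv g z))\<^sup>2 * moebius_weight s a z) * indicator {z. norm (1 - cnj a * z) \<le> \<kappa> * (1 - norm a)} z \<partial>\<lambda>\<D>) \<le> ennreal C"
    if \<kappa>: "1 \<le> \<kappa>" for \<kappa>
  proof -
    define K where "K = max CB (ln 2 powr (- (1 / p)) * ln (2 * \<kappa>))"
    obtain C where C: "C \<ge> 0" "\<And>f a. f holomorphic_on \<D> \<Longrightarrow> Besov_integral p f \<le> ennreal K \<Longrightarrow> norm (f 0) \<le> K \<Longrightarrow> norm a < 1 \<Longrightarrow>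
      Q_integral s (\<lambda>z. deriv g z * f z + g z * deriv f z) a \<le> ennreal C"
      using op(2)[of K] by blast
    have "ennreal (disc_log a powr (2 * (1 / p'))) *
      (\<integral>\<^sup>+z. ennreal ((norm (deriv g z))\<^sup>2 * moebius_weight s a z) * indicator {z. norm (1 - cnj a * z) \<le> \<kappa> * (1 - norm a)} z \<partial>\<lambda>\<D>)
      \<le> ennreal (2 * C + 2 * (M\<^sup>2 * CQ))" if a: "norm a < 1" for a
    proof -
      define F where "F = log_test p \<kappa> a"
      have F: "F holomorphic_on \<D>" unfolding F_def by (rule log_test_holomorphic[OF a])
      note [measurable] = measurable_disc_deriv[OF g] measurable_disc_holomorphic[OF g] measurable_disc_deriv[OF F]
        measurable_disc_holomorphic[OF F] moebius_weight_measurable[OF a]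
      let ?N = "{z. norm (1 - cnj a * z) \<le> \<kappa> * (1 - norm a)}"
      have [measurable]: "(indicator ?N :: complex \<Rightarrow> ennreal) \<in> borel_measurable \<lambda>\<D>"
        by (intro measurable_restrict_space1 borel_measurable_indicator) simp
      have "ennreal (disc_log a powr (2 * (1 / p'))) *
        (\<integral>\<^sup>+z. ennreal ((norm (deriv g z))\<^sup>2 * moebius_weight s a z) * indicator ?N z \<partial>\<lambda>\<D>)
        = (\<integral>\<^sup>+z. ennreal (disc_log a powr (2 * (1 / p'))) * (ennreal ((norm (deriv g z))\<^sup>2 * moebius_weight s a z) * indicator ?N z) \<partial>\<lambda>\<D>)"
        by (rule nn_integral_cmult[symmetric]) measurable
      also have "\<dots> \<le> Q_integral s (\<lambda>z. deriv g z * F z) a"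
        unfolding Q_integral_def
      proof (rule nn_integral_mono)
        fix z assume "z \<in> space \<lambda>\<D>"
        then have z: "norm z < 1" by simp
        have w: "0 \<le> moebius_weight s a z" using moebius_weight_bounds[OF a z s(1)] by simp
        show "ennreal (disc_log a powr (2 * (1 / p'))) * (ennreal ((norm (deriv g z))\<^sup>2 * moebius_weight s a z) * indicator ?N z)
          \<le> ennreal ((norm (deriv g z * F z))\<^sup>2 * moebius_weight s a z)"
        proof (cases "z \<in> ?N")
          case True
          then have "disc_log a powr (1 / p') \<le> norm (F z)"
            using norm_log_test_ge[OF a z _ \<kappa> p(1)] by (simp add: F_def pp)
          then have "(disc_log a powr (1 / p'))\<^sup>2 \<le> (norm (F z))\<^sup>2" by (intro power_mono) auto
          moreover have "(disc_log a powr (1 / p'))\<^sup>2 = disc_log a powr (2 * (1 / p'))"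
            by (simp add: power2_eq_square powr_add[symmetric])
          ultimately have "disc_log a powr (2 * (1 / p')) * ((norm (deriv g z))\<^sup>2 * moebius_weight s a z) \<le> (norm (F z))\<^sup>2 * ((norm (deriv g z))\<^sup>2 * moebius_weight s a z)"
            using w by (intro mult_right_mono) auto
          then have "ennreal (disc_log a powr (2 * (1 / p'))) * ennreal ((norm (deriv g z))\<^sup>2 * moebius_weight s a z)
            \<le> ennreal ((norm (deriv g z * F z))\<^sup>2 * moebius_weight s a z)"
            using w by (subst ennreal_mult[symmetric]) (auto intro!: ennreal_leI simp: norm_mult power_mult_distrib mult_ac)
          then show ?thesis using True by simp
        qed simp
      qed
      also have "\<dots> = Q_integral s (\<lambda>z. (deriv g z * F z + g z * deriv F z) + (- g z) * deriv F z) a"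
        by (rule Q_integral_cong) simp
      also have "\<dots> \<le> ennreal 2 * Q_integral s (\<lambda>z. deriv g z * F z + g z * deriv F z) a + ennreal 2 * Q_integral s (\<lambda>z. (- g z) * deriv F z) a"
        by (intro Q_integral_add_le a s) measurable
      also have "\<dots> \<le> ennreal 2 * ennreal C + ennreal 2 * ennreal (M\<^sup>2 * CQ)"
      proof (intro add_mono mult_left_mono)
        have "Besov_integral p F \<le> ennreal K" unfolding F_def
          using CB(2)[OF a] by (rule order_trans) (auto simp: K_def intro: ennreal_leI)
        moreover have "norm (F 0) \<le> K" unfolding F_def
          using norm_log_test_0[OF a \<kappa> p(1)] by (simp add: K_def)
        ultimately show "Q_integral s (\<lambda>z. deriv g z * F z + g z * deriv F z) a \<le> ennreal C"
          by (intro C F a)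
        have "Q_integral s (\<lambda>z. (- g z) * deriv F z) a \<le> ennreal (M\<^sup>2) * Q_integral s (deriv F) a"
          using M by (intro Q_integral_bounded_mult measurable_disc_deriv F a s) auto
        also have "\<dots> \<le> ennreal (M\<^sup>2) * ennreal CQ"
          by (intro mult_left_mono CQ F a) (simp_all add: F_def CB(2)[OF a])
        finally show "Q_integral s (\<lambda>z. (- g z) * deriv F z) a \<le> ennreal (M\<^sup>2 * CQ)"
          using CQ(1) by (simp add: ennreal_mult)
      qed auto
      also have "\<dots> = ennreal (2 * C + 2 * (M\<^sup>2 * CQ))"
        using C(1) CQ(1) by (intro ennreal_mult_add[symmetric]) auto
      finally show ?thesis .
    qed
    moreover have "2 * C + 2 * (M\<^sup>2 * CQ) \<ge> 0" using C(1) CQ(1) by simp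
    ultimately show ?thesis by blast
  qed
  obtain C0 where C0: "C0 \<ge> 0" "\<And>a. norm a < 1 \<Longrightarrow> Q_integral s (deriv g) a \<le> ennreal C0" using gi by blast
  have "\<exists>C. \<forall>a\<in>\<D>. ennreal (disc_log a powr (2 * (1 / p'))) * Q_integral s (deriv g) a \<le> ennreal C"
    using p' by (intro log_weight_of_near[OF g s(1) _ C0 near]) auto
  then show ?thesis using g by (simp add: Q_log_space_iff)
qed

section \<open>Lacunary polynomials\<close>

lemma annulus_area:
  assumes "0 \<le> \<rho>1" "\<rho>1 \<le> \<rho>2" "\<rho>2 \<le> 1"
  shows "(\<integral>\<^sup>+z. indicator (ball 0 \<rho>2 - ball 0 \<rho>1) z \<partial>\<lambda>\<D>) = ennreal (pi * (\<rho>2\<^sup>2 - \<rho>1\<^sup>2))"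
proof -
  have sub: "ball (0::complex) \<rho>1 \<subseteq> ball 0 \<rho>2" "ball (0::complex) \<rho>2 \<subseteq> \<D>" using assms by (auto intro: subset_ball)
  have "(\<integral>\<^sup>+z. indicator (ball 0 \<rho>2 - ball 0 \<rho>1) z \<partial>\<lambda>\<D>) = (\<integral>\<^sup>+z. indicator (ball (0::complex) \<rho>2 - ball 0 \<rho>1) z \<partial>lborel)"
    unfolding nn_integral_disc_lborel using subsetD[OF sub(2)] by (intro nn_integral_cong) (auto simp: indicator_def)
  also have "\<dots> = emeasure lborel (ball (0::complex) \<rho>2) - emeasure lborel (ball (0::complex) \<rho>1)"
    using emeasure_lborel_ball_finite[of "0::complex" \<rho>1] sub by (simp add: emeasure_Diff)
  also have "\<dots> = ennreal (pi * \<rho>2\<^sup>2) - ennreal (pi * \<rho>1\<^sup>2)"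
    using assms by (simp add: emeasure_ball unit_ball_vol_2)
  also have "\<dots> = ennreal (pi * \<rho>2\<^sup>2 - pi * \<rho>1\<^sup>2)" using assms by (intro ennreal_minus) auto
  finally show ?thesis by (simp add: right_diff_distrib)
qed

text \<open>The mean of \<open>G\<close> over a concentric annulus is G(0), as the difference of two
  disc means. Cauchy-Schwarz is done by hand through 2 |G| \<kappa> \<le> |G|^2 + \<kappa>^2 with
  \<kappa> = |G(0)|, after which half of the left side is absorbed.\<close>

lemma annulus_square_integral_ge:
  assumes G: "G holomorphic_on \<D>" and \<rho>: "0 < \<rho>1" "\<rho>1 < \<rho>2" "\<rho>2 < 1"
  shows "ennreal ((norm (G 0))\<^sup>2 * (pi * (\<rho>2\<^sup>2 - \<rho>1\<^sup>2)))
    \<le> (\<integral>\<^sup>+z. ennreal ((norm (G z))\<^sup>2) * indicator (ball 0 \<rho>2 - ball 0 \<rho>1) z \<partial>\<lambda>\<D>)"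
proof (cases "G 0 = 0")
  case False
  define \<kappa> where "\<kappa> = norm (G 0)"
  have \<kappa>: "\<kappa> > 0" using False by (simp add: \<kappa>_def)
  define V where "V = pi * (\<rho>2\<^sup>2 - \<rho>1\<^sup>2)"
  have V: "V \<ge> 0" using \<rho> by (simp add: V_def power_mono)
  let ?A = "ball 0 \<rho>2 - ball 0 \<rho>1 :: complex set"
  define I where "I = (\<integral>\<^sup>+z. ennreal ((norm (G z))\<^sup>2) * indicator ?A z \<partial>\<lambda>\<D>)"
  note [measurable] = measurable_disc_holomorphic[OF G]
  have [measurable]: "(indicator ?A :: complex \<Rightarrow> ennreal) \<in> borel_measurable \<lambda>\<D>"
    by (intro measurable_restrict_space1 borel_measurable_indicator) simp
  have int: "set_integrable lborel (ball 0 \<rho>) G" if "\<rho> < 1" for \<rho>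
    using that by (intro set_integrable_ball_continuous holomorphic_on_imp_continuous_on holomorphic_on_subset[OF G]) auto
  have intA: "set_integrable lborel ?A G" by (rule set_integrable_subset[OF int[OF \<rho>(3)]]) auto
  have "ball 0 \<rho>2 = ball 0 \<rho>1 \<union> ?A" using \<rho> subset_ball[of \<rho>1 \<rho>2 "0::complex"] by auto
  then have "(LINT z:ball 0 \<rho>2|lborel. G z) = (LINT z:ball 0 \<rho>1 \<union> ?A|lborel. G z)" by simp
  also have "\<dots> = (LINT z:ball 0 \<rho>1|lborel. G z) + (LINT z:?A|lborel. G z)"
    using \<rho> by (intro set_integral_Un int intA) auto
  finally have "(LINT z:?A|lborel. G z) = of_real V * G 0"
    using ball_mean_value_0[OF G, of \<rho>1] ball_mean_value_0[OF G, of \<rho>2] \<rho> by (simp add: V_def algebra_simps)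
  then have "ennreal (\<kappa> * V) = norm (LINT z:?A|lborel. G z)" using V by (simp add: norm_mult \<kappa>_def mult.commute)
  also have "\<dots> \<le> (\<integral>\<^sup>+z. norm (indicator ?A z *\<^sub>R G z) \<partial>lborel)"
    using integral_norm_bound_ennreal[OF intA[unfolded set_integrable_def]] by (simp add: set_lebesgue_integral_def)
  also have "\<dots> = (\<integral>\<^sup>+z. ennreal (norm (G z)) * indicator ?A z \<partial>\<lambda>\<D>)"
    unfolding nn_integral_disc_lborel using \<rho> by (intro nn_integral_cong) (auto simp: indicator_def)
  also have "\<dots> \<le> (\<integral>\<^sup>+z. ennreal (1 / (2 * \<kappa>)) * (ennreal ((norm (G z))\<^sup>2) * indicator ?A z) + ennreal (\<kappa> / 2) * indicator ?A z \<partial>\<lambda>\<D>)"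
  proof (rule nn_integral_mono)
    fix z
    have "2 * norm (G z) * \<kappa> \<le> (norm (G z))\<^sup>2 + \<kappa>\<^sup>2" by (rule sum_squares_bound)
    then have "norm (G z) \<le> 1 / (2 * \<kappa>) * (norm (G z))\<^sup>2 + \<kappa> / 2 * 1"
      using \<kappa> by (simp add: field_simps power2_eq_square)
    then have "ennreal (norm (G z)) \<le> ennreal (1 / (2 * \<kappa>) * (norm (G z))\<^sup>2 + \<kappa> / 2 * 1)" by (rule ennreal_leI)
    also have "\<dots> = ennreal (1 / (2 * \<kappa>)) * ennreal ((norm (G z))\<^sup>2) + ennreal (\<kappa> / 2) * ennreal 1"
      using \<kappa> by (intro ennreal_mult_add) auto
    finally show "ennreal (norm (G z)) * indicator ?A z \<le> ennreal (1 / (2 * \<kappa>)) * (ennreal ((norm (G z))\<^sup>2) * indicator ?A z) + ennreal (\<kappa> / 2) * indicator ?A z"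
      by (simp add: indicator_def)
  qed
  also have "\<dots> = ennreal (1 / (2 * \<kappa>)) * I + ennreal (\<kappa> / 2) * (\<integral>\<^sup>+z. indicator ?A z \<partial>\<lambda>\<D>)"
  proof -
    have mI: "(indicator ?A :: complex \<Rightarrow> ennreal) \<in> borel_measurable \<lambda>\<D>"
      and mG: "(\<lambda>z. ennreal ((norm (G z))\<^sup>2) * indicator ?A z) \<in> borel_measurable \<lambda>\<D>" by measurable
    have "(\<integral>\<^sup>+z. ennreal (1 / (2 * \<kappa>)) * (ennreal ((norm (G z))\<^sup>2) * indicator ?A z) + ennreal (\<kappa> / 2) * indicator ?A z \<partial>\<lambda>\<D>)
      = (\<integral>\<^sup>+z. ennreal (1 / (2 * \<kappa>)) * (ennreal ((norm (G z))\<^sup>2) * indicator ?A z) \<partial>\<lambda>\<D>) + (\<integral>\<^sup>+z. ennreal (\<kappa> / 2) * indicator ?A z \<partial>\<lambda>\<D>)"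
      by (rule nn_integral_add) (intro borel_measurable_times_ennreal borel_measurable_const mG mI)+
    then show ?thesis unfolding I_def by (simp only: nn_integral_cmult[OF mG] nn_integral_cmult[OF mI])
  qed
  also have "(\<integral>\<^sup>+z. indicator ?A z \<partial>\<lambda>\<D>) = ennreal V" unfolding V_def using \<rho> by (intro annulus_area) auto
  finally have main: "ennreal (\<kappa> * V) \<le> ennreal (1 / (2 * \<kappa>)) * I + ennreal (\<kappa> / 2) * ennreal V" .
  have "ennreal (\<kappa>\<^sup>2 * V) \<le> I"
  proof (cases I)
    case (real i)
    have "ennreal (\<kappa> * V) \<le> ennreal (1 / (2 * \<kappa>) * i + \<kappa> / 2 * V)"
      using main real \<kappa> V by (subst ennreal_mult_add) auto
    then have "\<kappa> * V \<le> 1 / (2 * \<kappa>) * i + \<kappa> / 2 * V" using \<kappa> V real by (subst (asm) ennreal_le_iff) auto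
    then have "\<kappa>\<^sup>2 * V \<le> i" using \<kappa> by (simp add: field_simps power2_eq_square)
    then show ?thesis using real by (auto intro: ennreal_leI)
  qed simp
  then show ?thesis by (simp add: \<kappa>_def V_def I_def)
qed simp

text \<open>The annulus estimate needs a nonzero value at 0. The local factorization at the zero is
  glued with g(z) / z^n, so that \<open>G\<close> is holomorphic on the whole disc.\<close>

lemma holomorphic_factor_origin:
  assumes g: "g holomorphic_on \<D>" and nz: "\<exists>z\<in>\<D>. g z \<noteq> 0"
  obtains m G where "G holomorphic_on \<D>" "G 0 \<noteq> 0" "\<And>z. norm z < 1 \<Longrightarrow> g z = z ^ m * G z"
proof (cases "g 0 = 0")
  case False
  then show ?thesis using g by (intro that[of g 0]) auto
next
  case True
  have nc: "\<not> g constant_on \<D>" using True nz by (force simp: constant_on_def)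
  obtain h r n where h: "0 < n" "0 < r" "ball 0 r \<subseteq> \<D>" "h holomorphic_on ball 0 r"
    "\<And>w. w \<in> ball 0 r \<Longrightarrow> g w = (w - 0) ^ n * h w" "\<And>w. w \<in> ball 0 r \<Longrightarrow> h w \<noteq> 0"
  proof (rule holomorphic_factor_zero_nonconstant[OF g, of 0])
    fix h r n assume "0 < (n::nat)" "0 < (r::real)" "ball 0 r \<subseteq> \<D>" "h holomorphic_on ball 0 r"
      "\<And>w. w \<in> ball 0 r \<Longrightarrow> g w = (w - 0) ^ n * h w" "\<And>w. w \<in> ball 0 r \<Longrightarrow> h w \<noteq> 0"
    then show thesis by (rule that)
  qed (use True nc in auto)
  define G where "G z = (if z = 0 then h 0 else g z / z ^ n)" for z
  have Gh: "G w = h w" if "w \<in> ball 0 r" for w using h(5)[OF that] by (simp add: G_def)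
  have "G holomorphic_on ball 0 r \<union> (\<D> - {0})"
  proof (rule holomorphic_on_Un)
    show "G holomorphic_on ball 0 r" by (rule holomorphic_transform[OF h(4)]) (simp only: Gh)
    have "(\<lambda>z. g z / z ^ n) holomorphic_on \<D> - {0}"
      by (intro holomorphic_intros holomorphic_on_subset[OF g]) auto
    then show "G holomorphic_on \<D> - {0}" by (rule holomorphic_transform) (simp add: G_def)
  qed auto
  moreover have "ball 0 r \<union> (\<D> - {0}) = \<D>" using h(2,3) by auto
  ultimately have "G holomorphic_on \<D>" by simp
  moreover have "G 0 \<noteq> 0" using h(2,6) by (simp add: G_def)
  moreover have "g z = z ^ n * G z" if "norm z < 1" for z using True h(1) by (simp add: G_def)
  ultimately show ?thesis by (rule that)
qed

text \<open>Bernoulli's inequality at the exponent 2^(k - 1) gives 1/2, and squaring gives 1/4;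
  applied directly at 2^k it would only give 0.\<close>

lemma half_power_le:
  assumes "1 \<le> k"
  shows "1/4 \<le> (1 - 1 / 2 ^ k :: real) ^ (2 ^ k)"
proof -
  obtain j where j: "k = Suc j" using assms by (cases k) auto
  have "1 + real (2 ^ j) * (- (1 / 2 ^ k)) \<le> (1 + (- (1 / 2 ^ k)) :: real) ^ (2 ^ j)"
    by (rule Bernoulli_inequality) (simp add: field_simps)
  then have "1/2 \<le> (1 - 1 / 2 ^ k :: real) ^ (2 ^ j)" by (simp add: j)
  then have "(1/2)\<^sup>2 \<le> ((1 - 1 / 2 ^ k :: real) ^ (2 ^ j))\<^sup>2" by (intro power_mono) auto
  also have "(x ^ (2 ^ j))\<^sup>2 = x ^ (2 ^ k)" for x :: real by (simp add: j power_mult[symmetric] mult.commute)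
  finally show ?thesis by (simp add: power2_eq_square)
qed

text \<open>With N = 2^k, the annulus between the radii 1 - 1 / N and 1 - 1 / (2 N) is where |z|^(N
  - 1) is still bounded below, the weight at 0 is about N^(-s) and the area about 1 / N. The zero of
  \<open>g\<close> at the origin costs a constant, since |z| \<ge> 1/2 there.\<close>

lemma monomial_lower_bound:
  assumes g: "g holomorphic_on \<D>" and nz: "\<exists>z\<in>\<D>. g z \<noteq> 0" and s: "0 < s"
  obtains c where "c > 0"
    "\<And>k. 1 \<le> k \<Longrightarrow> ennreal (c * (2 ^ k) powr (- 1 - s)) \<le> Q_integral s (\<lambda>z. g z * z ^ (2 ^ k - 1)) 0"
proof -
  obtain m G where G: "G holomorphic_on \<D>" "G 0 \<noteq> 0" "\<And>z. norm z < 1 \<Longrightarrow> g z = z ^ m * G z"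
    using holomorphic_factor_origin[OF g nz] by blast
  define b where "b = (1/2 :: real) ^ (2 * m) * (1/16) * (1/2) powr s"
  have b: "b > 0" by (simp add: b_def)
  define c where "c = b * ((norm (G 0))\<^sup>2 * (pi / 2))"
  have c: "c > 0" using b G(2) by (simp add: c_def)
  show ?thesis
  proof (rule that[OF c])
    fix k :: nat assume k: "1 \<le> k"
    define N where "N = (2::real) ^ k"
    have N: "N \<ge> 2" using power_increasing[OF k, of "2::real"] by (simp add: N_def)
    define \<rho>1 \<rho>2 where "\<rho>1 = 1 - 1 / N" and "\<rho>2 = 1 - 1 / (2 * N)"
    have \<rho>: "1/2 \<le> \<rho>1" "0 < \<rho>1" "\<rho>1 < \<rho>2" "\<rho>2 < 1" using N by (auto simp: \<rho>1_def \<rho>2_def field_simps)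
    let ?A = "ball 0 \<rho>2 - ball 0 \<rho>1 :: complex set"
    note [measurable] = measurable_disc_holomorphic[OF G(1)]
    have [measurable]: "(indicator ?A :: complex \<Rightarrow> ennreal) \<in> borel_measurable \<lambda>\<D>"
      by (intro measurable_restrict_space1 borel_measurable_indicator) simp
    have area: "pi / (2 * N) \<le> pi * (\<rho>2\<^sup>2 - \<rho>1\<^sup>2)"
    proof -
      have "1 / (2 * N) * 1 \<le> (\<rho>2 - \<rho>1) * (\<rho>2 + \<rho>1)"
        using \<rho> N by (intro mult_mono) (auto simp: \<rho>1_def \<rho>2_def field_simps)
      then have "1 / (2 * N) \<le> \<rho>2\<^sup>2 - \<rho>1\<^sup>2" by (simp add: power2_eq_square algebra_simps)
      then have "pi * (1 / (2 * N)) \<le> pi * (\<rho>2\<^sup>2 - \<rho>1\<^sup>2)" by (rule mult_left_mono) simp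
      then show ?thesis by simp
    qed
    have "c * (2 ^ k) powr (- 1 - s) = b * N powr (- s) * ((norm (G 0))\<^sup>2 * (pi / (2 * N)))"
      using N by (simp add: c_def N_def[symmetric] powr_diff powr_minus_divide)
    also have "\<dots> \<le> b * N powr (- s) * ((norm (G 0))\<^sup>2 * (pi * (\<rho>2\<^sup>2 - \<rho>1\<^sup>2)))"
      using b area by (intro mult_left_mono) auto
    finally have "ennreal (c * (2 ^ k) powr (- 1 - s)) \<le> ennreal (b * N powr (- s)) * ennreal ((norm (G 0))\<^sup>2 * (pi * (\<rho>2\<^sup>2 - \<rho>1\<^sup>2)))"
      using b by (subst ennreal_mult'[symmetric]) (auto intro: ennreal_leI)
    also have "\<dots> \<le> ennreal (b * N powr (- s)) * (\<integral>\<^sup>+z. ennreal ((norm (G z))\<^sup>2) * indicator ?A z \<partial>\<lambda>\<D>)"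
      by (intro mult_left_mono annulus_square_integral_ge G \<rho>) simp
    also have "\<dots> = (\<integral>\<^sup>+z. ennreal (b * N powr (- s)) * (ennreal ((norm (G z))\<^sup>2) * indicator ?A z) \<partial>\<lambda>\<D>)"
      by (rule nn_integral_cmult[symmetric]) measurable
    also have "\<dots> \<le> Q_integral s (\<lambda>z. g z * z ^ (2 ^ k - 1)) 0"
      unfolding Q_integral_def
    proof (rule nn_integral_mono)
      fix z assume "z \<in> space \<lambda>\<D>"
      then have z: "norm z < 1" by simp
      show "ennreal (b * N powr (- s)) * (ennreal ((norm (G z))\<^sup>2) * indicator ?A z)
        \<le> ennreal ((norm (g z * z ^ (2 ^ k - 1)))\<^sup>2 * moebius_weight s 0 z)"
      proof (cases "z \<in> ?A")
        case True
        then have zA: "\<rho>1 \<le> norm z" "norm z < \<rho>2" by auto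
        have 1: "(1/2) ^ (2 * m) \<le> (norm z) ^ (2 * m)" using \<rho> zA by (intro power_mono) auto
        have 2: "1/16 \<le> (norm z) ^ (2 * (2 ^ k - 1))"
        proof -
          have "(1/4)\<^sup>2 \<le> ((\<rho>1) ^ (2 ^ k))\<^sup>2"
            using half_power_le[OF k] by (intro power_mono) (auto simp: \<rho>1_def N_def)
          also have "\<dots> = \<rho>1 ^ (2 * 2 ^ k)" by (simp add: power_mult[symmetric] mult.commute)
          also have "\<dots> \<le> \<rho>1 ^ (2 * (2 ^ k - 1))" using \<rho> by (intro power_decreasing) auto
          also have "\<dots> \<le> (norm z) ^ (2 * (2 ^ k - 1))" using \<rho> zA by (intro power_mono) auto
          finally show ?thesis by (simp add: power2_eq_square)
        qed
        have 3: "(1/2) powr s * N powr (- s) \<le> moebius_weight s 0 z"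
        proof -
          have "1 / (2 * N) \<le> 1 - norm z" using zA by (simp add: \<rho>2_def)
          also have "1 - norm z \<le> 1 - (norm z)\<^sup>2" using z by (simp add: power2_eq_square mult_left_le)
          finally have "(1 / (2 * N)) powr s \<le> (1 - (norm z)\<^sup>2) powr s" using N s by (intro powr_mono2) auto
          moreover have "(1 / (2 * N)) powr s = (1/2) powr s * N powr (- s)"
            by (simp add: powr_divide powr_mult powr_minus_divide)
          ultimately show ?thesis by (simp add: moebius_weight_def moebius_disc_def)
        qed
        have "b * N powr (- s) * (norm (G z))\<^sup>2 = ((1/2) ^ (2 * m) * (1/16)) * ((1/2) powr s * N powr (- s)) * (norm (G z))\<^sup>2"
          by (simp add: b_def)
        also have "\<dots> \<le> ((norm z) ^ (2 * m) * (norm z) ^ (2 * (2 ^ k - 1))) * moebius_weight s 0 z * (norm (G z))\<^sup>2"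
          by (intro mult_right_mono mult_mono 1 2 3) (auto intro: mult_nonneg_nonneg)
        also have "\<dots> = (norm (g z * z ^ (2 ^ k - 1)))\<^sup>2 * moebius_weight s 0 z"
          by (simp add: G(3)[OF z] norm_mult norm_power power_mult_distrib power_mult[symmetric] mult_ac)
        finally show ?thesis using True b by (simp add: ennreal_mult'[symmetric] ennreal_leI)
      qed simp
    qed
    finally show "ennreal (c * (2 ^ k) powr (- 1 - s)) \<le> Q_integral s (\<lambda>z. g z * z ^ (2 ^ k - 1)) 0" .
  qed
qed

text \<open>By the parallelogram identity, each successive sign can be chosen so that no cross term
  decreases the integral.\<close>

lemma greedy_signs:
  fixes e :: "nat \<Rightarrow> complex \<Rightarrow> complex"
  assumes e: "\<And>k. e k \<in> borel_measurable \<lambda>\<D>" and s: "0 < s" and a: "norm a < 1"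
  shows "\<exists>\<epsilon> :: nat \<Rightarrow> real. (\<forall>k. \<bar>\<epsilon> k\<bar> = 1) \<and>
    (\<Sum>k<n. Q_integral s (e k) a) \<le> Q_integral s (\<lambda>z. \<Sum>k<n. of_real (\<epsilon> k) * e k z) a"
proof (induction n)
  case 0
  then show ?case by (intro exI[of _ "\<lambda>_. 1"]) simp
next
  case (Suc n)
  then obtain \<epsilon> where \<epsilon>: "\<And>k. \<bar>\<epsilon> k :: real\<bar> = 1"
    "(\<Sum>k<n. Q_integral s (e k) a) \<le> Q_integral s (\<lambda>z. \<Sum>k<n. of_real (\<epsilon> k) * e k z) a" by blast
  define S where "S z = (\<Sum>k<n. of_real (\<epsilon> k) * e k z)" for z
  note [measurable] = e moebius_weight_measurable[OF a]
  have [measurable]: "S \<in> borel_measurable \<lambda>\<D>" unfolding S_def by measurable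
  let ?Q = "\<lambda>u. Q_integral s u a"
  have par: "?Q (\<lambda>z. S z + e n z) + ?Q (\<lambda>z. S z - e n z) = 2 * (?Q S + ?Q (e n))"
  proof -
    have "?Q (\<lambda>z. S z + e n z) + ?Q (\<lambda>z. S z - e n z)
      = (\<integral>\<^sup>+z. ennreal ((norm (S z + e n z))\<^sup>2 * moebius_weight s a z) + ennreal ((norm (S z - e n z))\<^sup>2 * moebius_weight s a z) \<partial>\<lambda>\<D>)"
      unfolding Q_integral_def by (subst nn_integral_add) measurable
    also have "\<dots> = (\<integral>\<^sup>+z. ennreal 2 * (ennreal ((norm (S z))\<^sup>2 * moebius_weight s a z) + ennreal ((norm (e n z))\<^sup>2 * moebius_weight s a z)) \<partial>\<lambda>\<D>)"
    proof (rule nn_integral_cong)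
      fix z assume "z \<in> space \<lambda>\<D>"
      then have w: "0 \<le> moebius_weight s a z" using moebius_weight_bounds[OF a _ s] by simp
      have id: "(norm (S z + e n z))\<^sup>2 + (norm (S z - e n z))\<^sup>2 = 2 * ((norm (S z))\<^sup>2 + (norm (e n z))\<^sup>2)"
        unfolding cmod_power2 by (simp add: power2_eq_square algebra_simps)
      have "ennreal ((norm (S z + e n z))\<^sup>2 * moebius_weight s a z) + ennreal ((norm (S z - e n z))\<^sup>2 * moebius_weight s a z)
        = ennreal (((norm (S z + e n z))\<^sup>2 + (norm (S z - e n z))\<^sup>2) * moebius_weight s a z)"
        using w by (subst ennreal_plus[symmetric]) (auto simp: distrib_right)
      also have "\<dots> = ennreal (2 * ((norm (S z))\<^sup>2 * moebius_weight s a z) + 2 * ((norm (e n z))\<^sup>2 * moebius_weight s a z))"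
        unfolding id by (simp add: algebra_simps)
      also have "\<dots> = ennreal 2 * (ennreal ((norm (S z))\<^sup>2 * moebius_weight s a z) + ennreal ((norm (e n z))\<^sup>2 * moebius_weight s a z))"
        using w by (subst ennreal_mult_add) (auto simp: distrib_left)
      finally show "ennreal ((norm (S z + e n z))\<^sup>2 * moebius_weight s a z) + ennreal ((norm (S z - e n z))\<^sup>2 * moebius_weight s a z)
        = ennreal 2 * (ennreal ((norm (S z))\<^sup>2 * moebius_weight s a z) + ennreal ((norm (e n z))\<^sup>2 * moebius_weight s a z))" .
    qed
    also have "\<dots> = 2 * (?Q S + ?Q (e n))"
      unfolding Q_integral_def by (simp add: nn_integral_cmult nn_integral_add)
    finally show ?thesis .
  qed
  have "?Q S + ?Q (e n) \<le> ?Q (\<lambda>z. S z + e n z) \<or> ?Q S + ?Q (e n) \<le> ?Q (\<lambda>z. S z - e n z)"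
  proof (rule ccontr)
    assume "\<not> ?thesis"
    then have "?Q (\<lambda>z. S z + e n z) + ?Q (\<lambda>z. S z - e n z) < (?Q S + ?Q (e n)) + (?Q S + ?Q (e n))"
      by (intro add_strict_mono) (auto simp: not_le)
    then show False using par by (simp add: mult_2)
  qed
  then obtain t :: real where t: "\<bar>t\<bar> = 1" "?Q S + ?Q (e n) \<le> ?Q (\<lambda>z. S z + of_real t * e n z)"
  proof
    assume "?Q S + ?Q (e n) \<le> ?Q (\<lambda>z. S z + e n z)"
    then show thesis by (intro that[of 1]) auto
  next
    assume "?Q S + ?Q (e n) \<le> ?Q (\<lambda>z. S z - e n z)"
    then show thesis by (intro that[of "-1"]) auto
  qed
  have "(\<Sum>k<Suc n. Q_integral s (e k) a) \<le> ?Q S + ?Q (e n)"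
    using \<epsilon>(2) by (simp add: S_def[abs_def] add_right_mono)
  also note t(2)
  also have "(\<lambda>z. S z + of_real t * e n z) = (\<lambda>z. \<Sum>k<Suc n. of_real ((\<epsilon>(n := t)) k) * e k z)"
    by (simp add: S_def)
  finally show ?case using \<epsilon>(1) t(1) by (intro exI[of _ "\<epsilon>(n := t)"]) auto
qed

section \<open>Besov integrals of lacunary polynomials\<close>

lemma geometric_tail_le:
  fixes \<rho> :: real
  assumes \<rho>: "0 < \<rho>" "\<rho> < 1"
  shows "(\<Sum>k\<in>{m..<n}. \<rho> ^ k) \<le> \<rho> ^ m / (1 - \<rho>)"
proof (cases "m \<le> n")
  case True
  have "(1 - \<rho>) * (\<Sum>k\<in>{m..<n}. \<rho> ^ k) = \<rho> ^ m - \<rho> ^ n"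
    using True
  proof (induction n rule: dec_induct)
    case (step n)
    have "(1 - \<rho>) * (\<Sum>k\<in>{m..<Suc n}. \<rho> ^ k) = (1 - \<rho>) * (\<Sum>k\<in>{m..<n}. \<rho> ^ k) + (1 - \<rho>) * \<rho> ^ n"
      using step.hyps by (simp add: distrib_left)
    also have "\<dots> = \<rho> ^ m - \<rho> ^ n + (1 - \<rho>) * \<rho> ^ n" by (simp only: step.IH)
    also have "\<dots> = \<rho> ^ m - \<rho> ^ Suc n" by (simp add: left_diff_distrib)
    finally show ?case .
  qed simp
  then have "(1 - \<rho>) * (\<Sum>k\<in>{m..<n}. \<rho> ^ k) \<le> \<rho> ^ m" using \<rho> by simp
  then show ?thesis using \<rho> by (simp add: field_simps)
qed (use \<rho> in auto)

lemma geometric_head_le: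
  fixes q :: real
  assumes "1 < q"
  shows "(\<Sum>k<n. q ^ k) \<le> q ^ n / (q - 1)"
proof -
  have "(q - 1) * (\<Sum>k<n. q ^ k) = q ^ n - 1" by (induction n) (simp_all add: algebra_simps)
  then have "(q - 1) * (\<Sum>k<n. q ^ k) \<le> q ^ n" by simp
  then show ?thesis using assms by (simp add: field_simps)
qed

text \<open>The terms grow geometrically up to \<open>2\<^sup>k \<approx> 1/x\<close> and decay geometrically afterwards.\<close>

lemma lacunary_sum_le:
  fixes \<beta> :: real
  assumes \<beta>: "0 < \<beta>" "\<beta> < 1"
  obtains C where "C > 0"
    "\<And>n x. 0 < x \<Longrightarrow> x \<le> 1 \<Longrightarrow> (\<Sum>k<n. (2 powr \<beta>) ^ k * min 1 (1 / (2 ^ k * x))) \<le> C * x powr (- \<beta>)"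
    "\<And>n x. (\<Sum>k<n. (2 powr \<beta>) ^ k * min 1 (1 / (2 ^ k * x))) \<le> C * (2 ^ n) powr \<beta>"
proof -
  define q where "q = (2::real) powr \<beta>"
  define \<rho> where "\<rho> = (2::real) powr (\<beta> - 1)"
  have q: "1 < q" using \<beta> by (simp add: q_def gr_one_powr)
  have \<rho>: "0 < \<rho>" "\<rho> < 1" using \<beta> by (auto simp: \<rho>_def powr_less_one)
  have qk: "q ^ k = (2 ^ k) powr \<beta>" for k by (simp add: q_def powr_power powr_realpow[symmetric] powr_powr mult.commute)
  have \<rho>k: "\<rho> ^ k = (2 ^ k) powr (\<beta> - 1)" for k by (simp add: \<rho>_def powr_power powr_realpow[symmetric] powr_powr mult.commute)
  have \<rho>q: "q ^ k / 2 ^ k = \<rho> ^ k" for k by (simp add: qk \<rho>k powr_diff)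
  define C where "C = q / (q - 1) + 1 / (1 - \<rho>)"
  have "1 / (1 - \<rho>) \<ge> 0" "1 / (q - 1) \<le> q / (q - 1)" using q \<rho> by (auto intro: divide_right_mono)
  then have C1: "1 / (q - 1) \<le> C" unfolding C_def by linarith
  have C: "C > 0" using q \<rho> by (simp add: C_def add_pos_pos)
  show ?thesis
  proof (rule that[OF C])
    fix n :: nat and x :: real assume x: "0 < x" "x \<le> 1"
    obtain N where "1 / x < 2 ^ N" using real_arch_pow[of 2] by auto
    then have ex: "\<exists>m. 1 \<le> 2 ^ m * x" using x by (intro exI[of _ N]) (simp add: field_simps)
    \<comment> \<open>The first scale with 2^m x \<ge> 1. Below it the minimum is replaced by 1,
      which leaves the growing ratio \<open>q\<close>; above it by 1 / (2^k x), which leaves the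
      decaying ratio \<rho> = q / 2.\<close>
    define m where "m = (LEAST m. 1 \<le> 2 ^ m * x)"
    have m: "1 \<le> 2 ^ m * x" unfolding m_def using ex by (rule LeastI_ex)
    have head: "(\<Sum>k<m. q ^ k) \<le> q / (q - 1) * x powr (- \<beta>)"
    proof (cases m)
      case 0
      then show ?thesis using q by simp
    next
      case (Suc j)
      then have "\<not> 1 \<le> 2 ^ j * x" unfolding m_def using not_less_Least[of j] by (metis lessI)
      then have "2 ^ m \<le> 2 / x" using x Suc by (simp add: field_simps)
      then have "q ^ m \<le> (2 / x) powr \<beta>" unfolding qk using \<beta> by (intro powr_mono2) auto
      also have "\<dots> = q * x powr (- \<beta>)" by (simp add: powr_divide powr_minus_divide q_def)
      finally have "q ^ m / (q - 1) \<le> q * x powr (- \<beta>) / (q - 1)" using q by (intro divide_right_mono) auto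
      then show ?thesis using geometric_head_le[OF q, of m] by simp
    qed
    have tail: "(\<Sum>k\<in>{m..<n}. \<rho> ^ k) / x \<le> 1 / (1 - \<rho>) * x powr (- \<beta>)"
    proof -
      have "1 / x \<le> 2 ^ m" using m x by (simp add: field_simps)
      then have "\<rho> ^ m \<le> (1 / x) powr (\<beta> - 1)" unfolding \<rho>k using \<beta> x by (intro powr_mono2') auto
      also have "\<dots> = x * x powr (- \<beta>)" using x by (simp add: powr_divide powr_diff powr_minus_divide)
      finally have "\<rho> ^ m / (1 - \<rho>) \<le> x * x powr (- \<beta>) / (1 - \<rho>)" using \<rho> by (intro divide_right_mono) auto
      then have "(\<Sum>k\<in>{m..<n}. \<rho> ^ k) \<le> x * x powr (- \<beta>) / (1 - \<rho>)"
        using geometric_tail_le[OF \<rho>, of m n] by linarith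
      then have "(\<Sum>k\<in>{m..<n}. \<rho> ^ k) / x \<le> x * x powr (- \<beta>) / (1 - \<rho>) / x" using x by (intro divide_right_mono) auto
      then show ?thesis using x by simp
    qed
    have "(\<Sum>k<n. (2 powr \<beta>) ^ k * min 1 (1 / (2 ^ k * x))) \<le> (\<Sum>k\<in>{..<m} \<union> {m..<n}. (2 powr \<beta>) ^ k * min 1 (1 / (2 ^ k * x)))"
      using x by (intro sum_mono2) auto
    also have "\<dots> = (\<Sum>k<m. (2 powr \<beta>) ^ k * min 1 (1 / (2 ^ k * x))) + (\<Sum>k\<in>{m..<n}. (2 powr \<beta>) ^ k * min 1 (1 / (2 ^ k * x)))"
      by (intro sum.union_disjoint) auto
    also have "\<dots> \<le> (\<Sum>k<m. q ^ k) + (\<Sum>k\<in>{m..<n}. \<rho> ^ k / x)"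
    proof (intro add_mono sum_mono)
      fix k
      show "(2 powr \<beta>) ^ k * min 1 (1 / (2 ^ k * x)) \<le> q ^ k" using q by (simp add: q_def[symmetric] mult_left_le)
      have "q ^ k * min 1 (1 / (2 ^ k * x)) \<le> q ^ k * (1 / (2 ^ k * x))" using q by (intro mult_left_mono) auto
      also have "\<dots> = \<rho> ^ k / x" by (simp add: \<rho>q[symmetric])
      finally show "(2 powr \<beta>) ^ k * min 1 (1 / (2 ^ k * x)) \<le> \<rho> ^ k / x" by (simp add: q_def)
    qed
    also have "\<dots> \<le> q / (q - 1) * x powr (- \<beta>) + 1 / (1 - \<rho>) * x powr (- \<beta>)"
      using head tail by (simp add: sum_divide_distrib)
    also have "\<dots> = C * x powr (- \<beta>)" by (simp add: C_def distrib_right)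
    finally show "(\<Sum>k<n. (2 powr \<beta>) ^ k * min 1 (1 / (2 ^ k * x))) \<le> C * x powr (- \<beta>)" .
  next
    fix n :: nat and x :: real
    have "(\<Sum>k<n. (2 powr \<beta>) ^ k * min 1 (1 / (2 ^ k * x))) \<le> (\<Sum>k<n. q ^ k)"
      using q by (intro sum_mono) (simp add: q_def[symmetric] mult_left_le)
    also have "\<dots> \<le> 1 / (q - 1) * q ^ n" using geometric_head_le[OF q, of n] by simp
    also have "\<dots> \<le> C * q ^ n" using C1 q by (intro mult_right_mono) auto
    finally show "(\<Sum>k<n. (2 powr \<beta>) ^ k * min 1 (1 / (2 ^ k * x))) \<le> C * (2 ^ n) powr \<beta>" by (simp add: qk)
  qed
qed

text \<open>The coefficients 2^(-k/p) give every single term a Besov integral of order 1; since the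
  terms live on different dyadic annuli, n of them give order n, which the p-th power of the
  prefactor removes.\<close>

definition lacunary :: "real \<Rightarrow> nat \<Rightarrow> (nat \<Rightarrow> real) \<Rightarrow> complex \<Rightarrow> complex"
  where "lacunary p n \<epsilon> z = of_real (real n powr (- (1 / p))) *
    (\<Sum>k<n. of_real (\<epsilon> k * (2 powr (- (1 / p))) ^ k) * z ^ (2 ^ k))"

text \<open>The derivative of the k-th summand of \<open>lacunary\<close> without sign and
  prefactor: the coefficient 2^(k - k/p) combines 2^(-k/p) with the exponent 2^k. The subtraction is
  never truncated, as 2^k \<ge> 1.\<close>

definition lacunary_term :: "real \<Rightarrow> nat \<Rightarrow> complex \<Rightarrow> complex"
  where "lacunary_term p k z = of_real ((2 powr (1 - 1 / p)) ^ k) * z ^ (2 ^ k - 1)"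

lemma lacunary_deriv:
  "(lacunary p n \<epsilon> has_field_derivative of_real (real n powr (- (1 / p))) * (\<Sum>k<n. of_real (\<epsilon> k) * lacunary_term p k z)) (at z)"
proof -
  have c: "(2 powr (1 - 1 / p)) ^ k = (2 powr (- (1 / p))) ^ k * 2 ^ k" for k
  proof -
    have "2 powr (1 - 1 / p) = 2 powr (- (1 / p)) * (2::real)" using powr_add[of "2::real" "- (1 / p)" 1] by simp
    then show ?thesis by (simp add: power_mult_distrib)
  qed
  have "((\<lambda>z. of_real (\<epsilon> k * (2 powr (- (1 / p))) ^ k) * z ^ (2 ^ k)) has_field_derivative of_real (\<epsilon> k) * lacunary_term p k z) (at z)" for k
  proof -
    have "((\<lambda>z. of_real (\<epsilon> k * (2 powr (- (1 / p))) ^ k) * z ^ (2 ^ k)) has_field_derivative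
      of_real (\<epsilon> k * (2 powr (- (1 / p))) ^ k) * (of_nat (2 ^ k) * z ^ (2 ^ k - Suc 0))) (at z)"
      by (auto intro!: derivative_eq_intros)
    moreover have "of_real (\<epsilon> k * (2 powr (- (1 / p))) ^ k) * (of_nat (2 ^ k) * z ^ (2 ^ k - Suc 0)) = of_real (\<epsilon> k) * lacunary_term p k z"
      unfolding lacunary_term_def c by simp
    ultimately show ?thesis by (simp only:)
  qed
  then have "((\<lambda>z. \<Sum>k<n. of_real (\<epsilon> k * (2 powr (- (1 / p))) ^ k) * z ^ (2 ^ k)) has_field_derivative (\<Sum>k<n. of_real (\<epsilon> k) * lacunary_term p k z)) (at z)"
    by (intro DERIV_sum)
  then show ?thesis unfolding lacunary_def[abs_def] by (rule DERIV_cmult)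
qed

lemma lacunary_holomorphic: "lacunary p n \<epsilon> holomorphic_on S"
  using lacunary_deriv by (intro holomorphic_onI) (metis field_differentiable_def has_field_derivative_at_within)

text \<open>N r^(N - 1) is at most the geometric sum 1 + r + ... + r^(N - 1), which is at most 1 /
  (1 - r).\<close>

lemma power_le_inverse:
  fixes r :: real
  assumes "0 \<le> r" "r < 1" "1 \<le> N"
  shows "r ^ (N - 1) \<le> min 1 (1 / (real N * (1 - r)))"
proof -
  have "real N * r ^ (N - 1) = (\<Sum>j<N. r ^ (N - 1))" by simp
  also have "\<dots> \<le> (\<Sum>j<N. r ^ j)" using assms by (intro sum_mono power_decreasing) auto
  finally have "(1 - r) * (real N * r ^ (N - 1)) \<le> (1 - r) * (\<Sum>j<N. r ^ j)" using assms by (intro mult_left_mono) auto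
  also have "\<dots> = 1 - r ^ N" by (rule one_diff_power_eq[symmetric])
  also have "\<dots> \<le> 1" using assms by simp
  finally have "r ^ (N - 1) \<le> 1 / (real N * (1 - r))" using assms by (simp add: field_simps)
  then show ?thesis using assms by (simp add: power_le_one)
qed

text \<open>With d = 1 - |z|, \<open>lacunary_sum_le\<close> bounds the unnormalized derivative by a
  multiple of d^(-\<beta>). As \<beta> p = p - 1, the Besov density becomes a multiple of 1 / (n d),
  and the integral of 1 / d over n dyadic annuli is of order n.\<close>

lemma lacunary_Besov:
  assumes p: "2 < p"
  obtains K where "K > 0" "\<And>n \<epsilon>. 1 \<le> n \<Longrightarrow> (\<And>k. \<bar>\<epsilon> k\<bar> = 1) \<Longrightarrow> Besov_integral p (lacunary p n \<epsilon>) \<le> ennreal K"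
proof -
  define \<beta> where "\<beta> = 1 - 1 / p"
  have \<beta>: "0 < \<beta>" "\<beta> < 1" "\<beta> * p = p - 1" using p by (auto simp: \<beta>_def field_simps)
  obtain C where C: "C > 0"
    "\<And>n x. 0 < x \<Longrightarrow> x \<le> 1 \<Longrightarrow> (\<Sum>k<n. (2 powr \<beta>) ^ k * min 1 (1 / (2 ^ k * x))) \<le> C * x powr (- \<beta>)"
    "\<And>n x. (\<Sum>k<n. (2 powr \<beta>) ^ k * min 1 (1 / (2 ^ k * x))) \<le> C * (2 ^ n) powr \<beta>"
    using lacunary_sum_le[OF \<beta>(1,2)] by blast
  have pos: "C powr p * (8 * pi) > 0" using C by simp
  show ?thesis
  proof (rule that[OF pos])
    fix n :: nat and \<epsilon> :: "nat \<Rightarrow> real" assume n: "1 \<le> n" and \<epsilon>: "\<And>k. \<bar>\<epsilon> k\<bar> = 1"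
    \<comment> \<open>Full outer rings instead of annuli: the majorant only has to cover each
      \<open>z\<close> by one suitable \<open>k\<close>, and the area is still of order
      2^(-k).\<close>
    define A where "A k = (\<D> - ball 0 (1 - (1/2) ^ k) :: complex set)" for k :: nat
    have A_meas [measurable]: "(indicator (A k) :: complex \<Rightarrow> ennreal) \<in> borel_measurable \<lambda>\<D>" for k
      by (intro measurable_restrict_space1 borel_measurable_indicator) (simp add: A_def)
    have "Besov_integral p (lacunary p n \<epsilon>) \<le> (\<integral>\<^sup>+z. ennreal (C powr p / real n) * (\<Sum>k\<le>n. ennreal (2 ^ (k + 1)) * indicator (A k) z) \<partial>\<lambda>\<D>)"
      unfolding Besov_integral_def
    proof (rule nn_integral_mono)
      fix z assume "z \<in> space \<lambda>\<D>"
      then have z: "norm z < 1" by simp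
      define d where "d = 1 - norm z"
      have d: "0 < d" "d \<le> 1" using z by (auto simp: d_def)
      define S where "S = (\<Sum>k<n. (2 powr \<beta>) ^ k * min 1 (1 / (2 ^ k * d)))"
      have S0: "S \<ge> 0" unfolding S_def using d by (intro sum_nonneg) auto
      have "norm (deriv (lacunary p n \<epsilon>) z) = real n powr (- (1 / p)) * norm (\<Sum>k<n. of_real (\<epsilon> k) * lacunary_term p k z)"
        unfolding DERIV_imp_deriv[OF lacunary_deriv] by (simp add: norm_mult)
      also have "norm (\<Sum>k<n. of_real (\<epsilon> k) * lacunary_term p k z) \<le> S"
        unfolding S_def
      proof (rule sum_norm_le)
        fix k
        have "norm (of_real (\<epsilon> k) * lacunary_term p k z) = (2 powr \<beta>) ^ k * (norm z) ^ (2 ^ k - 1)"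
          using \<epsilon>[of k] by (simp add: lacunary_term_def norm_mult norm_power \<beta>_def)
        also have "(norm z) ^ (2 ^ k - 1) \<le> min 1 (1 / (2 ^ k * d))"
          using power_le_inverse[of "norm z" "2 ^ k"] z by (simp add: d_def)
        finally show "norm (of_real (\<epsilon> k) * lacunary_term p k z) \<le> (2 powr \<beta>) ^ k * min 1 (1 / (2 ^ k * d))"
          by (simp add: mult_left_mono)
      qed
      finally have "norm (deriv (lacunary p n \<epsilon>) z) \<le> real n powr (- (1 / p)) * S" by (simp add: mult_left_mono)
      then have "norm (deriv (lacunary p n \<epsilon>) z) powr p \<le> (real n powr (- (1 / p)) * S) powr p"
        using p by (intro powr_mono2) auto
      also have "\<dots> = (real n powr (- (1 / p))) powr p * S powr p" by (rule powr_mult)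
      also have "(real n powr (- (1 / p))) powr p = 1 / real n"
      proof -
        have "- (1 / p) * p = - 1" using p by simp
        then have "(real n powr (- (1 / p))) powr p = real n powr (- 1)" by (simp only: powr_powr)
        then show ?thesis using n by (simp add: powr_minus_divide)
      qed
      finally have 1: "d powr (p - 2) * norm (deriv (lacunary p n \<epsilon>) z) powr p \<le> 1 / real n * (d powr (p - 2) * S powr p)"
        using mult_left_mono[of "norm (deriv (lacunary p n \<epsilon>) z) powr p" "1 / real n * S powr p" "d powr (p - 2)"] by (simp add: mult_ac)
      \<comment> \<open>For d < 2^(-n) the polynomial no longer resolves the distance; there the
        bound 2^(n \<beta>) for the whole sum replaces d^(-\<beta>), and the last ring
        \<open>A n\<close> serves. This keeps the number of rings at n + 1.\<close>
      have "\<exists>k\<le>n. d powr (p - 2) * S powr p \<le> C powr p * 2 ^ (k + 1) \<and> z \<in> A k"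
      proof (cases "d < (1/2) ^ n")
        case True
        have "S powr p \<le> (C * (2 ^ n) powr \<beta>) powr p" using C(3)[of d n] S0 p by (intro powr_mono2) (auto simp: S_def)
        also have "\<dots> = C powr p * (2 ^ n) powr (p - 1)" by (simp add: powr_mult powr_powr \<beta>(3))
        finally have "d powr (p - 2) * S powr p \<le> ((1/2) ^ n) powr (p - 2) * (C powr p * (2 ^ n) powr (p - 1))"
          using True d p by (intro mult_mono powr_mono2) auto
        also have "\<dots> = C powr p * (((1/2) ^ n) powr (p - 2) * (2 ^ n) powr (p - 2) * (2 ^ n) powr 1)"
          by (simp only: mult.assoc powr_add[symmetric]) (simp add: mult.left_commute)
        also have "((1/2) ^ n) powr (p - 2) * (2 ^ n) powr (p - 2) = (1::real)"
          by (simp add: powr_mult[symmetric] power_mult_distrib[symmetric])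
        finally have "d powr (p - 2) * S powr p \<le> C powr p * 2 ^ n" by simp
        also have "\<dots> \<le> C powr p * 2 ^ (n + 1)" by (intro mult_left_mono) auto
        finally show ?thesis using True z by (intro exI[of _ n]) (auto simp: A_def d_def)
      next
        case False
        have "\<exists>k\<le>n. (1/2) ^ (k + 1) \<le> d \<and> d \<le> (1/2) ^ k"
          using False
        proof (induction n)
          case 0
          then show ?case using d by (intro exI[of _ 0]) auto
        next
          case (Suc n)
          show ?case
          proof (cases "d < (1/2) ^ n")
            case True
            then show ?thesis using Suc.prems by (intro exI[of _ n]) auto
          next
            case False
            from Suc.IH[OF this] show ?thesis using le_SucI by blast
          qed
        qed
        then obtain k where k: "k \<le> n" "(1/2) ^ (k + 1) \<le> d" "d \<le> (1/2) ^ k" by blast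
        have "S powr p \<le> (C * d powr (- \<beta>)) powr p"
          using C(2)[OF d, of n] S0 p by (intro powr_mono2) (auto simp: S_def)
        also have "\<dots> = C powr p * d powr (- (p - 1))"
        proof -
          have "- \<beta> * p = - (p - 1)" using \<beta>(3) by (simp only: mult_minus_left)
          then show ?thesis by (simp only: powr_mult powr_powr)
        qed
        finally have "d powr (p - 2) * S powr p \<le> d powr (p - 2) * (C powr p * d powr (- (p - 1)))"
          by (rule mult_left_mono) simp
        also have "\<dots> = C powr p * (d powr (p - 2) * d powr (- (p - 1)))" by simp
        also have "d powr (p - 2) * d powr (- (p - 1)) = d powr (- 1)" by (subst powr_add[symmetric]) simp
        also have "d powr (- 1) = 1 / d" using d by (simp add: powr_minus_divide)
        also have "1 / d \<le> 1 / (1/2) ^ (k + 1)" using k(2) d by (intro divide_left_mono) auto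
        also have "\<dots> = 2 ^ (k + 1)" by (simp add: power_one_over)
        finally have "d powr (p - 2) * S powr p \<le> C powr p * 2 ^ (k + 1)" by (simp add: mult_left_mono)
        moreover have "z \<in> A k" using k(3) z by (auto simp: A_def d_def)
        ultimately show ?thesis using k(1) by blast
      qed
      then obtain k where k: "k \<le> n" "d powr (p - 2) * S powr p \<le> C powr p * 2 ^ (k + 1)" "z \<in> A k" by blast
      have "d powr (p - 2) * norm (deriv (lacunary p n \<epsilon>) z) powr p \<le> 1 / real n * (C powr p * 2 ^ (k + 1))"
        using 1 mult_left_mono[OF k(2), of "1 / real n"] by simp
      then have "ennreal (d powr (p - 2) * norm (deriv (lacunary p n \<epsilon>) z) powr p) \<le> ennreal (C powr p / real n * 2 ^ (k + 1))"
        by (intro ennreal_leI) simp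
      also have "\<dots> = ennreal (C powr p / real n) * (ennreal (2 ^ (k + 1)) * indicator (A k) z)"
        using k(3) by (subst ennreal_mult) auto
      also have "\<dots> \<le> ennreal (C powr p / real n) * (\<Sum>k\<le>n. ennreal (2 ^ (k + 1)) * indicator (A k) z)"
        using k(1) by (intro mult_left_mono member_le_sum[of k "{..n}" "\<lambda>k. ennreal (2 ^ (k + 1)) * indicator (A k) z"]) auto
      finally show "ennreal ((1 - norm z) powr (p - 2) * norm (deriv (lacunary p n \<epsilon>) z) powr p)
        \<le> ennreal (C powr p / real n) * (\<Sum>k\<le>n. ennreal (2 ^ (k + 1)) * indicator (A k) z)" by (simp add: d_def)
    qed
    also have "\<dots> = ennreal (C powr p / real n) * (\<Sum>k\<le>n. ennreal (2 ^ (k + 1)) * (\<integral>\<^sup>+z. indicator (A k) z \<partial>\<lambda>\<D>))"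
    proof -
      have m: "(\<lambda>z. ennreal (2 ^ (k + 1)) * indicator (A k) z) \<in> borel_measurable \<lambda>\<D>"
        "(\<lambda>z. \<Sum>k\<le>n. ennreal (2 ^ (k + 1)) * indicator (A k) z) \<in> borel_measurable \<lambda>\<D>" for k
        by measurable
      show ?thesis by (simp only: nn_integral_cmult[OF m(2)] nn_integral_sum[OF m(1)] nn_integral_cmult[OF A_meas])
    qed
    also have "\<dots> \<le> ennreal (C powr p / real n) * (\<Sum>k\<le>n. ennreal (4 * pi))"
    proof (intro mult_left_mono sum_mono)
      fix k :: nat
      define y where "y = (1/2 :: real) ^ k"
      have y: "0 < y" "y \<le> 1" by (auto simp: y_def power_le_one)
      have "(\<integral>\<^sup>+z. indicator (A k) z \<partial>\<lambda>\<D>) = ennreal (pi * (1\<^sup>2 - (1 - y)\<^sup>2))"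
        unfolding A_def y_def[symmetric] using y by (intro annulus_area) auto
      also have "pi * (1\<^sup>2 - (1 - y)\<^sup>2) \<le> pi * (2 * y)" by (intro mult_left_mono) (auto simp: power2_eq_square algebra_simps)
      finally have "ennreal (2 ^ (k + 1)) * (\<integral>\<^sup>+z. indicator (A k) z \<partial>\<lambda>\<D>) \<le> ennreal (2 ^ (k + 1)) * ennreal (pi * (2 * y))"
        by (simp add: mult_left_mono ennreal_leI)
      also have "\<dots> = ennreal (4 * pi)" using y by (subst ennreal_mult[symmetric]) (auto simp: y_def power_one_over)
      finally show "ennreal (2 ^ (k + 1)) * (\<integral>\<^sup>+z. indicator (A k) z \<partial>\<lambda>\<D>) \<le> ennreal (4 * pi)" .
    qed simp
    also have "\<dots> = ennreal (C powr p / real n * (real (n + 1) * (4 * pi)))"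
      by (subst sum_ennreal, simp, subst ennreal_mult[symmetric]) auto
    also have "\<dots> \<le> ennreal (C powr p * (8 * pi))"
    proof (rule ennreal_leI)
      have "real (n + 1) / real n \<le> 2" using n by (simp add: field_simps)
      then have "C powr p * (4 * pi) * (real (n + 1) / real n) \<le> C powr p * (4 * pi) * 2" by (intro mult_left_mono) auto
      then show "C powr p / real n * (real (n + 1) * (4 * pi)) \<le> C powr p * (8 * pi)" by (simp add: mult_ac)
    qed
    finally show "Besov_integral p (lacunary p n \<epsilon>) \<le> ennreal (C powr p * (8 * pi))" .
  qed
qed

text \<open>If the operator were bounded, the functions \<open>e\<^sub>k = g \<cdot> lacunary_term p k\<close> would
  satisfy \<open>(n - 1) c \<le> C n powr (2 / p)\<close>, which is impossible because \<open>2 / p < 1\<close>.\<close>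

lemma lacunary_contradiction:
  assumes p: "2 < p" and s: "0 < s" "s \<le> 1 - 2 / p" and g: "g holomorphic_on \<D>" and C: "C \<ge> 0"
    and bound: "\<And>n \<epsilon>. 1 \<le> n \<Longrightarrow> (\<And>k. \<bar>\<epsilon> k\<bar> = 1) \<Longrightarrow> Q_integral s (\<lambda>z. g z * deriv (lacunary p n \<epsilon>) z) 0 \<le> ennreal C"
  shows "\<forall>z\<in>\<D>. g z = 0"
proof (rule ccontr)
  assume "\<not> ?thesis"
  then have ex: "\<exists>z\<in>\<D>. g z \<noteq> 0" by blast
  obtain c where c: "c > 0" "\<And>k. 1 \<le> k \<Longrightarrow> ennreal (c * (2 ^ k) powr (- 1 - s)) \<le> Q_integral s (\<lambda>z. g z * z ^ (2 ^ k - 1)) 0"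
    using monomial_lower_bound[OF g ex s(1)] by blast
  define e where "e k z = g z * lacunary_term p k z" for k z
  have lac_meas: "lacunary_term p k \<in> borel_measurable \<lambda>\<D>" for k
    unfolding lacunary_term_def
    by (intro measurable_disc_holomorphic holomorphic_intros)
  have g_meas: "g \<in> borel_measurable \<lambda>\<D>" using g by (rule measurable_disc_holomorphic)
  have e_meas: "e k \<in> borel_measurable \<lambda>\<D>" for k
    unfolding e_def[abs_def] using g_meas lac_meas by measurable
  have e_lower: "ennreal c \<le> Q_integral s (e k) 0" if k: "1 \<le> k" for k
  proof -
    define M where "M = (2 powr (1 - 1 / p)) ^ k"
    have M: "M > 0" by (simp add: M_def)
    have "Q_integral s (\<lambda>z. g z * z ^ (2 ^ k - 1)) 0 = Q_integral s (\<lambda>z. of_real (1 / M) * e k z) 0"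
      using M by (simp add: e_def lacunary_term_def M_def[symmetric])
    also have "\<dots> \<le> ennreal ((1 / M)\<^sup>2) * Q_integral s (e k) 0"
      using M by (intro Q_integral_bounded_mult e_meas s) (auto simp: norm_divide)
    finally have "ennreal (M\<^sup>2) * ennreal (c * (2 ^ k) powr (- 1 - s)) \<le> ennreal (M\<^sup>2) * (ennreal ((1 / M)\<^sup>2) * Q_integral s (e k) 0)"
      using c(2)[OF k] by (intro mult_left_mono) auto
    also have "\<dots> = ennreal (M\<^sup>2 * (1 / M)\<^sup>2) * Q_integral s (e k) 0"
      by (simp add: mult.assoc[symmetric] ennreal_mult)
    also have "M\<^sup>2 * (1 / M)\<^sup>2 = 1" using M by (simp add: power_divide)
    finally have 1: "ennreal (M\<^sup>2 * (c * (2 ^ k) powr (- 1 - s))) \<le> Q_integral s (e k) 0"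
      using c(1) by (simp add: ennreal_mult)
    have "M = (2 ^ k) powr (1 - 1 / p)"
      by (simp add: M_def powr_power powr_realpow[symmetric] powr_powr mult.commute)
    then have "M\<^sup>2 * (2 ^ k) powr (- 1 - s) = (2 ^ k) powr ((1 - 1 / p) + (1 - 1 / p) + (- 1 - s))"
      by (simp only: powr_add power2_eq_square)
    \<comment> \<open>The exponent is 1 - 2 / p - s; its sign is exactly the assumption on
      \<open>s\<close>.\<close>
    also have "\<dots> \<ge> 1" using s p by (intro ge_one_powr_ge_zero) auto
    finally have "c * 1 \<le> c * (M\<^sup>2 * (2 ^ k) powr (- 1 - s))" using c(1) by (intro mult_left_mono) auto
    then have "ennreal c \<le> ennreal (M\<^sup>2 * (c * (2 ^ k) powr (- 1 - s)))" by (intro ennreal_leI) (simp add: mult_ac)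
    with 1 show ?thesis by (rule order_trans[rotated])
  qed
  \<comment> \<open>Only n - 1 of the n terms are counted, since \<open>monomial_lower_bound\<close>
    starts at k = 1. The power n^(2/p) is the squared normalization of
    \<open>lacunary\<close>.\<close>
  have main: "real (n - 1) * c \<le> real n powr (2 / p) * C" if n: "1 \<le> n" for n
  proof -
    obtain \<epsilon> where \<epsilon>: "\<And>k. \<bar>\<epsilon> k\<bar> = 1"
      "(\<Sum>k<n. Q_integral s (e k) 0) \<le> Q_integral s (\<lambda>z. \<Sum>k<n. of_real (\<epsilon> k) * e k z) 0"
      using greedy_signs[of e s 0 n] e_meas s(1) by auto
    define M where "M = real n powr (1 / p)"
    have M: "M > 0" using n by (simp add: M_def)
    have nM: "real n powr (- (1 / p)) = 1 / M" by (simp add: M_def powr_minus_divide)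
    have "(\<Sum>k\<in>{1..<n}. ennreal c) \<le> (\<Sum>k\<in>{1..<n}. Q_integral s (e k) 0)"
      using e_lower by (intro sum_mono) auto
    also have "\<dots> \<le> (\<Sum>k<n. Q_integral s (e k) 0)" by (intro sum_mono2) auto
    also note \<epsilon>(2)
    also have "Q_integral s (\<lambda>z. \<Sum>k<n. of_real (\<epsilon> k) * e k z) 0 = Q_integral s (\<lambda>z. of_real M * (g z * deriv (lacunary p n \<epsilon>) z)) 0"
      unfolding DERIV_imp_deriv[OF lacunary_deriv] nM
      using M by (simp add: e_def sum_distrib_left mult.left_commute mult.commute)
    also have "\<dots> \<le> ennreal (M\<^sup>2) * Q_integral s (\<lambda>z. g z * deriv (lacunary p n \<epsilon>) z) 0"
    proof (intro Q_integral_bounded_mult)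
      have "deriv (lacunary p n \<epsilon>) \<in> borel_measurable \<lambda>\<D>"
        by (intro measurable_disc_holomorphic holomorphic_deriv lacunary_holomorphic) auto
      with g_meas show "(\<lambda>z. g z * deriv (lacunary p n \<epsilon>) z) \<in> borel_measurable \<lambda>\<D>" by measurable
    qed (use M s in auto)
    also have "\<dots> \<le> ennreal (M\<^sup>2) * ennreal C" using bound[OF n \<epsilon>(1)] by (intro mult_left_mono) auto
    finally have "ennreal (real (n - 1) * c) \<le> ennreal (M\<^sup>2 * C)"
      using c(1) C by (simp add: ennreal_mult ennreal_of_nat_eq_real_of_nat)
    then have "real (n - 1) * c \<le> M\<^sup>2 * C" using C by (subst (asm) ennreal_le_iff) auto
    also have "M\<^sup>2 = real n powr (2 / p)" unfolding M_def by (simp add: power2_eq_square powr_add[symmetric])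
    finally show ?thesis .
  qed
  define \<gamma> where "\<gamma> = 1 - 2 / p"
  have \<gamma>: "\<gamma> > 0" using p by (simp add: \<gamma>_def)
  \<comment> \<open>Beyond \<open>y\<close> the power n^(1 - 2/p) exceeds 2 C / c + 1; the 2
    compensates for n \<le> 2 (n - 1), and the added 1 makes the contradiction strict.\<close>
  define y where "y = (2 * C / c + 1) powr (1 / \<gamma>)"
  obtain n :: nat where "max 2 y \<le> real n" using real_arch_simple by blast
  then have n: "2 \<le> n" "y \<le> real n" by auto
  have base: "2 * C / c + 1 > 0" using C c(1) by (simp add: add_nonneg_pos)
  have "2 * C / c + 1 = y powr \<gamma>" using \<gamma> base by (simp add: y_def powr_powr)
  also have "\<dots> \<le> real n powr \<gamma>" using n \<gamma> by (intro powr_mono2) (auto simp: y_def)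
  finally have "(2 * C / c + 1) * real n powr (2 / p) \<le> real n powr \<gamma> * real n powr (2 / p)"
    by (intro mult_right_mono) auto
  also have "\<dots> = real n" using n by (simp add: powr_add[symmetric] \<gamma>_def)
  also have "\<dots> \<le> 2 * real (n - 1)" using n by (simp add: of_nat_diff)
  finally have "c * ((2 * C / c + 1) * real n powr (2 / p)) \<le> c * (2 * real (n - 1))"
    using c(1) by (intro mult_left_mono) auto
  also have "\<dots> \<le> 2 * (real n powr (2 / p) * C)" using mult_left_mono[OF main[of n], of 2] n by (simp only: mult_ac)
  finally have "c * (c * real n powr (2 / p)) \<le> 0" using c(1) by (simp add: field_simps)
  then show False using c(1) n by (simp add: mult_le_0_iff)
qed

section \<open>Vanishing of the symbol for small s\<close>

lemma lacunary_zero: "lacunary p n \<epsilon> 0 = 0"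
  by (simp add: lacunary_def power_0_left)

text \<open>The coefficients 2^(-k/p) are summable and n^(-1/p) is at most 1. A sup bound
  independent of n and of the signs is what the product rule needs for the multiplication
  operator.\<close>

lemma lacunary_bounded:
  assumes p: "2 < p" and "1 \<le> n" "\<And>k. \<bar>\<epsilon> k\<bar> = 1" and z: "norm z < 1"
  shows "norm (lacunary p n \<epsilon> z) \<le> 1 / (1 - 2 powr (- (1 / p)))"
proof -
  define \<rho> where "\<rho> = (2::real) powr (- (1 / p))"
  have \<rho>: "0 < \<rho>" "\<rho> < 1" using p by (auto simp: \<rho>_def powr_less_one)
  have 1: "real n powr (- (1 / p)) \<le> 1" using assms(2) p powr_mono[of "- (1 / p)" 0 "real n"] by simp
  have "norm (\<Sum>k<n. of_real (\<epsilon> k * \<rho> ^ k) * z ^ (2 ^ k)) \<le> (\<Sum>k<n. \<rho> ^ k)"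
  proof (rule sum_norm_le)
    fix k
    have "\<rho> ^ k * norm z ^ (2 ^ k) \<le> \<rho> ^ k" using \<rho> z by (simp add: mult_left_le power_le_one)
    then show "norm (of_real (\<epsilon> k * \<rho> ^ k) * z ^ (2 ^ k)) \<le> \<rho> ^ k"
      using assms(3)[of k] \<rho> by (simp add: norm_mult norm_power)
  qed
  also have "\<dots> \<le> 1 / (1 - \<rho>)" using geometric_tail_le[OF \<rho>, of 0 n] by (simp add: atLeast0LessThan)
  finally have "real n powr (- (1 / p)) * norm (\<Sum>k<n. of_real (\<epsilon> k * \<rho> ^ k) * z ^ (2 ^ k)) \<le> 1 * (1 / (1 - \<rho>))"
    using 1 by (intro mult_mono) auto
  then show ?thesis by (simp add: lacunary_def norm_mult \<rho>_def)
qed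

lemma integral_op_small_s:
  assumes p: "2 < p" and s: "0 < s" "s \<le> 1 - 2 / p" and g: "g holomorphic_on \<D>"
    and m: "maps_into (integral_op g) (Besov_space p) (Q_space s)"
  shows "\<forall>z\<in>\<D>. g z = 0"
proof -
  have s1: "s \<le> 1" using s p by (smt (verit) divide_nonneg_pos)
  obtain K where K: "K > 0" "\<And>n \<epsilon>. 1 \<le> n \<Longrightarrow> (\<And>k. \<bar>\<epsilon> k\<bar> = 1) \<Longrightarrow> Besov_integral p (lacunary p n \<epsilon>) \<le> ennreal K"
    using lacunary_Besov[OF p] by blast
  have "\<exists>C\<ge>0. \<forall>f a. f holomorphic_on \<D> \<longrightarrow> Besov_integral p f \<le> ennreal K \<longrightarrow> norm (f 0) \<le> K \<longrightarrow> norm a < 1 \<longrightarrow>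
      Q_integral s (\<lambda>z. 0 * f z + g z * deriv f z) a \<le> ennreal C"
    using p s g m s1 integral_op_deriv[OF g] by (intro bounded_of_operator(2)[where T = "integral_op g"]) auto
  then obtain C where C: "C \<ge> 0" "\<And>f a. f holomorphic_on \<D> \<Longrightarrow> Besov_integral p f \<le> ennreal K \<Longrightarrow> norm (f 0) \<le> K \<Longrightarrow> norm a < 1 \<Longrightarrow>
      Q_integral s (\<lambda>z. g z * deriv f z) a \<le> ennreal C" by auto
  show ?thesis
  proof (rule lacunary_contradiction[OF p s g C(1)])
    fix n :: nat and \<epsilon> :: "nat \<Rightarrow> real" assume "1 \<le> n" "\<And>k. \<bar>\<epsilon> k\<bar> = 1"
    then show "Q_integral s (\<lambda>z. g z * deriv (lacunary p n \<epsilon>) z) 0 \<le> ennreal C"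
      using K by (intro C(2) lacunary_holomorphic) (auto simp: lacunary_zero)
  qed
qed

text \<open>Reduction to the situation of the integral operator: g f' is (g f)' minus g' f, and for
  lacunary f the last term is harmless because f is uniformly bounded and the Q integral of g' at 0
  is finite, by testing on the constant 1.\<close>

lemma mult_op_small_s:
  assumes p: "2 < p" and s: "0 < s" "s \<le> 1 - 2 / p" and g: "g holomorphic_on \<D>"
    and m: "maps_into (mult_op g) (Besov_space p) (Q_space s)"
  shows "\<forall>z\<in>\<D>. g z = 0"
proof -
  have s1: "s \<le> 1" using s p by (smt (verit) divide_nonneg_pos)
  have dg: "deriv g holomorphic_on \<D>" using g by (intro holomorphic_deriv) auto
  have meas: "deriv g \<in> borel_measurable \<lambda>\<D>" "g \<in> borel_measurable \<lambda>\<D>"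
    using g dg by (auto intro: measurable_disc_holomorphic)
  obtain K0 where K0: "K0 > 0" "\<And>n \<epsilon>. 1 \<le> n \<Longrightarrow> (\<And>k. \<bar>\<epsilon> k\<bar> = 1) \<Longrightarrow> Besov_integral p (lacunary p n \<epsilon>) \<le> ennreal K0"
    using lacunary_Besov[OF p] by blast
  define K where "K = max K0 1"
  have "\<exists>C\<ge>0. \<forall>f a. f holomorphic_on \<D> \<longrightarrow> Besov_integral p f \<le> ennreal K \<longrightarrow> norm (f 0) \<le> K \<longrightarrow> norm a < 1 \<longrightarrow>
      Q_integral s (\<lambda>z. deriv g z * f z + g z * deriv f z) a \<le> ennreal C"
    using p s g m s1 dg mult_op_holomorphic[OF g] deriv_mult_op[OF g] by (intro bounded_of_operator(2)[where T = "mult_op g"]) auto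
  then obtain C where C: "C \<ge> 0" "\<And>f a. f holomorphic_on \<D> \<Longrightarrow> Besov_integral p f \<le> ennreal K \<Longrightarrow> norm (f 0) \<le> K \<Longrightarrow> norm a < 1 \<Longrightarrow>
      Q_integral s (\<lambda>z. deriv g z * f z + g z * deriv f z) a \<le> ennreal C" by auto
  have "Q_integral s (\<lambda>z. deriv g z * 1 + g z * deriv (\<lambda>_. 1) z) 0 \<le> ennreal C"
    by (intro C(2)) (auto simp: Besov_integral_def K_def)
  then have Qg: "Q_integral s (deriv g) 0 \<le> ennreal C" by simp
  define R where "R = 1 / (1 - 2 powr (- (1 / p)))"
  have R: "R \<ge> 0" using p by (simp add: R_def powr_le_one_le less_imp_le powr_less_one)
  show ?thesis
  proof (rule lacunary_contradiction[OF p s g])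
    show "0 \<le> 2 * C + 2 * (R\<^sup>2 * C)" using C by simp
    fix n :: nat and \<epsilon> :: "nat \<Rightarrow> real" assume n: "1 \<le> n" "\<And>k. \<bar>\<epsilon> k\<bar> = 1"
    let ?f = "lacunary p n \<epsilon>"
    have [measurable]: "?f \<in> borel_measurable \<lambda>\<D>" "deriv ?f \<in> borel_measurable \<lambda>\<D>"
      by (intro measurable_disc_holomorphic holomorphic_deriv lacunary_holomorphic; simp)+
    note meas[measurable]
    have 1: "Q_integral s (\<lambda>z. deriv g z * ?f z + g z * deriv ?f z) 0 \<le> ennreal C"
    proof (intro C(2) lacunary_holomorphic)
      have "ennreal K0 \<le> ennreal K" by (intro ennreal_leI) (simp add: K_def)
      with K0(2)[OF n] show "Besov_integral p ?f \<le> ennreal K" by (rule order_trans)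
    qed (auto simp: lacunary_zero K_def)
    have "Q_integral s (\<lambda>z. - ?f z * deriv g z) 0 \<le> ennreal (R\<^sup>2) * Q_integral s (deriv g) 0"
      using lacunary_bounded[OF p n] by (intro Q_integral_bounded_mult R meas s) (auto simp: R_def)
    also have "\<dots> \<le> ennreal (R\<^sup>2) * ennreal C" using Qg by (intro mult_left_mono) auto
    finally have 2: "Q_integral s (\<lambda>z. - ?f z * deriv g z) 0 \<le> ennreal (R\<^sup>2 * C)" using C by (simp add: ennreal_mult)
    have "Q_integral s (\<lambda>z. g z * deriv ?f z) 0 = Q_integral s (\<lambda>z. (deriv g z * ?f z + g z * deriv ?f z) + (- ?f z * deriv g z)) 0"
      by (simp add: mult.commute)
    also have "\<dots> \<le> ennreal 2 * Q_integral s (\<lambda>z. deriv g z * ?f z + g z * deriv ?f z) 0 + ennreal 2 * Q_integral s (\<lambda>z. - ?f z * deriv g z) 0"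
      by (rule Q_integral_add_le) (use s in measurable)
    also have "\<dots> \<le> ennreal 2 * ennreal C + ennreal 2 * ennreal (R\<^sup>2 * C)" using 1 2 by (intro add_mono mult_left_mono) auto
    also have "\<dots> = ennreal (2 * C + 2 * (R\<^sup>2 * C))" using C by (subst (1 2) ennreal_mult[symmetric], auto)
    finally show "Q_integral s (\<lambda>z. g z * deriv ?f z) 0 \<le> ennreal (2 * C + 2 * (R\<^sup>2 * C))" .
  qed
qed

lemma zero_deriv_in_Q_space:
  assumes "0 < s" "s \<le> 1" "f holomorphic_on \<D>" "\<And>z. z \<in> \<D> \<Longrightarrow> deriv f z = 0"
  shows "f \<in> Q_space s"
proof -
  have "Q_integral s (deriv f) a = Q_integral s (\<lambda>_. 0) a" for a using assms(4) by (intro Q_integral_cong) auto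
  then have "Q_integral s (deriv f) a \<le> ennreal 0" for a by (simp add: Q_integral_def)
  then show ?thesis unfolding Q_space_iff[OF assms(1,2)] using assms(3) by blast
qed

theorem theorem2p6:
  fixes g :: "complex \<Rightarrow> complex" and p p' s :: real
  assumes "g holomorphic_on \<D>"
    and "1 < p"
    and "1 / p + 1 / p' = 1"
  shows
    "(p \<le> 2 \<and> 0 < s \<and> s \<le> 1 \<longrightarrow>
       (maps_into (integral_op g) (Besov_space p) (Q_space s) \<longleftrightarrow> g \<in> H_infinity) \<and>
       (maps_into (mult_op g) (Besov_space p) (Q_space s)
          \<longrightarrow> g \<in> Q_log_space s (1 / p') \<inter> H_infinity) \<and>
       ((\<exists>\<alpha>>1/2. g \<in> Q_log_space s \<alpha> \<inter> H_infinity)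
          \<longrightarrow> maps_into (mult_op g) (Besov_space p) (Q_space s)))
     \<and>
     (2 < p \<and> 1 - 2 / p < s \<and> s \<le> 1 \<longrightarrow>
       (maps_into (integral_op g) (Besov_space p) (Q_space s) \<longleftrightarrow> g \<in> H_infinity) \<and>
       (maps_into (mult_op g) (Besov_space p) (Q_space s)
          \<longleftrightarrow> g \<in> Q_log_space s (1 / p') \<inter> H_infinity))
     \<and>
     (2 < p \<and> 0 < s \<and> s \<le> 1 - 2 / p \<longrightarrow>
       (maps_into (integral_op g) (Besov_space p) (Q_space s) \<longleftrightarrow> (\<forall>z\<in>\<D>. g z = 0)) \<and>
       (maps_into (mult_op g) (Besov_space p) (Q_space s) \<longleftrightarrow> (\<forall>z\<in>\<D>. g z = 0)))"
proof -
  note g = assms(1) and p = assms(2) and pp = assms(3)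
  have p': "1 / p' = 1 - 1 / p" using pp by simp
  have I_nec: "g \<in> H_infinity" if "0 < s" "s \<le> 1" "maps_into (integral_op g) (Besov_space p) (Q_space s)"
    using p that g integral_op_deriv[OF g] by (intro bounded_of_operator(1)[where T = "integral_op g" and u = "\<lambda>_. 0" and p = p and s = s]) auto
  have M_nec: "g \<in> H_infinity" if "0 < s" "s \<le> 1" "maps_into (mult_op g) (Besov_space p) (Q_space s)"
    using p that g mult_op_holomorphic[OF g] deriv_mult_op[OF g]
    by (intro bounded_of_operator(1)[where T = "mult_op g" and u = "deriv g" and p = p and s = s]) (auto intro: holomorphic_deriv)
  have case1: "(maps_into (integral_op g) (Besov_space p) (Q_space s) \<longleftrightarrow> g \<in> H_infinity) \<and>
       (maps_into (mult_op g) (Besov_space p) (Q_space s) \<longrightarrow> g \<in> Q_log_space s (1 / p') \<inter> H_infinity) \<and>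
       ((\<exists>\<alpha>>1/2. g \<in> Q_log_space s \<alpha> \<inter> H_infinity) \<longrightarrow> maps_into (mult_op g) (Besov_space p) (Q_space s))"
    if h: "p \<le> 2" "0 < s" "s \<le> 1"
  proof -
    have v: "2 < p \<Longrightarrow> 1 - 2 / p < s" using h by simp
    \<comment> \<open>For p \<le> 2 this gives 1 / p' \<le> 1/2, so every \<alpha> > 1/2 meets both
      requirements of \<open>mult_op_sufficient\<close>.\<close>
    have "1 / p \<ge> 1 / 2" using h p by (intro divide_left_mono) auto
    then have "1 / p' \<le> \<alpha>" if "\<alpha> > 1/2" for \<alpha> using p' that by simp
    then show ?thesis
      using I_nec M_nec h integral_op_sufficient[OF p h(2,3) v] mult_op_sufficient[OF p pp h(2,3) v] mult_op_necessary_log[OF p pp h(2,3) v g]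
      by blast
  qed
  have case2: "(maps_into (integral_op g) (Besov_space p) (Q_space s) \<longleftrightarrow> g \<in> H_infinity) \<and>
       (maps_into (mult_op g) (Besov_space p) (Q_space s) \<longleftrightarrow> g \<in> Q_log_space s (1 / p') \<inter> H_infinity)"
    if h: "2 < p" "1 - 2 / p < s" "s \<le> 1"
  proof -
    have "2 / p < 1" using h by simp
    then have s0: "0 < s" using h by linarith
    \<comment> \<open>For p > 2 the exponent 1 / p' itself exceeds 1/2, so it can be taken as
      \<alpha> and the necessary condition becomes sufficient.\<close>
    have "1 / p < 1 / 2" using h p by (intro divide_strict_left_mono) auto
    then have "1 / 2 < 1 / p'" using p' by simp
    then show ?thesis
      using I_nec M_nec s0 h integral_op_sufficient[OF p s0 h(3,2)] mult_op_sufficient[OF p pp s0 h(3,2)] mult_op_necessary_log[OF p pp s0 h(3,2) g]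
      by blast
  qed
  have case3: "(maps_into (integral_op g) (Besov_space p) (Q_space s) \<longleftrightarrow> (\<forall>z\<in>\<D>. g z = 0)) \<and>
       (maps_into (mult_op g) (Besov_space p) (Q_space s) \<longleftrightarrow> (\<forall>z\<in>\<D>. g z = 0))"
    if h: "2 < p" "0 < s" "s \<le> 1 - 2 / p"
  proof -
    have "2 / p > 0" using h by simp
    then have s1: "s \<le> 1" using h by linarith
    have "maps_into (integral_op g) (Besov_space p) (Q_space s)" "maps_into (mult_op g) (Besov_space p) (Q_space s)"
      if z: "\<forall>z\<in>\<D>. g z = 0"
    proof -
      have dg: "deriv g z = 0" if "z \<in> \<D>" for z
      proof -
        have "deriv g z = deriv (\<lambda>_. 0) z"
          using z that by (intro deriv_cong_ev refl) (auto simp: eventually_nhds intro!: exI[of _ "\<D>"])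
        then show ?thesis by simp
      qed
      have f: "f holomorphic_on \<D>" if "f \<in> Besov_space p" for f using that by (simp add: Besov_space_def)
      show "maps_into (integral_op g) (Besov_space p) (Q_space s)"
        unfolding maps_into_def using h s1 z integral_op_deriv[OF g f]
        by (auto intro!: zero_deriv_in_Q_space)
      show "maps_into (mult_op g) (Besov_space p) (Q_space s)"
        unfolding maps_into_def using h s1 z dg mult_op_holomorphic[OF g f] deriv_mult_op[OF g f]
        by (auto intro!: zero_deriv_in_Q_space)
    qed
    then show ?thesis using integral_op_small_s[OF h g] mult_op_small_s[OF h g] by blast
  qed
  show ?thesis using case1 case2 case3 by blast
qed

end
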